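(* Let $k\ge1$ be an integer. (1) The map $L^1(\mathbb{C})\ni f\mapsto T_{f,(k)}\in\mathcal{T}^1(F^2_{(k)})$ is injective. (2) The map $\mathcal{T}^1(F^2_{(k)})\ni A\mapsto\widetilde A\in L^1(\mathbb{C})$ is injective. (3) The map $L^\infty(\mathbb{C})\ni f\mapsto T_{f,(k)}\in\mathcal{L}(F^2_{(k)})$ has dense range with respect to the weak$^\ast$ topology. (4) The map $\mathcal{L}(F^2_{(k)})\ni A\mapsto\widetilde A\in L^\infty(\mathbb{C})$ has dense range with respect to the weak$^\ast$ topology.
   Context: Let $\mathrm{d}\mu(z)=\frac1\pi e^{-|z|^2}\,\mathrm{d}z$ on $\mathbb{C}\cong\mathbb{R}^2$. For $n\ge1$, $F_n^2$ is the closed subspace of $L^2(\mathbb{C},\mu)$ of smooth functions $f$ with $\partial^n f/\partial\overline z^n=0$; $F^2_{(1)}:=F^2_1$ and $F^2_{(k)}:=F^2_k\ominus F^2_{k-1}$ for $k\ge2$; $P_{(k)}$ is the orthogonal projection onto $F^2_{(k)}$. $\mathcal{L}(H)$, $\mathcal{T}^1(H)$ are the bounded and trace class operators on $H$; the weak$^\ast$ topologies are those with respect to the preduals $\mathcal{T}^1(F^2_{(k)})$ of $\mathcal{L}(F^2_{(k)})$ (trace pairing) and $L^1(\mathbb{C})$ of $L^\infty(\mathbb{C})$. $L^0_m(x)=\sum_{j=0}^m(-1)^j\binom{m}{m-j}\frac{x^j}{j!}$. The normalized reproducing kernels of $F^2_{(k)}$ are $k_{z,(k)}(w)=L^0_{k-1}(|w-z|^2)e^{w\overline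 z-|z|^2/2}$. The Berezin transform of $A\in\mathcal{L}(F^2_{(k)})$ is $\widetilde A(z)=\langle Ak_{z,(k)},k_{z,(k)}\rangle$; it lies in $L^1(\mathbb{C})$ if $A$ is trace class. For $f\in L^\infty(\mathbb{C})$, $T_{f,(k)}g=P_{(k)}(fg)$, $g\in F^2_{(k)}$. For $f\in L^1(\mathbb{C})$, $T_{f,(k)}=\frac1\pi\int_{\mathbb{C}}f(z)\,k_{z,(k)}\otimes k_{z,(k)}\,\mathrm{d}z$ as a Bochner integral in $\mathcal{T}^1(F^2_{(k)})$, where $(g\otimes h)(\varphi)=\langle\varphi,h\rangle g$ (for $f\in L^1\cap L^\infty$ the two definitions agree). *)

theory Defs
  imports "HOL-Analysis.Analysis"
begin

definition gauss_measure :: "complex measure" where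
  "gauss_measure = density lborel (\<lambda>z. ennreal (exp (- (cmod z)\<^sup>2) / pi))"

definition L2_gauss :: "(complex \<Rightarrow> complex) set" where
  "L2_gauss = {f \<in> borel_measurable borel. integrable gauss_measure (\<lambda>z. (cmod (f z))\<^sup>2)}"

definition ip :: "(complex \<Rightarrow> complex) \<Rightarrow> (complex \<Rightarrow> complex) \<Rightarrow> complex" where
  "ip f g = (LINT z|gauss_measure. f z * cnj (g z))"

definition nrm :: "(complex \<Rightarrow> complex) \<Rightarrow> real" where
  "nrm f = sqrt (LINT z|gauss_measure. (cmod (f z))\<^sup>2)"

definition partial_x :: "(complex \<Rightarrow> complex) \<Rightarrow> complex \<Rightarrow> complex" where
  "partial_x f z = frechet_derivative f (at z) 1"

definition partial_y :: "(complex \<Rightarrow> complex) \<Rightarrow> complex \<Rightarrow> complex" where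
  "partial_y f z = frechet_derivative f (at z) \<i>"

definition dbar :: "(complex \<Rightarrow> complex) \<Rightarrow> complex \<Rightarrow> complex" where
  "dbar f z = (partial_x f z + \<i> * partial_y f z) / 2"

text \<open>Differentiability is that of the underlying map of real vector spaces.\<close>

fun C_fun :: "nat \<Rightarrow> (complex \<Rightarrow> complex) \<Rightarrow> bool" where
  "C_fun 0 f = continuous_on UNIV f"
| "C_fun (Suc n) f =
     ((\<forall>z. f differentiable (at z)) \<and> C_fun n (partial_x f) \<and> C_fun n (partial_y f))"

definition smooth_fun :: "(complex \<Rightarrow> complex) \<Rightarrow> bool" where
  "smooth_fun f \<longleftrightarrow> (\<forall>n. C_fun n f)"

text \<open>
  Two smooth functions that agree almost everywhere are equal, so the elements of these spaces
  are genuine functions and no passage to equivalence classes is needed.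
\<close>

definition polyfock :: "nat \<Rightarrow> (complex \<Rightarrow> complex) set" where
  "polyfock n = {f \<in> L2_gauss. smooth_fun f \<and> (dbar ^^ n) f = (\<lambda>z. 0)}"

definition true_polyfock :: "nat \<Rightarrow> (complex \<Rightarrow> complex) set" where
  "true_polyfock k =
     (if k = 1 then polyfock 1 else {f \<in> polyfock k. \<forall>g\<in>polyfock (k - 1). ip f g = 0})"

definition proj :: "(complex \<Rightarrow> complex) set \<Rightarrow> (complex \<Rightarrow> complex) \<Rightarrow> complex \<Rightarrow> complex" where
  "proj H f = (THE h. h \<in> H \<and> (\<forall>g\<in>H. ip (\<lambda>z. f z - h z) g = 0))"

text \<open>
  Throughout, \<open>H\<close> is a closed subspace of \<open>L\<^sup>2(\<mu>)\<close> consisting of smooth functions. An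
  operator on \<open>H\<close> is a function that is \<open>undefined\<close> outside \<open>H\<close>, so that two operators are equal
  as terms iff they agree on \<open>H\<close>.
\<close>

type_synonym oper = "(complex \<Rightarrow> complex) \<Rightarrow> (complex \<Rightarrow> complex)"

definition bounded_ops :: "(complex \<Rightarrow> complex) set \<Rightarrow> oper set" where
  "bounded_ops H = {A \<in> H \<rightarrow>\<^sub>E H.
     (\<forall>x\<in>H. \<forall>y\<in>H. A (\<lambda>z. x z + y z) = (\<lambda>z. A x z + A y z)) \<and>
     (\<forall>c. \<forall>x\<in>H. A (\<lambda>z. c * x z) = (\<lambda>z. c * A x z)) \<and>
     (\<exists>C. \<forall>x\<in>H. nrm (A x) \<le> C * nrm x)}"

definition op_zero :: "(complex \<Rightarrow> complex) set \<Rightarrow> oper" where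
  "op_zero H = (\<lambda>x\<in>H. \<lambda>w. 0)"

definition op_diff :: "(complex \<Rightarrow> complex) set \<Rightarrow> oper \<Rightarrow> oper \<Rightarrow> oper" where
  "op_diff H A B = (\<lambda>x\<in>H. \<lambda>w. A x w - B x w)"

definition op_scale :: "(complex \<Rightarrow> complex) set \<Rightarrow> complex \<Rightarrow> oper \<Rightarrow> oper" where
  "op_scale H c A = (\<lambda>x\<in>H. \<lambda>w. c * A x w)"

definition rank_one ::
  "(complex \<Rightarrow> complex) set \<Rightarrow> (complex \<Rightarrow> complex) \<Rightarrow> (complex \<Rightarrow> complex) \<Rightarrow> oper" where
  "rank_one H g h = (\<lambda>x\<in>H. \<lambda>w. ip x h * g w)"

definition op_adj :: "(complex \<Rightarrow> complex) set \<Rightarrow> oper \<Rightarrow> oper" where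
  "op_adj H A = (THE B. B \<in> bounded_ops H \<and> (\<forall>x\<in>H. \<forall>y\<in>H. ip (A x) y = ip x (B y)))"

definition positive_op :: "(complex \<Rightarrow> complex) set \<Rightarrow> oper \<Rightarrow> bool" where
  "positive_op H P \<longleftrightarrow>
     P \<in> bounded_ops H \<and> (\<forall>x\<in>H. Im (ip (P x) x) = 0 \<and> 0 \<le> Re (ip (P x) x))"

definition op_abs :: "(complex \<Rightarrow> complex) set \<Rightarrow> oper \<Rightarrow> oper" where
  "op_abs H A = (THE P. positive_op H P \<and> compose H P P = compose H (op_adj H A) A)"

definition is_onb :: "(complex \<Rightarrow> complex) set \<Rightarrow> (complex \<Rightarrow> complex) set \<Rightarrow> bool" where
  "is_onb H E \<longleftrightarrow> E \<subseteq> H \<and> (\<forall>e\<in>E. \<forall>e'\<in>E. ip e e' = (if e = e' then 1 else 0)) \<and>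
     (\<forall>x\<in>H. (\<forall>e\<in>E. ip x e = 0) \<longrightarrow> x = (\<lambda>z. 0))"

text \<open>The trace and the trace norm do not depend on the choice of the orthonormal basis.\<close>

definition some_onb :: "(complex \<Rightarrow> complex) set \<Rightarrow> (complex \<Rightarrow> complex) set" where
  "some_onb H = (SOME E. is_onb H E)"

definition trace_class :: "(complex \<Rightarrow> complex) set \<Rightarrow> oper set" where
  "trace_class H =
     {A \<in> bounded_ops H. (\<lambda>e. ip (op_abs H A e) e) summable_on some_onb H}"

definition trace :: "(complex \<Rightarrow> complex) set \<Rightarrow> oper \<Rightarrow> complex" where
  "trace H A = (\<Sum>\<^sub>\<infinity>e\<in>some_onb H. ip (A e) e)"

definition trace_norm :: "(complex \<Rightarrow> complex) set \<Rightarrow> oper \<Rightarrow> real" where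
  "trace_norm H A = Re (trace H (op_abs H A))"

text \<open>
  The trace class operators on \<open>H\<close> form a set and not a type, so the library's Bochner integral
  does not apply; the definitions below follow those of \<open>simple_bochner_integrable\<close>,
  \<open>simple_bochner_integral\<close> and \<open>has_bochner_integral\<close>, with respect to Lebesgue measure and the
  trace norm.
\<close>

definition simple_tc :: "(complex \<Rightarrow> complex) set \<Rightarrow> (complex \<Rightarrow> oper) \<Rightarrow> bool" where
  "simple_tc H s \<longleftrightarrow> finite (range s) \<and> range s \<subseteq> trace_class H \<and>
     (\<forall>A. {z. s z = A} \<in> sets lborel) \<and> emeasure lborel {z. s z \<noteq> op_zero H} < \<infinity>"

definition simple_tc_integral ::
  "(complex \<Rightarrow> complex) set \<Rightarrow> (complex \<Rightarrow> oper) \<Rightarrow> oper" where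
  "simple_tc_integral H s =
     (\<lambda>x\<in>H. \<lambda>w. \<Sum>A\<in>range s. of_real (measure lborel {z. s z = A}) * A x w)"

text \<open>
  Integrability of the trace norm of \<open>F - s\<^sub>i\<close> includes its measurability; together with the
  convergence of the integrals it gives strong measurability of \<open>F\<close>.
\<close>

definition has_tc_integral ::
  "(complex \<Rightarrow> complex) set \<Rightarrow> (complex \<Rightarrow> oper) \<Rightarrow> oper \<Rightarrow> bool" where
  "has_tc_integral H F T \<longleftrightarrow> range F \<subseteq> trace_class H \<and> T \<in> trace_class H \<and>
     (\<exists>s. (\<forall>i. simple_tc H (s i)) \<and>
          (\<forall>i. integrable lborel (\<lambda>z. trace_norm H (op_diff H (F z) (s i z)))) \<and>
          (\<lambda>i. LINT z|lborel. trace_norm H (op_diff H (F z) (s i z))) \<longlonglongrightarrow> 0 \<and>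
          (\<lambda>i::nat. trace_norm H (op_diff H (simple_tc_integral H (s i)) T)) \<longlonglongrightarrow> 0)"

definition tc_integral :: "(complex \<Rightarrow> complex) set \<Rightarrow> (complex \<Rightarrow> oper) \<Rightarrow> oper" where
  "tc_integral H F = (THE T. has_tc_integral H F T)"

text \<open>Elements of \<open>L\<^sup>1\<close> and \<open>L\<^sup>\<infinity>\<close> are represented by Borel functions, up to equality a.e.\<close>

definition L1_fun :: "(complex \<Rightarrow> complex) set" where
  "L1_fun = {f. integrable lborel f}"

definition Linf_fun :: "(complex \<Rightarrow> complex) set" where
  "Linf_fun = {f \<in> borel_measurable lborel. \<exists>C. AE z in lborel. cmod (f z) \<le> C}"

definition laguerre0 :: "nat \<Rightarrow> real \<Rightarrow> real" where
  "laguerre0 m x = (\<Sum>j=0..m. (-1) ^ j * real (m choose (m - j)) * (x ^ j / fact j))"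

definition nkernel :: "nat \<Rightarrow> complex \<Rightarrow> complex \<Rightarrow> complex" where
  "nkernel k z w = of_real (laguerre0 (k - 1) ((cmod (w - z))\<^sup>2)) *
     exp (w * cnj z - of_real ((cmod z)\<^sup>2 / 2))"

definition berezin :: "nat \<Rightarrow> oper \<Rightarrow> complex \<Rightarrow> complex" where
  "berezin k A z = ip (A (nkernel k z)) (nkernel k z)"

definition toeplitz_Linf :: "nat \<Rightarrow> (complex \<Rightarrow> complex) \<Rightarrow> oper" where
  "toeplitz_Linf k f = (\<lambda>g\<in>true_polyfock k. proj (true_polyfock k) (\<lambda>z. f z * g z))"

definition toeplitz_L1 :: "nat \<Rightarrow> (complex \<Rightarrow> complex) \<Rightarrow> oper" where
  "toeplitz_L1 k f = op_scale (true_polyfock k) (1 / of_real pi)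
     (tc_integral (true_polyfock k)
       (\<lambda>z. op_scale (true_polyfock k) (f z)
              (rank_one (true_polyfock k) (nkernel k z) (nkernel k z))))"

text \<open>
  The coarsest topology on \<open>X\<close> that makes all functionals \<open>\<lambda>x. \<beta> x s\<close> with \<open>s \<in> S\<close> continuous.
\<close>

definition weak_topology :: "'a set \<Rightarrow> 'b set \<Rightarrow> ('a \<Rightarrow> 'b \<Rightarrow> complex) \<Rightarrow> 'a topology" where
  "weak_topology X S \<beta> =
     topology_generated_by {{x \<in> X. \<beta> x s \<in> U} | s U. s \<in> S \<and> open U}"

definition weak_star_ops :: "(complex \<Rightarrow> complex) set \<Rightarrow> oper topology" where
  "weak_star_ops H =
     weak_topology (bounded_ops H) (trace_class H) (\<lambda>A B. trace H (compose H A B))"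

text \<open>
  This is the preimage, on representatives, of the weak-star topology of the quotient by equality
  a.e.; open sets are saturated, so a set of functions is dense here iff the set of its classes is
  dense in the quotient.
\<close>

definition weak_star_Linf :: "(complex \<Rightarrow> complex) topology" where
  "weak_star_Linf = weak_topology Linf_fun L1_fun (\<lambda>f g. LINT z|lborel. f z * g z)"

end

theory Submission
  imports Defs "HOL-Complex_Analysis.Complex_Analysis" "HOL-Probability.Probability"
begin

text \<open>
  Write \<open>k = n + 1\<close>. The complex Hermite polynomials are an orthogonal basis of \<open>F\<^sup>2\<^sub>(\<^sub>k\<^sub>)\<close>, which transports all
  notions to operators on square-summable sequences. Since \<open>\<langle>T\<^sub>f x, y\<rangle>\<close> is the integral of \<open>f\<close> against
  \<open>\<langle>x, k\<^sub>z\<rangle>\<langle>k\<^sub>z, y\<rangle>\<close>, injectivity in (1) and, by duality, density in (4) say that these functions of \<open>z\<close> are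
  total. Already the choice \<open>x = y = k\<^sub>a\<close> suffices: it gives a convolution with a function whose Fourier
  transform is a Gaussian times \<open>L\<^sub>n(|\<xi>|\<^sup>2)\<^sup>2\<close>, which has only finitely many zeros on each ray.

  In the same way (2) and (3) both reduce to the injectivity of the Berezin transform. In the Hermite bases
  the compression of the character \<open>z \<mapsto> exp (z cnj \<xi> - cnj z \<xi>)\<close> to \<open>F\<^sup>2\<^sub>(\<^sub>k\<^sub>)\<close> is \<open>L\<^sub>n(|\<xi>|\<^sup>2)\<close> times its
  compression to the Fock space \<open>F\<^sup>2\<^sub>(\<^sub>1\<^sub>)\<close>. Hence if the Berezin transform of order \<open>k\<close> vanishes, so does
  the one of order \<open>1\<close>, and that one is a power series in \<open>z\<close> and \<open>cnj z\<close> whose coefficients are the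
  matrix entries of the operator.
\<close>

section \<open>The Hilbert space of square-summable sequences\<close>

text \<open>The spaces in the statement are sets of functions, while limits and series of operators
  want a Banach space type. Sequences supply one, and every \<open>THE\<close> in the statement
  (adjoint, modulus, projection, Bochner integral) is resolved there by a uniqueness proof. Trace
  class is stated through the modulus and one unspecified orthonormal basis. Giving this class a
  manageable form is the bulk of the operator theory: the factorization \<open>T = V Q\<close>, with
  \<open>Q\<close> a root of the modulus, turns a trace class operator into a series of rank-one
  operators with square-summable factors, which can be composed, traced and integrated term by term.
  The duality is one identity: pi times the trace of \<open>T_f A\<close> is the integral of
  \<open>f\<close> times the Berezin transform of \<open>A\<close>. A weakly open neighbourhood
  constrains only finitely many functionals, so density reduces to interpolating finitely many
  values, hence to linear algebra of annihilators. Where a Laguerre factor vanishes, Fourier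
  transforms cannot be divided; continuity of the transform along the ray fills these points
  in.\<close>

typedef ell2 = "{f :: nat \<Rightarrow> complex. summable (\<lambda>n. (cmod (f n))\<^sup>2)}"
  morphisms coord Abs_ell2
  by (rule exI[of _ "\<lambda>_. 0"]) auto

setup_lifting type_definition_ell2

lemma summable_coord: "summable (\<lambda>n. (cmod (coord x n))\<^sup>2)"
  using coord[of x] by simp

lemma ell2_eqI: "(\<And>n. coord x n = coord y n) \<Longrightarrow> x = y"
  by (metis coord_inject ext)

lemma cmod_add_square_le: "(cmod (a + b))\<^sup>2 \<le> 2 * (cmod a)\<^sup>2 + 2 * (cmod b)\<^sup>2"
proof -
  have "(cmod (a + b))\<^sup>2 \<le> (cmod a + cmod b)\<^sup>2"
    by (intro power_mono norm_triangle_ineq) auto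
  also have "\<dots> \<le> 2 * (cmod a)\<^sup>2 + 2 * (cmod b)\<^sup>2"
    using zero_le_power2[of "cmod a - cmod b"] by (simp add: power2_eq_square algebra_simps)
  finally show ?thesis .
qed

lemma square_summable_add:
  fixes f g :: "nat \<Rightarrow> complex"
  assumes "summable (\<lambda>n. (cmod (f n))\<^sup>2)" "summable (\<lambda>n. (cmod (g n))\<^sup>2)"
  shows "summable (\<lambda>n. (cmod (f n + g n))\<^sup>2)"
  by (rule summable_comparison_test'[OF summable_add[OF summable_mult[OF assms(1), of 2] summable_mult[OF assms(2), of 2]]])
     (use cmod_add_square_le in auto)

lemma square_summable_scale:
  fixes f :: "nat \<Rightarrow> complex"
  assumes "summable (\<lambda>n. (cmod (f n))\<^sup>2)"
  shows "summable (\<lambda>n. (cmod (c * f n))\<^sup>2)"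
  using summable_mult[OF assms, of "(cmod c)\<^sup>2"] by (simp add: norm_mult power_mult_distrib)

instantiation ell2 :: real_vector
begin
lift_definition zero_ell2 :: ell2 is "\<lambda>_. 0" by simp
lift_definition plus_ell2 :: "ell2 \<Rightarrow> ell2 \<Rightarrow> ell2" is "\<lambda>f g n. f n + g n"
  by (rule square_summable_add)
lift_definition uminus_ell2 :: "ell2 \<Rightarrow> ell2" is "\<lambda>f n. - f n" by simp
lift_definition minus_ell2 :: "ell2 \<Rightarrow> ell2 \<Rightarrow> ell2" is "\<lambda>f g n. f n - g n"
  using square_summable_add[of _ "\<lambda>n. - _ n"] by simp
lift_definition scaleR_ell2 :: "real \<Rightarrow> ell2 \<Rightarrow> ell2" is "\<lambda>r f n. of_real r * f n"
  by (rule square_summable_scale)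
instance
  by standard (transfer; auto simp: algebra_simps)+
end

text \<open>The type classes and bounded operators used below are real. Complex scalars are
  therefore a separate operation, and complex linearity a separate predicate
  (\<open>clin\<close>).\<close>

lift_definition scaleC :: "complex \<Rightarrow> ell2 \<Rightarrow> ell2" (infixr \<open>*\<^sub>C\<close> 75) is "\<lambda>c f n. c * f n"
  by (rule square_summable_scale)

lemma coord_simps [simp]:
  "coord 0 n = 0" "coord (x + y) n = coord x n + coord y n" "coord (- x) n = - coord x n"
  "coord (x - y) n = coord x n - coord y n" "coord (r *\<^sub>R x) n = of_real r * coord x n"
  "coord (c *\<^sub>C x) n = c * coord x n"
  by (transfer, simp)+

definition cinner :: "ell2 \<Rightarrow> ell2 \<Rightarrow> complex" where
  "cinner x y = (\<Sum>n. coord x n * cnj (coord y n))"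

lemma summable_norm_cinner: "summable (\<lambda>n. norm (coord x n * cnj (coord y n)))"
proof (rule summable_comparison_test'[OF summable_add[OF summable_coord[of x] summable_coord[of y]]])
  fix n
  show "norm (norm (coord x n * cnj (coord y n))) \<le> (cmod (coord x n))\<^sup>2 + (cmod (coord y n))\<^sup>2"
    using zero_le_power2[of "cmod (coord x n) - cmod (coord y n)"]
      mult_nonneg_nonneg[OF norm_ge_zero[of "coord x n"] norm_ge_zero[of "coord y n"]]
    unfolding norm_mult real_norm_def power2_eq_square abs_mult abs_norm_cancel complex_mod_cnj
    by (simp only: algebra_simps)
qed

lemma summable_cinner: "summable (\<lambda>n. coord x n * cnj (coord y n))"
  by (rule summable_norm_cancel[OF summable_norm_cinner])

lemma cinner_sums: "(\<lambda>n. coord x n * cnj (coord y n)) sums cinner x y"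
  unfolding cinner_def by (rule summable_sums[OF summable_cinner])

lemma cinner_add_left: "cinner (x + y) z = cinner x z + cinner y z"
  by (rule sums_unique2[OF cinner_sums])
     (use sums_add[OF cinner_sums[of x z] cinner_sums[of y z]] in \<open>simp add: algebra_simps\<close>)

lemma cinner_scaleC_left: "cinner (c *\<^sub>C x) z = c * cinner x z"
  by (rule sums_unique2[OF cinner_sums])
     (use sums_mult[OF cinner_sums[of x z], of c] in \<open>simp add: algebra_simps\<close>)

lemma cinner_commute: "cinner x y = cnj (cinner y x)"
  by (rule sums_unique2[OF cinner_sums])
     (use cinner_sums[of y x, THEN sums_cnj[THEN iffD2]] in \<open>simp add: mult.commute\<close>)

lemma cinner_add_right: "cinner z (x + y) = cinner z x + cinner z y"
  by (metis cinner_add_left cinner_commute complex_cnj_add)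

lemma cinner_scaleC_right: "cinner z (c *\<^sub>C x) = cnj c * cinner z x"
  by (metis cinner_scaleC_left cinner_commute complex_cnj_mult)

lemma scaleR_scaleC: "r *\<^sub>R x = of_real r *\<^sub>C x" for x :: ell2
  by (rule ell2_eqI) simp

lemma scaleC_simps:
  "c *\<^sub>C (d *\<^sub>C x) = (c * d) *\<^sub>C x" "1 *\<^sub>C x = x" "0 *\<^sub>C x = 0" "c *\<^sub>C 0 = 0" "(-1) *\<^sub>C x = - x"
  "c *\<^sub>C (x + y) = c *\<^sub>C x + c *\<^sub>C y" "c *\<^sub>C (x - y) = c *\<^sub>C x - c *\<^sub>C y"
  "(c + d) *\<^sub>C x = c *\<^sub>C x + d *\<^sub>C x" "r *\<^sub>R (c *\<^sub>C x) = c *\<^sub>C (r *\<^sub>R x)"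
  by (rule ell2_eqI; simp add: algebra_simps)+

lemma cinner_self_sums: "(\<lambda>n. (cmod (coord x n))\<^sup>2) sums Re (cinner x x)"
proof -
  have "(\<lambda>n. Re (coord x n * cnj (coord x n))) sums Re (cinner x x)"
    by (rule sums_Re[OF cinner_sums])
  then show ?thesis by (simp add: complex_mult_cnj cmod_power2)
qed

lemma cinner_self_Im: "Im (cinner x x) = 0"
  using cinner_commute[of x x] by (metis Reals_cnj_iff complex_is_Real_iff)

text \<open>The real inner product is the real part of \<open>cinner\<close>. It induces the same
  norm, so the Cauchy-Schwarz inequality and the metric structure of real inner product spaces carry
  over.\<close>

instantiation ell2 :: real_inner
begin
definition inner_ell2 :: "ell2 \<Rightarrow> ell2 \<Rightarrow> real" where "inner_ell2 x y = Re (cinner x y)"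
definition norm_ell2 :: "ell2 \<Rightarrow> real" where "norm_ell2 x = sqrt (inner x x)"
definition dist_ell2 :: "ell2 \<Rightarrow> ell2 \<Rightarrow> real" where "dist_ell2 x y = norm (x - y)"
definition sgn_ell2 :: "ell2 \<Rightarrow> ell2" where "sgn_ell2 x = x /\<^sub>R norm x"
definition uniformity_ell2 :: "(ell2 \<times> ell2) filter" where
  "uniformity_ell2 = (INF e\<in>{0<..}. principal {(x, y). dist x y < e})"
definition open_ell2 :: "ell2 set \<Rightarrow> bool" where
  "open_ell2 U = (\<forall>x\<in>U. eventually (\<lambda>(x', y). x' = x \<longrightarrow> y \<in> U) uniformity)"
instance
proof
  fix x y z :: ell2 and r :: real
  show "inner x y = inner y x"
    unfolding inner_ell2_def by (subst cinner_commute) simp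
  show "inner (x + y) z = inner x z + inner y z"
    by (simp add: inner_ell2_def cinner_add_left)
  show "inner (r *\<^sub>R x) y = r * inner x y"
    by (simp add: inner_ell2_def scaleR_scaleC cinner_scaleC_left)
  show nn: "0 \<le> inner x x"
    unfolding inner_ell2_def by (rule sums_le[OF _ sums_zero cinner_self_sums]) auto
  show "inner x x = 0 \<longleftrightarrow> x = 0"
  proof
    assume "inner x x = 0"
    then have *: "(\<lambda>n. (cmod (coord x n))\<^sup>2) sums 0"
      using cinner_self_sums[of x] by (simp add: inner_ell2_def)
    have "(cmod (coord x n))\<^sup>2 = 0" for n
      using suminf_eq_zero_iff[of "\<lambda>n. (cmod (coord x n))\<^sup>2"] * by (auto simp: sums_iff)
    then show "x = 0" by (intro ell2_eqI) simp
  qed (simp add: inner_ell2_def cinner_def)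
qed (simp_all add: norm_ell2_def dist_ell2_def sgn_ell2_def uniformity_ell2_def open_ell2_def)
end

lemma norm_sq_sums: "(\<lambda>n. (cmod (coord x n))\<^sup>2) sums (norm x)\<^sup>2"
  using cinner_self_sums[of x] by (simp add: power2_norm_eq_inner inner_ell2_def)

lemma cinner_self: "cinner x x = of_real ((norm x)\<^sup>2)"
  by (simp add: complex_eq_iff power2_norm_eq_inner inner_ell2_def cinner_self_Im)

lemma norm_scaleC [simp]: "norm (c *\<^sub>C x) = cmod c * norm x"
proof -
  have "cinner (c *\<^sub>C x) (c *\<^sub>C x) = (c * cnj c) * cinner x x"
    by (simp add: cinner_scaleC_left cinner_scaleC_right)
  also have "c * cnj c = of_real ((cmod c)\<^sup>2)" by (rule complex_norm_square[symmetric])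
  also have "of_real ((cmod c)\<^sup>2) * cinner x x = of_real ((cmod c * norm x)\<^sup>2)"
    by (simp add: cinner_self power_mult_distrib)
  finally have "of_real ((norm (c *\<^sub>C x))\<^sup>2) = (of_real ((cmod c * norm x)\<^sup>2) :: complex)"
    by (simp only: cinner_self)
  then have "(norm (c *\<^sub>C x))\<^sup>2 = (cmod c * norm x)\<^sup>2" using of_real_eq_iff by blast
  then show ?thesis by (simp add: power2_eq_iff_nonneg)
qed

text \<open>A unimodular factor \<open>c\<close> rotates the inner product onto the nonnegative real
  axis, where it coincides with the real inner product.\<close>

lemma cinner_cauchy_schwarz: "cmod (cinner x y) \<le> norm x * norm y"
proof (cases "cinner x y = 0")
  case False
  define c where "c = cnj (sgn (cinner x y))"
  have c: "cmod c = 1" using False by (simp add: c_def norm_sgn)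
  have "cinner (c *\<^sub>C x) y = of_real (cmod (cinner x y))"
  proof -
    have "cnj (cinner x y) * cinner x y = of_real ((cmod (cinner x y))\<^sup>2)"
      by (metis complex_norm_square mult.commute)
    then show ?thesis using False
      by (simp add: cinner_scaleC_left c_def sgn_eq field_simps power2_eq_square)
  qed
  then have "cmod (cinner x y) = inner (c *\<^sub>C x) y" by (simp add: inner_ell2_def)
  also have "\<dots> \<le> norm (c *\<^sub>C x) * norm y" by (rule norm_cauchy_schwarz)
  finally show ?thesis by (simp add: c)
qed simp

lemma cinner_simps [simp]: "cinner 0 x = 0" "cinner x 0 = 0"
  "cinner (- x) y = - cinner x y" "cinner x (- y) = - cinner x y"
  by (metis cinner_scaleC_left scaleC_simps(3) mult_zero_left,
      metis cinner_scaleC_right scaleC_simps(3) mult_zero_left complex_cnj_zero,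
      metis cinner_scaleC_left scaleC_simps(5) mult_minus1,
      metis cinner_scaleC_right scaleC_simps(5) mult_minus1 complex_cnj_minus complex_cnj_one)

lemma cinner_diff_left: "cinner (x - y) z = cinner x z - cinner y z"
  using cinner_add_left[of x "- y" z] by simp

lemma cinner_diff_right: "cinner z (x - y) = cinner z x - cinner z y"
  using cinner_add_right[of z x "- y"] by simp

lemma cinner_sum_left: "cinner (sum f A) y = (\<Sum>i\<in>A. cinner (f i) y)"
  by (induction A rule: infinite_finite_induct) (auto simp: cinner_add_left)

lemma cinner_sum_right: "cinner y (sum f A) = (\<Sum>i\<in>A. cinner y (f i))"
  by (induction A rule: infinite_finite_induct) (auto simp: cinner_add_right)

lemma bounded_bilinear_cinner: "bounded_bilinear cinner"
proof
  show "\<exists>K. \<forall>a b. norm (cinner a b) \<le> norm a * norm b * K"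
    using cinner_cauchy_schwarz by (intro exI[of _ 1]) auto
qed (auto simp: cinner_add_left cinner_add_right scaleR_scaleC cinner_scaleC_left
       cinner_scaleC_right scaleR_conv_of_real)

interpretation cinner: bounded_bilinear cinner by (rule bounded_bilinear_cinner)

lemma bounded_linear_scaleC: "bounded_linear (\<lambda>x. c *\<^sub>C x)"
  by (rule bounded_linear_intro[of _ "cmod c"]) (auto simp: scaleC_simps)

lemma sum_coord_le: "finite F \<Longrightarrow> (\<Sum>n\<in>F. (cmod (coord x n))\<^sup>2) \<le> (norm x)\<^sup>2"
  using sum_le_suminf[OF summable_coord[of x], of F] sums_unique[OF norm_sq_sums[of x]] by simp

lemma norm_coord_le: "cmod (coord x n) \<le> norm x"
  using sum_coord_le[of "{n}" x] by (simp add: power2_le_iff_abs_le)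

text \<open>A Cauchy sequence converges in each coordinate. The Cauchy estimate, restricted to
  finitely many coordinates, passes to the limit with a bound independent of their number; this
  gives both square-summability of the limit and convergence in norm.\<close>

instance ell2 :: complete_space
proof
  fix X :: "nat \<Rightarrow> ell2"
  assume X: "Cauchy X"
  have "Cauchy (\<lambda>n. coord (X n) k)" for k
  proof (rule metric_CauchyI)
    fix e :: real assume "0 < e"
    then obtain M where "\<forall>m\<ge>M. \<forall>n\<ge>M. dist (X m) (X n) < e" using metric_CauchyD[OF X] by blast
    moreover have "dist (coord (X m) k) (coord (X n) k) \<le> dist (X m) (X n)" for m n
      using norm_coord_le[of "X m - X n" k] by (simp add: dist_norm)
    ultimately show "\<exists>M. \<forall>m\<ge>M. \<forall>n\<ge>M. dist (coord (X m) k) (coord (X n) k) < e"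
      by (meson le_less_trans)
  qed
  then obtain f where f: "\<And>k. (\<lambda>n. coord (X n) k) \<longlonglongrightarrow> f k"
    unfolding Cauchy_convergent_iff convergent_def by metis
  have part: "(\<Sum>k<K. (cmod (coord (X n) k - f k))\<^sup>2) \<le> e\<^sup>2"
    if "\<forall>m\<ge>M. \<forall>n\<ge>M. dist (X m) (X n) < e" "n \<ge> M" for e M n K
  proof (rule LIMSEQ_le_const2)
    show "(\<lambda>m. \<Sum>k<K. (cmod (coord (X n) k - coord (X m) k))\<^sup>2) \<longlonglongrightarrow>
        (\<Sum>k<K. (cmod (coord (X n) k - f k))\<^sup>2)"
      by (intro tendsto_intros f)
    show "\<exists>N. \<forall>m\<ge>N. (\<Sum>k<K. (cmod (coord (X n) k - coord (X m) k))\<^sup>2) \<le> e\<^sup>2"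
    proof (intro exI[of _ M] allI impI)
      fix m assume m: "m \<ge> M"
      have "(\<Sum>k<K. (cmod (coord (X n - X m) k))\<^sup>2) \<le> (norm (X n - X m))\<^sup>2"
        by (rule sum_coord_le) simp
      also have "dist (X n) (X m) < e" using that m by blast
      then have "(norm (X n - X m))\<^sup>2 \<le> e\<^sup>2"
        by (intro power_mono) (simp_all add: dist_norm)
      finally show "(\<Sum>k<K. (cmod (coord (X n) k - coord (X m) k))\<^sup>2) \<le> e\<^sup>2" by simp
    qed
  qed
  have diff: "summable (\<lambda>k. (cmod (coord (X n) k - f k))\<^sup>2) \<and>
      (\<Sum>k. (cmod (coord (X n) k - f k))\<^sup>2) \<le> e\<^sup>2"
    if "\<forall>m\<ge>M. \<forall>n\<ge>M. dist (X m) (X n) < e" "n \<ge> M" for e M n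
  proof -
    have "summable (\<lambda>k. (cmod (coord (X n) k - f k))\<^sup>2)"
      by (rule bounded_imp_summable[where B = "e\<^sup>2"])
         (simp_all only: lessThan_Suc_atMost[symmetric] part[OF that] zero_le_power2)
    then show ?thesis using part[OF that] by (intro conjI suminf_le_const)
  qed
  obtain M where M: "\<forall>m\<ge>M. \<forall>n\<ge>M. dist (X m) (X n) < 1" using metric_CauchyD[OF X, of 1] by auto
  \<comment> \<open>The limit is written as a member of the sequence minus a square-summable
    difference.\<close>
  have "summable (\<lambda>k. (cmod (coord (X M) k + (-1) * (coord (X M) k - f k)))\<^sup>2)"
    by (intro square_summable_add square_summable_scale summable_coord conjunct1[OF diff[OF M order_refl]])
  then have "summable (\<lambda>k. (cmod (f k))\<^sup>2)" by simp
  then have cf: "coord (Abs_ell2 f) = f" by (intro Abs_ell2_inverse) simp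
  have "X \<longlonglongrightarrow> Abs_ell2 f"
  proof (rule metric_LIMSEQ_I)
    fix r :: real assume r: "0 < r"
    then obtain M where M: "\<forall>m\<ge>M. \<forall>n\<ge>M. dist (X m) (X n) < r / 2"
      using metric_CauchyD[OF X, of "r / 2"] by auto
    show "\<exists>no. \<forall>n\<ge>no. dist (X n) (Abs_ell2 f) < r"
    proof (intro exI[of _ M] allI impI)
      fix n assume n: "n \<ge> M"
      have "(norm (X n - Abs_ell2 f))\<^sup>2 \<le> (r / 2)\<^sup>2"
        using diff[OF M n] sums_unique[OF norm_sq_sums[of "X n - Abs_ell2 f"]] by (simp only: coord_simps cf)
      then have "norm (X n - Abs_ell2 f) \<le> r / 2" using r by (simp add: power2_le_iff_abs_le)
      then show "dist (X n) (Abs_ell2 f) < r" using r by (simp add: dist_norm)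
    qed
  qed
  then show "convergent X" by (auto simp: convergent_def)
qed

lift_definition unit_vec :: "nat \<Rightarrow> ell2" is "\<lambda>n m. if m = n then 1 else 0"
proof -
  fix n :: nat
  have "(\<lambda>m. (cmod (if m = n then 1 else 0))\<^sup>2) = (\<lambda>m. if m = n then 1 else (0::real))" by auto
  then show "summable (\<lambda>m. (cmod (if m = n then 1 else 0))\<^sup>2)" by simp
qed

lemma coord_unit_vec: "coord (unit_vec n) m = (if m = n then 1 else 0)"
  by transfer simp

lemma cinner_unit_vec_right [simp]: "cinner x (unit_vec n) = coord x n"
proof (rule sums_unique2[OF cinner_sums])
  have "(\<lambda>m. if m = n then coord x m else 0) sums coord x n" by (rule sums_single)
  moreover have "(\<lambda>m. coord x m * cnj (coord (unit_vec n) m)) = (\<lambda>m. if m = n then coord x m else 0)"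
    by (auto simp: coord_unit_vec)
  ultimately show "(\<lambda>m. coord x m * cnj (coord (unit_vec n) m)) sums coord x n" by simp
qed

lemma cinner_unit_vec_left [simp]: "cinner (unit_vec n) x = cnj (coord x n)"
  by (subst cinner_commute) simp

lemma norm_unit_vec [simp]: "norm (unit_vec n) = 1"
proof -
  have "of_real ((norm (unit_vec n))\<^sup>2) = (1 :: complex)"
    unfolding cinner_self[symmetric] by (simp add: coord_unit_vec)
  then have "(norm (unit_vec n))\<^sup>2 = 1\<^sup>2" by (metis of_real_eq_1_iff one_power2)
  then show ?thesis by (rule power2_eq_imp_eq) auto
qed

lemma coord_sum [simp]: "coord (sum f A) n = (\<Sum>i\<in>A. coord (f i) n)"
  by (induction A rule: infinite_finite_induct) auto

lemma coord_sum_unit_vec: "coord (\<Sum>i<N. a i *\<^sub>C unit_vec i) n = (if n < N then a n else 0)"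
  by (induction N) (auto simp: coord_unit_vec less_Suc_eq simp del: coord_sum)

text \<open>The squared norm of the remainder is the tail of a convergent series.\<close>

lemma ell2_expansion: "(\<lambda>n. coord x n *\<^sub>C unit_vec n) sums x"
proof -
  define t where "t N = (\<Sum>n<N. coord x n *\<^sub>C unit_vec n)" for N
  have co: "coord (t N) k = (if k < N then coord x k else 0)" for N k
    by (simp add: t_def coord_sum_unit_vec del: coord_sum)
  have nt: "(norm (x - t N))\<^sup>2 = (\<Sum>k. (cmod (coord x (k + N)))\<^sup>2)" for N
  proof -
    have "(norm (x - t N))\<^sup>2 = (\<Sum>k. (cmod (coord (x - t N) k))\<^sup>2)"
      using norm_sq_sums by (rule sums_unique)
    also have "\<dots> = (\<Sum>k. (cmod (coord (x - t N) (k + N)))\<^sup>2) + (\<Sum>k<N. (cmod (coord (x - t N) k))\<^sup>2)"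
      by (rule suminf_split_initial_segment[OF summable_coord])
    finally show ?thesis by (simp add: co)
  qed
  have "(\<lambda>N. (norm (x - t N))\<^sup>2) \<longlonglongrightarrow> 0"
    unfolding nt by (rule suminf_exist_split2[OF summable_coord])
  then have "(\<lambda>N. sqrt ((norm (x - t N))\<^sup>2)) \<longlonglongrightarrow> sqrt 0"
    by (rule tendsto_real_sqrt)
  then have "(\<lambda>N. norm (t N - x)) \<longlonglongrightarrow> 0" by (simp add: norm_minus_commute)
  then have "t \<longlonglongrightarrow> x" by (simp add: tendsto_norm_zero_iff LIM_zero_iff)
  then show ?thesis by (simp add: sums_def t_def[abs_def])
qed

instance ell2 :: banach ..

section \<open>Bounded operators\<close>

type_synonym ell2_op = "ell2 \<Rightarrow>\<^sub>L ell2"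

text \<open>The type \<open>ell2_op\<close> contains all bounded real-linear maps; the operators of
  the theorem correspond to those satisfying \<open>clin\<close>.\<close>

definition clin :: "ell2_op \<Rightarrow> bool" where
  "clin T \<longleftrightarrow> (\<forall>c x. T (c *\<^sub>C x) = c *\<^sub>C T x)"

lemma clinD: "clin T \<Longrightarrow> T (c *\<^sub>C x) = c *\<^sub>C T x"
  by (simp add: clin_def)

lemma clin_closed:
  "clin 0" "clin id_blinfun" "clin S \<Longrightarrow> clin T \<Longrightarrow> clin (S + T)" "clin S \<Longrightarrow> clin T \<Longrightarrow> clin (S - T)"
  "clin T \<Longrightarrow> clin (r *\<^sub>R T)" "clin S \<Longrightarrow> clin T \<Longrightarrow> clin (S o\<^sub>L T)"
  by (auto simp: clin_def scaleC_simps blinfun.bilinear_simps)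

lemma clin_sum: "(\<And>i. i \<in> I \<Longrightarrow> clin (T i)) \<Longrightarrow> clin (sum T I)"
  by (induction I rule: infinite_finite_induct) (auto intro: clin_closed)

lemma tendsto_scaleC: "(f \<longlongrightarrow> x) F \<Longrightarrow> ((\<lambda>n. c *\<^sub>C f n) \<longlongrightarrow> c *\<^sub>C x) F"
  by (rule bounded_linear.tendsto[OF bounded_linear_scaleC])

lemma clin_limit:
  assumes "\<And>n. clin (T n)" "T \<longlonglongrightarrow> L"
  shows "clin L"
  unfolding clin_def
proof (intro allI)
  fix c x
  have "(\<lambda>n. (T n) (c *\<^sub>C x)) \<longlonglongrightarrow> L (c *\<^sub>C x)"
    by (intro tendsto_intros assms)
  moreover have "(\<lambda>n. c *\<^sub>C (T n) x) \<longlonglongrightarrow> c *\<^sub>C L x"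
    by (intro tendsto_scaleC tendsto_intros assms)
  ultimately show "L (c *\<^sub>C x) = c *\<^sub>C L x"
    using assms(1) by (intro LIMSEQ_unique) (auto simp: clin_def)
qed

lemma cinner_eqI: "(\<And>x. cinner x y = cinner x z) \<Longrightarrow> y = z"
proof -
  assume "\<And>x. cinner x y = cinner x z"
  then have "cinner (y - z) (y - z) = 0" by (simp add: cinner_diff_right)
  then show ?thesis by (simp add: cinner_self)
qed

lemma cinner_eqI': "(\<And>x. cinner y x = cinner z x) \<Longrightarrow> y = z"
  by (rule cinner_eqI) (metis cinner_commute)

lemma norm_le_of_cinner:
  assumes "\<And>x. cmod (cinner y x) \<le> C * norm x" "0 \<le> C"
  shows "norm y \<le> C"
proof (cases "y = 0")
  case False
  have "norm y * norm y \<le> C * norm y"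
    using assms(1)[of y] by (simp add: cinner_self power2_eq_square norm_mult)
  then show ?thesis using False by simp
qed (use assms in simp)

text \<open>Riesz representation in coordinates: the only candidate for \<open>T x\<close> has the
  coordinates \<open>B x (unit_vec n)\<close>, and the point is that they are square-summable.
  Adjoints and weak integrals are both obtained from this lemma.\<close>

lemma sesquilinear_op:
  fixes B :: "ell2 \<Rightarrow> ell2 \<Rightarrow> complex"
  assumes addl: "\<And>x y z. B (x + y) z = B x z + B y z" and scl: "\<And>c x z. B (c *\<^sub>C x) z = c * B x z"
    and addr: "\<And>x y z. B z (x + y) = B z x + B z y" and scr: "\<And>c x z. B z (c *\<^sub>C x) = cnj c * B z x"
    and bound: "\<And>x y. cmod (B x y) \<le> C * norm x * norm y"
  shows "\<exists>T. clin T \<and> (\<forall>x y. cinner (T x) y = B x y)"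
proof -
  have sumr: "B x (sum g I) = (\<Sum>i\<in>I. B x (g i))" if "finite I" for x I and g :: "nat \<Rightarrow> ell2"
    using that
  proof (induction I rule: finite_induct)
    case empty
    show ?case using scr[of x 0 0] by (simp add: scaleC_simps)
  qed (simp add: addr)
  define K where "K = max C 0"
  have K0: "0 \<le> K" by (simp add: K_def)
  have bK: "cmod (B x y) \<le> K * norm x * norm y" for x y
    by (rule order_trans[OF bound]) (auto simp: K_def intro!: mult_right_mono)
  define t where "t x = Abs_ell2 (\<lambda>n. B x (unit_vec n))" for x
  have ct: "coord (t x) n = B x (unit_vec n)" for x n
  proof -
    define a where "a n = B x (unit_vec n)" for n
    have "(\<Sum>n<N. (cmod (a n))\<^sup>2) \<le> (K * norm x)\<^sup>2" for N
    proof -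
      define S where "S = (\<Sum>n<N. (cmod (a n))\<^sup>2)"
      \<comment> \<open>For this truncation both \<open>B x z\<close> and the square of
        \<open>norm z\<close> equal \<open>S\<close>, so the bound on \<open>B\<close> can be
        divided by \<open>norm z\<close> and the result does not depend on \<open>N\<close>.\<close>
      define z where "z = (\<Sum>n<N. a n *\<^sub>C unit_vec n)"
      have S0: "S \<ge> 0" by (simp add: S_def sum_nonneg)
      have sq: "w * cnj w = of_real ((cmod w)\<^sup>2)" for w :: complex by (rule complex_norm_square[symmetric])
      have "coord z n = a n" if "n < N" for n
        using that by (simp add: z_def coord_sum_unit_vec del: coord_sum)
      then have "(\<Sum>n<N. a n * cnj (coord z n)) = of_real S" by (simp add: S_def sq)
      moreover have "cinner z z = (\<Sum>n<N. a n * cnj (coord z n))"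
        by (subst (1) z_def) (simp add: cinner_sum_left cinner_scaleC_left)
      ultimately have "cinner z z = of_real S" by simp
      then have nz: "(norm z)\<^sup>2 = S" unfolding cinner_self using of_real_eq_iff by blast
      have "B x z = (\<Sum>n<N. a n * cnj (a n))"
        unfolding z_def by (simp add: sumr scr a_def mult.commute)
      also have "\<dots> = of_real S" by (simp add: S_def sq)
      finally have "S = cmod (B x z)" using S0 by simp
      also have "\<dots> \<le> K * norm x * norm z" by (rule bK)
      finally have *: "norm z * norm z \<le> norm z * (K * norm x)"
        using nz by (simp add: power2_eq_square algebra_simps)
      have "norm z \<le> K * norm x"
        using * K0 by (cases "norm z = 0") (auto dest: mult_left_le_imp_le)
      then have "(norm z)\<^sup>2 \<le> (K * norm x)\<^sup>2" by (intro power_mono) auto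
      then show ?thesis using nz by (simp add: S_def)
    qed
    then have "summable (\<lambda>n. (cmod (a n))\<^sup>2)"
      by (intro bounded_imp_summable[where B = "(K * norm x)\<^sup>2"])
         (simp_all only: lessThan_Suc_atMost[symmetric] zero_le_power2)
    then show ?thesis unfolding t_def a_def by (simp add: Abs_ell2_inverse)
  qed
  \<comment> \<open>\<open>B\<close> is conjugate-linear in its second argument, so its conjugate is
    a bounded linear functional there and can be applied termwise to the expansion of
    \<open>y\<close>.\<close>
  have bl: "bounded_linear (B' y)" if "B' = (\<lambda>x y. cnj (B x y))" for B' y
    unfolding that
  proof (rule bounded_linear_intro[where K = "K * norm y"])
    show "cnj (B y (a + b)) = cnj (B y a) + cnj (B y b)" for a b by (simp add: addr)
    show "cnj (B y (r *\<^sub>R a)) = r *\<^sub>R cnj (B y a)" for r a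
      by (simp add: scaleR_scaleC scr scaleR_conv_of_real)
    show "norm (cnj (B y a)) \<le> norm a * (K * norm y)" for a
      using bK[of y a] by (simp add: mult_ac)
  qed
  have tB: "cinner (t x) y = B x y" for x y
  proof -
    have "(\<lambda>n. cnj (B x (coord y n *\<^sub>C unit_vec n))) sums cnj (B x y)"
      by (rule bounded_linear.sums[OF bl[OF refl] ell2_expansion])
    then have "(\<lambda>n. coord (t x) n * cnj (coord y n)) sums B x y"
      using sums_cnj[of "\<lambda>n. B x (coord y n *\<^sub>C unit_vec n)" "B x y"] by (simp add: scr ct mult.commute)
    then show ?thesis by (rule sums_unique2[OF cinner_sums])
  qed
  have tsc: "t (c *\<^sub>C x) = c *\<^sub>C t x" for c x
    by (rule cinner_eqI') (simp add: tB scl cinner_scaleC_left)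
  have "bounded_linear t"
  proof (rule bounded_linear_intro[where K = K])
    show "t (x + y) = t x + t y" for x y by (rule cinner_eqI') (simp add: tB addl cinner_add_left)
    show "t (r *\<^sub>R x) = r *\<^sub>R t x" for r x unfolding scaleR_scaleC by (rule tsc)
    show "norm (t x) \<le> norm x * K" for x
    proof (rule norm_le_of_cinner)
      show "cmod (cinner (t x) y) \<le> norm x * K * norm y" for y
        unfolding tB using bK[of x y] by (simp add: mult_ac)
    qed (simp add: K0)
  qed
  then show ?thesis
    by (intro exI[of _ "Blinfun t"]) (simp add: clin_def bounded_linear_Blinfun_apply tB tsc)
qed

section \<open>Adjoints and positive operators\<close>

definition adj :: "ell2_op \<Rightarrow> ell2_op" where
  "adj T = (SOME S. clin S \<and> (\<forall>x y. cinner (S x) y = cinner x (T y)))"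

lemma
  assumes T: "clin T"
  shows clin_adj: "clin (adj T)"
    and cinner_adj': "cinner (adj T x) y = cinner x (T y)"
proof -
  have "cmod (cinner x (T y)) \<le> norm T * norm x * norm y" for x y
  proof -
    have "cmod (cinner x (T y)) \<le> norm x * norm (T y)" by (rule cinner_cauchy_schwarz)
    also have "\<dots> \<le> norm x * (norm T * norm y)" by (intro mult_left_mono norm_blinfun) auto
    finally show ?thesis by (simp add: mult_ac)
  qed
  then have "\<exists>S. clin S \<and> (\<forall>x y. cinner (S x) y = cinner x (T y))"
    by (intro sesquilinear_op)
       (simp_all add: cinner_add_left cinner_add_right cinner_scaleC_left cinner_scaleC_right blinfun.add_right clinD[OF T])
  from someI_ex[OF this] show "clin (adj T)" "cinner (adj T x) y = cinner x (T y)"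
    unfolding adj_def by auto
qed

lemma cinner_adj: "clin T \<Longrightarrow> cinner (T x) y = cinner x (adj T y)"
  by (metis cinner_adj' cinner_commute)

lemma adj_unique:
  fixes S T :: ell2_op
  assumes "clin T" "\<And>x y. cinner (T x) y = cinner x (S y)"
  shows "S = adj T"
  using assms by (intro blinfun_eqI cinner_eqI) (simp add: cinner_adj[symmetric])

definition pos :: "ell2_op \<Rightarrow> bool" where
  "pos T \<longleftrightarrow> clin T \<and> (\<forall>x. Im (cinner (T x) x) = 0 \<and> 0 \<le> Re (cinner (T x) x))"

definition selfadj :: "ell2_op \<Rightarrow> bool" where
  "selfadj T \<longleftrightarrow> clin T \<and> (\<forall>x y. cinner (T x) y = cinner x (T y))"

lemma selfadjD: "selfadj T \<Longrightarrow> cinner (T x) y = cinner x (T y)"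
  by (simp add: selfadj_def)

text \<open>Polarization of the sesquilinear form \<open>\<langle>Tx, y\<rangle> - \<langle>x, Ty\<rangle>\<close>, which vanishes on the diagonal.\<close>

lemma pos_selfadj:
  assumes "pos T"
  shows "selfadj T"
proof -
  have T: "clin T" and im: "\<And>x. Im (cinner (T x) x) = 0"
    using assms by (auto simp: pos_def)
  define D where "D x y = cinner (T x) y - cinner x (T y)" for x y
  have D0: "D x x = 0" for x
    using im[of x] cinner_commute[of x "T x"] by (simp add: D_def complex_eq_iff)
  have D1: "D (x + y) (x + y) = D x x + D x y + D y x + D y y" for x y
    by (simp add: D_def blinfun.bilinear_simps cinner_add_left cinner_add_right)
  have D2: "D (x + \<i> *\<^sub>C y) (x + \<i> *\<^sub>C y) = D x x - \<i> * D x y + \<i> * D y x + D y y" for x y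
    by (simp add: D_def blinfun.bilinear_simps cinner_add_left cinner_add_right clinD[OF T]
        cinner_scaleC_left cinner_scaleC_right algebra_simps)
  have "D x y = 0" for x y
  proof -
    have "D x y + D y x = 0" using D1[of x y] by (simp add: D0)
    moreover have "\<i> * D y x = \<i> * D x y" using D2[of x y] by (simp add: D0)
    ultimately show ?thesis by simp
  qed
  then show ?thesis using T by (auto simp: selfadj_def D_def)
qed

lemma selfadj_Im: "selfadj T \<Longrightarrow> Im (cinner (T x) x) = 0"
  by (metis Reals_cnj_iff cinner_commute complex_is_Real_iff selfadjD)

text \<open>\<open><T x, y>\<close> is a positive semidefinite form. Its value at
  \<open>x - t c y\<close>, with a phase \<open>c\<close> making the cross term real, is bounded by
  a real quadratic in \<open>t\<close>, which therefore stays nonnegative.\<close>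

lemma pos_cauchy_schwarz:
  assumes "pos T"
  shows "(cmod (cinner (T x) y))\<^sup>2 \<le>
    Re (cinner (T x) x) * Re (cinner (T y) y)"
proof -
  have T: "clin T" and nn: "\<And>x. 0 \<le> Re (cinner (T x) x)" using assms by (auto simp: pos_def)
  note sa = selfadjD[OF pos_selfadj[OF assms]]
  define w where "w = cinner (T x) y"
  define c where "c = sgn w"
  define a where "a = Re (cinner (T x) x)"
  define d where "d = Re (cinner (T y) y)"
  have "w * cnj w = of_real ((cmod w)\<^sup>2)" by (rule complex_norm_square[symmetric])
  then have cw: "cnj c * w = of_real (cmod w)"
    by (cases "w = 0") (auto simp: c_def sgn_eq field_simps power2_eq_square)
  have q: "0 \<le> a - 2 * t * cmod w + t\<^sup>2 * d" for t :: real
  proof -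
    define z where "z = x - (of_real t * c) *\<^sub>C y"
    have yx: "cinner (T y) x = cnj w"
      unfolding w_def by (metis sa cinner_commute)
    have "cinner (T z) z = cinner (T x) x - of_real t * (cnj c * w)
        - of_real t * cnj (cnj c * w) + (of_real t * c) * cnj (of_real t * c) * cinner (T y) y"
      by (simp add: z_def blinfun.bilinear_simps clinD[OF T] cinner_diff_left cinner_diff_right
        cinner_scaleC_left cinner_scaleC_right yx w_def[symmetric] algebra_simps)
    also have "(of_real t * c) * cnj (of_real t * c) = of_real ((cmod (of_real t * c))\<^sup>2)"
      by (rule complex_norm_square[symmetric])
    also have "(cmod (of_real t * c))\<^sup>2 = t\<^sup>2 * (cmod c)\<^sup>2"
      by (simp add: norm_mult power_mult_distrib)
    finally have "Re (cinner (T z) z) = a - 2 * t * cmod w + t\<^sup>2 * (cmod c)\<^sup>2 * d"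
      by (simp add: cw a_def d_def)
    moreover have "t\<^sup>2 * (cmod c)\<^sup>2 * d \<le> t\<^sup>2 * 1 * d"
      using nn[of y] by (intro mult_right_mono mult_left_mono) (auto simp: c_def norm_sgn d_def)
    ultimately show ?thesis using nn[of z] by simp
  qed
  have "(cmod w)\<^sup>2 \<le> a * d"
  proof (cases "d = 0")
    case True
    have "cmod w = 0"
    proof (rule ccontr)
      assume "cmod w \<noteq> 0"
      \<comment> \<open>For \<open>d = 0\<close> the quadratic is affine in \<open>t\<close>, and at
        this \<open>t\<close> it equals \<open>-1\<close>.\<close>
      then show False using q[of "(a + 1) / (2 * cmod w)"] True by (simp add: field_simps)
    qed
    then show ?thesis using True by simp
  next
    case False
    then have "d > 0" using nn[of y] by (simp add: d_def)
    \<comment> \<open>The minimizer of the quadratic.\<close>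
    then show ?thesis using q[of "cmod w / d"] by (simp add: field_simps power2_eq_square)
  qed
  then show ?thesis by (simp add: w_def a_def d_def)
qed

text \<open>The Cauchy-Schwarz inequality for the form of \<open>T\<close>, applied to
  \<open>x\<close> and \<open>T x\<close>, upgrades a bound on the diagonal of the form to a bound
  on the operator norm.\<close>

lemma pos_norm_le:
  assumes "pos T" "\<And>x. Re (cinner (T x) x) \<le> (norm x)\<^sup>2"
  shows "norm T \<le> 1"
proof (rule norm_blinfun_bound)
  fix x
  let ?y = "T x"
  have nn: "0 \<le> Re (cinner (T z) z)" for z using assms by (simp add: pos_def)
  have "(norm ?y)\<^sup>2 * (norm ?y)\<^sup>2 = (cmod (cinner ?y ?y))\<^sup>2"
    by (simp add: cinner_self power2_eq_square norm_mult)
  also have "\<dots> \<le> Re (cinner ?y x) * Re (cinner (T ?y) ?y)"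
    by (rule pos_cauchy_schwarz[OF assms(1)])
  also have "\<dots> \<le> (norm x)\<^sup>2 * (norm ?y)\<^sup>2" by (intro mult_mono assms nn) auto
  finally have *: "(norm ?y)\<^sup>2 * (norm ?y)\<^sup>2 \<le> (norm x)\<^sup>2 * (norm ?y)\<^sup>2" .
  have "(norm ?y)\<^sup>2 \<le> (norm x)\<^sup>2"
  proof (cases "?y = 0")
    case False
    show ?thesis by (rule mult_right_le_imp_le[OF *]) (use False in simp)
  qed simp
  then show "norm ?y \<le> 1 * norm x" by (simp add: power2_le_iff_abs_le)
qed simp



lemma pos_adj_self: "clin T \<Longrightarrow> pos (adj T o\<^sub>L T)"
  unfolding pos_def by (auto intro: clin_closed clin_adj simp: cinner_adj' cinner_self)

lemma pos_zero_iff: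
  assumes "pos T" "cinner (T x) x = 0"
  shows "T x = 0"
proof -
  have "(cmod (cinner (T x) (T x)))\<^sup>2 \<le> 0"
    using pos_cauchy_schwarz[OF assms(1), of x "T x"] assms(2) by simp
  then show ?thesis by (simp add: cinner_self)
qed

text \<open>
  The square root of \<open>1 - B\<close> is \<open>1 - Y\<close> where \<open>Y = (B + Y\<^sup>2) / 2\<close>. The fixed point iteration from \<open>0\<close>
  is majorized by the scalar one \<open>t \<mapsto> (1 + t\<^sup>2) / 2\<close>.
\<close>

primrec sqrt_iter :: "ell2_op \<Rightarrow> nat \<Rightarrow> ell2_op" where
  "sqrt_iter B 0 = 0"
| "sqrt_iter B (Suc n) = (1/2) *\<^sub>R (B + (sqrt_iter B n o\<^sub>L sqrt_iter B n))"

primrec sqrt_majorant :: "nat \<Rightarrow> real" where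
  "sqrt_majorant 0 = 0"
| "sqrt_majorant (Suc n) = (1 + (sqrt_majorant n)\<^sup>2) / 2"

lemma sqrt_majorant_bounds: "0 \<le> sqrt_majorant n" "sqrt_majorant n \<le> 1"
proof (induction n)
  case (Suc n)
  { case 1 show ?case by simp }
  { case 2 show ?case using Suc power_le_one[of "sqrt_majorant n" 2] by simp }
qed auto

lemma blinfun_compose_simps:
  fixes A B C :: ell2_op
  shows "(A + B) o\<^sub>L C = (A o\<^sub>L C) + (B o\<^sub>L C)" "C o\<^sub>L (A + B) = (C o\<^sub>L A) + (C o\<^sub>L B)"
    "(A - B) o\<^sub>L C = (A o\<^sub>L C) - (B o\<^sub>L C)" "C o\<^sub>L (A - B) = (C o\<^sub>L A) - (C o\<^sub>L B)"
    "(r *\<^sub>R A) o\<^sub>L C = r *\<^sub>R (A o\<^sub>L C)" "C o\<^sub>L (r *\<^sub>R A) = r *\<^sub>R (C o\<^sub>L A)"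
    "(A o\<^sub>L B) o\<^sub>L C = A o\<^sub>L (B o\<^sub>L C)" "id_blinfun o\<^sub>L A = A" "A o\<^sub>L id_blinfun = A"
  by (rule blinfun_eqI; simp add: blinfun.bilinear_simps)+

text \<open>Every iterate is a polynomial in \<open>B\<close>. For \<open>C\<close> an iterate this
  shows that the iterates commute with each other; a general \<open>C\<close> serves the uniqueness
  of the root.\<close>

lemma sqrt_iter_commute:
  assumes "C o\<^sub>L B = B o\<^sub>L C"
  shows "C o\<^sub>L sqrt_iter B n = sqrt_iter B n o\<^sub>L C"
proof (induction n)
  case (Suc n)
  have "C o\<^sub>L (sqrt_iter B n o\<^sub>L sqrt_iter B n) = (sqrt_iter B n o\<^sub>L sqrt_iter B n) o\<^sub>L C"
    by (metis Suc blinfun_compose_simps(7))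
  then show ?case by (simp add: blinfun_compose_simps assms)
qed simp

lemma sqrt_iter_clin: "clin B \<Longrightarrow> clin (sqrt_iter B n)"
  by (induction n) (auto intro!: clin_closed)

lemma sqrt_iter_selfadj: "selfadj B \<Longrightarrow> selfadj (sqrt_iter B n)"
proof (induction n)
  case (Suc n)
  then show ?case
    by (auto intro!: clin_closed simp: selfadj_def blinfun.bilinear_simps scaleR_scaleC
      cinner_add_left cinner_add_right cinner_scaleC_left cinner_scaleC_right)
qed (simp add: selfadj_def clin_closed)

lemma sqrt_iter_norm:
  assumes "norm B \<le> 1"
  shows "norm (sqrt_iter B n) \<le> sqrt_majorant n"
proof (induction n)
  case (Suc n)
  have "norm (B + (sqrt_iter B n o\<^sub>L sqrt_iter B n)) \<le> norm B + norm (sqrt_iter B n) * norm (sqrt_iter B n)"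
    by (rule order_trans[OF norm_triangle_ineq add_left_mono[OF norm_blinfun_compose]])
  also have "\<dots> \<le> 1 + sqrt_majorant n * sqrt_majorant n"
    by (intro add_mono assms mult_mono Suc sqrt_majorant_bounds norm_ge_zero)
  finally show ?case by (simp add: power2_eq_square)
qed simp

lemma sqrt_iter_increment:
  assumes "norm B \<le> 1"
  shows "norm (sqrt_iter B (Suc n) - sqrt_iter B n) \<le> sqrt_majorant (Suc n) - sqrt_majorant n"
proof (induction n)
  case (Suc n)
  let ?Y = "sqrt_iter B" and ?t = "sqrt_majorant"
  have comm: "?Y (Suc n) o\<^sub>L ?Y n = ?Y n o\<^sub>L ?Y (Suc n)"
    by (intro sqrt_iter_commute) (metis sqrt_iter_commute)
  have "?Y (Suc (Suc n)) - ?Y (Suc n) = (1/2) *\<^sub>R ((?Y (Suc n) o\<^sub>L ?Y (Suc n)) - (?Y n o\<^sub>L ?Y n))"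
    unfolding sqrt_iter.simps(2)[of B "Suc n"] sqrt_iter.simps(2)[of B n] scaleR_diff_right[symmetric]
    by simp
  \<comment> \<open>Difference of two squares, factored because consecutive iterates
    commute.\<close>
  also have "\<dots> = (1/2) *\<^sub>R ((?Y (Suc n) - ?Y n) o\<^sub>L (?Y (Suc n) + ?Y n))"
    using comm by (simp only: blinfun_compose_simps) simp
  also have "norm \<dots> \<le> (1/2) * (norm (?Y (Suc n) - ?Y n) * norm (?Y (Suc n) + ?Y n))"
    using norm_blinfun_compose[of "?Y (Suc n) - ?Y n" "?Y (Suc n) + ?Y n"] by simp
  also have "\<dots> \<le> (1/2) * ((?t (Suc n) - ?t n) * (?t (Suc n) + ?t n))"
  proof (intro mult_left_mono mult_mono Suc)
    show "norm (?Y (Suc n) + ?Y n) \<le> ?t (Suc n) + ?t n"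
      by (rule order_trans[OF norm_triangle_ineq add_mono[OF sqrt_iter_norm[OF assms] sqrt_iter_norm[OF assms]]])
    show "0 \<le> ?t (Suc n) - ?t n" using Suc norm_ge_zero order_trans by blast
  qed auto
  also have "\<dots> = ?t (Suc (Suc n)) - ?t (Suc n)"
    by (subst (3) sqrt_majorant.simps(2), subst (4) sqrt_majorant.simps(2))
       (simp add: power2_eq_square algebra_simps)
  finally show ?case .
qed (use assms in simp)

text \<open>The scalar majorant is increasing and bounded by 1, so its increments are summable, and
  they dominate those of the iteration.\<close>

lemma sqrt_iter_convergent:
  assumes "norm B \<le> 1"
  shows "convergent (sqrt_iter B)"
proof -
  have mono: "incseq sqrt_majorant"
  proof (rule incseq_SucI)
    fix n
    \<comment> \<open>The increment bound holds for every \<open>B\<close> of norm at most 1;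
      already for \<open>B = 0\<close> it bounds the scalar increment from below by a norm.\<close>
    show "sqrt_majorant n \<le> sqrt_majorant (Suc n)"
      using order_trans[OF norm_ge_zero sqrt_iter_increment[of 0 n]] by (simp del: sqrt_majorant.simps)
  qed
  obtain L where "sqrt_majorant \<longlonglongrightarrow> L"
    using incseq_convergent[OF mono] sqrt_majorant_bounds(2) by metis
  then have "summable (\<lambda>n. sqrt_majorant (Suc n) - sqrt_majorant n)"
    by (rule sums_summable[OF telescope_sums])
  then have "summable (\<lambda>n. norm (sqrt_iter B (Suc n) - sqrt_iter B n))"
    by (rule summable_comparison_test') (simp add: sqrt_iter_increment[OF assms] del: sqrt_iter.simps sqrt_majorant.simps)
  then have "summable (\<lambda>n. sqrt_iter B (Suc n) - sqrt_iter B n)" by (rule summable_norm_cancel)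
  then show ?thesis
    by (simp add: summable_iff_convergent sum_lessThan_telescope del: sqrt_iter.simps(2))
qed

text \<open>The root is \<open>1 - Y\<close> with \<open>Y\<close> the limit of the iteration for
  \<open>B = 1 - P\<close>; it is positive because \<open>norm Y\<close> is at most 1. The clause on
  commuting operators later forces any other positive root to commute with this one.\<close>

lemma pos_sqrt_exists_contraction:
  assumes P: "pos P" "\<And>x. Re (cinner (P x) x) \<le> (norm x)\<^sup>2"
  shows "\<exists>Q. pos Q \<and> Q o\<^sub>L Q = P \<and> (\<forall>C. C o\<^sub>L P = P o\<^sub>L C \<longrightarrow> C o\<^sub>L Q = Q o\<^sub>L C)"
proof -
  define B where "B = id_blinfun - P"
  have cB: "clin B" using P by (auto simp: B_def pos_def intro: clin_closed)
  have BP: "cinner (B x) x = of_real ((norm x)\<^sup>2) - cinner (P x) x" for x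
    by (simp add: B_def blinfun.bilinear_simps cinner_diff_left cinner_self)
  have posB: "pos B" using P cB unfolding pos_def BP by auto
  have nB: "norm B \<le> 1" by (rule pos_norm_le[OF posB]) (use P in \<open>auto simp: BP pos_def\<close>)
  note saB = pos_selfadj[OF posB]
  obtain Y where Y: "sqrt_iter B \<longlonglongrightarrow> Y" using sqrt_iter_convergent[OF nB] by (auto simp: convergent_def)
  have Yeq: "Y = (1/2) *\<^sub>R (B + (Y o\<^sub>L Y))"
  proof (rule LIMSEQ_unique)
    show "(\<lambda>n. sqrt_iter B (Suc n)) \<longlonglongrightarrow> Y" using Y by (rule LIMSEQ_Suc)
    show "(\<lambda>n. sqrt_iter B (Suc n)) \<longlonglongrightarrow> (1/2) *\<^sub>R (B + (Y o\<^sub>L Y))"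
      unfolding sqrt_iter.simps by (intro tendsto_intros bounded_bilinear.tendsto[OF bounded_bilinear_blinfun_compose] Y)
  qed
  have nY: "norm Y \<le> 1"
    by (rule LIMSEQ_le_const2[OF tendsto_norm[OF Y]])
       (use order_trans[OF sqrt_iter_norm[OF nB] sqrt_majorant_bounds(2)] in auto)
  have cY: "clin Y" by (rule clin_limit[OF sqrt_iter_clin[OF cB] Y])
  have saY: "cinner (Y x) y = cinner x (Y y)" for x y
  proof (rule LIMSEQ_unique)
    show "(\<lambda>n. cinner (sqrt_iter B n x) y) \<longlonglongrightarrow> cinner (Y x) y"
      by (intro tendsto_intros cinner.tendsto Y)
    show "(\<lambda>n. cinner (sqrt_iter B n x) y) \<longlonglongrightarrow> cinner x (Y y)"
      unfolding selfadjD[OF sqrt_iter_selfadj[OF saB]] by (intro tendsto_intros cinner.tendsto Y)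
  qed
  define Q where "Q = id_blinfun - Y"
  have "pos Q" unfolding pos_def
  proof (intro conjI allI)
    show "clin Q" unfolding Q_def by (intro clin_closed cY)
    fix x
    have e: "cinner (Q x) x = of_real ((norm x)\<^sup>2) - cinner (Y x) x"
      by (simp add: Q_def blinfun.bilinear_simps cinner_diff_left cinner_self)
    show "Im (cinner (Q x) x) = 0"
      unfolding e using selfadj_Im[of Y x] saY cY by (simp add: selfadj_def)
    have "Re (cinner (Y x) x) \<le> cmod (cinner (Y x) x)" by (rule complex_Re_le_cmod)
    also have "\<dots> \<le> norm (Y x) * norm x" by (rule cinner_cauchy_schwarz)
    also have "\<dots> \<le> (1 * norm x) * norm x"
      by (intro mult_right_mono order_trans[OF norm_blinfun] nY) auto
    finally show "0 \<le> Re (cinner (Q x) x)" unfolding e by (simp add: power2_eq_square)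
  qed
  moreover have "Q o\<^sub>L Q = P"
  proof -
    have "Q o\<^sub>L Q = id_blinfun - 2 *\<^sub>R Y + (Y o\<^sub>L Y)"
      by (simp add: Q_def blinfun_compose_simps algebra_simps scaleR_2)
    also have "2 *\<^sub>R Y = B + (Y o\<^sub>L Y)"
      by (subst Yeq) simp
    finally show ?thesis by (simp add: B_def)
  qed
  moreover have "C o\<^sub>L Q = Q o\<^sub>L C" if "C o\<^sub>L P = P o\<^sub>L C" for C
  proof -
    have CB: "C o\<^sub>L B = B o\<^sub>L C" using that by (simp add: B_def blinfun_compose_simps)
    have "C o\<^sub>L Y = Y o\<^sub>L C"
    proof (rule LIMSEQ_unique)
      show "(\<lambda>n. C o\<^sub>L sqrt_iter B n) \<longlonglongrightarrow> (C o\<^sub>L Y)"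
        by (intro bounded_bilinear.tendsto[OF bounded_bilinear_blinfun_compose] tendsto_const Y)
      show "(\<lambda>n. C o\<^sub>L sqrt_iter B n) \<longlonglongrightarrow> (Y o\<^sub>L C)"
        unfolding sqrt_iter_commute[OF CB]
        by (intro bounded_bilinear.tendsto[OF bounded_bilinear_blinfun_compose] tendsto_const Y)
    qed
    then show ?thesis by (simp add: Q_def blinfun_compose_simps)
  qed
  ultimately show ?thesis by blast
qed

section \<open>Square roots of general positive operators and the modulus\<close>

lemma pos_scaleR: "pos P \<Longrightarrow> 0 \<le> r \<Longrightarrow> pos (r *\<^sub>R P)"
  by (auto simp: pos_def blinfun.bilinear_simps scaleR_scaleC cinner_scaleC_left intro: clin_closed)

lemma pos_form_le: "Re (cinner (P x) x) \<le> norm P * (norm x)\<^sup>2" for P :: ell2_op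
proof -
  have "Re (cinner (P x) x) \<le> cmod (cinner (P x) x)" by (rule complex_Re_le_cmod)
  also have "\<dots> \<le> norm (P x) * norm x" by (rule cinner_cauchy_schwarz)
  also have "\<dots> \<le> (norm P * norm x) * norm x" by (intro mult_right_mono norm_blinfun) auto
  finally show ?thesis by (simp add: power2_eq_square)
qed

text \<open>The added 1 keeps the divisor positive when \<open>P = 0\<close>.\<close>

lemma pos_normalize:
  assumes "pos P"
  shows "Re (cinner (((1 / (norm P + 1)) *\<^sub>R P) x) x) \<le> (norm x)\<^sup>2"
proof -
  have "norm P * (norm x)\<^sup>2 \<le> (norm P + 1) * (norm x)\<^sup>2" by (intro mult_right_mono) auto
  then have "Re (cinner (P x) x) / (norm P + 1) \<le> (norm x)\<^sup>2"
    using pos_form_le[of P x] by (simp add: divide_le_eq add_pos_nonneg add.commute mult.commute)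
  then show ?thesis
    by (simp add: blinfun.bilinear_simps scaleR_scaleC cinner_scaleC_left Re_divide_of_real)
qed

lemma pos_sqrt_exists:
  assumes P: "pos P"
  shows "\<exists>Q. pos Q \<and> Q o\<^sub>L Q = P \<and> (\<forall>C. C o\<^sub>L P = P o\<^sub>L C \<longrightarrow> C o\<^sub>L Q = Q o\<^sub>L C)"
proof -
  define s where "s = norm P + 1"
  have s: "s > 0" by (simp add: s_def add_nonneg_pos)
  have "pos ((1 / s) *\<^sub>R P)" using s by (intro pos_scaleR P) simp
  from pos_sqrt_exists_contraction[OF this pos_normalize[OF P, folded s_def]]
  obtain Q where Q: "pos Q \<and> Q o\<^sub>L Q = (1 / s) *\<^sub>R P \<and>
    (\<forall>C. C o\<^sub>L ((1 / s) *\<^sub>R P) = ((1 / s) *\<^sub>R P) o\<^sub>L C \<longrightarrow> C o\<^sub>L Q = Q o\<^sub>L C)" ..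
  note Q1 = conjunct1[OF Q] and Q2 = conjunct1[OF conjunct2[OF Q]]
    and Q3 = conjunct2[OF conjunct2[OF Q], rule_format]
  show ?thesis
  proof (intro exI[of _ "sqrt s *\<^sub>R Q"] conjI allI impI)
    show "pos (sqrt s *\<^sub>R Q)" using s by (intro pos_scaleR Q1) simp
    show "(sqrt s *\<^sub>R Q) o\<^sub>L (sqrt s *\<^sub>R Q) = P"
      using s by (simp add: blinfun_compose_simps(5,6) Q2)
    fix C assume "C o\<^sub>L P = P o\<^sub>L C"
    then have "C o\<^sub>L Q = Q o\<^sub>L C" by (intro Q3) (simp add: blinfun_compose_simps(5,6))
    then show "C o\<^sub>L (sqrt s *\<^sub>R Q) = (sqrt s *\<^sub>R Q) o\<^sub>L C"
      by (simp add: blinfun_compose_simps(5,6))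
  qed
qed

text \<open>Put \<open>y = (Q - S) x\<close>. Since \<open>Q\<close> and \<open>S\<close> commute
  and have the same square, \<open>(Q + S) y = 0\<close>; both forms are nonnegative, so
  \<open>Q y = S y = 0\<close>. Then the square of \<open>norm y\<close> is
  \<open><(Q - S) y, x> = 0\<close>.\<close>

lemma pos_sqrt_unique:
  assumes S: "pos S" "\<And>C. C o\<^sub>L P = P o\<^sub>L C \<Longrightarrow> C o\<^sub>L S = S o\<^sub>L C" "S o\<^sub>L S = P"
    and Q: "pos Q" "Q o\<^sub>L Q = P"
  shows "Q = S"
proof -
  have com: "Q o\<^sub>L S = S o\<^sub>L Q" using Q by (intro S(2)) (simp add: blinfun_compose_simps flip: Q(2))
  have com': "Q (S x) = S (Q x)" for x
    using arg_cong[OF com, of "\<lambda>T. T x"] by simp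
  have sq: "Q (Q x) = S (S x)" for x
    using arg_cong[OF trans[OF Q(2) S(3)[symmetric]], of "\<lambda>T. T x"] by simp
  have D: "(Q - S) y = 0" if "y = (Q - S) x" for x y
  proof -
    have "cinner (Q y) y + cinner (S y) y = cinner ((Q + S) y) y"
      by (simp add: blinfun.bilinear_simps cinner_add_left)
    also have "(Q + S) y = 0"
      by (simp add: that blinfun.bilinear_simps com' sq)
    finally have sum0: "cinner (Q y) y + cinner (S y) y = 0" by simp
    have "0 \<le> Re (cinner (Q y) y)" "0 \<le> Re (cinner (S y) y)"
      "Im (cinner (Q y) y) = 0" "Im (cinner (S y) y) = 0"
      using S(1) Q(1) by (auto simp: pos_def)
    then have "cinner (Q y) y = 0" "cinner (S y) y = 0"
      using sum0 by (auto simp: complex_eq_iff)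
    then have "Q y = 0" "S y = 0"
      using pos_zero_iff S(1) Q(1) by blast+
    then show ?thesis by (simp add: blinfun.bilinear_simps)
  qed
  show ?thesis
  proof (rule blinfun_eqI)
    fix x
    let ?y = "(Q - S) x"
    have "cinner ?y ?y = cinner ((Q - S) ?y) x"
      using selfadjD[OF pos_selfadj[OF Q(1)]] selfadjD[OF pos_selfadj[OF S(1)]]
      by (simp add: blinfun.bilinear_simps cinner_diff_left cinner_diff_right)
    then have "?y = 0" using D by (simp add: cinner_self)
    then show "Q x = S x" by (simp add: blinfun.bilinear_simps)
  qed
qed

definition op_sqrt :: "ell2_op \<Rightarrow> ell2_op" where
  "op_sqrt P = (THE Q. pos Q \<and> Q o\<^sub>L Q = P)"

lemma op_sqrt:
  assumes "pos P"
  shows "pos (op_sqrt P)" "op_sqrt P o\<^sub>L op_sqrt P = P"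
    "C o\<^sub>L P = P o\<^sub>L C \<Longrightarrow> C o\<^sub>L op_sqrt P = op_sqrt P o\<^sub>L C"
    "pos Q \<Longrightarrow> Q o\<^sub>L Q = P \<Longrightarrow> Q = op_sqrt P"
proof -
  obtain S where S': "pos S \<and> S o\<^sub>L S = P \<and> (\<forall>C. C o\<^sub>L P = P o\<^sub>L C \<longrightarrow> C o\<^sub>L S = S o\<^sub>L C)"
    using pos_sqrt_exists[OF assms] ..
  note S = conjunct1[OF S'] conjunct1[OF conjunct2[OF S']]
    and S3 = conjunct2[OF conjunct2[OF S'], rule_format]
  have u: "Q = S" if "pos Q" "Q o\<^sub>L Q = P" for Q
    by (rule pos_sqrt_unique[OF S(1) S3 S(2) that])
  have eq: "op_sqrt P = S"
    unfolding op_sqrt_def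
  proof (rule the_equality)
    show "pos S \<and> S o\<^sub>L S = P" using S(1,2) by (rule conjI)
    show "Q = S" if "pos Q \<and> Q o\<^sub>L Q = P" for Q using that u by (elim conjE)
  qed
  show "pos (op_sqrt P)" "op_sqrt P o\<^sub>L op_sqrt P = P"
    "C o\<^sub>L P = P o\<^sub>L C \<Longrightarrow> C o\<^sub>L op_sqrt P = op_sqrt P o\<^sub>L C"
    "pos Q \<Longrightarrow> Q o\<^sub>L Q = P \<Longrightarrow> Q = op_sqrt P"
    unfolding eq by (fact S(1), fact S(2), erule S3, erule (1) u)
qed

definition absop :: "ell2_op \<Rightarrow> ell2_op" where
  "absop T = op_sqrt (adj T o\<^sub>L T)"

lemma pos_absop: "clin T \<Longrightarrow> pos (absop T)"
  unfolding absop_def by (rule op_sqrt(1)[OF pos_adj_self])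

lemma absop_square: "clin T \<Longrightarrow> absop T o\<^sub>L absop T = adj T o\<^sub>L T"
  unfolding absop_def by (rule op_sqrt(2)[OF pos_adj_self])

lemma cinner_absop:
  assumes "clin T"
  shows "cinner (absop T x) (absop T y) = cinner (T x) (T y)"
proof -
  have "cinner (T x) (T y) = cinner x ((adj T o\<^sub>L T) y)"
    using assms by (simp add: cinner_adj)
  also have "\<dots> = cinner x (absop T (absop T y))"
    by (simp flip: absop_square[OF assms])
  finally show ?thesis using selfadjD[OF pos_selfadj[OF pos_absop[OF assms]]] by simp
qed

lemma norm_absop: "clin T \<Longrightarrow> norm (absop T x) = norm (T x)"
  using cinner_absop[of T x x] by (simp add: cinner_self flip: of_real_power)

section \<open>Polar decomposition\<close>

lemma blinfun_eqD: "S = T \<Longrightarrow> S x = T x" for S T :: ell2_op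
  by simp

primrec bpow :: "ell2_op \<Rightarrow> nat \<Rightarrow> ell2_op" where
  "bpow B 0 = id_blinfun"
| "bpow B (Suc n) = B o\<^sub>L bpow B n"

lemma bpow_commute:
  fixes B C :: ell2_op
  assumes "\<And>x. C (B x) = B (C x)"
  shows "C (bpow B n x) = (bpow B n) (C x)"
  by (induction n) (simp_all add: assms)

lemma clin_bpow: "clin B \<Longrightarrow> clin (bpow B n)"
  by (induction n) (auto intro: clin_closed)

lemma bpow_add: "(bpow B (m + n)) x = (bpow B m) (bpow B n x)"
  by (induction m) simp_all

lemma selfadj_bpow:
  assumes "selfadj B"
  shows "selfadj (bpow B n)"
proof (induction n)
  case (Suc n)
  have "(bpow B n) (B x) = B (bpow B n x)" for x
    using bpow_commute[of B B n x] by simp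
  then show ?case
    using Suc assms by (auto simp: selfadj_def clin_closed)
qed (simp add: selfadj_def clin_closed)

text \<open>Two powers are split off symmetrically, \<open><B^(n+2) x, x> = <B^n B x, B x>\<close>,
  hence the induction in steps of two.\<close>

lemma pos_bpow:
  assumes "pos B"
  shows "pos (bpow B n)"
proof (induction n rule: induct_nat_012)
  case (ge2 n)
  note sa = selfadjD[OF pos_selfadj[OF assms]]
  have c: "(bpow B n) (B x) = B (bpow B n x)" for x
    using bpow_commute[of B B n x] by simp
  have "cinner ((bpow B (Suc (Suc n))) x) x
      = cinner (bpow B n (B x)) (B x)" for x
    by (simp add: c sa)
  moreover have "clin (bpow B (Suc (Suc n)))" using assms by (intro clin_bpow) (simp add: pos_def)
  ultimately show ?case using ge2 unfolding pos_def by simp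
qed (use assms in \<open>auto simp: pos_def clin_closed cinner_self\<close>)

lemma norm_bpow_apply_le:
  assumes "norm B \<le> 1"
  shows "norm (bpow B n x) \<le> norm x"
proof (induction n)
  case (Suc n)
  have "norm (B (bpow B n x)) \<le> norm B * norm (bpow B n x)"
    by (rule norm_blinfun)
  also have "\<dots> \<le> 1 * norm x" by (intro mult_mono assms Suc) auto
  finally show ?case by simp
qed simp

text \<open>The geometric sum telescopes because \<open>P = 1 - B\<close> for the operator
  \<open>B\<close> whose powers are summed. The sums thus act as approximate inverses of
  \<open>P\<close>.\<close>

lemma geometric_bpow:
  "(\<Sum>i<m. bpow (id_blinfun - P) i) (P x) = x - (bpow (id_blinfun - P) m) x"
proof (induction m)
  case (Suc m)
  let ?B = "id_blinfun - P"
  have "(bpow ?B m) (?B x) = ?B ((bpow ?B m) x)"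
    using bpow_commute[of ?B ?B m x] by simp
  then have "(bpow ?B m) (P x) = (bpow ?B m) x - (bpow ?B (Suc m)) x"
    by (simp add: blinfun.bilinear_simps)
  then show ?case using Suc by (simp add: blinfun.bilinear_simps)
qed (simp add: blinfun.bilinear_simps)

text \<open>
  With \<open>B = 1 - Q\<^sup>2\<close>, the numbers \<open>b\<^sub>i = \<langle>B\<^sup>i Qx, Qx\<rangle>\<close> decrease and sum up to at most \<open>\<parallel>x\<parallel>\<^sup>2\<close>.
\<close>

lemma norm_bpow_sqrt_le:
  assumes Q: "pos Q" and B: "B = id_blinfun - (Q o\<^sub>L Q)" and posB: "pos B"
  shows "real m * (norm (bpow B m (Q x)))\<^sup>2 \<le> (norm x)\<^sup>2"
proof -
  note saQ = selfadjD[OF pos_selfadj[OF Q]] and saB = selfadjD[OF pos_selfadj[OF posB]]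
  have QB: "Q (B x) = B (Q x)" for x
    by (simp add: B blinfun.bilinear_simps)
  define y where "y = Q x"
  define b where "b i = Re (cinner (bpow B i y) y)" for i
  have b0: "0 \<le> b i" for i using pos_bpow[OF posB, of i] by (simp add: b_def pos_def)
  have bdec: "b (Suc i) \<le> b i" for i
  proof -
    have "b i - b (Suc i) = Re (cinner (bpow B i (y - B y)) y)"
      using bpow_commute[of B B i y] by (simp add: b_def blinfun.bilinear_simps cinner_diff_left)
    \<comment> \<open>As \<open>1 - B = Q Q\<close>, the difference of consecutive terms is the form
      of \<open>B^i\<close> at \<open>Q y\<close>.\<close>
    also have "y - B y = Q (Q y)"
      by (simp add: B blinfun.bilinear_simps)
    also have "(bpow B i) (Q (Q y))
        = Q (bpow B i (Q y))"
      by (rule bpow_commute[symmetric]) (rule QB)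
    also have "cinner \<dots> y = cinner (bpow B i (Q y)) (Q y)"
      by (rule saQ)
    also have "0 \<le> Re \<dots>" using pos_bpow[OF posB, of i] by (simp add: pos_def)
    finally show ?thesis by simp
  qed
  have "(\<Sum>i<n. b i) = Re (cinner (x - (bpow B n) x) x)" for n
  proof -
    have "(\<Sum>i<n. b i) = Re (cinner ((\<Sum>i<n. bpow B i) (Q x)) (Q x))"
      by (simp add: b_def y_def blinfun.bilinear_simps cinner_sum_left blinfun.sum_left)
    also have "\<dots> = Re (cinner (Q ((\<Sum>i<n. bpow B i) (Q x))) x)"
      by (simp add: saQ)
    also have "Q ((\<Sum>i<n. bpow B i) (Q x))
        = (\<Sum>i<n. bpow B i) ((Q o\<^sub>L Q) x)"
      by (simp add: blinfun.sum_left blinfun.sum_right bpow_commute[OF QB])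
    also have "\<dots> = x - (bpow B n) x" unfolding B by (rule geometric_bpow)
    finally show ?thesis .
  qed
  moreover have "0 \<le> Re (cinner (bpow B n x) x)" for n
    using pos_bpow[OF posB, of n] by (simp add: pos_def)
  ultimately have bsum: "(\<Sum>i<n. b i) \<le> (norm x)\<^sup>2" for n by (simp add: cinner_diff_left cinner_self)
  have anti: "decseq b" by (rule decseq_SucI) (rule bdec)
  have "real n * b n \<le> (norm x)\<^sup>2" for n
  proof -
    have "real n * b n = (\<Sum>i<n. b n)" by simp
    also have "\<dots> \<le> (\<Sum>i<n. b i)" by (intro sum_mono decseqD[OF anti]) simp
    finally show ?thesis using bsum[of n] by simp
  qed
  \<comment> \<open>An even index, since \<open>b (m + m)\<close> is the squared norm of
    \<open>B^m y\<close>.\<close>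
  then have "real (m + m) * b (m + m) \<le> (norm x)\<^sup>2" .
  moreover have "b (m + m) = (norm (bpow B m y))\<^sup>2"
    unfolding b_def bpow_add using selfadjD[OF selfadj_bpow[OF pos_selfadj[OF posB], of m]]
    by (simp add: cinner_self)
  ultimately have "real m * (norm (bpow B m y))\<^sup>2 + real m * (norm (bpow B m y))\<^sup>2 \<le> (norm x)\<^sup>2"
    by (simp add: algebra_simps)
  moreover have "0 \<le> real m * (norm (bpow B m y))\<^sup>2" by simp
  ultimately show ?thesis unfolding y_def by linarith
qed

text \<open>
  The operators \<open>U\<^sub>m\<close> converge strongly to the partial isometry of the polar decomposition of \<open>T\<close>,
  but only the norm limit \<open>V\<close> of \<open>U\<^sub>m Q\<close> is needed.
\<close>

lemma polar_decomposition_normalized: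
  assumes T: "clin T" and Q: "pos Q" and TQ: "\<And>x. norm (T x) = norm (Q (Q x))"
    and le: "\<And>x. norm (Q x) \<le> norm x"
  shows "\<exists>V U. clin V \<and> (V o\<^sub>L Q) = T \<and> (\<forall>x. norm (V x) = norm (Q x)) \<and>
    (\<forall>m. U m = (T o\<^sub>L (\<Sum>i<m. bpow (id_blinfun - (Q o\<^sub>L Q)) i))) \<and>
    (\<forall>m x. norm ((U m) x) \<le> norm x)"
proof -
  define B where "B = id_blinfun - (Q o\<^sub>L Q)"
  note saQ = selfadjD[OF pos_selfadj[OF Q]]
  have cQ: "clin Q" using Q by (simp add: pos_def)
  have cB: "clin B" unfolding B_def by (intro clin_closed cQ)
  have formB: "cinner (B x) x = of_real ((norm x)\<^sup>2 - (norm (Q x))\<^sup>2)" for x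
    by (simp add: B_def blinfun.bilinear_simps cinner_diff_left cinner_self saQ)
  have posB: "pos B" unfolding pos_def formB using cB le by (simp add: power_mono)
  have nB: "norm B \<le> 1" by (rule pos_norm_le[OF posB]) (simp add: formB)
  have QB: "Q (B x) = B (Q x)" for x
    by (simp add: B_def blinfun.bilinear_simps)
  \<comment> \<open>An approximate inverse of \<open>Q Q\<close>, with error
    \<open>B^m\<close>.\<close>
  define f where "f m = (\<Sum>i<m. bpow B i)" for m
  have fQ: "Q ((f m) x) = (f m) (Q x)" for m x
    by (simp add: f_def blinfun.sum_left blinfun.sum_right bpow_commute[OF QB])
  have fP: "(f m) (Q (Q x)) = x - (bpow B m) x" for m x
    using geometric_bpow[of "Q o\<^sub>L Q" m x] by (simp add: f_def B_def)
  have nT: "norm (T ((f m) x)) = norm (x - (bpow B m) x)" for m x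
    unfolding TQ fQ fP ..
  define U where "U m = (T o\<^sub>L f m)" for m
  have Ule: "norm ((U m) x) \<le> norm x" for m x
  proof -
    \<comment> \<open>For the positive contraction \<open>C = B^m\<close> the square of
      \<open>norm (C x)\<close> is at most \<open><C x, x>\<close>; expanding the square then shows
      that \<open>1 - C\<close> is a contraction.\<close>
    have "(norm (x - (bpow B m) x))\<^sup>2 \<le> (norm x)\<^sup>2"
    proof -
      let ?z = "(bpow B m) x"
      have pb: "pos (bpow B m)" by (rule pos_bpow[OF posB])
      have sq: "(norm (x - ?z))\<^sup>2 = (norm x)\<^sup>2 - 2 * Re (cinner ?z x) + (norm ?z)\<^sup>2"
        unfolding inner_ell2_def[symmetric]
        by (simp add: power2_norm_eq_inner inner_diff_left inner_diff_right inner_commute)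
      have "(norm ?z)\<^sup>2 * (norm ?z)\<^sup>2 = (cmod (cinner ?z ?z))\<^sup>2"
        by (simp add: cinner_self power2_eq_square norm_mult)
      also have "\<dots> \<le> Re (cinner ?z x) * Re (cinner ((bpow B m) ?z) ?z)"
        by (rule pos_cauchy_schwarz[OF pb])
      also have "\<dots> \<le> Re (cinner ?z x) * (norm ?z)\<^sup>2"
      proof (rule mult_left_mono)
        have "Re (cinner ((bpow B m) ?z) ?z) \<le> norm ((bpow B m) ?z) * norm ?z"
          using complex_Re_le_cmod cinner_cauchy_schwarz order_trans by blast
        also have "\<dots> \<le> norm ?z * norm ?z" by (intro mult_right_mono norm_bpow_apply_le nB) simp
        finally show "Re (cinner ((bpow B m) ?z) ?z) \<le> (norm ?z)\<^sup>2" by (simp add: power2_eq_square)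
      qed (use pb in \<open>simp add: pos_def\<close>)
      finally have zz: "(norm ?z)\<^sup>2 * (norm ?z)\<^sup>2 \<le> Re (cinner ?z x) * (norm ?z)\<^sup>2" .
      have "0 \<le> Re (cinner ?z x)" using pb by (simp add: pos_def)
      moreover have "(norm ?z)\<^sup>2 \<le> Re (cinner ?z x)"
      proof (cases "?z = 0")
        case False
        show ?thesis by (rule mult_right_le_imp_le[OF zz]) (use False in simp)
      qed simp
      ultimately show ?thesis using sq by linarith
    qed
    then show ?thesis unfolding U_def using nT by (simp add: power2_le_iff_abs_le)
  qed
  \<comment> \<open>The decay rate of \<open>B^m Q\<close> in operator norm, from
    \<open>norm_bpow_sqrt_le\<close>. It makes the products of \<open>U m\<close> with
    \<open>Q\<close> a Cauchy sequence; the shift by \<open>Suc\<close> keeps the rate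
    finite.\<close>
  define r where "r m = 1 / sqrt (real (Suc m))" for m
  have r0: "r \<longlonglongrightarrow> 0" unfolding r_def
    by (rule real_tendsto_divide_at_top[OF tendsto_const])
       (intro filterlim_compose[OF sqrt_at_top] filterlim_compose[OF filterlim_real_sequentially] filterlim_Suc)
  have rb: "norm ((bpow B (Suc m)) (Q x)) \<le> r m * norm x" for m x
  proof -
    have "real (Suc m) * (norm ((bpow B (Suc m)) (Q x)))\<^sup>2 \<le> (norm x)\<^sup>2"
      by (rule norm_bpow_sqrt_le[OF Q B_def posB])
    then have "(norm ((bpow B (Suc m)) (Q x)))\<^sup>2 \<le> (r m * norm x)\<^sup>2"
      by (simp add: r_def power_divide power_mult_distrib field_simps del: of_nat_Suc bpow.simps)
    then show ?thesis by (rule power2_le_imp_le) (simp add: r_def)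
  qed
  define W where "W m = (U (Suc m) o\<^sub>L Q)" for m
  have Wd: "norm (W m - W n) \<le> r m + r n" for m n
  proof (rule norm_blinfun_bound)
    fix x
    let ?y = "Q x"
    have "norm ((W m - W n) x) = norm (T ((f (Suc m)) ?y - (f (Suc n)) ?y))"
      by (simp add: W_def U_def blinfun.bilinear_simps)
    also have "\<dots> = norm ((bpow B (Suc n)) ?y - (bpow B (Suc m)) ?y)"
      unfolding TQ by (simp add: blinfun.diff_right fQ fP bpow_commute[OF QB] del: bpow.simps)
    also have "\<dots> \<le> r n * norm x + r m * norm x"
      by (rule order_trans[OF norm_triangle_ineq4 add_mono[OF rb rb]])
    finally show "norm ((W m - W n) x) \<le> (r m + r n) * norm x" by (simp add: algebra_simps)
  qed (simp add: r_def)
  have "Cauchy W"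
  proof (rule metric_CauchyI)
    fix e :: real assume "0 < e"
    then obtain N where N: "\<And>n. n \<ge> N \<Longrightarrow> norm (r n - 0) < e / 2"
      using LIMSEQ_D[OF r0, of "e / 2"] by auto
    have "dist (W m) (W n) < e" if "m \<ge> N" "n \<ge> N" for m n
      using Wd[of m n] N[OF that(1)] N[OF that(2)] by (simp add: dist_norm abs_less_iff)
    then show "\<exists>M. \<forall>m\<ge>M. \<forall>n\<ge>M. dist (W m) (W n) < e" by blast
  qed
  then obtain V where V: "W \<longlonglongrightarrow> V" by (auto simp: Cauchy_convergent_iff convergent_def)
  have Vx: "(\<lambda>m. (W m) x) \<longlonglongrightarrow> V x" for x
    by (intro tendsto_intros V)
  have bx: "(\<lambda>m. (bpow B (Suc m)) (Q x)) \<longlonglongrightarrow> 0" for x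
  proof (rule Lim_null_comparison)
    show "(\<lambda>m. r m * norm x) \<longlonglongrightarrow> 0" using tendsto_mult_left_zero[OF r0] by simp
  qed (use rb in auto)
  have cV: "clin V"
  proof (rule clin_limit[OF _ V])
    show "clin (W n)" for n
      unfolding W_def U_def f_def by (intro clin_closed clin_sum clin_bpow T cQ cB)
  qed
  have VQ: "V (Q x) = T x" for x
  proof (rule LIMSEQ_unique[OF Vx])
    have eq: "(W m) (Q x) = T x - T ((bpow B (Suc m)) x)" for m
      by (simp add: W_def U_def fP blinfun.bilinear_simps del: bpow.simps)
    have "(\<lambda>m. T ((bpow B (Suc m)) x)) \<longlonglongrightarrow> 0"
    proof (rule tendsto_norm_zero_cancel)
      have "(\<lambda>m. Q ((bpow B (Suc m)) (Q x))) \<longlonglongrightarrow> Q 0"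
        by (intro tendsto_intros bx)
      then show "(\<lambda>m. norm (T ((bpow B (Suc m)) x))) \<longlonglongrightarrow> 0"
        unfolding TQ by (intro tendsto_norm_zero) (simp add: bpow_commute[OF QB] del: bpow.simps)
    qed
    from tendsto_diff[OF tendsto_const[of "T x"] this]
    show "(\<lambda>m. (W m) (Q x)) \<longlonglongrightarrow> T x"
      unfolding eq by simp
  qed
  have "norm (V x) = norm (Q x)" for x
  proof (rule LIMSEQ_unique[OF tendsto_norm[OF Vx]])
    have "norm ((W m) x) = norm (Q x - (bpow B (Suc m)) (Q x))" for m
      unfolding W_def U_def by (simp add: nT del: bpow.simps)
    then show "(\<lambda>m. norm ((W m) x)) \<longlonglongrightarrow> norm (Q x)"
      using tendsto_norm[OF tendsto_diff[OF tendsto_const bx[of x]], of "Q x"] by simp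
  qed
  then show ?thesis
    using cV VQ Ule
    by (intro exI[of _ V] exI[of _ U] conjI allI blinfun_eqI) (simp_all add: U_def f_def B_def)
qed

text \<open>\<open>Q\<close> is the root of the modulus and \<open>V\<close> stretches every vector
  exactly as \<open>Q\<close> does, so \<open>T = V Q\<close> has two factors that are
  Hilbert-Schmidt precisely when \<open>T\<close> is trace class. The contractions
  \<open>U m\<close> recover the diagonal of the modulus from \<open>T\<close> in the limit, which
  bounds the trace of the modulus by test sums of \<open>T\<close>.\<close>

lemma polar_decomposition:
  assumes T: "clin T"
  obtains V Q U where "clin V" "pos Q" "(Q o\<^sub>L Q) = absop T" "(V o\<^sub>L Q) = T"
    "\<And>x. norm (V x) = norm (Q x)"
    "\<And>m. clin (U m)" "\<And>m x. norm ((U m) x) \<le> norm x"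
    "\<And>x. (\<lambda>m. cinner (T x) ((U m) x)) \<longlonglongrightarrow> cinner (absop T x) x"
proof -
  define P where "P = absop T"
  \<comment> \<open>Scaling by \<open>1 / s\<close> brings the modulus below the identity, as the
    normalized case requires; afterwards each of the two factors gets back
    \<open>sqrt s\<close>.\<close>
  define s where "s = norm P + 1"
  have s: "s > 0" by (simp add: s_def add_nonneg_pos)
  have P: "pos P" unfolding P_def by (rule pos_absop[OF T])
  have cP: "clin P" using P by (simp add: pos_def)
  define P' where "P' = (1 / s) *\<^sub>R P"
  have P': "pos P'" unfolding P'_def using s by (intro pos_scaleR P) simp
  define Q where "Q = op_sqrt P'"
  have Q: "pos Q" "(Q o\<^sub>L Q) = P'" unfolding Q_def by (rule op_sqrt[OF P'])+
  note saQ = selfadjD[OF pos_selfadj[OF Q(1)]]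
  have QQ: "Q (Q x) = (1 / s) *\<^sub>R P x" for x
    using blinfun_eqD[OF Q(2), of x] by (simp add: P'_def blinfun.bilinear_simps)
  define T' where "T' = (1 / s) *\<^sub>R T"
  have T': "clin T'" unfolding T'_def by (intro clin_closed T)
  have nT': "norm (T' x) = norm (Q (Q x))" for x
    unfolding QQ T'_def P_def by (simp add: blinfun.bilinear_simps norm_absop[OF T])
  have Qle: "norm (Q x) \<le> norm x" for x
  proof -
    have "of_real ((norm (Q x))\<^sup>2) = cinner (P' x) x"
      unfolding cinner_self[symmetric] saQ Q(2)[symmetric] by (simp add: saQ)
    then have "(norm (Q x))\<^sup>2 = Re (cinner (P' x) x)"
      by (metis Re_complex_of_real)
    also have "\<dots> \<le> (norm x)\<^sup>2" unfolding P'_def s_def by (rule pos_normalize[OF P])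
    finally show ?thesis by (rule power2_le_imp_le) simp
  qed
  obtain V U where VU: "clin V \<and> (V o\<^sub>L Q) = T' \<and> (\<forall>x. norm (V x) = norm (Q x)) \<and>
    (\<forall>m. U m = (T' o\<^sub>L (\<Sum>i<m. bpow (id_blinfun - (Q o\<^sub>L Q)) i))) \<and>
    (\<forall>m x. norm ((U m) x) \<le> norm x)"
    using polar_decomposition_normalized[OF T' Q(1) nT' Qle] by (elim exE)
  note V1 = VU[THEN conjunct1] and V2 = VU[THEN conjunct2, THEN conjunct1]
    and V3 = VU[THEN conjunct2, THEN conjunct2, THEN conjunct1, rule_format]
    and U1 = VU[THEN conjunct2, THEN conjunct2, THEN conjunct2, THEN conjunct1, rule_format]
    and U2 = VU[THEN conjunct2, THEN conjunct2, THEN conjunct2, THEN conjunct2, rule_format]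
  have cB: "clin (id_blinfun - (Q o\<^sub>L Q))" using Q(1) by (intro clin_closed) (simp_all add: pos_def)
  show thesis
  proof (rule that[of "sqrt s *\<^sub>R V" "sqrt s *\<^sub>R Q" U])
    show "clin (sqrt s *\<^sub>R V)" by (intro clin_closed V1)
    show "pos (sqrt s *\<^sub>R Q)" using s by (intro pos_scaleR Q(1)) simp
    show "((sqrt s *\<^sub>R Q) o\<^sub>L (sqrt s *\<^sub>R Q)) = absop T"
      using s by (simp add: blinfun_compose_simps(5,6) Q(2) P'_def P_def)
    show "((sqrt s *\<^sub>R V) o\<^sub>L (sqrt s *\<^sub>R Q)) = T"
      using s by (simp add: blinfun_compose_simps(5,6) V2 T'_def)
    show "norm ((sqrt s *\<^sub>R V) x) = norm ((sqrt s *\<^sub>R Q) x)" for x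
      by (simp add: blinfun.bilinear_simps V3)
    show "clin (U m)" for m
      unfolding U1 by (intro clin_closed clin_sum clin_bpow T' cB)
    show "norm ((U m) x) \<le> norm x" for m x by (rule U2)
    fix x
    define f where "f m = (\<Sum>i<m. bpow (id_blinfun - P') i)" for m
    have eq: "cinner (T x) ((U m) x) =
        cinner (P x - (bpow (id_blinfun - P') m) (P x)) x" for m
    proof -
      have cPf: "P ((f m) y) = (f m) (P y)" for y
      proof -
        have "P ((id_blinfun - P') x) = (id_blinfun - P') (P x)" for x
          by (simp add: P'_def blinfun.bilinear_simps)
        from bpow_commute[OF this] show ?thesis
          by (simp add: f_def blinfun.sum_left blinfun.sum_right)
      qed
      have saf: "cinner ((f m) y) z = cinner y ((f m) z)" for y z
      proof -
        have "selfadj (id_blinfun - P')"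
          using pos_selfadj[OF P'] by (auto simp: selfadj_def blinfun.bilinear_simps cinner_diff_left cinner_diff_right intro: clin_closed)
        from selfadjD[OF selfadj_bpow[OF this]] show ?thesis
          by (simp add: f_def blinfun.sum_left cinner_sum_left cinner_sum_right)
      qed
      have "cinner (T x) ((U m) x)
          = (1 / s) *\<^sub>R cinner (T x) (T ((f m) x))"
        by (simp add: U1 T'_def f_def[symmetric] Q(2) blinfun.scaleR_left blinfun.scaleR_right cinner.scaleR_right)
      also have "\<dots> = (1 / s) *\<^sub>R cinner (P x) (P ((f m) x))"
        unfolding P_def cinner_absop[OF T] ..
      also have "\<dots> = (1 / s) *\<^sub>R cinner ((f m) (P (P x))) x"
        by (metis cPf saf selfadjD[OF pos_selfadj[OF P]])
      also have "\<dots> = cinner ((f m) (P' (P x))) x"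
        by (simp add: P'_def blinfun.bilinear_simps cinner.scaleR_left)
      finally show ?thesis unfolding f_def geometric_bpow .
    qed
    have "(\<lambda>m. (bpow (id_blinfun - P') m) (P x)) \<longlonglongrightarrow> 0"
    proof (rule LIMSEQ_imp_Suc, rule tendsto_norm_zero_cancel, rule Lim_null_comparison)
      \<comment> \<open>\<open>P x\<close> lies in the range of \<open>Q\<close>, so the decay
        estimate for \<open>B^m Q\<close> applies to it.\<close>
      define z where "z = s *\<^sub>R Q x"
      have z: "P x = Q z"
        using QQ[of x] s by (simp add: z_def blinfun.bilinear_simps)
      have B: "id_blinfun - P' = id_blinfun - (Q o\<^sub>L Q)" by (simp only: Q(2))
      have posB: "pos (id_blinfun - P')"
        using pos_normalize[OF P] P' unfolding pos_def s_def[symmetric] P'_def[symmetric]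
        by (auto simp: blinfun.bilinear_simps cinner_diff_left cinner_self intro: clin_closed)
      show "\<forall>\<^sub>F m in sequentially. norm (norm ((bpow (id_blinfun - P') (Suc m)) (P x)))
          \<le> norm z / sqrt (real (Suc m))"
      proof (intro always_eventually allI)
        fix m
        have "real (Suc m) * (norm ((bpow (id_blinfun - P') (Suc m)) (Q z)))\<^sup>2 \<le> (norm z)\<^sup>2"
          by (rule norm_bpow_sqrt_le[OF Q(1) B posB])
        then have "(norm ((bpow (id_blinfun - P') (Suc m)) (P x)))\<^sup>2 \<le> (norm z / sqrt (real (Suc m)))\<^sup>2"
          unfolding z by (simp add: power_divide field_simps del: of_nat_Suc bpow.simps)
        then have "norm ((bpow (id_blinfun - P') (Suc m)) (P x)) \<le> norm z / sqrt (real (Suc m))"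
          by (rule power2_le_imp_le) simp
        then show "norm (norm ((bpow (id_blinfun - P') (Suc m)) (P x)))
            \<le> norm z / sqrt (real (Suc m))" by (simp del: bpow.simps)
      qed
      show "(\<lambda>m. norm z / sqrt (real (Suc m))) \<longlonglongrightarrow> 0"
        by (rule real_tendsto_divide_at_top[OF tendsto_const])
           (intro filterlim_compose[OF sqrt_at_top] filterlim_compose[OF filterlim_real_sequentially] filterlim_Suc)
    qed
    from cinner.tendsto[OF tendsto_diff[OF tendsto_const[of "P x"] this] tendsto_const[of x]]
    show "(\<lambda>m. cinner (T x) ((U m) x)) \<longlonglongrightarrow> cinner (absop T x) x"
      unfolding P_def[symmetric] eq by simp
  qed
qed

section \<open>Orthonormal bases\<close>

definition orthonormal :: "ell2 set \<Rightarrow> bool" where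
  "orthonormal E \<longleftrightarrow> (\<forall>e\<in>E. \<forall>e'\<in>E. cinner e e' = (if e = e' then 1 else 0))"

definition onb :: "ell2 set \<Rightarrow> bool" where
  "onb E \<longleftrightarrow> orthonormal E \<and> (\<forall>x. (\<forall>e\<in>E. cinner x e = 0) \<longrightarrow> x = 0)"

definition partial_exp :: "ell2 \<Rightarrow> ell2 set \<Rightarrow> ell2" where
  "partial_exp x F = (\<Sum>e\<in>F. cinner x e *\<^sub>C e)"

lemma cinner_partial_exp:
  assumes "orthonormal E" "finite F" "F \<subseteq> E" "e \<in> E"
  shows "cinner (partial_exp x F) e = (if e \<in> F then cinner x e else 0)"
proof -
  have "cinner (partial_exp x F) e = (\<Sum>e'\<in>F. if e' = e then cinner x e else 0)"
    unfolding partial_exp_def cinner_sum_left cinner_scaleC_left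
    using assms by (intro sum.cong) (auto simp: orthonormal_def)
  then show ?thesis using assms(2) by simp
qed

lemma norm_partial_exp_diff:
  assumes E: "orthonormal E" and F: "finite G" "F \<subseteq> G" "G \<subseteq> E"
  shows "(norm (partial_exp x G - partial_exp x F))\<^sup>2 = (\<Sum>e\<in>G. (cmod (cinner x e))\<^sup>2) - (\<Sum>e\<in>F. (cmod (cinner x e))\<^sup>2)"
proof -
  have fF: "finite F" using F finite_subset by blast
  have d: "partial_exp x G - partial_exp x F = partial_exp x (G - F)"
    unfolding partial_exp_def by (rule sum_diff[symmetric]) (use F in auto)
  have "cinner (partial_exp x (G - F)) (partial_exp x (G - F)) = (\<Sum>e\<in>G - F. cnj (cinner x e) * cinner (partial_exp x (G - F)) e)"
    by (subst (2) partial_exp_def) (simp add: cinner_sum_right cinner_scaleC_right)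
  also have "\<dots> = (\<Sum>e\<in>G - F. of_real ((cmod (cinner x e))\<^sup>2))"
  proof (rule sum.cong)
    fix e assume e: "e \<in> G - F"
    then have "cinner (partial_exp x (G - F)) e = cinner x e"
      using cinner_partial_exp[OF E, of "G - F" e x] F by auto
    then show "cnj (cinner x e) * cinner (partial_exp x (G - F)) e = of_real ((cmod (cinner x e))\<^sup>2)"
      by (simp only: complex_norm_square mult.commute)
  qed simp
  also have "\<dots> = of_real (\<Sum>e\<in>G - F. (cmod (cinner x e))\<^sup>2)" by simp
  finally have "(norm (partial_exp x (G - F)))\<^sup>2 = (\<Sum>e\<in>G - F. (cmod (cinner x e))\<^sup>2)"
    unfolding cinner_self of_real_eq_iff .
  also have "\<dots> = (\<Sum>e\<in>G. (cmod (cinner x e))\<^sup>2) - (\<Sum>e\<in>F. (cmod (cinner x e))\<^sup>2)"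
    by (rule sum_diff) (use F in auto)
  finally show ?thesis unfolding d .
qed

lemma bessel_inequality:
  assumes E: "orthonormal F" and F: "finite F"
  shows "(\<Sum>e\<in>F. (cmod (cinner x e))\<^sup>2) \<le> (norm x)\<^sup>2"
proof -
  define y where "y = partial_exp x F"
  have ye: "cinner y e = cinner x e" if "e \<in> F" for e
    using cinner_partial_exp[OF E F subset_refl that, of x] that by (simp add: y_def)
  have "cinner (x - y) y = (\<Sum>e\<in>F. cnj (cinner x e) * cinner (x - y) e)"
    by (subst (2) y_def) (simp add: partial_exp_def cinner_sum_right cinner_scaleC_right)
  then have o: "cinner (x - y) y = 0" by (simp add: cinner_diff_left ye)
  have "inner (x - y) y = 0" by (simp add: inner_ell2_def o)
  then have "(norm x)\<^sup>2 = (norm (x - y))\<^sup>2 + (norm y)\<^sup>2"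
    by (simp add: power2_norm_eq_inner inner_diff_left inner_diff_right inner_commute)
  moreover have "(norm y)\<^sup>2 = (\<Sum>e\<in>F. (cmod (cinner x e))\<^sup>2)"
    using norm_partial_exp_diff[OF E F, of "{}" x] by (simp add: y_def partial_exp_def)
  moreover have "0 \<le> (norm (x - y))\<^sup>2" by simp
  ultimately show ?thesis by linarith
qed

lemma orthonormal_subset: "orthonormal E \<Longrightarrow> F \<subseteq> E \<Longrightarrow> orthonormal F"
  unfolding orthonormal_def by (meson subsetD)

text \<open>\<open>E\<close> is an arbitrary set, so the sum is unordered. By Bessel's inequality
  there are finite sets \<open>F n\<close> missing at most \<open>(1 / (n+1))^2\<close> of the total
  of the squared coefficients; their partial sums are Cauchy, all larger partial sums stay close,
  and totality of \<open>E\<close> identifies the limit.\<close>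

lemma onb_expansion:
  assumes E: "onb E"
  shows "((\<lambda>e. cinner x e *\<^sub>C e) has_sum x) E"
proof -
  have on: "orthonormal E" and tot: "\<And>z. (\<And>e. e \<in> E \<Longrightarrow> cinner z e = 0) \<Longrightarrow> z = 0"
    using E by (auto simp: onb_def)
  define a where "a e = (cmod (cinner x e))\<^sup>2" for e
  have "a summable_on E"
  proof (rule nonneg_bdd_above_summable_on)
    show "bdd_above (sum a ` {F. F \<subseteq> E \<and> finite F})"
      unfolding a_def
      by (rule bdd_aboveI2[where M = "(norm x)\<^sup>2"]) (auto intro: bessel_inequality orthonormal_subset[OF on])
  qed (simp add: a_def)
  then obtain s where s: "(a has_sum s) E" by (auto simp: summable_on_def)
  have le: "sum a F \<le> s" if "finite F" "F \<subseteq> E" for F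
    by (rule finite_sum_le_has_sum[OF s that]) (simp add: a_def)
  have "\<exists>F. finite F \<and> F \<subseteq> E \<and> s - (1 / real (Suc n))\<^sup>2 \<le> sum a F" for n
  proof -
    obtain F where "finite F" "F \<subseteq> E" "dist (sum a F) s \<le> (1 / real (Suc n))\<^sup>2"
      using has_sum_finite_approximation[OF s, of "(1 / real (Suc n))\<^sup>2"] by auto
    then show ?thesis by (intro exI[of _ F]) (auto simp: dist_real_def abs_le_iff)
  qed
  then obtain F where F: "\<And>n. finite (F n)" "\<And>n. F n \<subseteq> E" "\<And>n. s - (1 / real (Suc n))\<^sup>2 \<le> sum a (F n)"
    by metis
  have near: "norm (partial_exp x G - partial_exp x (F n)) \<le> 1 / real (Suc n)"
    if "finite G" "G \<subseteq> E" "F n \<subseteq> G" for G n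
  proof -
    have "(norm (partial_exp x G - partial_exp x (F n)))\<^sup>2 = sum a G - sum a (F n)"
      unfolding a_def by (rule norm_partial_exp_diff[OF on that(1) that(3) that(2)])
    also have "\<dots> \<le> (1 / real (Suc n))\<^sup>2" using le[OF that(1,2)] F(3)[of n] by linarith
    finally show ?thesis by (rule power2_le_imp_le) simp
  qed
  have near2: "norm (partial_exp x (F m) - partial_exp x (F n)) \<le> 1 / real (Suc m) + 1 / real (Suc n)" for m n
  proof -
    have "norm (partial_exp x (F m \<union> F n) - partial_exp x (F m)) \<le> 1 / real (Suc m)"
      "norm (partial_exp x (F m \<union> F n) - partial_exp x (F n)) \<le> 1 / real (Suc n)"
      by (rule near; use F in auto)+
    then show ?thesis
      using norm_triangle_ineq4[of "partial_exp x (F m \<union> F n) - partial_exp x (F n)" "partial_exp x (F m \<union> F n) - partial_exp x (F m)"]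
      by simp
  qed
  have small: "\<exists>N. \<forall>n\<ge>N. 1 / real (Suc n) < e" if "0 < e" for e
    using LIMSEQ_D[OF LIMSEQ_inverse_real_of_nat that] by (auto simp: inverse_eq_divide)
  have "Cauchy (\<lambda>n. partial_exp x (F n))"
  proof (rule metric_CauchyI)
    fix e :: real assume "0 < e"
    then obtain N where N: "\<And>n. n \<ge> N \<Longrightarrow> 1 / real (Suc n) < e / 2" using small[of "e / 2"] by auto
    have "dist (partial_exp x (F m)) (partial_exp x (F n)) < e" if "m \<ge> N" "n \<ge> N" for m n
      using near2[of m n] N[OF that(1)] N[OF that(2)] by (simp add: dist_norm)
    then show "\<exists>M. \<forall>m\<ge>M. \<forall>n\<ge>M. dist (partial_exp x (F m)) (partial_exp x (F n)) < e" by blast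
  qed
  then obtain y where y: "(\<lambda>n. partial_exp x (F n)) \<longlonglongrightarrow> y" by (auto simp: Cauchy_convergent_iff convergent_def)
  have hs: "((\<lambda>e. cinner x e *\<^sub>C e) has_sum y) E"
    unfolding has_sum_def tendsto_iff eventually_finite_subsets_at_top
  proof (intro allI impI)
    fix e :: real assume e: "0 < e"
    obtain N1 where N1: "\<And>n. n \<ge> N1 \<Longrightarrow> 1 / real (Suc n) < e / 2" using small[of "e / 2"] e by auto
    obtain N2 where N2: "\<And>n. n \<ge> N2 \<Longrightarrow> norm (partial_exp x (F n) - y) < e / 2"
      using LIMSEQ_D[OF y, of "e / 2"] e by auto
    define n where "n = max N1 N2"
    show "\<exists>X. finite X \<and> X \<subseteq> E \<and> (\<forall>Y. finite Y \<and> X \<subseteq> Y \<and> Y \<subseteq> E \<longrightarrow> dist (\<Sum>e\<in>Y. cinner x e *\<^sub>C e) y < e)"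
    proof (intro exI[of _ "F n"] conjI allI impI F)
      fix Y assume Y: "finite Y \<and> F n \<subseteq> Y \<and> Y \<subseteq> E"
      have "norm (partial_exp x Y - y) \<le> norm (partial_exp x Y - partial_exp x (F n)) + norm (partial_exp x (F n) - y)"
        by (rule norm_diff_triangle_ineq[of "partial_exp x Y" "partial_exp x (F n)" "partial_exp x (F n)" y, simplified] norm_diff_triangle_le) auto
      also have "\<dots> < e" using near[of Y n] Y N1[of n] N2[of n] by (simp add: n_def)
      finally show "dist (\<Sum>e\<in>Y. cinner x e *\<^sub>C e) y < e" by (simp add: dist_norm partial_exp_def)
    qed
  qed
  have "cinner y e = cinner x e" if e: "e \<in> E" for e
  proof -
    have "((\<lambda>e'. cinner (cinner x e' *\<^sub>C e') e) has_sum cinner y e) E"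
      by (rule has_sum_bounded_linear[OF cinner.bounded_linear_left hs])
    moreover have "((\<lambda>e'. cinner (cinner x e' *\<^sub>C e') e) has_sum cinner x e) E"
    proof (rule has_sum_finite_neutralI[of "{e}"])
      show "cinner (cinner x e' *\<^sub>C e') e = 0" if "e' \<in> E - {e}" for e'
        using on that e by (auto simp: orthonormal_def cinner_scaleC_left)
      show "cinner x e = (\<Sum>e'\<in>{e}. cinner (cinner x e' *\<^sub>C e') e)"
        using on e by (simp add: orthonormal_def cinner_scaleC_left)
    qed (use e in auto)
    ultimately show ?thesis by (rule has_sum_unique)
  qed
  then have "y = x" using tot[of "y - x"] by (simp add: cinner_diff_left)
  then show ?thesis using hs by simp
qed

lemma parseval:
  assumes "onb E"
  shows "((\<lambda>e. cinner x e * cinner e y) has_sum cinner x y) E"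
  using has_sum_bounded_linear[OF cinner.bounded_linear_left onb_expansion[OF assms, of x], of y]
  by (simp add: cinner_scaleC_left)

lemma parseval_norm:
  assumes "onb E"
  shows "((\<lambda>e. (cmod (cinner x e))\<^sup>2) has_sum (norm x)\<^sup>2) E"
proof -
  have "cinner x e * cinner e x = of_real ((cmod (cinner x e))\<^sup>2)" for e
    by (subst (2) cinner_commute) (rule complex_norm_square[symmetric])
  then have "((\<lambda>e. complex_of_real ((cmod (cinner x e))\<^sup>2)) has_sum of_real ((norm x)\<^sup>2)) E"
    using parseval[OF assms, of x x] by (simp only: cinner_self)
  from has_sum_Re[OF this] show ?thesis by simp
qed

lemma inj_unit_vec: "inj unit_vec"
  by (rule injI) (metis coord_unit_vec zero_neq_one)

lemma onb_unit_vec: "onb (range unit_vec)"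
  unfolding onb_def orthonormal_def
  by (auto simp: coord_unit_vec inj_eq[OF inj_unit_vec] intro: ell2_eqI)

section \<open>Trace class operators\<close>

text \<open>
  Images of orthonormal systems under contractions satisfy Bessel's inequality but need not be
  orthonormal, so the trace norm is described by testing against finite Bessel families.
\<close>

definition bessel :: "nat \<Rightarrow> (nat \<Rightarrow> ell2) \<Rightarrow> bool" where
  "bessel n f \<longleftrightarrow> (\<forall>x. (\<Sum>j<n. (cmod (cinner x (f j)))\<^sup>2) \<le> (norm x)\<^sup>2)"

definition tcbound :: "ell2_op \<Rightarrow> real \<Rightarrow> bool" where
  "tcbound T C \<longleftrightarrow> (\<forall>n e f. bessel n e \<longrightarrow> bessel n f \<longrightarrow>
     (\<Sum>j<n. cmod (cinner (T (e j)) (f j))) \<le> C)"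

definition tc :: "ell2_op \<Rightarrow> bool" where
  "tc T \<longleftrightarrow> clin T \<and> (\<exists>C. tcbound T C)"

text \<open>The supremum of the test sums, written as the least admissible bound so that triangle
  inequalities are immediate. For trace class operators it is the trace norm
  (\<open>trace_norm_lift\<close>).\<close>

definition tn :: "ell2_op \<Rightarrow> real" where
  "tn T = Inf {C. tcbound T C}"

lemma bessel_0: "bessel 0 e"
  by (simp add: bessel_def)

lemma tcbound_nonneg: "tcbound T C \<Longrightarrow> 0 \<le> C"
  using bessel_0 unfolding tcbound_def by (metis lessThan_0 sum.empty)

lemma tn_le: "tcbound T C \<Longrightarrow> tn T \<le> C"
  unfolding tn_def by (rule cInf_lower) (auto intro!: bdd_belowI[of _ 0] tcbound_nonneg)

lemma tcbound_tn:
  assumes "tc T"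
  shows "tcbound T (tn T)"
  unfolding tcbound_def
proof (intro allI impI)
  fix n e f assume "bessel n e" "bessel n f"
  then show "(\<Sum>j<n. cmod (cinner (T (e j)) (f j))) \<le> tn T"
    unfolding tn_def using assms by (intro cInf_greatest) (auto simp: tc_def tcbound_def)
qed

lemma tn_nonneg: "tc T \<Longrightarrow> 0 \<le> tn T"
  by (rule tcbound_nonneg[OF tcbound_tn])

lemma tcI: "clin T \<Longrightarrow> tcbound T C \<Longrightarrow> tc T"
  by (auto simp: tc_def)

lemma tcbound_add:
  assumes "tcbound S C" "tcbound T D"
  shows "tcbound (S + T) (C + D)"
  unfolding tcbound_def
proof (intro allI impI)
  fix n e f assume b: "bessel n e" "bessel n f"
  have "(\<Sum>j<n. cmod (cinner ((S + T) (e j)) (f j)))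
      \<le> (\<Sum>j<n. cmod (cinner (S (e j)) (f j)) + cmod (cinner (T (e j)) (f j)))"
    by (intro sum_mono) (simp add: blinfun.bilinear_simps cinner_add_left norm_triangle_ineq)
  also have "\<dots> \<le> C + D"
    unfolding sum.distrib using assms b by (intro add_mono) (auto simp: tcbound_def)
  finally show "(\<Sum>j<n. cmod (cinner ((S + T) (e j)) (f j))) \<le> C + D" .
qed

lemma tcbound_uminus: "tcbound T C \<Longrightarrow> tcbound (- T) C"
  by (simp add: tcbound_def blinfun.bilinear_simps)

lemma tcbound_diff: "tcbound S C \<Longrightarrow> tcbound T D \<Longrightarrow> tcbound (S - T) (C + D)"
  using tcbound_add[of S C "- T" D] tcbound_uminus[of T D] by simp

lemma tc_add: "tc S \<Longrightarrow> tc T \<Longrightarrow> tc (S + T)"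
  unfolding tc_def using tcbound_add clin_closed(3) by blast

lemma tc_diff: "tc S \<Longrightarrow> tc T \<Longrightarrow> tc (S - T)"
  unfolding tc_def using tcbound_diff clin_closed(4) by blast

lemma tn_add_le: "tc S \<Longrightarrow> tc T \<Longrightarrow> tn (S + T) \<le> tn S + tn T"
  by (intro tn_le tcbound_add tcbound_tn)

lemma tn_diff_le: "tc S \<Longrightarrow> tc T \<Longrightarrow> tn (S - T) \<le> tn S + tn T"
  by (intro tn_le tcbound_diff tcbound_tn)

lemma tc_0: "tc 0" and tn_0: "tn 0 = 0"
proof -
  have b: "tcbound 0 0" by (simp add: tcbound_def)
  show t: "tc 0" by (rule tcI[OF clin_closed(1) b])
  show "tn 0 = 0" using tn_le[OF b] tn_nonneg[OF t] by simp
qed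

definition scop :: "complex \<Rightarrow> ell2_op \<Rightarrow> ell2_op" where
  "scop c T = Blinfun (\<lambda>x. c *\<^sub>C T x)"

lemma scop_apply [simp]: "(scop c T) x = c *\<^sub>C T x"
  unfolding scop_def
  by (subst bounded_linear_Blinfun_apply) (auto intro!: bounded_linear_compose[OF bounded_linear_scaleC] blinfun.bounded_linear_right)

lemma clin_scop: "clin T \<Longrightarrow> clin (scop c T)"
  by (simp add: clin_def scaleC_simps mult.commute)

lemma tcbound_scop:
  assumes "tcbound T C"
  shows "tcbound (scop c T) (cmod c * C)"
  using assms unfolding tcbound_def
  by (auto simp: cinner_scaleC_left norm_mult sum_distrib_left[symmetric] intro!: mult_left_mono)

lemma tc_scop: "tc T \<Longrightarrow> tc (scop c T)"
  unfolding tc_def using tcbound_scop clin_scop by blast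

lemma tn_scop_le: "tc T \<Longrightarrow> tn (scop c T) \<le> cmod c * tn T"
  by (intro tn_le tcbound_scop tcbound_tn)

lemma bessel_single:
  assumes "norm e \<le> 1"
  shows "bessel 1 (\<lambda>_. e)"
  unfolding bessel_def
proof
  fix x
  have "cmod (cinner x e) \<le> norm x * norm e" by (rule cinner_cauchy_schwarz)
  also have "\<dots> \<le> norm x * 1" by (intro mult_left_mono assms) auto
  finally show "(\<Sum>j<(1::nat). (cmod (cinner x e))\<^sup>2) \<le> (norm x)\<^sup>2" by (simp add: power_mono)
qed

lemma cinner_le_tn:
  assumes "tc T"
  shows "cmod (cinner (T x) y) \<le> tn T * norm x * norm y"
proof (cases "x = 0 \<or> y = 0")
  case False
  then have nz: "norm x \<noteq> 0" "norm y \<noteq> 0" by auto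
  have "(\<Sum>j<(1::nat). cmod (cinner (T (inverse (norm x) *\<^sub>R x)) (inverse (norm y) *\<^sub>R y))) \<le> tn T"
    using tcbound_tn[OF assms, unfolded tcbound_def, rule_format,
      OF bessel_single[of "inverse (norm x) *\<^sub>R x"] bessel_single[of "inverse (norm y) *\<^sub>R y"]] nz by simp
  also have "(\<Sum>j<(1::nat). cmod (cinner (T (inverse (norm x) *\<^sub>R x)) (inverse (norm y) *\<^sub>R y)))
      = cmod (cinner (T x) y) / (norm x * norm y)"
    by (simp add: blinfun.scaleR_right cinner.scaleR_left cinner.scaleR_right divide_inverse)
  finally show ?thesis using nz by (simp add: field_simps)
qed auto

lemma norm_adj_apply_le:
  assumes "clin U" "\<And>x. norm (U x) \<le> norm x"
  shows "norm (adj U x) \<le> norm x"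
proof (rule norm_le_of_cinner)
  fix z
  have "cmod (cinner (adj U x) z) \<le> norm x * norm (U z)"
    unfolding cinner_adj'[OF assms(1)] by (rule cinner_cauchy_schwarz)
  also have "\<dots> \<le> norm x * norm z" by (intro mult_left_mono assms) auto
  finally show "cmod (cinner (adj U x) z) \<le> norm x * norm z" .
qed simp

text \<open>The contraction is moved to the other side as its adjoint, which is again a
  contraction.\<close>

lemma bessel_contraction:
  assumes "clin U" "\<And>x. norm (U x) \<le> norm x" "bessel n e"
  shows "bessel n (\<lambda>j. U (e j))"
  unfolding bessel_def
proof
  fix x
  have "(\<Sum>j<n. (cmod (cinner x (U (e j))))\<^sup>2) = (\<Sum>j<n. (cmod (cinner (adj U x) (e j)))\<^sup>2)"
    by (simp add: cinner_adj'[OF assms(1)])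
  also have "\<dots> \<le> (norm (adj U x))\<^sup>2" using assms(3) by (simp add: bessel_def)
  also have "\<dots> \<le> (norm x)\<^sup>2" by (intro power_mono norm_adj_apply_le assms(1,2)) auto
  finally show "(\<Sum>j<n. (cmod (cinner x (U (e j))))\<^sup>2) \<le> (norm x)\<^sup>2" .
qed

lemma bessel_enum:
  assumes "orthonormal F" "bij_betw h {..<n} F"
  shows "bessel n h"
  unfolding bessel_def
proof
  fix x
  have "finite F" using assms(2) bij_betw_finite by blast
  then show "(\<Sum>j<n. (cmod (cinner x (h j)))\<^sup>2) \<le> (norm x)\<^sup>2"
    using bessel_inequality[OF assms(1), of x] sum.reindex_bij_betw[OF assms(2), of "\<lambda>e. (cmod (cinner x e))\<^sup>2"]
    by simp
qed

lemma has_sum_sum: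
  fixes f :: "'i \<Rightarrow> 'a \<Rightarrow> 'b :: topological_comm_monoid_add"
  shows "(\<And>i. i \<in> I \<Longrightarrow> (f i has_sum S i) E) \<Longrightarrow> ((\<lambda>e. \<Sum>i\<in>I. f i e) has_sum (\<Sum>i\<in>I. S i)) E"
  by (induction I rule: infinite_finite_induct) (auto intro: has_sum_add)

text \<open>Parseval for each \<open>adj T (f j)\<close>; the finite sum over \<open>j\<close> is
  then moved inside, where the Bessel property is applied to \<open>T e\<close> for each fixed
  \<open>e\<close>.\<close>

lemma hilbert_schmidt_bessel:
  assumes E: "onb E" and T: "clin T" and S: "((\<lambda>e. (norm (T e))\<^sup>2) has_sum S) E" and f: "bessel n f"
  shows "(\<Sum>j<n. (norm (adj T (f j)))\<^sup>2) \<le> S"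
proof (rule has_sum_mono[OF _ S])
  show "((\<lambda>e. \<Sum>j<n. (cmod (cinner (adj T (f j)) e))\<^sup>2) has_sum
      (\<Sum>j<n. (norm (adj T (f j)))\<^sup>2)) E"
    by (rule has_sum_sum) (rule parseval_norm[OF E])
  fix e
  have "cmod (cinner (adj T (f j)) e) = cmod (cinner (T e) (f j))" for j
    unfolding cinner_adj'[OF T] by (subst cinner_commute) simp
  then show "(\<Sum>j<n. (cmod (cinner (adj T (f j)) e))\<^sup>2) \<le> (norm (T e))\<^sup>2"
    using f by (simp add: bessel_def)
qed

lemma cinner_square:
  assumes "pos Q" "(Q o\<^sub>L Q) = P"
  shows "cinner (P x) x = of_real ((norm (Q x))\<^sup>2)"
  using selfadjD[OF pos_selfadj[OF assms(1)]] blinfun_eqD[OF assms(2)[symmetric], of x]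
  by (simp only: blinfun_apply_blinfun_compose cinner_self[symmetric])

lemma adj_selfadj: "selfadj Q \<Longrightarrow> adj Q = Q"
  by (rule adj_unique[symmetric]) (auto simp: selfadj_def)

definition polar :: "ell2_op \<Rightarrow> ell2_op \<Rightarrow> ell2_op \<Rightarrow> (nat \<Rightarrow> ell2_op) \<Rightarrow> bool" where
  "polar T V Q U \<longleftrightarrow> clin V \<and> pos Q \<and> (Q o\<^sub>L Q) = absop T \<and> (V o\<^sub>L Q) = T \<and>
    (\<forall>x. norm (V x) = norm (Q x)) \<and>
    (\<forall>m. clin (U m)) \<and> (\<forall>m x. norm ((U m) x) \<le> norm x) \<and>
    (\<forall>x. (\<lambda>m. cinner (T x) ((U m) x)) \<longlonglongrightarrow> cinner (absop T x) x)"

lemma polar_exists: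
  assumes T: "clin T"
  shows "\<exists>V Q U. polar T V Q U"
proof (rule polar_decomposition[OF T])
  fix V Q U
  assume A: "clin V" "pos Q" "(Q o\<^sub>L Q) = absop T" "(V o\<^sub>L Q) = T"
    "\<And>x. norm (V x) = norm (Q x)"
    "\<And>m. clin (U m)" "\<And>m x. norm ((U m) x) \<le> norm x"
    "\<And>x. (\<lambda>m. cinner (T x) ((U m) x)) \<longlonglongrightarrow> cinner (absop T x) x"
  have "polar T V Q U" unfolding polar_def by (intro conjI allI) (fact A)+
  then show ?thesis by blast
qed

text \<open>Testing \<open>T\<close> with the families \<open>h\<close> and \<open>U m h\<close>
  bounds the diagonal of the modulus; conversely \<open><T e, f> = <Q e, adj V f>\<close>, and the
  sum over \<open>E\<close> controls both factors. As \<open>E\<close> is arbitrary and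
  \<open>tn\<close> does not mention it, independence of the basis comes for free.\<close>

lemma tc_onb_aux:
  assumes E: "onb E" and T: "clin T" and Q: "pos Q" "(Q o\<^sub>L Q) = absop T"
  shows "tc T \<longleftrightarrow> (\<lambda>e. (norm (Q e))\<^sup>2) summable_on E"
    "tc T \<Longrightarrow> ((\<lambda>e. (norm (Q e))\<^sup>2) has_sum tn T) E"
proof -
  obtain V Q' U where VQU: "polar T V Q' U" using polar_exists[OF T] by blast
  have V: "clin V" "pos Q'" "(Q' o\<^sub>L Q') = absop T" "(V o\<^sub>L Q') = T"
    "\<And>x. norm (V x) = norm (Q' x)"
    using VQU unfolding polar_def by blast+
  have U: "\<And>m. clin (U m)" "\<And>m x. norm ((U m) x) \<le> norm x"
    "\<And>x. (\<lambda>m. cinner (T x) ((U m) x)) \<longlonglongrightarrow> cinner (absop T x) x"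
    using VQU unfolding polar_def by blast+
  \<comment> \<open>By uniqueness of positive roots, the given \<open>Q\<close> is the one from the
    polar decomposition.\<close>
  have QQ': "Q = Q'"
    using op_sqrt(4)[OF pos_absop[OF T] Q] op_sqrt(4)[OF pos_absop[OF T] V(2,3)] by simp
  define a where "a e = (norm (Q e))\<^sup>2" for e
  have aP: "cinner (absop T e) e = of_real (a e)" for e
    unfolding a_def by (rule cinner_square[OF Q])
  have cQ: "clin Q" using Q by (simp add: pos_def)
  have fin: "sum a F \<le> C" if C: "tcbound T C" and F: "finite F" "F \<subseteq> E" for C F
  proof -
    obtain h where h: "bij_betw h {..<card F} F"
      using ex_bij_betw_nat_finite[OF F(1)] by (auto simp: atLeast0LessThan)
    have be: "bessel (card F) h"
      by (rule bessel_enum[OF _ h]) (use E F in \<open>auto simp: onb_def intro: orthonormal_subset\<close>)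
    have lim: "(\<lambda>m. \<Sum>j<card F. Re (cinner (T (h j)) ((U m) (h j)))) \<longlonglongrightarrow>
        (\<Sum>j<card F. Re (cinner (absop T (h j)) (h j)))"
      by (intro tendsto_sum tendsto_Re U)
    have "(\<Sum>j<card F. Re (cinner (T (h j)) ((U m) (h j)))) \<le> C" for m
    proof -
      have "(\<Sum>j<card F. Re (cinner (T (h j)) ((U m) (h j))))
          \<le> (\<Sum>j<card F. cmod (cinner (T (h j)) ((U m) (h j))))"
        by (intro sum_mono complex_Re_le_cmod)
      also have "\<dots> \<le> C"
        using C be bessel_contraction[OF U(1,2) be, of m] unfolding tcbound_def by blast
      finally show ?thesis .
    qed
    then have "(\<Sum>j<card F. Re (cinner (absop T (h j)) (h j))) \<le> C"
      by (intro LIMSEQ_le_const2[OF lim]) auto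
    then have "(\<Sum>j<card F. a (h j)) \<le> C" by (simp add: aP)
    then show ?thesis using sum.reindex_bij_betw[OF h, of a] by simp
  qed
  have dir1: "a summable_on E" if C: "tcbound T C" for C
    by (rule nonneg_bdd_above_summable_on)
       (auto simp: a_def[symmetric] intro!: bdd_aboveI2[where M = C] fin[OF C], simp add: a_def)
  have dir2: "tcbound T S" if S: "(a has_sum S) E" for S
    unfolding tcbound_def
  proof (intro allI impI)
    fix n e f assume b: "bessel n e" "bessel n f"
    have SQ: "(\<Sum>j<n. (norm (Q (e j)))\<^sup>2) \<le> S"
      using hilbert_schmidt_bessel[OF E cQ S[unfolded a_def] b(1)] by (simp add: adj_selfadj pos_selfadj Q)
    have SV: "(\<Sum>j<n. (norm (adj V (f j)))\<^sup>2) \<le> S"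
      by (rule hilbert_schmidt_bessel[OF E V(1) _ b(2)]) (use S[unfolded a_def] V(5) QQ' in simp)
    \<comment> \<open>The arithmetic-geometric mean loses nothing here, because both sums of squares
      have the same bound \<open>S\<close>.\<close>
    have "(\<Sum>j<n. cmod (cinner (T (e j)) (f j))) \<le>
        (\<Sum>j<n. ((norm (Q (e j)))\<^sup>2 + (norm (adj V (f j)))\<^sup>2) / 2)"
    proof (rule sum_mono)
      fix j
      have "cinner (T (e j)) (f j) = cinner (Q (e j)) (adj V (f j))"
        unfolding V(4)[symmetric] by (simp add: cinner_adj[OF V(1)] QQ')
      then have "cmod (cinner (T (e j)) (f j)) \<le> norm (Q (e j)) * norm (adj V (f j))"
        by (simp add: cinner_cauchy_schwarz)
      also have "\<dots> \<le> ((norm (Q (e j)))\<^sup>2 + (norm (adj V (f j)))\<^sup>2) / 2"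
        using sum_squares_bound[of "norm (Q (e j))" "norm (adj V (f j))"] by simp
      finally show "cmod (cinner (T (e j)) (f j)) \<le>
          ((norm (Q (e j)))\<^sup>2 + (norm (adj V (f j)))\<^sup>2) / 2" .
    qed
    also have "\<dots> \<le> S"
      unfolding sum_divide_distrib[symmetric] sum.distrib using SQ SV by simp
    finally show "(\<Sum>j<n. cmod (cinner (T (e j)) (f j))) \<le> S" .
  qed
  show "tc T \<longleftrightarrow> (\<lambda>e. (norm (Q e))\<^sup>2) summable_on E"
    unfolding a_def[symmetric] tc_def using T dir1 dir2 by (auto simp: summable_on_def)
  assume tcT: "tc T"
  then obtain S where S: "(a has_sum S) E" using dir1[OF tcbound_tn] by (auto simp: summable_on_def)
  have "S \<le> tn T" by (rule has_sum_le_finite_sums[OF S]) (rule fin[OF tcbound_tn[OF tcT]])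
  moreover have "tn T \<le> S" by (rule tn_le[OF dir2[OF S]])
  ultimately show "((\<lambda>e. (norm (Q e))\<^sup>2) has_sum tn T) E"
    using S by (simp add: a_def[abs_def])
qed

lemma tc_iff_summable:
  assumes E: "onb E" and T: "clin T"
  shows "tc T \<longleftrightarrow> (\<lambda>e. cinner (absop T e) e) summable_on E"
    "tc T \<Longrightarrow> ((\<lambda>e. cinner (absop T e) e) has_sum of_real (tn T)) E"
proof -
  define Q where "Q = op_sqrt (absop T)"
  have Q: "pos Q" "(Q o\<^sub>L Q) = absop T" unfolding Q_def by (rule op_sqrt[OF pos_absop[OF T]])+
  note aux = tc_onb_aux[OF E T Q]
  have eq: "(\<lambda>e. cinner (absop T e) e) = (\<lambda>e. of_real ((norm (Q e))\<^sup>2))"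
    by (intro ext cinner_square[OF Q])
  show "tc T \<longleftrightarrow> (\<lambda>e. cinner (absop T e) e) summable_on E"
    unfolding eq aux(1) by (metis (mono_tags, lifting) Re_complex_of_real summable_on_Re summable_on_cong summable_on_of_real)
  show "((\<lambda>e. cinner (absop T e) e) has_sum of_real (tn T)) E" if "tc T"
    unfolding eq by (rule has_sum_of_real[OF aux(2)[OF that]])
qed

text \<open>A representation \<open>T = sum <., u_j> v_j\<close> whose square-summable factors make
  it absolutely convergent. Composition on the left acts on \<open>v\<close> alone, so traces of
  products can be read off.\<close>

definition nuclear :: "ell2_op \<Rightarrow> (nat \<Rightarrow> ell2) \<Rightarrow> (nat \<Rightarrow> ell2) \<Rightarrow> bool" where
  "nuclear T u v \<longleftrightarrow> summable (\<lambda>j. (norm (u j))\<^sup>2) \<and> summable (\<lambda>j. (norm (v j))\<^sup>2) \<and>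
     (\<forall>x. (\<lambda>j. cinner x (u j) *\<^sub>C v j) sums T x)"

text \<open>Expand \<open>Q x\<close> in unit vectors and apply \<open>V\<close>: this gives
  \<open>u j = Q e_j\<close> and \<open>v j = V e_j\<close>, of equal norms whose squares are
  summable.\<close>

lemma tc_nuclear:
  assumes "tc T"
  shows "\<exists>u v. nuclear T u v"
proof -
  have T: "clin T" using assms by (simp add: tc_def)
  obtain V Q U where VQU: "polar T V Q U" using polar_exists[OF T] by blast
  have V: "clin V" "pos Q" "(Q o\<^sub>L Q) = absop T" "(V o\<^sub>L Q) = T"
    "\<And>x. norm (V x) = norm (Q x)"
    using VQU unfolding polar_def by blast+
  have "(\<lambda>e. (norm (Q e))\<^sup>2) summable_on range unit_vec"
    using tc_onb_aux(1)[OF onb_unit_vec T V(2,3)] assms by simp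
  then have "((\<lambda>e. (norm (Q e))\<^sup>2) \<circ> unit_vec) summable_on UNIV"
    using summable_on_reindex[OF inj_unit_vec] by blast
  then have s: "summable (\<lambda>j. (norm (Q (unit_vec j)))\<^sup>2)"
    by (auto dest!: summable_on_imp_summable simp: o_def)
  have "nuclear T (\<lambda>j. Q (unit_vec j)) (\<lambda>j. V (unit_vec j))"
    unfolding nuclear_def
  proof (intro conjI allI)
    fix x
    have "(\<lambda>j. V (coord (Q x) j *\<^sub>C unit_vec j)) sums V (Q x)"
      by (rule bounded_linear.sums[OF blinfun.bounded_linear_right ell2_expansion])
    moreover have "coord (Q x) j = cinner x (Q (unit_vec j))" for j
      using selfadjD[OF pos_selfadj[OF V(2)], of x "unit_vec j"] by simp
    ultimately show "(\<lambda>j. cinner x (Q (unit_vec j)) *\<^sub>C V (unit_vec j)) sums T x"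
      using blinfun_eqD[OF V(4), of x] by (simp add: clinD[OF V(1)])
  qed (use s V(5) in simp_all)
  then show ?thesis by blast
qed

lemma nuclear_compose:
  assumes A: "clin A" and T: "nuclear T u v"
  shows "nuclear (A o\<^sub>L T) u (\<lambda>j. A (v j))"
  unfolding nuclear_def
proof (intro conjI allI)
  show "summable (\<lambda>j. (norm (u j))\<^sup>2)" using T by (simp add: nuclear_def)
  have "summable (\<lambda>j. (norm A)\<^sup>2 * (norm (v j))\<^sup>2)"
    using T by (intro summable_mult) (simp add: nuclear_def)
  then show "summable (\<lambda>j. (norm (A (v j)))\<^sup>2)"
  proof (rule summable_comparison_test')
    fix j
    have "(norm (A (v j)))\<^sup>2 \<le> (norm A * norm (v j))\<^sup>2" by (intro power_mono norm_blinfun) auto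
    then show "norm ((norm (A (v j)))\<^sup>2) \<le> (norm A)\<^sup>2 * (norm (v j))\<^sup>2"
      by (simp add: power_mult_distrib)
  qed
  fix x
  have "(\<lambda>j. A (cinner x (u j) *\<^sub>C v j)) sums A (T x)"
    using T by (intro bounded_linear.sums[OF blinfun.bounded_linear_right]) (simp add: nuclear_def)
  then show "(\<lambda>j. cinner x (u j) *\<^sub>C A (v j)) sums (A o\<^sub>L T) x"
    by (simp add: clinD[OF A])
qed

lemma mult_le_sum_squares:
  fixes a b :: real
  assumes "0 \<le> a" "0 \<le> b"
  shows "a * b \<le> a\<^sup>2 + b\<^sup>2"
proof -
  have "2 * (a * b) \<le> a\<^sup>2 + b\<^sup>2" using sum_squares_bound[of a b] by (simp add: mult.assoc)
  then show ?thesis using mult_nonneg_nonneg[OF assms] by linarith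
qed

lemma summable_norm_mult:
  fixes u v :: "nat \<Rightarrow> 'a :: real_normed_vector"
  assumes "summable (\<lambda>j. (norm (u j))\<^sup>2)" "summable (\<lambda>j. (norm (v j))\<^sup>2)"
  shows "summable (\<lambda>j. norm (u j) * norm (v j))"
proof (rule summable_comparison_test'[OF summable_add[OF assms]])
  fix j
  show "norm (norm (u j) * norm (v j)) \<le> (norm (u j))\<^sup>2 + (norm (v j))\<^sup>2"
    using mult_le_sum_squares[of "norm (u j)" "norm (v j)"] by simp
qed

text \<open>Fubini for the double family \<open>g\<close>: summing over \<open>e\<close> first gives
  \<open><v_j, u_j>\<close> by Parseval, summing over \<open>j\<close> first gives
  \<open><T e, e>\<close>.\<close>

lemma nuclear_trace:
  assumes E: "onb E" and T: "nuclear T u v"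
  shows "((\<lambda>e. cinner (T e) e) has_sum (\<Sum>j. cinner (v j) (u j))) E"
proof -
  define g where "g = (\<lambda>(j, e). cinner e (u j) * cinner (v j) e)"
  have gj: "((\<lambda>e. g (j, e)) has_sum cinner (v j) (u j)) E" for j
    using parseval[OF E, of "v j" "u j"] by (simp add: g_def mult.commute)
  \<comment> \<open>A majorant whose sum over \<open>E\<close> is known from Parseval and is
    summable in \<open>j\<close>.\<close>
  define h where "h j e = (cmod (cinner (u j) e))\<^sup>2 + (cmod (cinner (v j) e))\<^sup>2" for j e
  have hs: "(h j has_sum ((norm (u j))\<^sup>2 + (norm (v j))\<^sup>2)) E" for j
    unfolding h_def by (intro has_sum_add parseval_norm[OF E])
  have gh: "norm (g (j, e)) \<le> h j e" for j e
  proof -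
    have "cmod (cinner e (u j)) = cmod (cinner (u j) e)" by (subst cinner_commute) simp
    then show ?thesis
      using mult_le_sum_squares[of "cmod (cinner (u j) e)" "cmod (cinner (v j) e)"]
      unfolding g_def h_def by (simp add: norm_mult)
  qed
  have gsum: "(\<lambda>e. norm (g (j, e))) summable_on E" for j
    by (rule summable_on_comparison_test[OF has_sum_imp_summable[OF hs[of j]]]) (simp_all add: gh)
  have "(\<lambda>x. norm (g x)) summable_on (UNIV \<times> E)"
  proof (rule Infinite_Sum.abs_summable_on_Sigma_iff[THEN iffD2], intro conjI ballI)
    show "(\<lambda>e. norm (g (j, e))) summable_on E" for j by (rule gsum)
    have "summable (\<lambda>j. (norm (u j))\<^sup>2 + (norm (v j))\<^sup>2)" using T by (intro summable_add) (auto simp: nuclear_def)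
    then have "(\<lambda>j. (norm (u j))\<^sup>2 + (norm (v j))\<^sup>2) summable_on UNIV"
      by (rule summable_nonneg_imp_summable_on) simp
    then show "(\<lambda>j. norm (infsum (\<lambda>e. norm (g (j, e))) E)) summable_on UNIV"
    proof (rule summable_on_comparison_test)
      fix j
      have "infsum (\<lambda>e. norm (g (j, e))) E \<le> (norm (u j))\<^sup>2 + (norm (v j))\<^sup>2"
        by (rule has_sum_mono[OF has_sum_infsum[OF gsum] hs]) (rule gh)
      then show "norm (infsum (\<lambda>e. norm (g (j, e))) E) \<le> (norm (u j))\<^sup>2 + (norm (v j))\<^sup>2"
        by (simp add: infsum_nonneg)
    qed simp
  qed
  then have "g summable_on (UNIV \<times> E)" by (rule Infinite_Sum.abs_summable_summable)
  then obtain s where s: "(g has_sum s) (UNIV \<times> E)" by (auto simp: summable_on_def)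
  have "((\<lambda>j. cinner (v j) (u j)) has_sum s) UNIV"
    by (rule has_sum_SigmaD[OF s]) (use gj in auto)
  then have s_eq: "s = (\<Sum>j. cinner (v j) (u j))" by (rule sums_unique[OF has_sum_imp_sums])
  have s': "((\<lambda>(e, j). g (j, e)) has_sum s) (E \<times> UNIV)"
    using s has_sum_swap[of g UNIV E s] by simp
  have ge: "((\<lambda>j. g (j, e)) has_sum cinner (T e) e) UNIV" if "e \<in> E" for e
  proof (rule norm_summable_imp_has_sum)
    have "(\<lambda>j. cinner (cinner e (u j) *\<^sub>C v j) e) sums cinner (T e) e"
      using T by (intro bounded_linear.sums[OF cinner.bounded_linear_left]) (simp add: nuclear_def)
    then show "(\<lambda>j. g (j, e)) sums cinner (T e) e" by (simp add: g_def cinner_scaleC_left)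
    have "summable (\<lambda>j. (norm e)\<^sup>2 * (norm (u j) * norm (v j)))"
      using T by (intro summable_mult summable_norm_mult) (auto simp: nuclear_def)
    then show "summable (\<lambda>j. norm (g (j, e)))"
    proof (rule summable_comparison_test')
      fix j
      have "norm (g (j, e)) \<le> (norm e * norm (u j)) * (norm (v j) * norm e)"
        unfolding g_def by (simp add: norm_mult) (intro mult_mono cinner_cauchy_schwarz; simp)
      then show "norm (norm (g (j, e))) \<le> (norm e)\<^sup>2 * (norm (u j) * norm (v j))"
        by (simp add: power2_eq_square mult_ac)
    qed
  qed
  have "((\<lambda>e. cinner (T e) e) has_sum s) E"
    by (rule has_sum_SigmaD[OF s']) (use ge in auto)
  then show ?thesis by (simp only: s_eq)
qed

definition rk :: "ell2 \<Rightarrow> ell2 \<Rightarrow> ell2_op" where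
  "rk g h = Blinfun (\<lambda>x. cinner x h *\<^sub>C g)"

lemma rk_apply [simp]: "(rk g h) x = cinner x h *\<^sub>C g"
  unfolding rk_def
proof (rule bounded_linear_Blinfun_apply[THEN fun_cong], rule bounded_linear_intro)
  show "norm (cinner x h *\<^sub>C g) \<le> norm x * (norm h * norm g)" for x
    using mult_right_mono[OF cinner_cauchy_schwarz[of x h] norm_ge_zero[of g]] by (simp add: mult_ac)
qed (simp_all add: cinner_add_left scaleC_simps scaleR_scaleC cinner_scaleC_left)

lemma clin_rk: "clin (rk g h)"
  by (simp add: clin_def cinner_scaleC_left scaleC_simps)

text \<open>Cauchy-Schwarz in \<open>j\<close>, then the Bessel property of each family.\<close>

lemma tcbound_rk: "tcbound (rk g h) (norm g * norm h)"
  unfolding tcbound_def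
proof (intro allI impI)
  fix n e f assume b: "bessel n e" "bessel n f"
  have sw: "cmod (cinner x y) = cmod (cinner y x)" for x y by (subst cinner_commute) simp
  have "(\<Sum>j<n. cmod (cinner (rk g h (e j)) (f j))) = (\<Sum>j<n. \<bar>cmod (cinner h (e j))\<bar> * \<bar>cmod (cinner g (f j))\<bar>)"
    by (simp add: cinner_scaleC_left norm_mult sw[of h])
  also have "\<dots> \<le> L2_set (\<lambda>j. cmod (cinner h (e j))) {..<n} * L2_set (\<lambda>j. cmod (cinner g (f j))) {..<n}"
    by (rule L2_set_mult_ineq)
  also have "\<dots> \<le> norm h * norm g"
    using b by (intro mult_mono) (auto simp: L2_set_def bessel_def intro!: real_le_lsqrt sum_nonneg)
  finally show "(\<Sum>j<n. cmod (cinner (rk g h (e j)) (f j))) \<le> norm g * norm h" by (simp add: mult.commute)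
qed

lemma tc_rk: "tc (rk g h)"
  by (rule tcI[OF clin_rk tcbound_rk])

text \<open>Quantitative continuity of \<open>rk g g\<close> in trace norm; it makes the rank-one
  operators of the kernels a continuous family.\<close>

lemma tn_rk_diff: "tn (rk g g - rk h h) \<le> norm (g - h) * (norm g + norm h)"
proof -
  have "rk g g - rk h h = rk (g - h) g + rk h (g - h)"
    by (rule blinfun_eqI, rule ell2_eqI) (simp add: blinfun.bilinear_simps cinner_diff_right algebra_simps)
  also have "tn \<dots> \<le> norm (g - h) * norm g + norm h * norm (g - h)"
    by (intro tn_le tcbound_add tcbound_rk)
  finally show ?thesis by (simp add: algebra_simps)
qed

section \<open>Integration over the complex plane\<close>

lemma measurable_Complex [measurable]: "(\<lambda>p. Complex (fst p) (snd p)) \<in> borel_measurable (lborel \<Otimes>\<^sub>M lborel)"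
  unfolding Complex_eq by measurable

text \<open>Lebesgue measure is determined by its values on boxes. In this form integrals over the
  plane become iterated real integrals.\<close>

lemma lborel_complex_eq: "lborel = distr (lborel \<Otimes>\<^sub>M lborel) borel (\<lambda>p. Complex (fst p) (snd p))"
proof (rule lborel_eqI)
  fix l u :: complex
  assume A: "\<And>b. b \<in> Basis \<Longrightarrow> l \<bullet> b \<le> u \<bullet> b"
  have le: "Re l \<le> Re u" "Im l \<le> Im u"
    using A[of 1] A[of \<i>] by (auto simp: Basis_complex_def)
  have "(\<lambda>p. Complex (fst p) (snd p)) -` box l u \<inter> space (lborel \<Otimes>\<^sub>M lborel) = {Re l<..<Re u} \<times> {Im l<..<Im u}"
    by (auto simp: box_def Basis_complex_def space_pair_measure)
  then have "emeasure (distr (lborel \<Otimes>\<^sub>M lborel) borel (\<lambda>p. Complex (fst p) (snd p))) (box l u)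
      = emeasure (lborel \<Otimes>\<^sub>M lborel) ({Re l<..<Re u} \<times> {Im l<..<Im u})"
    by (subst emeasure_distr) auto
  also have "\<dots> = ennreal (Re u - Re l) * ennreal (Im u - Im l)"
    using le by (simp add: lborel.emeasure_pair_measure_Times)
  also have "\<dots> = ennreal (\<Prod>b\<in>Basis. (u - l) \<bullet> b)"
    using le by (simp add: Basis_complex_def ennreal_mult[symmetric])
  finally show "emeasure (distr (lborel \<Otimes>\<^sub>M lborel) borel (\<lambda>p. Complex (fst p) (snd p))) (box l u)
      = ennreal (\<Prod>b\<in>Basis. (u - l) \<bullet> b)" .
qed simp

lemma integrable_complex_iff:
  fixes f :: "complex \<Rightarrow> 'a :: {banach, second_countable_topology}"
  assumes [measurable]: "f \<in> borel_measurable borel"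
  shows "integrable lborel f \<longleftrightarrow> integrable (lborel \<Otimes>\<^sub>M lborel) (\<lambda>(x, y). f (Complex x y))"
proof -
  have "integrable lborel f \<longleftrightarrow> integrable (distr (lborel \<Otimes>\<^sub>M lborel) borel (\<lambda>p. Complex (fst p) (snd p))) f"
    by (subst lborel_complex_eq) simp
  also have "\<dots> \<longleftrightarrow> integrable (lborel \<Otimes>\<^sub>M lborel) (\<lambda>p. f (Complex (fst p) (snd p)))"
    by (rule integrable_distr_eq) auto
  finally show ?thesis by (simp add: case_prod_unfold)
qed

lemma integral_complex_eq:
  fixes f :: "complex \<Rightarrow> 'a :: {banach, second_countable_topology}"
  assumes [measurable]: "f \<in> borel_measurable borel"
  shows "integral\<^sup>L lborel f = integral\<^sup>L (lborel \<Otimes>\<^sub>M lborel) (\<lambda>(x, y). f (Complex x y))"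
proof -
  have "integral\<^sup>L lborel f = integral\<^sup>L (distr (lborel \<Otimes>\<^sub>M lborel) borel (\<lambda>p. Complex (fst p) (snd p))) f"
    by (subst lborel_complex_eq) simp
  also have "\<dots> = integral\<^sup>L (lborel \<Otimes>\<^sub>M lborel) (\<lambda>p. f (Complex (fst p) (snd p)))"
    by (rule integral_distr) auto
  finally show ?thesis by (simp add: case_prod_unfold)
qed

lemma integrable_shift:
  fixes f :: "'b :: euclidean_space \<Rightarrow> 'a :: {banach, second_countable_topology}"
  assumes f: "integrable lborel f"
  shows "integrable lborel (\<lambda>z. f (z + a))"
proof -
  have "integrable (distr lborel borel ((+) a)) f" using f by (simp add: lborel_distr_plus)
  from integrable_distr[OF _ this] show ?thesis by (simp add: add.commute)
qed

lemma integral_shift: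
  fixes f :: "'b :: euclidean_space \<Rightarrow> 'a :: {banach, second_countable_topology}"
  assumes [measurable]: "f \<in> borel_measurable borel"
  shows "(LINT z|lborel. f (z + a)) = integral\<^sup>L lborel f"
proof -
  have "integral\<^sup>L lborel f = integral\<^sup>L (distr lborel borel ((+) a)) f" by (simp add: lborel_distr_plus)
  also have "\<dots> = (LINT z|lborel. f (a + z))" by (rule integral_distr) auto
  finally show ?thesis by (simp add: add.commute)
qed

text \<open>
  Integrating \<open>F (z + v) - F z = \<integral>\<^sub>0\<^sup>1 F' (z + s v) v ds\<close> over the plane and using translation invariance.
\<close>

lemma integral_derivative_eq_0:
  fixes F :: "complex \<Rightarrow> complex"
  assumes F: "integrable lborel F" and g: "integrable lborel g"
    and d: "\<And>z. ((\<lambda>t. F (z + of_real t * v)) has_vector_derivative g z) (at 0)"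
  shows "integral\<^sup>L lborel g = 0"
proof -
  have [measurable]: "g \<in> borel_measurable borel" "F \<in> borel_measurable borel" using F g by auto
  have d': "((\<lambda>t. F (z + of_real t * v)) has_vector_derivative g (z + of_real s * v)) (at s within S)" for z s S
  proof -
    have "((\<lambda>t. F ((z + of_real s * v) + of_real t * v)) has_vector_derivative g (z + of_real s * v)) (at (s - s))"
      using d[of "z + of_real s * v"] by simp
    then have "(((\<lambda>t. F ((z + of_real s * v) + of_real t * v)) \<circ> (\<lambda>t. t - s)) has_vector_derivative
        1 *\<^sub>R g (z + of_real s * v)) (at s)"
      by (intro vector_diff_chain_at derivative_eq_intros) (auto intro!: derivative_eq_intros)
    then have "((\<lambda>t. F (z + of_real t * v)) has_vector_derivative g (z + of_real s * v)) (at s)"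
      by (simp add: o_def algebra_simps)
    then show ?thesis by (rule has_vector_derivative_at_within)
  qed
  define f where "f = (\<lambda>(s::real) z. indicator {0..1} s *\<^sub>R g (z + of_real s * v))"
  have [measurable]: "(\<lambda>(s, z). f s z) \<in> borel_measurable (lborel \<Otimes>\<^sub>M lborel)"
    unfolding f_def by measurable
  have gs: "integrable lborel (\<lambda>z. g (z + of_real s * v))" for s :: real by (rule integrable_shift[OF g])
  have int: "integrable (lborel \<Otimes>\<^sub>M lborel) (\<lambda>(s, z). f s z)"
  proof (rule lborel_pair.Fubini_integrable)
    have "(LINT z|lborel. norm (f s z)) = indicator {0..1} s * (LINT z|lborel. norm (g z))" for s
      unfolding f_def using integral_shift[of "\<lambda>z. norm (g z)" "of_real s * v"] by simp
    moreover have "integrable lborel (\<lambda>s::real. indicator {0..1} s * (LINT z|lborel. norm (g z)))"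
      by (intro integrable_mult_left integrable_real_indicator) auto
    ultimately show "integrable lborel (\<lambda>s. LINT z|lborel. norm (case (s, z) of (s, z) \<Rightarrow> f s z))" by simp
    show "AE s in lborel. integrable lborel (\<lambda>z. case (s, z) of (s, z) \<Rightarrow> f s z)"
      unfolding f_def using gs by auto
  qed simp
  have 1: "(LINT s|lborel. LINT z|lborel. f s z) = integral\<^sup>L lborel g"
  proof -
    have "(LINT z|lborel. f s z) = indicator {0..1} s *\<^sub>R integral\<^sup>L lborel g" for s
      unfolding f_def using integral_shift[of g "of_real s * v"] by simp
    then show ?thesis by simp
  qed
  have 2: "(LINT z|lborel. LINT s|lborel. f s z) = (LINT z|lborel. F (z + v) - F z)"
  proof (rule integral_cong_AE)
    show "(\<lambda>z. LINT s|lborel. f s z) \<in> borel_measurable lborel" by measurable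
    show "(\<lambda>z. F (z + v) - F z) \<in> borel_measurable lborel" by measurable
    have "AE z in lborel. integrable lborel (\<lambda>s. f s z)"
      by (rule lborel_pair.AE_integrable_snd) (use int in simp)
    then show "AE z in lborel. (LINT s|lborel. f s z) = F (z + v) - F z"
    proof eventually_elim
      case (elim z)
      have "((\<lambda>s. g (z + of_real s * v)) has_integral F (z + of_real 1 * v) - F (z + of_real 0 * v)) {0..1}"
        by (rule fundamental_theorem_of_calculus) (auto intro: d')
      then have "integral {0..1} (\<lambda>s. g (z + of_real s * v)) = F (z + v) - F z"
        by (simp add: integral_unique)
      moreover have "set_integrable lborel {0..1} (\<lambda>s. g (z + of_real s * v))"
        using elim by (simp add: f_def set_integrable_def)
      ultimately show ?case
        using set_borel_integral_eq_integral(2)[of "{0..1}" "\<lambda>s. g (z + of_real s * v)"]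
        by (simp add: f_def set_lebesgue_integral_def)
    qed
  qed
  have "(LINT s|lborel. LINT z|lborel. f s z) = (LINT z|lborel. LINT s|lborel. f s z)"
    using lborel_pair.integral_fst[OF int] lborel_pair.integral_snd[OF int] by simp
  moreover have "(LINT z|lborel. F (z + v) - F z) = 0"
    using integral_shift[of F v] integrable_shift[OF F] F by simp
  ultimately show ?thesis using 1 2 by simp
qed

section \<open>Gaussian integrals\<close>

lemma integrable_gauss_real: "integrable lborel (\<lambda>x::real. exp (- x\<^sup>2))"
  and integral_gauss_real: "(LINT x|lborel. exp (- x\<^sup>2)) = sqrt pi"
proof -
  \<comment> \<open>The standard deviation \<open>1 / sqrt 2\<close> turns the normal density into
    \<open>exp (- x^2)\<close> up to the factor \<open>sqrt pi\<close>.\<close>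
  have n: "normal_density 0 (1 / sqrt 2) x * sqrt pi = exp (- x\<^sup>2)" for x
    by (simp add: normal_density_def power_divide real_sqrt_divide)
  have "integrable lborel (\<lambda>x. normal_density 0 (1 / sqrt 2) x * sqrt pi)" by simp
  then show "integrable lborel (\<lambda>x::real. exp (- x\<^sup>2))" unfolding n .
  have "(LINT x|lborel. normal_density 0 (1 / sqrt 2) x * sqrt pi) = sqrt pi" by simp
  then show "(LINT x|lborel. exp (- x\<^sup>2)) = sqrt pi" unfolding n .
qed

lemma integrable_gauss_complex: "integrable lborel (\<lambda>z. exp (- (cmod z)\<^sup>2))"
  and integral_gauss_complex: "(LINT z|lborel. exp (- (cmod z)\<^sup>2)) = pi"
proof -
  have e: "exp (- (cmod (Complex x y))\<^sup>2) = exp (- x\<^sup>2) * exp (- y\<^sup>2)" for x y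
    by (simp add: cmod_power2 exp_add[symmetric])
  have i: "integrable (lborel \<Otimes>\<^sub>M lborel) (\<lambda>(x::real, y::real). exp (- x\<^sup>2) * exp (- y\<^sup>2))"
    by (rule lborel_pair.Fubini_integrable)
       (use integrable_gauss_real in \<open>simp_all add: abs_mult integral_gauss_real\<close>)
  then show "integrable lborel (\<lambda>z. exp (- (cmod z)\<^sup>2))"
    by (subst integrable_complex_iff) (simp_all add: e)
  have "(LINT z|lborel. exp (- (cmod z)\<^sup>2)) = integral\<^sup>L (lborel \<Otimes>\<^sub>M lborel) (\<lambda>(x::real, y::real). exp (- x\<^sup>2) * exp (- y\<^sup>2))"
    by (subst integral_complex_eq) (simp_all add: e)
  also have "\<dots> = (LINT x|lborel. LINT y|lborel. exp (- x\<^sup>2) * exp (- y\<^sup>2))"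
    using lborel_pair.integral_fst[OF i] by simp
  also have "\<dots> = pi" by (simp add: integral_gauss_real)
  finally show "(LINT z|lborel. exp (- (cmod z)\<^sup>2)) = pi" .
qed

lemma integrable_power_gauss: "integrable lborel (\<lambda>z::complex. (1 + cmod z) ^ N * exp (- (cmod z)\<^sup>2))"
proof -
  have g2: "integrable lborel (\<lambda>z::complex. exp (- (cmod z)\<^sup>2 / 2))"
  proof -
    have e: "(\<lambda>z::complex. exp (- (cmod z)\<^sup>2 / 2)) = (\<lambda>z. exp (- (cmod (0 + (1 / sqrt 2) *\<^sub>R z))\<^sup>2))"
      by (simp add: power_mult_distrib power_divide)
    have "integrable (density (distr lborel borel (\<lambda>z. 0 + (1 / sqrt 2) *\<^sub>R z)) (\<lambda>_. \<bar>1 / sqrt 2\<bar> ^ DIM(complex)))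
        (\<lambda>z. exp (- (cmod z)\<^sup>2))"
      using integrable_gauss_complex by (subst (asm) lborel_affine[of "1 / sqrt 2" 0]) auto
    then have "integrable lborel (\<lambda>z. (1/2) * exp (- (cmod (0 + (1 / sqrt 2) *\<^sub>R z))\<^sup>2))"
      by (subst (asm) integrable_density, simp, simp, simp) (subst (asm) integrable_distr_eq; simp add: power_divide)
    then have "integrable lborel (\<lambda>z. 2 * ((1/2) * exp (- (cmod (0 + (1 / sqrt 2) *\<^sub>R z))\<^sup>2)))"
      by (rule integrable_mult_right)
    then show ?thesis unfolding e by simp
  qed
  \<comment> \<open>\<open>(1 + t)^N / N!\<close> is a term of the series of
    \<open>exp (1 + t)\<close>, and \<open>1 + t - t^2\<close> is at most
    \<open>2 - t^2 / 2\<close>; hence the factor \<open>fact N\<close> and the two factors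
    \<open>exp 1\<close>.\<close>
  have bound: "(1 + t) ^ N * exp (- t\<^sup>2) \<le> (fact N * exp 1 * exp 1) * exp (- t\<^sup>2 / 2)" if "0 \<le> t" for t :: real
  proof -
    have "(1 + t) ^ N / fact N \<le> exp (1 + t)"
      using sum_le_suminf[OF summable_exp_generic[of "1 + t"], of "{N}"] that
      by (simp add: exp_def divide_inverse mult.commute)
    then have "(1 + t) ^ N \<le> fact N * exp (1 + t)" by (simp add: field_simps)
    moreover have "exp (1 + t) * exp (- t\<^sup>2) \<le> exp 1 * exp 1 * exp (- t\<^sup>2 / 2)"
    proof -
      have "1 + t + - t\<^sup>2 \<le> 1 + 1 + - t\<^sup>2 / 2"
        using zero_le_power2[of "t - 1"] by (simp add: power2_eq_square algebra_simps)
      then show ?thesis by (simp add: exp_add[symmetric])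
    qed
    ultimately have "(1 + t) ^ N * exp (- t\<^sup>2) \<le> fact N * (exp 1 * exp 1 * exp (- t\<^sup>2 / 2))"
      by (smt (verit, best) exp_gt_zero fact_ge_zero mult.assoc mult_left_mono mult_right_mono)
    then show ?thesis by (simp add: mult.assoc)
  qed
  show ?thesis
  proof (rule Bochner_Integration.integrable_bound[OF integrable_mult_right[OF g2, of "fact N * exp 1 * exp 1"]])
    show "AE z in lborel. norm ((1 + cmod z) ^ N * exp (- (cmod z)\<^sup>2)) \<le> norm (fact N * exp 1 * exp 1 * exp (- (cmod z)\<^sup>2 / 2))"
      using bound[OF norm_ge_zero] by (intro AE_I2) (simp add: abs_mult)
  qed measurable
qed

section \<open>Uniqueness of the Fourier transform\<close>

lemma integrable_mult_iexp:
  fixes f :: "real \<Rightarrow> complex"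
  assumes "integrable lborel f"
  shows "integrable lborel (\<lambda>x. f x * iexp (t * x))"
proof (rule Bochner_Integration.integrable_bound[OF assms])
  show "(\<lambda>x. f x * iexp (t * x)) \<in> borel_measurable lborel" using assms by measurable
qed (simp add: norm_mult del: of_real_mult)

text \<open>The positive and negative parts of \<open>g\<close> have equal transforms and (at
  \<open>t = 0\<close>) equal mass. Normalized to probability measures they have the same
  characteristic function, so Levy's uniqueness theorem identifies them.\<close>

lemma fourier_unique_real:
  fixes g :: "real \<Rightarrow> real"
  assumes g: "integrable lborel g" and z: "\<And>t. (LINT x|lborel. of_real (g x) * iexp (t * x)) = 0"
  shows "AE x in lborel. g x = 0"
proof -
  have [measurable]: "g \<in> borel_measurable borel" using g by auto
  define p where "p x = max (g x) 0" for x
  define q where "q x = max (- g x) 0" for x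
  have pq: "g x = p x - q x" "0 \<le> p x" "0 \<le> q x" for x by (auto simp: p_def q_def)
  have p: "integrable lborel p" unfolding p_def using g by (intro integrable_max) auto
  have q: "integrable lborel q" unfolding q_def using g by (intro integrable_max) auto
  have [measurable]: "p \<in> borel_measurable borel" "q \<in> borel_measurable borel" using p q by auto
  have ft: "(LINT x|lborel. of_real (p x) * iexp (t * x)) = (LINT x|lborel. of_real (q x) * iexp (t * x))" for t
  proof -
    have "(LINT x|lborel. of_real (g x) * iexp (t * x)) =
        (LINT x|lborel. of_real (p x) * iexp (t * x) - of_real (q x) * iexp (t * x))"
      by (simp add: pq(1) left_diff_distrib)
    also have "\<dots> = (LINT x|lborel. of_real (p x) * iexp (t * x)) - (LINT x|lborel. of_real (q x) * iexp (t * x))"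
      using p q by (intro Bochner_Integration.integral_diff integrable_mult_iexp integrable_of_real)
    finally show ?thesis using z[of t] by simp
  qed
  have mass: "integral\<^sup>L lborel p = integral\<^sup>L lborel q"
    using ft[of 0] by (simp add: integral_complex_of_real)
  define c where "c = integral\<^sup>L lborel p"
  have c0: "0 \<le> c" unfolding c_def using pq(2) by (intro integral_nonneg_AE) auto
  show ?thesis
  proof (cases "c = 0")
    case True
    have "AE x in lborel. p x = 0"
      using True integral_nonneg_eq_0_iff_AE[OF p] pq by (simp add: c_def)
    moreover have "AE x in lborel. q x = 0"
      using True integral_nonneg_eq_0_iff_AE[OF q] pq by (simp add: c_def mass)
    ultimately show ?thesis by eventually_elim (simp add: pq(1))
  next
    case False
    then have c: "c > 0" using c0 by simp
    have rd: "real_distribution (density lborel (\<lambda>x. ennreal (h x / c)))"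
      if h: "integrable lborel h" "\<And>x. 0 \<le> h x" "integral\<^sup>L lborel h = c" for h
    proof -
      have "prob_space (density lborel (\<lambda>x. ennreal (h x / c)))"
      proof
        have [measurable]: "h \<in> borel_measurable borel" using h by auto
        have "emeasure (density lborel (\<lambda>x. ennreal (h x / c))) (space (density lborel (\<lambda>x. ennreal (h x / c))))
            = (\<integral>\<^sup>+x. ennreal (h x / c) \<partial>lborel)"
          by (simp add: emeasure_density)
        also have "\<dots> = ennreal (LINT x|lborel. h x / c)"
          using h c by (intro nn_integral_eq_integral) auto
        also have "\<dots> = 1" using h c by simp
        finally show "emeasure (density lborel (\<lambda>x. ennreal (h x / c))) (space (density lborel (\<lambda>x. ennreal (h x / c)))) = 1" .
      qed
      then show ?thesis by (simp add: real_distribution_def real_distribution_axioms_def)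
    qed
    have ch: "char (density lborel (\<lambda>x. ennreal (h x / c))) t = (LINT x|lborel. of_real (h x) * iexp (t * x)) / c"
      if h: "integrable lborel h" "\<And>x. 0 \<le> h x" for h t
    proof -
      have [measurable]: "h \<in> borel_measurable borel" using h by auto
      have "char (density lborel (\<lambda>x. ennreal (h x / c))) t = (LINT x|lborel. (h x / c) *\<^sub>R iexp (t * x))"
        unfolding char_def using c h(2) by (intro integral_density) auto
      also have "\<dots> = (LINT x|lborel. of_real (h x) * iexp (t * x) / of_real c)"
        by (simp add: scaleR_conv_of_real)
      finally show ?thesis by simp
    qed
    have "density lborel (\<lambda>x. ennreal (p x / c)) = density lborel (\<lambda>x. ennreal (q x / c))"
    proof (rule Levy_uniqueness)
      show "char (density lborel (\<lambda>x. ennreal (p x / c))) = char (density lborel (\<lambda>x. ennreal (q x / c)))"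
        by (rule ext) (simp only: ch[OF p pq(2)] ch[OF q pq(3)] ft)
    qed (use rd p q pq mass c_def in auto)
    then have "AE x in lborel. ennreal (p x / c) = ennreal (q x / c)"
      by (intro sigma_finite_measure.density_unique[OF sigma_finite_lborel]) auto
    then show ?thesis
      by eventually_elim (use pq c in \<open>simp add: ennreal_inj\<close>)
  qed
qed

text \<open>The conjugate of \<open>f\<close> also has vanishing transform, hence so have the real
  and imaginary parts.\<close>

lemma fourier_unique_complex:
  fixes f :: "real \<Rightarrow> complex"
  assumes f: "integrable lborel f" and z: "\<And>t. (LINT x|lborel. f x * iexp (t * x)) = 0"
  shows "AE x in lborel. f x = 0"
proof -
  have z': "(LINT x|lborel. cnj (f x) * iexp (t * x)) = 0" for t
  proof -
    have "(LINT x|lborel. cnj (f x) * iexp (t * x)) = (LINT x|lborel. cnj (f x * iexp (- t * x)))"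
      by (simp add: exp_cnj)
    also have "\<dots> = cnj (LINT x|lborel. f x * iexp (- t * x))" by (rule Bochner_Integration.integral_cnj)
    finally show ?thesis using z[of "- t"] by simp
  qed
  have fc: "integrable lborel (\<lambda>x. cnj (f x))" using f by (rule integrable_cnj)
  have "AE x in lborel. Re (f x) = 0"
  proof (rule fourier_unique_real)
    show "integrable lborel (\<lambda>x. Re (f x))" using f by (rule integrable_Re)
    fix t
    have "(LINT x|lborel. of_real (Re (f x)) * iexp (t * x)) = (LINT x|lborel. (f x * iexp (t * x) + cnj (f x) * iexp (t * x)) / 2)"
      by (intro Bochner_Integration.integral_cong refl) (simp add: complex_add_cnj flip: distrib_right)
    also have "\<dots> = 0"
      using Bochner_Integration.integral_add[OF integrable_mult_iexp[OF f, of t] integrable_mult_iexp[OF fc, of t]]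
        z[of t] z'[of t] by simp
    finally show "(LINT x|lborel. of_real (Re (f x)) * iexp (t * x)) = 0" .
  qed
  moreover have "AE x in lborel. Im (f x) = 0"
  proof (rule fourier_unique_real)
    show "integrable lborel (\<lambda>x. Im (f x))" using f by (rule integrable_Im)
    fix t
    have "(LINT x|lborel. of_real (Im (f x)) * iexp (t * x)) = (LINT x|lborel. (f x * iexp (t * x) - cnj (f x) * iexp (t * x)) / (2 * \<i>))"
    proof (intro Bochner_Integration.integral_cong refl)
      fix x
      have "of_real (Im (f x)) = (f x - cnj (f x)) / (2 * \<i>)"
        by (subst nonzero_eq_divide_eq) (simp_all add: complex_diff_cnj)
      then show "of_real (Im (f x)) * iexp (t * x) = (f x * iexp (t * x) - cnj (f x) * iexp (t * x)) / (2 * \<i>)"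
        by (simp only: left_diff_distrib times_divide_eq_left)
    qed
    also have "\<dots> = 0"
      using Bochner_Integration.integral_diff[OF integrable_mult_iexp[OF f, of t] integrable_mult_iexp[OF fc, of t]]
        z[of t] z'[of t] by simp
    finally show "(LINT x|lborel. of_real (Im (f x)) * iexp (t * x)) = 0" .
  qed
  ultimately show ?thesis by eventually_elim (simp add: complex_eq_iff)
qed

lemma fourier_continuous:
  fixes f :: "real \<Rightarrow> complex"
  assumes f: "integrable lborel f" and t: "t \<longlonglongrightarrow> s"
  shows "(\<lambda>n. LINT x|lborel. f x * iexp (t n * x)) \<longlonglongrightarrow> (LINT x|lborel. f x * iexp (s * x))"
proof (rule integral_dominated_convergence[where w = "\<lambda>x. norm (f x)"])
  show "(\<lambda>x. f x * iexp (s * x)) \<in> borel_measurable lborel" using f by measurable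
  show "(\<lambda>x. f x * iexp (t n * x)) \<in> borel_measurable lborel" for n using f by measurable
  show "AE x in lborel. (\<lambda>n. f x * iexp (t n * x)) \<longlonglongrightarrow> f x * iexp (s * x)"
    by (intro AE_I2 tendsto_intros t)
qed (use f in \<open>auto simp: norm_mult simp del: of_real_mult\<close>)

text \<open>The exponent is purely imaginary, so these are the unitary characters of the plane
  (\<open>chi_iexp\<close>), parametrized to fit the Wirtinger derivatives.\<close>

definition chi :: "complex \<Rightarrow> complex \<Rightarrow> complex" where
  "chi \<xi> z = exp (z * cnj \<xi> - cnj z * \<xi>)"

lemma chi_iexp: "chi \<xi> z = iexp (2 * (Im z * Re \<xi> - Re z * Im \<xi>))"
  unfolding chi_def by (rule arg_cong[where f = exp]) (simp add: complex_eq_iff algebra_simps)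

lemma norm_chi [simp]: "norm (chi \<xi> z) = 1"
  unfolding chi_iexp by (simp del: of_real_mult)

lemma continuous_on_chi: "continuous_on UNIV (chi \<xi>)"
  unfolding chi_def by (intro continuous_intros)

lemma chi_measurable [measurable]: "chi \<xi> \<in> borel_measurable borel"
  by (rule borel_measurable_continuous_onI[OF continuous_on_chi])

lemma integrable_mult_chi:
  assumes "integrable lborel f"
  shows "integrable lborel (\<lambda>z. f z * chi \<xi> z)"
proof (rule Bochner_Integration.integrable_bound[OF assms])
  show "(\<lambda>z. f z * chi \<xi> z) \<in> borel_measurable lborel" using assms by measurable
qed (simp add: norm_mult)

text \<open>One variable at a time: for fixed \<open>b\<close> the partial transform in
  \<open>y\<close> has vanishing transform in \<open>x\<close>, so it is 0 for almost every
  \<open>x\<close>.\<close>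

lemma fourier_unique:
  assumes f: "integrable lborel f" and z: "\<And>\<xi>. (LINT z|lborel. f z * chi \<xi> z) = 0"
  shows "AE z in lborel. f z = 0"
proof -
  have [measurable]: "f \<in> borel_measurable borel" using f by auto
  define F where "F x y = f (Complex x y)" for x y
  have Fm [measurable]: "(\<lambda>(x, y). F x y) \<in> borel_measurable (lborel \<Otimes>\<^sub>M lborel)"
    using measurable_compose[OF measurable_Complex, of f borel] by (simp add: F_def case_prod_unfold)
  have F: "integrable (lborel \<Otimes>\<^sub>M lborel) (\<lambda>(x, y). F x y)"
    using f by (subst (asm) integrable_complex_iff) (auto simp: F_def)
  have Fx: "AE x in lborel. integrable lborel (\<lambda>y. F x y)"
    using lborel_pair.AE_integrable_fst[OF F] .
  have Fb: "integrable (lborel \<Otimes>\<^sub>M lborel) (\<lambda>(x, y). F x y * iexp (b * y))" for b :: real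
    by (rule Bochner_Integration.integrable_bound[OF F]) (auto simp: norm_mult simp del: of_real_mult)
  have G0: "AE x in lborel. (LINT y|lborel. F x y * iexp (b * y)) = 0" for b
  proof (rule fourier_unique_complex)
    show "integrable lborel (\<lambda>x. LINT y|lborel. F x y * iexp (b * y))"
      using lborel_pair.integrable_fst[OF Fb[of b]] .
    fix a
    have Fab: "integrable (lborel \<Otimes>\<^sub>M lborel) (\<lambda>(x, y). F x y * iexp (b * y) * iexp (a * x))"
      by (rule Bochner_Integration.integrable_bound[OF F]) (auto simp: norm_mult simp del: of_real_mult)
    \<comment> \<open>By \<open>chi_iexp\<close> the frequency in \<open>y\<close> is
      \<open>2 Re \<xi>\<close> and that in \<open>x\<close> is \<open>-2 Im \<xi>\<close>.\<close>
    define \<xi> where "\<xi> = Complex (b / 2) (- a / 2)"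
    have "(LINT x|lborel. (LINT y|lborel. F x y * iexp (b * y)) * iexp (a * x)) =
        (LINT x|lborel. LINT y|lborel. F x y * iexp (b * y) * iexp (a * x))"
      by simp
    also have "\<dots> = integral\<^sup>L (lborel \<Otimes>\<^sub>M lborel) (\<lambda>(x, y). F x y * iexp (b * y) * iexp (a * x))"
      using lborel_pair.integral_fst[OF Fab] .
    also have "\<dots> = integral\<^sup>L (lborel \<Otimes>\<^sub>M lborel) (\<lambda>(x, y). f (Complex x y) * chi \<xi> (Complex x y))"
    proof (rule Bochner_Integration.integral_cong[OF refl])
      fix p :: "real \<times> real"
      obtain x y where p: "p = (x, y)" by (cases p)
      have "iexp (b * y) * iexp (a * x) = chi \<xi> (Complex x y)"
        unfolding chi_iexp \<xi>_def by (simp add: exp_add[symmetric] algebra_simps)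
      then show "(case p of (x, y) \<Rightarrow> F x y * iexp (b * y) * iexp (a * x)) = (case p of (x, y) \<Rightarrow> f (Complex x y) * chi \<xi> (Complex x y))"
        by (simp add: p F_def mult.assoc)
    qed
    also have "\<dots> = (LINT z|lborel. f z * chi \<xi> z)"
      by (rule integral_complex_eq[symmetric]) measurable
    finally show "(LINT x|lborel. (LINT y|lborel. F x y * iexp (b * y)) * iexp (a * x)) = 0" using z by simp
  qed
  \<comment> \<open>The exceptional null set depends on \<open>b\<close>; countably many
    \<open>b\<close> share one, and continuity of the transform extends from rational to real
    frequencies.\<close>
  have "AE x in lborel. \<forall>b\<in>\<rat>. (LINT y|lborel. F x y * iexp (b * y)) = 0"
    using G0 by (subst AE_ball_countable[OF countable_rat]) auto
  then have "AE x in lborel. AE y in lborel. F x y = 0"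
    using Fx
  proof eventually_elim
    case (elim x)
    show ?case
    proof (rule fourier_unique_complex)
      fix t :: real
      obtain r where r: "\<And>n. r n \<in> \<rat>" "r \<longlonglongrightarrow> t"
        using closure_sequential[of t "\<rat> :: real set"] Rats_closure_real by auto
      show "(LINT y|lborel. F x y * iexp (t * y)) = 0"
        using LIMSEQ_unique[OF fourier_continuous[OF elim(2) r(2)], of 0] elim(1) r(1) by simp
    qed (use elim in simp)
  qed
  then have "AE x in lborel. AE y in lborel. f (Complex (fst (x, y)) (snd (x, y))) = 0"
    by (simp add: F_def)
  moreover have "{p \<in> space (lborel \<Otimes>\<^sub>M lborel). f (Complex (fst p) (snd p)) = 0} \<in> sets (lborel \<Otimes>\<^sub>M lborel)"
  proof -
    have [measurable]: "(\<lambda>p. f (Complex (fst p) (snd p))) \<in> borel_measurable (lborel \<Otimes>\<^sub>M lborel)"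
      by (rule measurable_compose[OF measurable_Complex]) simp
    show ?thesis by measurable
  qed
  ultimately have "AE p in lborel \<Otimes>\<^sub>M lborel. f (Complex (fst p) (snd p)) = 0"
    by (intro lborel_pair.AE_pair_measure)
  then show ?thesis
    by (subst lborel_complex_eq) (simp add: AE_distr_iff)
qed

section \<open>Polynomials in \<open>z\<close> and \<open>cnj z\<close> under the Gaussian measure\<close>

text \<open>An algebra of functions that contains the polynomials in \<open>z\<close> and
  \<open>cnj z\<close> as well as the cutoffs, all integrable against the Gaussian weight.\<close>

definition pgrow :: "(complex \<Rightarrow> complex) \<Rightarrow> bool" where
  "pgrow f \<longleftrightarrow> continuous_on UNIV f \<and> (\<exists>C N. \<forall>z. cmod (f z) \<le> C * (1 + cmod z) ^ N)"

lemma pgrowI: "continuous_on UNIV f \<Longrightarrow> (\<And>z. cmod (f z) \<le> C * (1 + cmod z) ^ N) \<Longrightarrow> pgrow f"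
  unfolding pgrow_def by blast

lemma pgrow_bounded: "continuous_on UNIV f \<Longrightarrow> (\<And>z. cmod (f z) \<le> C) \<Longrightarrow> pgrow f"
  by (rule pgrowI[where C = C and N = 0]) auto

lemma pgrow_const: "pgrow (\<lambda>_. c)"
  by (rule pgrow_bounded[where C = "cmod c"]) auto

lemma pgrow_id: "pgrow (\<lambda>z. z)"
  by (rule pgrowI[where C = 1 and N = 1]) auto

lemma pgrow_cnj: "pgrow f \<Longrightarrow> pgrow (\<lambda>z. cnj (f z))"
  unfolding pgrow_def by (auto intro!: continuous_intros)

lemma pgrow_mult:
  assumes "pgrow f" "pgrow g"
  shows "pgrow (\<lambda>z. f z * g z)"
proof -
  obtain C N D M where f: "continuous_on UNIV f" "\<And>z. cmod (f z) \<le> C * (1 + cmod z) ^ N"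
    and g: "continuous_on UNIV g" "\<And>z. cmod (g z) \<le> D * (1 + cmod z) ^ M"
    using assms unfolding pgrow_def by blast
  show ?thesis
  proof (rule pgrowI[where C = "C * D" and N = "N + M"])
    fix z
    have "cmod (f z * g z) \<le> (C * (1 + cmod z) ^ N) * (D * (1 + cmod z) ^ M)"
      unfolding norm_mult by (intro mult_mono f g) (use order_trans[OF norm_ge_zero f(2)[of z]] in auto)
    then show "cmod (f z * g z) \<le> C * D * (1 + cmod z) ^ (N + M)" by (simp add: power_add mult_ac)
  qed (intro continuous_intros f g)
qed

lemma pgrow_add:
  assumes "pgrow f" "pgrow g"
  shows "pgrow (\<lambda>z. f z + g z)"
proof -
  obtain C N D M where f: "continuous_on UNIV f" "\<And>z. cmod (f z) \<le> C * (1 + cmod z) ^ N"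
    and g: "continuous_on UNIV g" "\<And>z. cmod (g z) \<le> D * (1 + cmod z) ^ M"
    using assms unfolding pgrow_def by blast
  have CD: "0 \<le> C" "0 \<le> D" using order_trans[OF norm_ge_zero f(2)[of 0]] order_trans[OF norm_ge_zero g(2)[of 0]] by auto
  show ?thesis
  proof (rule pgrowI[where C = "C + D" and N = "N + M"])
    fix z
    have "C * (1 + cmod z) ^ N \<le> C * (1 + cmod z) ^ (N + M)" "D * (1 + cmod z) ^ M \<le> D * (1 + cmod z) ^ (N + M)"
      by (intro mult_left_mono power_increasing CD; simp)+
    then have "C * (1 + cmod z) ^ N + D * (1 + cmod z) ^ M \<le> (C + D) * (1 + cmod z) ^ (N + M)"
      by (simp add: distrib_right)
    then show "cmod (f z + g z) \<le> (C + D) * (1 + cmod z) ^ (N + M)"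
      using norm_triangle_ineq[of "f z" "g z"] f(2)[of z] g(2)[of z] by linarith
  qed (intro continuous_intros f g)
qed

lemmas pgrow_intros = pgrow_const pgrow_id pgrow_cnj pgrow_mult pgrow_add

lemma pgrow_diff: "pgrow f \<Longrightarrow> pgrow g \<Longrightarrow> pgrow (\<lambda>z. f z - g z)"
  using pgrow_add[of f "\<lambda>z. (-1) * g z"] pgrow_mult[OF pgrow_const[of "-1"], of g] by simp

lemma pgrow_measurable: "pgrow f \<Longrightarrow> f \<in> borel_measurable borel"
  unfolding pgrow_def by (intro borel_measurable_continuous_onI) blast

text \<open>The unnormalized Gaussian weight as a complex exponential, so that its derivative splits
  into a \<open>z\<close> part and a \<open>cnj z\<close> part.\<close>

definition gw :: "complex \<Rightarrow> complex" where
  "gw z = exp (- (z * cnj z))"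

lemma gw_eq: "gw z = of_real (exp (- (cmod z)\<^sup>2))"
  unfolding gw_def complex_norm_square[symmetric] by (metis exp_of_real of_real_minus)

lemma norm_gw: "norm (gw z) = exp (- (cmod z)\<^sup>2)"
  by (simp add: gw_eq)

lemma continuous_on_gw: "continuous_on UNIV gw"
  unfolding gw_def by (intro continuous_intros)

lemma gw_measurable [measurable]: "gw \<in> borel_measurable borel"
  by (rule borel_measurable_continuous_onI[OF continuous_on_gw])

lemma integrable_pgrow_gw:
  assumes "pgrow f"
  shows "integrable lborel (\<lambda>z. f z * gw z)"
proof -
  obtain C N where C: "\<And>z. cmod (f z) \<le> C * (1 + cmod z) ^ N" using assms unfolding pgrow_def by blast
  note [measurable] = pgrow_measurable[OF assms]
  show ?thesis
  proof (rule Bochner_Integration.integrable_bound[OF integrable_mult_right[OF integrable_power_gauss[of N], of C]])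
    have "norm (f z * gw z) \<le> norm (C * ((1 + cmod z) ^ N * exp (- (cmod z)\<^sup>2)))" for z
    proof -
      have "norm (f z * gw z) \<le> (C * (1 + cmod z) ^ N) * exp (- (cmod z)\<^sup>2)"
        unfolding norm_mult norm_gw by (intro mult_right_mono C) simp
      also have "\<dots> \<le> \<bar>C * ((1 + cmod z) ^ N * exp (- (cmod z)\<^sup>2))\<bar>" by (simp add: mult.assoc)
      finally show ?thesis by simp
    qed
    then show "AE z in lborel. norm (f z * gw z) \<le> norm (C * ((1 + cmod z) ^ N * exp (- (cmod z)\<^sup>2)))" by simp
  qed measurable
qed

text \<open>The directions \<open>1\<close> and \<open>i\<close> give the sum of the two integrals
  and \<open>i\<close> times their difference.\<close>

lemma integral_wirtinger_eq_0:
  assumes d: "\<And>z. (F has_derivative (\<lambda>h. F1 z * h + F2 z * cnj h)) (at z)"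
    and F: "integrable lborel F" "integrable lborel F1" "integrable lborel F2"
  shows "integral\<^sup>L lborel F1 = 0" "integral\<^sup>L lborel F2 = 0"
proof -
  have v: "(LINT z|lborel. F1 z * v + F2 z * cnj v) = 0" for v
  proof (rule integral_derivative_eq_0[OF F(1), where v = v])
    show "integrable lborel (\<lambda>z. F1 z * v + F2 z * cnj v)" using F by simp
    fix z
    have "(F has_derivative (\<lambda>h. F1 z * h + F2 z * cnj h)) (at (z + of_real 0 * v))" using d[of z] by simp
    moreover have "((\<lambda>t. z + of_real t * v) has_derivative (\<lambda>t. of_real t * v)) (at 0)"
      by (auto intro!: derivative_eq_intros)
    ultimately have "((\<lambda>t. F (z + of_real t * v)) has_derivative
        (\<lambda>t. F1 z * (of_real t * v) + F2 z * cnj (of_real t * v))) (at 0)"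
      by (rule has_derivative_compose[rotated])
    then show "((\<lambda>t. F (z + of_real t * v)) has_vector_derivative F1 z * v + F2 z * cnj v) (at 0)"
      unfolding has_vector_derivative_def by (simp add: scaleR_conv_of_real algebra_simps)
  qed
  have "integral\<^sup>L lborel F1 + integral\<^sup>L lborel F2 = 0" using v[of 1] F by simp
  moreover have "\<i> * integral\<^sup>L lborel F1 - \<i> * integral\<^sup>L lborel F2 = 0" using v[of \<i>] F by (simp add: mult.commute)
  ultimately show "integral\<^sup>L lborel F1 = 0" "integral\<^sup>L lborel F2 = 0"
    by (simp_all add: add_eq_0_iff flip: right_diff_distrib)
qed

text \<open>Polynomials in \<open>z\<close> and \<open>cnj z\<close> together with their Wirtinger
  derivatives, by \<open>z\<close> and then by \<open>cnj z\<close>. Carrying the derivatives along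
  lets induction deliver growth bounds and differentiability.\<close>

inductive zpoly :: "(complex \<Rightarrow> complex) \<Rightarrow> (complex \<Rightarrow> complex) \<Rightarrow> (complex \<Rightarrow> complex) \<Rightarrow> bool" where
  zpoly_const: "zpoly (\<lambda>_. c) (\<lambda>_. 0) (\<lambda>_. 0)"
| zpoly_id: "zpoly (\<lambda>z. z) (\<lambda>_. 1) (\<lambda>_. 0)"
| zpoly_cnj_id: "zpoly (\<lambda>z. cnj z) (\<lambda>_. 0) (\<lambda>_. 1)"
| zpoly_add: "zpoly f f1 f2 \<Longrightarrow> zpoly g g1 g2 \<Longrightarrow>
    zpoly (\<lambda>z. f z + g z) (\<lambda>z. f1 z + g1 z) (\<lambda>z. f2 z + g2 z)"
| zpoly_mult: "zpoly f f1 f2 \<Longrightarrow> zpoly g g1 g2 \<Longrightarrow>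
    zpoly (\<lambda>z. f z * g z) (\<lambda>z. f1 z * g z + f z * g1 z) (\<lambda>z. f2 z * g z + f z * g2 z)"

lemma zpoly_cong: "zpoly f f1 f2 \<Longrightarrow> f = g \<Longrightarrow> f1 = g1 \<Longrightarrow> f2 = g2 \<Longrightarrow> zpoly g g1 g2"
  by simp

lemma zpoly_pgrow: "zpoly f f1 f2 \<Longrightarrow> pgrow f \<and> pgrow f1 \<and> pgrow f2"
  by (induction rule: zpoly.induct) (auto intro!: pgrow_intros)

lemma zpoly_has_derivative:
  "zpoly f f1 f2 \<Longrightarrow> (f has_derivative (\<lambda>h. f1 z * h + f2 z * cnj h)) (at z)"
proof (induction rule: zpoly.induct)
  case (zpoly_mult f f1 f2 g g1 g2)
  show ?case
    by (rule has_derivative_eq_rhs[OF has_derivative_mult[OF zpoly_mult.IH]]) (auto simp: algebra_simps)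
qed (auto intro!: derivative_eq_intros simp: algebra_simps)

lemma zpoly_cnj: "zpoly f f1 f2 \<Longrightarrow> zpoly (\<lambda>z. cnj (f z)) (\<lambda>z. cnj (f2 z)) (\<lambda>z. cnj (f1 z))"
proof (induction rule: zpoly.induct)
  case (zpoly_mult f f1 f2 g g1 g2)
  show ?case
    by (rule zpoly_cong[OF zpoly.zpoly_mult[OF zpoly_mult.IH]]) auto
qed (auto intro: zpoly.intros)

lemma integral_gauss_measure:
  assumes "f \<in> borel_measurable borel"
  shows "integral\<^sup>L gauss_measure f = (LINT z|lborel. f z * gw z) / of_real pi"
proof -
  have "integral\<^sup>L gauss_measure f = (LINT z|lborel. (exp (- (cmod z)\<^sup>2) / pi) *\<^sub>R f z)"
    unfolding gauss_measure_def by (rule integral_density) (use assms in auto)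
  also have "\<dots> = (LINT z|lborel. f z * gw z / of_real pi)"
    by (simp add: gw_eq scaleR_conv_of_real mult.commute)
  finally show ?thesis by simp
qed

lemma integrable_gauss_measure:
  fixes f :: "complex \<Rightarrow> complex"
  assumes "f \<in> borel_measurable borel"
  shows "integrable gauss_measure f \<longleftrightarrow> integrable lborel (\<lambda>z. f z * gw z)"
proof -
  have "integrable gauss_measure f \<longleftrightarrow> integrable lborel (\<lambda>z. (exp (- (cmod z)\<^sup>2) / pi) *\<^sub>R f z)"
    unfolding gauss_measure_def by (rule integrable_density) (use assms in auto)
  also have "(\<lambda>z. (exp (- (cmod z)\<^sup>2) / pi) *\<^sub>R f z) = (\<lambda>z. f z * gw z / of_real pi)"
    by (simp add: gw_eq scaleR_conv_of_real mult.commute)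
  also have "integrable lborel (\<lambda>z. f z * gw z / of_real pi) \<longleftrightarrow> integrable lborel (\<lambda>z. f z * gw z)"
  proof
    assume "integrable lborel (\<lambda>z. f z * gw z / of_real pi)"
    then have "integrable lborel (\<lambda>z. of_real pi * (f z * gw z / of_real pi))" by (rule integrable_mult_right)
    then show "integrable lborel (\<lambda>z. f z * gw z)" by simp
  qed (rule integrable_divide)
  finally show ?thesis .
qed

lemma measurable_gauss [simp]: "borel_measurable gauss_measure = borel_measurable borel"
  by (rule measurable_cong_sets) (simp_all add: gauss_measure_def)

lemma integrable_pgrow_chi:
  assumes "pgrow f"
  shows "integrable gauss_measure (\<lambda>z. f z * chi \<xi> z)"
proof -
  note [measurable] = pgrow_measurable[OF assms]
  have "(\<lambda>z. f z * chi \<xi> z * gw z) = (\<lambda>z. f z * gw z * chi \<xi> z)" by (simp add: mult_ac)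
  then show ?thesis
    using integrable_mult_chi[OF integrable_pgrow_gw[OF assms]] by (subst integrable_gauss_measure) simp_all
qed

lemma integrable_pgrow: "pgrow f \<Longrightarrow> integrable gauss_measure f"
  using integrable_pgrow_chi[of f 0] by (simp add: chi_def)

definition gchi :: "complex \<Rightarrow> (complex \<Rightarrow> complex) \<Rightarrow> complex" where
  "gchi \<xi> f = (LINT z|gauss_measure. f z * chi \<xi> z)"

lemma gchi_add: "pgrow f \<Longrightarrow> pgrow g \<Longrightarrow> gchi \<xi> (\<lambda>z. f z + g z) = gchi \<xi> f + gchi \<xi> g"
  unfolding gchi_def distrib_right by (intro Bochner_Integration.integral_add integrable_pgrow_chi)

lemma gchi_diff: "pgrow f \<Longrightarrow> pgrow g \<Longrightarrow> gchi \<xi> (\<lambda>z. f z - g z) = gchi \<xi> f - gchi \<xi> g"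
  unfolding gchi_def left_diff_distrib by (intro Bochner_Integration.integral_diff integrable_pgrow_chi)

lemma gchi_cmult: "gchi \<xi> (\<lambda>z. c * f z) = c * gchi \<xi> f"
  unfolding gchi_def mult.assoc by (rule integral_mult_right_zero)

lemma gchi_zero [simp]: "gchi \<xi> (\<lambda>_. 0) = 0"
  by (simp add: gchi_def)

text \<open>Gaussian integration by parts (Stein's identity): both Wirtinger derivatives of
  \<open>f\<close> times character times weight integrate to 0. The exponential contributes
  \<open>cnj \<xi> - cnj z\<close> and \<open>- \<xi> - z\<close>.\<close>

lemma stein:
  assumes "zpoly f f1 f2"
  shows "gchi \<xi> (\<lambda>z. cnj z * f z) = gchi \<xi> f1 + cnj \<xi> * gchi \<xi> f"
    "gchi \<xi> (\<lambda>z. z * f z) = gchi \<xi> f2 - \<xi> * gchi \<xi> f"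
proof -
  have p: "pgrow f" "pgrow f1" "pgrow f2" using zpoly_pgrow[OF assms] by auto
  note pI = pgrow_intros pgrow_diff p
  define F where "F z = f z * exp (z * cnj \<xi> - cnj z * \<xi> - z * cnj z)" for z
  have ch: "exp (z * cnj \<xi> - cnj z * \<xi> - z * cnj z) = chi \<xi> z * gw z" for z
    unfolding chi_def gw_def exp_add[symmetric] by simp
  define q1 where "q1 z = f1 z + cnj \<xi> * f z - cnj z * f z" for z
  define q2 where "q2 z = f2 z - \<xi> * f z - z * f z" for z
  have pq: "pgrow q1" "pgrow q2" unfolding q1_def q2_def by (intro pI)+
  have d: "(F has_derivative (\<lambda>h. (q1 z * chi \<xi> z * gw z) * h + (q2 z * chi \<xi> z * gw z) * cnj h)) (at z)" for z
  proof -
    have e: "((\<lambda>z. z * cnj \<xi> - cnj z * \<xi> - z * cnj z) has_derivative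
        (\<lambda>h. h * cnj \<xi> - cnj h * \<xi> - (z * cnj h + h * cnj z))) (at z)"
      by (auto intro!: derivative_eq_intros)
    have "((\<lambda>z. exp (z * cnj \<xi> - cnj z * \<xi> - z * cnj z)) has_derivative
        (\<lambda>h. exp (z * cnj \<xi> - cnj z * \<xi> - z * cnj z) * (h * cnj \<xi> - cnj h * \<xi> - (z * cnj h + h * cnj z)))) (at z)"
      by (rule has_derivative_compose[OF e DERIV_exp[unfolded has_field_derivative_def]])
    from has_derivative_mult[OF zpoly_has_derivative[OF assms] this]
    have "(F has_derivative (\<lambda>h. f z * (exp (z * cnj \<xi> - cnj z * \<xi> - z * cnj z) * (h * cnj \<xi> - cnj h * \<xi> - (z * cnj h + h * cnj z)))
        + (f1 z * h + f2 z * cnj h) * exp (z * cnj \<xi> - cnj z * \<xi> - z * cnj z))) (at z)"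
      unfolding F_def[abs_def] .
    from this[unfolded ch] show ?thesis
      by (rule has_derivative_eq_rhs) (auto simp: q1_def q2_def algebra_simps)
  qed
  have i: "integrable lborel (\<lambda>z. q z * chi \<xi> z * gw z)" if "pgrow q" for q
    using integrable_mult_chi[OF integrable_pgrow_gw[OF that]] by (simp add: mult_ac)
  have iF: "integrable lborel F" unfolding F_def ch using i[OF p(1)] by (simp add: mult_ac)
  note z = integral_wirtinger_eq_0[OF d iF i[OF pq(1)] i[OF pq(2)]]
  have g: "gchi \<xi> q = (LINT z|lborel. q z * chi \<xi> z * gw z) / of_real pi" if "pgrow q" for q
  proof -
    note [measurable] = pgrow_measurable[OF that]
    show ?thesis unfolding gchi_def by (rule integral_gauss_measure) measurable
  qed
  have "gchi \<xi> q1 = 0" "gchi \<xi> q2 = 0" unfolding g[OF pq(1)] g[OF pq(2)] using z by simp_all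
  moreover have "gchi \<xi> q1 = gchi \<xi> f1 + cnj \<xi> * gchi \<xi> f - gchi \<xi> (\<lambda>z. cnj z * f z)"
    unfolding q1_def
    by (simp add: gchi_diff[OF pgrow_add[OF p(2) pgrow_mult[OF pgrow_const p(1)]] pgrow_mult[OF pgrow_cnj[OF pgrow_id] p(1)]]
      gchi_add[OF p(2) pgrow_mult[OF pgrow_const p(1)]] gchi_cmult)
  moreover have "gchi \<xi> q2 = gchi \<xi> f2 - \<xi> * gchi \<xi> f - gchi \<xi> (\<lambda>z. z * f z)"
    unfolding q2_def
    by (simp add: gchi_diff[OF pgrow_diff[OF p(3) pgrow_mult[OF pgrow_const p(1)]] pgrow_mult[OF pgrow_id p(1)]]
      gchi_diff[OF p(3) pgrow_mult[OF pgrow_const p(1)]] gchi_cmult)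
  ultimately show "gchi \<xi> (\<lambda>z. cnj z * f z) = gchi \<xi> f1 + cnj \<xi> * gchi \<xi> f"
    "gchi \<xi> (\<lambda>z. z * f z) = gchi \<xi> f2 - \<xi> * gchi \<xi> f" by (simp_all add: algebra_simps)
qed

section \<open>Complex Hermite polynomials\<close>

text \<open>The unnormalized complex Hermite (Ito) polynomials: each step applies
  \<open>cnj z - d/dz\<close>, as \<open>d/dz\<close> lowers \<open>m\<close> with factor
  \<open>m\<close> (see \<open>zpoly_herm\<close>). For \<open>m = 0\<close> the truncated index
  \<open>m - 1\<close> is harmless because of that factor.\<close>

fun herm :: "nat \<Rightarrow> nat \<Rightarrow> complex \<Rightarrow> complex" where
  "herm 0 m z = z ^ m"
| "herm (Suc n) m z = cnj z * herm n m z - of_nat m * herm n (m - 1) z"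

lemma zpoly_power: "zpoly (\<lambda>z. z ^ m) (\<lambda>z. of_nat m * z ^ (m - 1)) (\<lambda>_. 0)"
proof (induction m)
  case (Suc m)
  show ?case
  proof (rule zpoly_cong[OF zpoly_mult[OF zpoly_id Suc]])
    show "(\<lambda>z. 1 * z ^ m + z * (of_nat m * z ^ (m - 1))) = (\<lambda>z::complex. of_nat (Suc m) * z ^ (Suc m - 1))"
      by (cases m) (auto simp: algebra_simps)
  qed auto
qed (auto intro: zpoly_cong[OF zpoly_const])

lemma zpoly_herm:
  "zpoly (herm n m) (\<lambda>z. of_nat m * herm n (m - 1) z) (\<lambda>z. of_nat n * herm (n - 1) m z)"
proof (induction n arbitrary: m)
  case 0
  show ?case by (rule zpoly_cong[OF zpoly_power[of m]]) auto
next
  case (Suc n)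
  have h: "cnj z * herm n m z = herm (Suc n) m z + of_nat m * herm n (m - 1) z" for m z by simp
  show ?case
  proof (rule zpoly_cong[OF zpoly_add[OF zpoly_mult[OF zpoly_cnj_id Suc[of m]] zpoly_mult[OF zpoly_const[of "- of_nat m"] Suc[of "m - 1"]]]])
    show "(\<lambda>z. 0 * herm n m z + cnj z * (of_nat m * herm n (m - 1) z) +
         (0 * herm n (m - 1) z + - of_nat m * (of_nat (m - 1) * herm n (m - 1 - 1) z))) =
        (\<lambda>z. of_nat m * herm (Suc n) (m - 1) z)"
      by (auto simp: algebra_simps)
    show "(\<lambda>z. 1 * herm n m z + cnj z * (of_nat n * herm (n - 1) m z) +
         (0 * herm n (m - 1) z + - of_nat m * (of_nat n * herm (n - 1) (m - 1) z))) =
        (\<lambda>z. of_nat (Suc n) * herm (Suc n - 1) m z)"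
      by (cases n) (auto simp: algebra_simps)
  qed auto
qed

lemma pgrow_herm: "pgrow (herm n m)"
  using zpoly_pgrow[OF zpoly_herm] by blast

text \<open>Hermite polynomials are eigenfunctions of the rotation field, the eigenvalue being the
  rotation frequency \<open>m - n\<close>.\<close>

lemma herm_euler:
  "z * (of_nat m * herm n (m - 1) z) - cnj z * (of_nat n * herm (n - 1) m z) = (of_nat m - of_nat n) * herm n m z"
proof (induction n arbitrary: m)
  case 0
  show ?case by (cases m) auto
next
  case (Suc n)
  have a: "z * (of_nat m * herm n (m - 1) z) = cnj z * (of_nat n * herm (n - 1) m z) + (of_nat m - of_nat n) * herm n m z"
    using Suc[of m] by (simp add: algebra_simps)
  have b: "of_nat m * (z * (of_nat (m - 1) * herm n (m - 1 - 1) z)) =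
      of_nat m * (cnj z * (of_nat n * herm (n - 1) (m - 1) z) + (of_nat m - 1 - of_nat n) * herm n (m - 1) z)"
  proof -
    have "z * (of_nat (m - 1) * herm n (m - 1 - 1) z) =
        cnj z * (of_nat n * herm (n - 1) (m - 1) z) + (of_nat (m - 1) - of_nat n) * herm n (m - 1) z"
      using Suc[of "m - 1"] by (simp add: algebra_simps)
    then show ?thesis by (cases m) simp_all
  qed
  have c: "of_nat n * herm n m z = of_nat n * (cnj z * herm (n - 1) m z - of_nat m * herm (n - 1) (m - 1) z)"
    by (cases n) auto
  have "z * (of_nat m * herm (Suc n) (m - 1) z) - cnj z * (of_nat (Suc n) * herm (Suc n - 1) m z) =
      cnj z * (z * (of_nat m * herm n (m - 1) z)) - of_nat m * (z * (of_nat (m - 1) * herm n (m - 1 - 1) z))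
      - cnj z * (of_nat (Suc n) * herm n m z)"
    by (simp add: algebra_simps)
  also have "\<dots> = cnj z * (of_nat n * (cnj z * herm (n - 1) m z - of_nat m * herm (n - 1) (m - 1) z))
      + (of_nat m - of_nat n) * (cnj z * herm n m z) - of_nat m * (of_nat m - 1 - of_nat n) * herm n (m - 1) z
      - cnj z * (of_nat (Suc n) * herm n m z)"
    unfolding a b by (simp add: algebra_simps)
  also have "\<dots> = (of_nat m - of_nat (Suc n)) * herm (Suc n) m z"
    unfolding c[symmetric] by (simp add: algebra_simps)
  finally show ?case .
qed

definition herm_form :: "complex \<Rightarrow> nat \<Rightarrow> nat \<Rightarrow> nat \<Rightarrow> nat \<Rightarrow> complex" where
  "herm_form \<xi> n m n' l = gchi \<xi> (\<lambda>z. herm n m z * cnj (herm n' l z))"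

lemma zpoly_herm_prod:
  "zpoly (\<lambda>z. herm n m z * cnj (herm n' l z))
     (\<lambda>z. of_nat m * (herm n (m - 1) z * cnj (herm n' l z)) + of_nat n' * (herm n m z * cnj (herm (n' - 1) l z)))
     (\<lambda>z. of_nat n * (herm (n - 1) m z * cnj (herm n' l z)) + of_nat l * (herm n m z * cnj (herm n' (l - 1) z)))"
  by (rule zpoly_cong[OF zpoly_mult[OF zpoly_herm[of n m] zpoly_cnj[OF zpoly_herm[of n' l]]]])
     (auto simp: mult_ac)

lemma herm_form_stein:
  "gchi \<xi> (\<lambda>z. cnj z * (herm n m z * cnj (herm n' l z))) =
     of_nat m * herm_form \<xi> n (m - 1) n' l + of_nat n' * herm_form \<xi> n m (n' - 1) l + cnj \<xi> * herm_form \<xi> n m n' l"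
  "gchi \<xi> (\<lambda>z. z * (herm n m z * cnj (herm n' l z))) =
     of_nat n * herm_form \<xi> (n - 1) m n' l + of_nat l * herm_form \<xi> n m n' (l - 1) - \<xi> * herm_form \<xi> n m n' l"
  unfolding stein[OF zpoly_herm_prod] herm_form_def
  by (subst gchi_add; simp add: gchi_cmult pgrow_intros pgrow_herm)+

text \<open>The terms lowering \<open>m\<close> in the recursion and in
  \<open>herm_form_stein\<close> cancel. The ladder in \<open>n\<close> and \<open>n'\<close>
  therefore never touches \<open>m\<close> and \<open>l\<close>, which is why the form factors in
  \<open>herm_form_kap\<close>.\<close>

lemma herm_form_Suc1:
  "herm_form \<xi> (Suc n) m n' l = of_nat n' * herm_form \<xi> n m (n' - 1) l + cnj \<xi> * herm_form \<xi> n m n' l"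
proof -
  have "herm_form \<xi> (Suc n) m n' l = gchi \<xi> (\<lambda>z. cnj z * (herm n m z * cnj (herm n' l z)) - of_nat m * (herm n (m - 1) z * cnj (herm n' l z)))"
    unfolding herm_form_def by (simp add: algebra_simps)
  also have "\<dots> = gchi \<xi> (\<lambda>z. cnj z * (herm n m z * cnj (herm n' l z))) - of_nat m * herm_form \<xi> n (m - 1) n' l"
    unfolding herm_form_def by (subst gchi_diff) (auto intro!: pgrow_intros pgrow_herm simp: gchi_cmult)
  finally show ?thesis unfolding herm_form_stein(1) by simp
qed

lemma herm_form_Suc2:
  "herm_form \<xi> n m (Suc n') l = of_nat n * herm_form \<xi> (n - 1) m n' l - \<xi> * herm_form \<xi> n m n' l"
proof -
  have "herm_form \<xi> n m (Suc n') l = gchi \<xi> (\<lambda>z. z * (herm n m z * cnj (herm n' l z)) - of_nat l * (herm n m z * cnj (herm n' (l - 1) z)))"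
    unfolding herm_form_def by (simp add: algebra_simps)
  also have "\<dots> = gchi \<xi> (\<lambda>z. z * (herm n m z * cnj (herm n' l z))) - of_nat l * herm_form \<xi> n m n' (l - 1)"
    unfolding herm_form_def by (subst gchi_diff) (auto intro!: pgrow_intros pgrow_herm simp: gchi_cmult)
  finally show ?thesis unfolding herm_form_stein(2) by simp
qed

text \<open>\<open>kap \<xi> n n / n!\<close> is the Laguerre polynomial \<open>L\<^sub>n\<close> at \<open>|\<xi>|\<^sup>2\<close>, but only the recursion is used.\<close>

fun kap :: "complex \<Rightarrow> nat \<Rightarrow> nat \<Rightarrow> complex" where
  "kap \<xi> 0 0 = 1"
| "kap \<xi> 0 (Suc n') = - \<xi> * kap \<xi> 0 n'"
| "kap \<xi> (Suc n) n' = of_nat n' * kap \<xi> n (n' - 1) + cnj \<xi> * kap \<xi> n n'"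

lemma herm_form_kap: "herm_form \<xi> n m n' l = kap \<xi> n n' * herm_form \<xi> 0 m 0 l"
proof (induction n arbitrary: n')
  case 0
  show ?case by (induction n') (simp_all add: herm_form_Suc2)
next
  case (Suc n)
  show ?case unfolding herm_form_Suc1 Suc by (simp add: algebra_simps)
qed

text \<open>The same ladder in \<open>m\<close> and \<open>l\<close>; exchanging the roles of
  \<open>z\<close> and \<open>cnj z\<close> replaces \<open>\<xi>\<close> by
  \<open>- cnj \<xi>\<close>.\<close>

lemma herm_form_0_kap: "herm_form \<xi> 0 m 0 l = kap (- cnj \<xi>) m l * herm_form \<xi> 0 0 0 0"
proof (induction m arbitrary: l)
  case 0
  show ?case
  proof (induction l)
    case (Suc l)
    have "herm_form \<xi> 0 0 0 (Suc l) = gchi \<xi> (\<lambda>z. cnj z * (herm 0 0 z * cnj (herm 0 l z)))"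
      by (simp add: herm_form_def)
    also have "\<dots> = cnj \<xi> * herm_form \<xi> 0 0 0 l" unfolding herm_form_stein by simp
    finally show ?case using Suc by simp
  qed simp
next
  case (Suc m)
  have "herm_form \<xi> 0 (Suc m) 0 l = gchi \<xi> (\<lambda>z. z * (herm 0 m z * cnj (herm 0 l z)))"
    by (simp add: herm_form_def mult.assoc)
  also have "\<dots> = of_nat l * herm_form \<xi> 0 m 0 (l - 1) - \<xi> * herm_form \<xi> 0 m 0 l"
    unfolding herm_form_stein by simp
  finally show ?case unfolding Suc by (simp add: algebra_simps)
qed

lemma kap_0: "kap 0 n n' = (if n = n' then fact n else 0)"
proof (induction n arbitrary: n')
  case 0
  show ?case by (cases n') auto
next
  case (Suc n)
  show ?case by (cases n') (auto simp: Suc)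
qed

text \<open>The recursion is polynomial in the ray parameter. At \<open>t = 0\<close> the value is
  \<open>n!\<close>, so the polynomial is not zero.\<close>

lemma kap_poly: "\<exists>p. p \<noteq> 0 \<and> (\<forall>t. kap (of_real t * \<xi>) n n = poly p (of_real t))"
proof -
  have "\<exists>p. \<forall>t. kap (of_real t * \<xi>) n n' = poly p (of_real t)" for n'
  proof (induction n arbitrary: n')
    case 0
    show ?case
    proof (induction n')
      case 0
      show ?case by (rule exI[of _ 1]) simp
    next
      case (Suc n')
      then obtain p where "\<forall>t. kap (of_real t * \<xi>) 0 n' = poly p (of_real t)" by blast
      then show ?case by (intro exI[of _ "[:0, - \<xi>:] * p"]) simp
    qed
  next
    case (Suc n)
    obtain p q where "\<forall>t. kap (of_real t * \<xi>) n n' = poly p (of_real t)"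
      "\<forall>t. kap (of_real t * \<xi>) n (n' - 1) = poly q (of_real t)" using Suc by meson
    then show ?case by (intro exI[of _ "of_nat n' * q + [:0, cnj \<xi>:] * p"]) simp
  qed
  then obtain p where p: "\<forall>t. kap (of_real t * \<xi>) n n = poly p (of_real t)" by blast
  have "poly p 0 = fact n" using p[rule_format, of 0] kap_0[of n n] by simp
  then have "p \<noteq> 0" by auto
  then show ?thesis using p by blast
qed

lemma gchi_0: "gchi 0 f = integral\<^sup>L gauss_measure f"
  by (simp add: gchi_def chi_def)

lemma herm_form_0000: "herm_form 0 0 0 0 0 = 1"
proof -
  have "integral\<^sup>L gauss_measure (\<lambda>z. 1) = (LINT z|lborel. complex_of_real (exp (- (cmod z)\<^sup>2))) / of_real pi"
    by (subst integral_gauss_measure) (simp_all add: gw_eq)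
  also have "\<dots> = 1" by (simp add: integral_complex_of_real integral_gauss_complex del: of_real_exp)
  finally show ?thesis by (simp add: herm_form_def gchi_0)
qed

lemma ip_herm: "ip (herm n m) (herm n' l) = (if n = n' \<and> m = l then fact n * fact m else 0)"
proof -
  have "ip (herm n m) (herm n' l) = herm_form 0 n m n' l"
    by (simp add: ip_def herm_form_def gchi_0)
  also have "\<dots> = kap 0 n n' * kap 0 m l"
    unfolding herm_form_kap[of _ n m] herm_form_0_kap[of _ m] herm_form_0000 by simp
  finally show ?thesis by (auto simp: kap_0)
qed

text \<open>Each level of the recursion for \<open>herm\<close> costs, after \<open>stein\<close>,
  one derivative in \<open>cnj z\<close> and strips one factor from \<open>cnj z ^ j\<close>. For
  \<open>j\<close> below \<open>n\<close> the factor \<open>j\<close> becomes 0 before the recursion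
  ends.\<close>

lemma ip_monomial_herm:
  assumes "j \<le> n"
  shows "ip (\<lambda>z. cnj z ^ j * z ^ p) (herm n m) = (if j = n \<and> p = m then fact n * fact m else 0)"
  using assms
proof (induction n arbitrary: j)
  case 0
  have "herm 0 p = (\<lambda>z. z ^ p)" for p by (rule ext) simp
  then show ?case using 0 ip_herm[of 0 p 0 m] by auto
next
  case (Suc n)
  have zp: "zpoly (\<lambda>z. cnj z ^ j * z ^ p) (\<lambda>z. cnj z ^ j * (of_nat p * z ^ (p - 1))) (\<lambda>z. of_nat j * (cnj z ^ (j - 1) * z ^ p))"
    by (rule zpoly_cong[OF zpoly_mult[OF zpoly_cnj[OF zpoly_power[of j]] zpoly_power[of p]]]) (auto simp: mult_ac)
  have zq: "zpoly (\<lambda>z. cnj z ^ j * z ^ p * cnj (herm n m z))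
      (\<lambda>z. cnj z ^ j * (of_nat p * z ^ (p - 1)) * cnj (herm n m z) + cnj z ^ j * z ^ p * (of_nat n * cnj (herm (n - 1) m z)))
      (\<lambda>z. of_nat j * (cnj z ^ (j - 1) * z ^ p * cnj (herm n m z)) + of_nat m * (cnj z ^ j * z ^ p * cnj (herm n (m - 1) z)))"
    by (rule zpoly_cong[OF zpoly_mult[OF zp zpoly_cnj[OF zpoly_herm[of n m]]]]) (auto simp: mult_ac)
  have pg: "pgrow (\<lambda>z. cnj z ^ j * z ^ p)" for j using zpoly_pgrow zpoly_mult[OF zpoly_cnj[OF zpoly_power[of j]] zpoly_power[of p]] by fastforce
  have pgr: "pgrow (\<lambda>z. cnj z ^ j * z ^ p * cnj (herm n m z))" for j m
    by (intro pgrow_mult pgrow_cnj pgrow_herm pg)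
  have "ip (\<lambda>z. cnj z ^ j * z ^ p) (herm (Suc n) m) =
      gchi 0 (\<lambda>z. z * (cnj z ^ j * z ^ p * cnj (herm n m z)) - of_nat m * (cnj z ^ j * z ^ p * cnj (herm n (m - 1) z)))"
    by (simp add: ip_def gchi_0 algebra_simps)
  also have "\<dots> = gchi 0 (\<lambda>z. z * (cnj z ^ j * z ^ p * cnj (herm n m z))) - of_nat m * gchi 0 (\<lambda>z. cnj z ^ j * z ^ p * cnj (herm n (m - 1) z))"
    unfolding gchi_cmult[symmetric] by (intro gchi_diff pgrow_mult[OF pgrow_id] pgrow_mult[OF pgrow_const] pgr)
  also have "gchi 0 (\<lambda>z. z * (cnj z ^ j * z ^ p * cnj (herm n m z))) =
      of_nat j * gchi 0 (\<lambda>z. cnj z ^ (j - 1) * z ^ p * cnj (herm n m z)) + of_nat m * gchi 0 (\<lambda>z. cnj z ^ j * z ^ p * cnj (herm n (m - 1) z))"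
    unfolding stein(2)[OF zq] gchi_cmult[symmetric]
    by (subst gchi_add) (auto intro!: pgrow_mult[OF pgrow_const] pgr)
  finally have "ip (\<lambda>z. cnj z ^ j * z ^ p) (herm (Suc n) m) = of_nat j * ip (\<lambda>z. cnj z ^ (j - 1) * z ^ p) (herm n m)"
    by (simp add: ip_def gchi_0)
  then show ?case using Suc.IH[of "j - 1"] Suc.prems
    by (cases j) (auto simp del: herm.simps simp: algebra_simps)
qed

section \<open>Polyanalytic functions\<close>

text \<open>Polyanalytic functions of order \<open>n\<close> in their classical normal form, which
  replaces the iterated \<open>dbar\<close> equation (\<open>polyfock_iff\<close>).\<close>

definition panal :: "nat \<Rightarrow> (complex \<Rightarrow> complex) \<Rightarrow> bool" where
  "panal n f \<longleftrightarrow> (\<exists>g. (\<forall>j. g j holomorphic_on UNIV) \<and> f = (\<lambda>z. \<Sum>j<n. cnj z ^ j * g j z))"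

lemma panalI: "(\<And>j. g j holomorphic_on UNIV) \<Longrightarrow> f = (\<lambda>z. \<Sum>j<n. cnj z ^ j * g j z) \<Longrightarrow> panal n f"
  unfolding panal_def by blast

lemma panal_add:
  assumes "panal n f" "panal n g"
  shows "panal n (\<lambda>z. f z + g z)"
proof -
  obtain a b where a: "\<And>j. a j holomorphic_on UNIV" "f = (\<lambda>z. \<Sum>j<n. cnj z ^ j * a j z)"
    and b: "\<And>j. b j holomorphic_on UNIV" "g = (\<lambda>z. \<Sum>j<n. cnj z ^ j * b j z)"
    using assms unfolding panal_def by blast
  show ?thesis
    by (rule panalI[where g = "\<lambda>j z. a j z + b j z"])
       (auto intro!: holomorphic_intros a b simp: a(2) b(2) sum.distrib algebra_simps)
qed

lemma panal_cmult:
  assumes "panal n f"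
  shows "panal n (\<lambda>z. c * f z)"
proof -
  obtain a where a: "\<And>j. a j holomorphic_on UNIV" "f = (\<lambda>z. \<Sum>j<n. cnj z ^ j * a j z)"
    using assms unfolding panal_def by blast
  show ?thesis
    by (rule panalI[where g = "\<lambda>j z. c * a j z"])
       (auto intro!: holomorphic_intros a simp: a(2) sum_distrib_left mult_ac)
qed

lemma panal_diff: "panal n f \<Longrightarrow> panal n g \<Longrightarrow> panal n (\<lambda>z. f z - g z)"
  using panal_add[of n f "\<lambda>z. (-1) * g z"] panal_cmult[of n g "-1"] by simp

lemma panal_mono:
  assumes "panal m f" "m \<le> n"
  shows "panal n f"
proof -
  obtain a where a: "\<And>j. a j holomorphic_on UNIV" "f = (\<lambda>z. \<Sum>j<m. cnj z ^ j * a j z)"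
    using assms unfolding panal_def by blast
  have "(\<Sum>j<m. cnj z ^ j * a j z) = (\<Sum>j<n. cnj z ^ j * (if j < m then a j z else 0))" for z
    using assms(2) by (intro sum.mono_neutral_cong_left) auto
  moreover have "(\<lambda>z. if j < m then a j z else 0) holomorphic_on UNIV" for j
    using a(1) by (cases "j < m") auto
  ultimately show ?thesis
    by (intro panalI[where g = "\<lambda>j z. if j < m then a j z else 0"]) (auto simp: a(2))
qed

lemma panal_holomorphic: "g holomorphic_on UNIV \<Longrightarrow> panal 1 g"
  by (rule panalI[where g = "\<lambda>_. g"]) auto

lemma panal_cnj_mult:
  assumes "panal n f"
  shows "panal (Suc n) (\<lambda>z. cnj z * f z)"
proof -
  obtain a where a: "\<And>j. a j holomorphic_on UNIV" "f = (\<lambda>z. \<Sum>j<n. cnj z ^ j * a j z)"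
    using assms unfolding panal_def by blast
  have "(\<lambda>z. case j of 0 \<Rightarrow> 0 | Suc i \<Rightarrow> a i z) holomorphic_on UNIV" for j
    using a(1) by (cases j) auto
  then show ?thesis
    by (intro panalI[where g = "\<lambda>j z. case j of 0 \<Rightarrow> 0 | Suc i \<Rightarrow> a i z"])
       (auto simp: a(2) sum.lessThan_Suc_shift sum_distrib_left mult.assoc simp del: sum.lessThan_Suc)
qed

lemma panal_holomorphic_mult:
  assumes "panal n f" "h holomorphic_on UNIV"
  shows "panal n (\<lambda>z. h z * f z)"
proof -
  obtain a where a: "\<And>j. a j holomorphic_on UNIV" "f = (\<lambda>z. \<Sum>j<n. cnj z ^ j * a j z)"
    using assms unfolding panal_def by blast
  show ?thesis
    by (rule panalI[where g = "\<lambda>j z. h z * a j z"])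
       (auto intro!: holomorphic_intros a assms simp: a(2) sum_distrib_left mult_ac)
qed

lemma panal_has_derivative:
  assumes g: "\<And>j. g j holomorphic_on UNIV"
  shows "((\<lambda>z. \<Sum>j<n. cnj z ^ j * g j z) has_derivative
    (\<lambda>h. (\<Sum>j<n. cnj z ^ j * deriv (g j) z) * h + (\<Sum>j<n. of_nat j * cnj z ^ (j - 1) * g j z) * cnj h)) (at z)"
proof -
  have dg: "(g j has_derivative (\<lambda>h. deriv (g j) z * h)) (at z)" for j
    using holomorphic_derivI[OF g, of z j] by (auto simp: has_field_derivative_def)
  have "((\<lambda>z. cnj z ^ j * g j z) has_derivative
      (\<lambda>h. (cnj z ^ j * deriv (g j) z) * h + (of_nat j * cnj z ^ (j - 1) * g j z) * cnj h)) (at z)" for j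
    using dg[of j] by (auto intro!: derivative_eq_intros simp: algebra_simps)
  then have "((\<lambda>z. \<Sum>j<n. cnj z ^ j * g j z) has_derivative
      (\<lambda>h. \<Sum>j<n. (cnj z ^ j * deriv (g j) z) * h + (of_nat j * cnj z ^ (j - 1) * g j z) * cnj h)) (at z)"
    by (intro has_derivative_sum)
  then show ?thesis by (simp add: sum.distrib sum_distrib_right)
qed

lemma has_derivative_partials:
  assumes "(f has_derivative (\<lambda>h. a * h + b * cnj h)) (at z)"
  shows "partial_x f z = a + b" "partial_y f z = \<i> * a - \<i> * b" "dbar f z = b"
proof -
  have "frechet_derivative f (at z) = (\<lambda>h. a * h + b * cnj h)"
    by (rule frechet_derivative_at[OF assms, symmetric])
  then show px: "partial_x f z = a + b" and py: "partial_y f z = \<i> * a - \<i> * b"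
    by (simp_all add: partial_x_def partial_y_def mult.commute)
  show "dbar f z = b" by (simp add: dbar_def px py right_diff_distrib flip: mult.assoc)
qed

lemma panal_partials:
  assumes f: "panal n f"
  shows "f differentiable (at z)" "panal n (partial_x f)" "panal n (partial_y f)"
    "panal (n - 1) (dbar f)" "continuous_on UNIV f"
proof -
  obtain g where g: "\<And>j. g j holomorphic_on UNIV" "f = (\<lambda>z. \<Sum>j<n. cnj z ^ j * g j z)"
    using f unfolding panal_def by blast
  define A where "A z = (\<Sum>j<n. cnj z ^ j * deriv (g j) z)" for z
  define B where "B z = (\<Sum>j<n. of_nat j * cnj z ^ (j - 1) * g j z)" for z
  have d: "(f has_derivative (\<lambda>h. A z * h + B z * cnj h)) (at z)" for z
    unfolding g(2) A_def B_def by (rule panal_has_derivative[OF g(1)])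
  then show "f differentiable (at z)" by (rule differentiableI)
  show "continuous_on UNIV f"
    using d by (intro continuous_at_imp_continuous_on ballI has_derivative_continuous)
  have pA: "panal n A"
    by (rule panalI[where g = "\<lambda>j. deriv (g j)"]) (auto intro!: holomorphic_deriv g simp: A_def[abs_def])
  have pB': "panal (n - 1) B"
  proof (rule panalI[where g = "\<lambda>j z. of_nat (Suc j) * g (Suc j) z"])
    show "B = (\<lambda>z. \<Sum>j<n - 1. cnj z ^ j * (of_nat (Suc j) * g (Suc j) z))"
    proof (cases n)
      case (Suc k)
      show ?thesis unfolding B_def[abs_def] Suc
        by (subst sum.lessThan_Suc_shift) (simp add: mult_ac)
    qed (simp add: B_def[abs_def])
  qed (intro holomorphic_intros g)
  have pB: "panal n B" by (rule panal_mono[OF pB']) simp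
  have "partial_x f = (\<lambda>z. A z + B z)" using has_derivative_partials(1)[OF d] by (rule ext)
  then show "panal n (partial_x f)" using panal_add[OF pA pB] by simp
  have "partial_y f = (\<lambda>z. \<i> * A z - \<i> * B z)" using has_derivative_partials(2)[OF d] by (rule ext)
  then show "panal n (partial_y f)" using panal_diff[OF panal_cmult[OF pA] panal_cmult[OF pB]] by simp
  have "dbar f = B" using has_derivative_partials(3)[OF d] by (rule ext)
  then show "panal (n - 1) (dbar f)" using pB' by simp
qed

lemma panal_smooth: "panal n f \<Longrightarrow> smooth_fun f"
  unfolding smooth_fun_def
proof
  fix m assume "panal n f"
  then show "C_fun m f"
    by (induction m arbitrary: f) (auto intro: panal_partials)
qed

lemma panal_dbar_power: "panal n f \<Longrightarrow> (dbar ^^ n) f = (\<lambda>z. 0)"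
proof (induction n arbitrary: f)
  case 0
  then show ?case by (auto simp: panal_def)
next
  case (Suc n)
  then show ?case using panal_partials(4)[OF Suc.prems] by (simp add: funpow_swap1)
qed

section \<open>Solving the iterated \<open>dbar\<close> equation\<close>

lemma partials_linear:
  assumes "f differentiable (at z)" "g differentiable (at z)"
  shows "partial_x (\<lambda>z. a * f z + b * g z) z = a * partial_x f z + b * partial_x g z"
    "partial_y (\<lambda>z. a * f z + b * g z) z = a * partial_y f z + b * partial_y g z"
    "(\<lambda>z. a * f z + b * g z) differentiable (at z)"
proof -
  have f: "(f has_derivative frechet_derivative f (at z)) (at z)"
    and g: "(g has_derivative frechet_derivative g (at z)) (at z)"
    using assms by (simp_all add: frechet_derivative_works)
  have d: "((\<lambda>z. a * f z + b * g z) has_derivative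
      (\<lambda>h. a * frechet_derivative f (at z) h + b * frechet_derivative g (at z) h)) (at z)"
    by (intro has_derivative_add has_derivative_mult_right f g)
  show "(\<lambda>z. a * f z + b * g z) differentiable (at z)" using d by (rule differentiableI)
  show "partial_x (\<lambda>z. a * f z + b * g z) z = a * partial_x f z + b * partial_x g z"
    "partial_y (\<lambda>z. a * f z + b * g z) z = a * partial_y f z + b * partial_y g z"
    unfolding partial_x_def partial_y_def frechet_derivative_at[OF d, symmetric] by simp_all
qed

lemma C_fun_linear: "C_fun m f \<Longrightarrow> C_fun m g \<Longrightarrow> C_fun m (\<lambda>z. a * f z + b * g z)"
proof (induction m arbitrary: f g)
  case 0
  then show ?case by (auto intro!: continuous_intros)
next
  case (Suc m)
  then have d: "\<And>z. f differentiable (at z)" "\<And>z. g differentiable (at z)" by auto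
  have "partial_x (\<lambda>z. a * f z + b * g z) = (\<lambda>z. a * partial_x f z + b * partial_x g z)"
    "partial_y (\<lambda>z. a * f z + b * g z) = (\<lambda>z. a * partial_y f z + b * partial_y g z)"
    using partials_linear[OF d] by auto
  then show ?case using Suc partials_linear(3)[OF d] by simp
qed

lemma smooth_dbar:
  assumes "smooth_fun f"
  shows "smooth_fun (dbar f)"
  unfolding smooth_fun_def
proof
  fix m
  have "C_fun (Suc m) f" using assms by (simp only: smooth_fun_def)
  then have "C_fun m (partial_x f)" "C_fun m (partial_y f)" by auto
  then have "C_fun m (\<lambda>z. (1/2) * partial_x f z + (\<i>/2) * partial_y f z)" by (rule C_fun_linear)
  moreover have "dbar f = (\<lambda>z. (1/2) * partial_x f z + (\<i>/2) * partial_y f z)"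
    by (rule ext) (simp add: dbar_def add_divide_distrib)
  ultimately show "C_fun m (dbar f)" by simp
qed

text \<open>The Cauchy-Riemann equation \<open>D i = i D 1\<close> makes the real-linear derivative
  complex-linear.\<close>

lemma dbar_0_holomorphic:
  assumes d: "\<And>z. f differentiable (at z)" and "\<And>z. dbar f z = 0"
  shows "f holomorphic_on UNIV"
proof (rule holomorphic_onI)
  fix z
  define D where "D = frechet_derivative f (at z)"
  have D: "(f has_derivative D) (at z)" using d by (simp add: D_def frechet_derivative_works)
  then have lin: "linear D" by (rule has_derivative_linear)
  have "D 1 + \<i> * D \<i> = 0" using assms(2)[of z] by (simp add: dbar_def partial_x_def partial_y_def D_def)
  then have "\<i> * (D 1 + \<i> * D \<i>) = 0" by simp
  then have Di: "D \<i> = \<i> * D 1" by (simp add: algebra_simps flip: mult.assoc)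
  have "D h = D 1 * h" for h
  proof -
    have "h = Re h *\<^sub>R 1 + Im h *\<^sub>R \<i>" by (simp add: complex_eq_iff)
    then have "D h = D (Re h *\<^sub>R 1 + Im h *\<^sub>R \<i>)" by (rule arg_cong)
    also have "\<dots> = Re h *\<^sub>R D 1 + Im h *\<^sub>R D \<i>" using lin by (simp add: linear_add linear_scale)
    also have "\<dots> = D 1 * (of_real (Re h) + \<i> * of_real (Im h))"
      unfolding Di by (simp add: scaleR_conv_of_real algebra_simps)
    finally show ?thesis by (simp add: complex_eq[symmetric])
  qed
  then have "D = (\<lambda>h. D 1 * h)" by (rule ext)
  then have "(f has_field_derivative D 1) (at z)" using D unfolding has_field_derivative_def by simp
  then show "f field_differentiable at z within UNIV" by (auto simp: field_differentiable_def)
qed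

text \<open>By induction \<open>dbar f\<close> has the normal form, so an explicit
  \<open>dbar\<close> primitive \<open>F\<close> of it can be written down; the difference of
  \<open>f\<close> and \<open>F\<close> is entire.\<close>

lemma smooth_dbar_power_panal:
  "smooth_fun f \<Longrightarrow> (dbar ^^ n) f = (\<lambda>z. 0) \<Longrightarrow> panal n f"
proof (induction n arbitrary: f)
  case 0
  then show ?case by (auto simp: panal_def intro!: exI[of _ "\<lambda>_ _. 0"])
next
  case (Suc n)
  have "panal n (dbar f)"
    by (rule Suc.IH[OF smooth_dbar[OF Suc.prems(1)]]) (use Suc.prems(2) in \<open>simp add: funpow_swap1\<close>)
  then obtain g where g: "\<And>j. g j holomorphic_on UNIV" "dbar f = (\<lambda>z. \<Sum>j<n. cnj z ^ j * g j z)"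
    unfolding panal_def by blast
  \<comment> \<open>Termwise primitive: \<open>cnj z ^ j\<close> comes from
    \<open>cnj z ^ (j+1) / (j+1)\<close>, so the coefficients shift by one and the zeroth, which is
    free, is set to 0.\<close>
  define a where "a j z = (case j of 0 \<Rightarrow> 0 | Suc i \<Rightarrow> g i z / of_nat (Suc i))" for j z
  have a: "a j holomorphic_on UNIV" for j
    unfolding a_def[abs_def] by (cases j) (auto intro!: holomorphic_intros g simp del: of_nat_Suc)
  define F where "F = (\<lambda>z. \<Sum>j<Suc n. cnj z ^ j * a j z)"
  have pF: "panal (Suc n) F" by (rule panalI[where g = a]) (auto simp: F_def a)
  have dF: "dbar F z = dbar f z" for z
  proof -
    have "dbar F z = (\<Sum>j<Suc n. of_nat j * cnj z ^ (j - 1) * a j z)"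
      unfolding F_def by (rule has_derivative_partials(3)[OF panal_has_derivative[OF a]])
    also have "\<dots> = (\<Sum>j<n. cnj z ^ j * g j z)"
      by (subst sum.lessThan_Suc_shift) (simp add: a_def del: of_nat_Suc)
    finally show ?thesis by (simp add: g(2))
  qed
  have df: "f differentiable (at z)" for z
    using Suc.prems(1) unfolding smooth_fun_def by (metis C_fun.simps(2))
  define h where "h z = 1 * f z + (-1) * F z" for z
  have "h holomorphic_on UNIV"
  proof (rule dbar_0_holomorphic)
    fix z
    note pl = partials_linear[OF df[of z] panal_partials(1)[OF pF, of z], where a = 1 and b = "-1", folded h_def[abs_def]]
    show "h differentiable (at z)" by (rule pl(3))
    have "dbar h z = dbar f z - dbar F z"
      unfolding dbar_def pl(1,2) by (simp add: algebra_simps diff_divide_distrib add_divide_distrib)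
    then show "dbar h z = 0" by (simp add: dF)
  qed
  then have "panal (Suc n) h" using panal_mono[OF panal_holomorphic] by simp
  from panal_add[OF this pF] show ?case by (simp add: h_def)
qed

lemma polyfock_iff: "f \<in> polyfock n \<longleftrightarrow> f \<in> L2_gauss \<and> panal n f"
  unfolding polyfock_def using panal_smooth panal_dbar_power smooth_dbar_power_panal by blast

section \<open>The Hilbert space of the Gaussian measure\<close>

lemma cnj_measurable [measurable]: "cnj \<in> borel_measurable borel"
  by (intro borel_measurable_continuous_onI continuous_intros)

lemma L2_measurable: "f \<in> L2_gauss \<Longrightarrow> f \<in> borel_measurable borel"
  by (simp add: L2_gauss_def)

lemma L2_integrable: "f \<in> L2_gauss \<Longrightarrow> integrable gauss_measure (\<lambda>z. (cmod (f z))\<^sup>2)"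
  by (simp add: L2_gauss_def)

lemma L2_integrable_mult:
  assumes "f \<in> L2_gauss" "g \<in> L2_gauss"
  shows "integrable gauss_measure (\<lambda>z. f z * cnj (g z))"
proof (rule Bochner_Integration.integrable_bound)
  note [measurable] = L2_measurable[OF assms(1)] L2_measurable[OF assms(2)]
  show "integrable gauss_measure (\<lambda>z. (cmod (f z))\<^sup>2 + (cmod (g z))\<^sup>2)"
    using assms by (intro Bochner_Integration.integrable_add L2_integrable)
  show "(\<lambda>z. f z * cnj (g z)) \<in> borel_measurable gauss_measure" unfolding measurable_gauss by measurable
  show "AE z in gauss_measure. norm (f z * cnj (g z)) \<le> norm ((cmod (f z))\<^sup>2 + (cmod (g z))\<^sup>2)"
    by (intro AE_I2) (simp add: norm_mult mult_le_sum_squares)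
qed

lemma L2_linear:
  assumes "f \<in> L2_gauss" "g \<in> L2_gauss"
  shows "(\<lambda>z. a * f z + b * g z) \<in> L2_gauss"
  unfolding L2_gauss_def
proof (intro CollectI conjI)
  note [measurable] = L2_measurable[OF assms(1)] L2_measurable[OF assms(2)]
  show m: "(\<lambda>z. a * f z + b * g z) \<in> borel_measurable borel" by measurable
  show "integrable gauss_measure (\<lambda>z. (cmod (a * f z + b * g z))\<^sup>2)"
  proof (rule Bochner_Integration.integrable_bound)
    show "integrable gauss_measure (\<lambda>z. 2 * ((cmod a)\<^sup>2 * (cmod (f z))\<^sup>2) + 2 * ((cmod b)\<^sup>2 * (cmod (g z))\<^sup>2))"
      using assms by (intro Bochner_Integration.integrable_add integrable_mult_right L2_integrable)
    show "(\<lambda>z. (cmod (a * f z + b * g z))\<^sup>2) \<in> borel_measurable gauss_measure" unfolding measurable_gauss by measurable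
    show "AE z in gauss_measure. norm ((cmod (a * f z + b * g z))\<^sup>2) \<le>
        norm (2 * ((cmod a)\<^sup>2 * (cmod (f z))\<^sup>2) + 2 * ((cmod b)\<^sup>2 * (cmod (g z))\<^sup>2))"
      using cmod_add_square_le[of "a * f _" "b * g _"]
      by (intro AE_I2) (simp add: norm_mult power_mult_distrib)
  qed
qed

lemma L2_closed:
  assumes "f \<in> L2_gauss" "g \<in> L2_gauss"
  shows "(\<lambda>z. f z + g z) \<in> L2_gauss" "(\<lambda>z. f z - g z) \<in> L2_gauss" "(\<lambda>z. c * f z) \<in> L2_gauss" "(\<lambda>z. 0) \<in> L2_gauss"
  using L2_linear[OF assms, of 1 1] L2_linear[OF assms, of 1 "-1"] L2_linear[OF assms, of c 0] L2_linear[OF assms, of 0 0]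
  by simp_all

lemma pgrow_L2: "pgrow f \<Longrightarrow> f \<in> L2_gauss"
proof -
  assume f: "pgrow f"
  have "integrable gauss_measure (\<lambda>z. norm (f z * cnj (f z)))"
    by (intro integrable_norm integrable_pgrow pgrow_intros f)
  then show ?thesis by (simp add: L2_gauss_def pgrow_measurable[OF f] norm_mult power2_eq_square)
qed

lemma herm_L2: "herm n m \<in> L2_gauss"
  by (rule pgrow_L2[OF pgrow_herm])

lemma ip_add_left: "f \<in> L2_gauss \<Longrightarrow> g \<in> L2_gauss \<Longrightarrow> h \<in> L2_gauss \<Longrightarrow> ip (\<lambda>z. f z + g z) h = ip f h + ip g h"
  unfolding ip_def distrib_right by (intro Bochner_Integration.integral_add L2_integrable_mult)

lemma ip_diff_left: "f \<in> L2_gauss \<Longrightarrow> g \<in> L2_gauss \<Longrightarrow> h \<in> L2_gauss \<Longrightarrow> ip (\<lambda>z. f z - g z) h = ip f h - ip g h"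
  unfolding ip_def left_diff_distrib by (intro Bochner_Integration.integral_diff L2_integrable_mult)

lemma ip_cmult_left: "ip (\<lambda>z. c * f z) g = c * ip f g"
  unfolding ip_def mult.assoc by (rule integral_mult_right_zero)

lemma ip_commute: "ip f g = cnj (ip g f)"
  unfolding ip_def by (subst Bochner_Integration.integral_cnj[symmetric]) (simp add: mult.commute)

lemma ip_cmult_right: "ip f (\<lambda>z. c * g z) = cnj c * ip f g"
  by (metis ip_cmult_left ip_commute complex_cnj_mult)

lemma ip_sum_left:
  assumes "\<And>i. i \<in> I \<Longrightarrow> f i \<in> L2_gauss" "g \<in> L2_gauss"
  shows "ip (\<lambda>z. \<Sum>i\<in>I. f i z) g = (\<Sum>i\<in>I. ip (f i) g)"
  unfolding ip_def sum_distrib_right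
  by (rule Bochner_Integration.integral_sum) (intro L2_integrable_mult assms)

lemma ip_self: "ip f f = of_real (LINT z|gauss_measure. (cmod (f z))\<^sup>2)"
proof -
  have "ip f f = (LINT z|gauss_measure. complex_of_real ((cmod (f z))\<^sup>2))"
    unfolding ip_def complex_norm_square ..
  then show ?thesis by (simp only: integral_complex_of_real)
qed

lemma nrm_square: "(nrm f)\<^sup>2 = (LINT z|gauss_measure. (cmod (f z))\<^sup>2)"
  unfolding nrm_def by (rule real_sqrt_pow2) (rule integral_nonneg_AE, simp)

lemma nrm_nonneg: "0 \<le> nrm f"
  unfolding nrm_def by (simp add: integral_nonneg_AE)

text \<open>The set where \<open>f\<close> is nonzero is open, and a nonempty open set is not
  negligible.\<close>

lemma continuous_AE_zero:
  fixes f :: "complex \<Rightarrow> complex"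
  assumes f: "continuous_on UNIV f" and z: "AE z in lborel. f z = 0"
  shows "f z = 0"
proof -
  have o: "open {z. f z \<noteq> 0}" by (intro open_Collect_neq f continuous_on_const)
  have "{z. f z \<noteq> 0} \<in> null_sets lborel"
    using z o by (intro AE_iff_null_sets[THEN iffD2]) auto
  then have "negligible {z. f z \<noteq> 0}"
    by (simp add: negligible_iff_null_sets null_sets_completionI)
  then have "{z. f z \<noteq> 0} = {}" using open_not_negligible[OF o] by blast
  then show ?thesis by auto
qed

lemma continuous_L2_zero:
  assumes f: "f \<in> L2_gauss" "continuous_on UNIV f" and "ip f f = 0"
  shows "f = (\<lambda>z. 0)"
proof -
  have "(LINT z|gauss_measure. (cmod (f z))\<^sup>2) = 0" using assms(3) unfolding ip_self by simp
  then have "AE z in gauss_measure. (cmod (f z))\<^sup>2 = 0"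
    by (subst (asm) integral_nonneg_eq_0_iff_AE) (use L2_integrable[OF f(1)] in auto)
  then have "AE z in lborel. f z = 0"
    unfolding gauss_measure_def by (subst (asm) AE_density) auto
  then have "f z = 0" for z by (rule continuous_AE_zero[OF f(2)])
  then show ?thesis by (rule ext)
qed

section \<open>Inner products with Hermite polynomials\<close>

text \<open>For positive \<open>s\<close> it is radial, supported in the disc of radius
  \<open>1 / sqrt s\<close>, and tends to 1 pointwise as \<open>s\<close> tends to 0. The outer
  square makes it differentiable across the edge.\<close>

definition cutoff :: "real \<Rightarrow> complex \<Rightarrow> complex" where
  "cutoff s z = of_real ((max 0 (1 - s * (cmod z)\<^sup>2))\<^sup>2)"

text \<open>The derivative of \<open>cutoff\<close> with respect to the squared modulus.\<close>

definition dcutoff :: "real \<Rightarrow> complex \<Rightarrow> complex" where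
  "dcutoff s z = of_real (- 2 * s * max 0 (1 - s * (cmod z)\<^sup>2))"

lemma has_real_derivative_max_square: "((\<lambda>t. (max 0 t)\<^sup>2) has_real_derivative 2 * max 0 t) (at t)"
proof -
  consider "t > 0" | "t < 0" | "t = 0" by linarith
  then show ?thesis
  proof cases
    case 1
    have "((\<lambda>t. t\<^sup>2) has_real_derivative 2 * max 0 t) (at t)"
      using 1 by (auto intro!: derivative_eq_intros)
    then show ?thesis
      by (rule has_field_derivative_transform_within_open[where S = "{0<..}"]) (use 1 in auto)
  next
    case 2
    have "((\<lambda>t. 0) has_real_derivative 2 * max 0 t) (at t)"
      using 2 by (auto intro!: derivative_eq_intros)
    then show ?thesis
      by (rule has_field_derivative_transform_within_open[where S = "{..<0}"]) (use 2 in auto)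
  next
    case 3
    have "((\<lambda>h::real. (max 0 h)\<^sup>2 / h) \<longlongrightarrow> 0) (at 0)"
    proof (rule Lim_null_comparison)
      have "norm ((max 0 h)\<^sup>2 / h) \<le> \<bar>h\<bar>" for h :: real
        by (cases "h > 0") (auto simp: power2_eq_square)
      then show "\<forall>\<^sub>F h in at 0. norm ((max 0 h)\<^sup>2 / h) \<le> \<bar>h::real\<bar>" by simp
      show "((\<lambda>h::real. \<bar>h\<bar>) \<longlongrightarrow> 0) (at 0)" by (rule tendsto_rabs_zero) simp
    qed
    then show ?thesis using 3 by (simp add: has_field_derivative_iff)
  qed
qed

lemma cutoff_has_derivative: "(cutoff s has_derivative (\<lambda>h. (dcutoff s z * cnj z) * h + (dcutoff s z * z) * cnj h)) (at z)"
proof -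
  have q: "((\<lambda>z. 1 - s * (cmod z)\<^sup>2) has_derivative (\<lambda>h. - s * (2 * Re z * Re h + 2 * Im z * Im h))) (at z)"
    unfolding cmod_power2
    by (auto intro!: derivative_eq_intros simp: algebra_simps)
  have "((\<lambda>z. (max 0 (1 - s * (cmod z)\<^sup>2))\<^sup>2) has_derivative
      (\<lambda>h. (2 * max 0 (1 - s * (cmod z)\<^sup>2)) * (- s * (2 * Re z * Re h + 2 * Im z * Im h)))) (at z)"
    by (rule has_derivative_compose[OF q has_real_derivative_max_square[unfolded has_field_derivative_def]])
  then have "(cutoff s has_derivative
      (\<lambda>h. of_real ((2 * max 0 (1 - s * (cmod z)\<^sup>2)) * (- s * (2 * Re z * Re h + 2 * Im z * Im h))))) (at z)"
    unfolding cutoff_def[abs_def] by (rule has_derivative_of_real)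
  moreover have "of_real (2 * Re z * Re h + 2 * Im z * Im h) = cnj z * h + z * cnj h" for h
    by (simp add: complex_eq_iff)
  then have "of_real ((2 * max 0 (1 - s * (cmod z)\<^sup>2)) * (- s * (2 * Re z * Re h + 2 * Im z * Im h))) =
      (dcutoff s z * cnj z) * h + (dcutoff s z * z) * cnj h" for h
    unfolding dcutoff_def of_real_mult by (simp add: algebra_simps)
  ultimately show ?thesis by simp
qed

lemma cutoff_bounds:
  assumes "0 \<le> s"
  shows "cmod (cutoff s z) \<le> 1" "cmod (dcutoff s z) \<le> 2 * s"
proof -
  have m: "0 \<le> max 0 (1 - s * (cmod z)\<^sup>2)" "max 0 (1 - s * (cmod z)\<^sup>2) \<le> 1" using assms by auto
  show "cmod (cutoff s z) \<le> 1" unfolding cutoff_def norm_of_real using m by (simp add: power_le_one)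
  show "cmod (dcutoff s z) \<le> 2 * s" unfolding dcutoff_def norm_of_real
    using m assms mult_left_mono[OF m(2), of "2 * s"] by (simp add: abs_mult)
qed

lemma pgrow_cutoff: "0 \<le> s \<Longrightarrow> pgrow (cutoff s)" "0 \<le> s \<Longrightarrow> pgrow (dcutoff s)"
  by (rule pgrow_bounded[where C = 1]; use cutoff_bounds in \<open>auto simp: cutoff_def[abs_def] intro!: continuous_intros\<close>)
     (rule pgrow_bounded[where C = "2 * s"]; use cutoff_bounds in \<open>auto simp: dcutoff_def[abs_def] intro!: continuous_intros\<close>)

text \<open>
  Integration by parts along the rotation field \<open>z \<partial> - cnj z \<partial>\<close>, which annihilates radial functions.
\<close>

lemma integral_angular_eq_0:
  assumes q: "zpoly q q1 q2" and e: "\<And>z. z * q1 z - cnj z * q2 z = d * q z" and "d \<noteq> 0" and s: "0 \<le> s"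
  shows "(LINT z|gauss_measure. q z * cutoff s z) = 0"
proof -
  note pg = pgrow_intros pgrow_diff pgrow_cutoff[OF s] conjunct1[OF zpoly_pgrow[OF q]]
    conjunct1[OF conjunct2[OF zpoly_pgrow[OF q]]] conjunct2[OF conjunct2[OF zpoly_pgrow[OF q]]]
  \<comment> \<open>Up to the factor \<open>gw\<close>, \<open>k1\<close> and \<open>k2\<close> are
    the Wirtinger derivatives of \<open>q\<close> times cutoff times weight.\<close>
  define k1 where "k1 z = q1 z * cutoff s z + q z * (dcutoff s z * cnj z) - q z * cutoff s z * cnj z" for z
  define k2 where "k2 z = q2 z * cutoff s z + q z * (dcutoff s z * z) - q z * cutoff s z * z" for z
  have dgw: "(gw has_derivative (\<lambda>h. (- cnj z * gw z) * h + (- z * gw z) * cnj h)) (at z)" for z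
  proof -
    have "((\<lambda>z. - (z * cnj z)) has_derivative (\<lambda>h. - (z * cnj h + h * cnj z))) (at z)"
      by (auto intro!: derivative_eq_intros)
    from has_derivative_compose[OF this DERIV_exp[unfolded has_field_derivative_def]]
    show ?thesis unfolding gw_def[abs_def]
      by (rule has_derivative_eq_rhs) (auto simp: algebra_simps)
  qed
  have dK: "((\<lambda>z. q z * cutoff s z * gw z) has_derivative (\<lambda>h. (k1 z * gw z) * h + (k2 z * gw z) * cnj h)) (at z)" for z
    by (rule has_derivative_eq_rhs[OF has_derivative_mult[OF has_derivative_mult[OF zpoly_has_derivative[OF q] cutoff_has_derivative] dgw]])
       (auto simp: k1_def k2_def algebra_simps)
  have pk: "pgrow k1" "pgrow k2" unfolding k1_def[abs_def] k2_def[abs_def] by (intro pg)+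
  have 1: "(LINT z|lborel. (q z * cutoff s z + z * k1 z) * gw z) = 0"
  proof (rule integral_wirtinger_eq_0(1))
    fix z
    show "((\<lambda>z. z * (q z * cutoff s z * gw z)) has_derivative
        (\<lambda>h. (q z * cutoff s z + z * k1 z) * gw z * h + (z * k2 z * gw z) * cnj h)) (at z)"
      by (rule has_derivative_eq_rhs[OF has_derivative_mult[OF has_derivative_ident dK]]) (auto simp: algebra_simps)
    show "integrable lborel (\<lambda>z. z * (q z * cutoff s z * gw z))"
      using integrable_pgrow_gw[of "\<lambda>z. z * (q z * cutoff s z)"] pg by (simp add: mult.assoc)
  qed (intro integrable_pgrow_gw pg pk)+
  have 2: "(LINT z|lborel. (q z * cutoff s z + cnj z * k2 z) * gw z) = 0"
  proof (rule integral_wirtinger_eq_0(2))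
    fix z
    have c: "((\<lambda>z. cnj z) has_derivative (\<lambda>h. cnj h)) (at z)" by (auto intro!: derivative_eq_intros)
    show "((\<lambda>z. cnj z * (q z * cutoff s z * gw z)) has_derivative
        (\<lambda>h. (cnj z * k1 z * gw z) * h + (q z * cutoff s z + cnj z * k2 z) * gw z * cnj h)) (at z)"
      by (rule has_derivative_eq_rhs[OF has_derivative_mult[OF c dK]]) (auto simp: algebra_simps)
    show "integrable lborel (\<lambda>z. cnj z * (q z * cutoff s z * gw z))"
      using integrable_pgrow_gw[of "\<lambda>z. cnj z * (q z * cutoff s z)"] pg by (simp add: mult.assoc)
  qed (intro integrable_pgrow_gw pg pk)+
  \<comment> \<open>In \<open>z k1 - cnj z k2\<close> the derivatives of the radial factors cancel,
    and only the rotation derivative of \<open>q\<close> remains.\<close>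
  have "(LINT z|lborel. (q z * cutoff s z + z * k1 z) * gw z - (q z * cutoff s z + cnj z * k2 z) * gw z) = 0"
    by (subst Bochner_Integration.integral_diff) (auto intro!: integrable_pgrow_gw pg pk simp: 1 2)
  also have "(\<lambda>z. (q z * cutoff s z + z * k1 z) * gw z - (q z * cutoff s z + cnj z * k2 z) * gw z) = (\<lambda>z. d * (q z * cutoff s z * gw z))"
  proof
    fix z
    have "(q z * cutoff s z + z * k1 z) * gw z - (q z * cutoff s z + cnj z * k2 z) * gw z =
        (z * q1 z - cnj z * q2 z) * cutoff s z * gw z"
      unfolding k1_def k2_def by (simp add: algebra_simps)
    then show "(q z * cutoff s z + z * k1 z) * gw z - (q z * cutoff s z + cnj z * k2 z) * gw z = d * (q z * cutoff s z * gw z)"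
      by (simp add: e)
  qed
  finally have "(LINT z|lborel. q z * cutoff s z * gw z) = 0" using \<open>d \<noteq> 0\<close> by simp
  moreover have "(\<lambda>z. q z * cutoff s z) \<in> borel_measurable borel"
    by (intro pgrow_measurable pg)
  ultimately show ?thesis by (simp add: integral_gauss_measure)
qed

lemma tendsto_integral_cutoff:
  assumes F: "integrable gauss_measure F"
  shows "(\<lambda>N. LINT z|gauss_measure. F z * cutoff (1 / real (Suc N)) z) \<longlonglongrightarrow> integral\<^sup>L gauss_measure F"
proof (rule integral_dominated_convergence[where w = "\<lambda>z. norm (F z)"])
  have [measurable]: "F \<in> borel_measurable borel" using borel_measurable_integrable[OF F] by simp
  have [measurable]: "cutoff (1 / real (Suc N)) \<in> borel_measurable borel" for N
    by (rule pgrow_measurable[OF pgrow_cutoff(1)]) simp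
  show "F \<in> borel_measurable gauss_measure" by simp
  show "(\<lambda>z. F z * cutoff (1 / real (Suc N)) z) \<in> borel_measurable gauss_measure" for N
    unfolding measurable_gauss by measurable
  show "AE z in gauss_measure. norm (F z * cutoff (1 / real (Suc N)) z) \<le> norm (F z)" for N
    using cutoff_bounds(1)[of "1 / real (Suc N)"] by (intro AE_I2) (simp add: norm_mult mult_left_le del: of_nat_Suc)
  show "AE z in gauss_measure. (\<lambda>N. F z * cutoff (1 / real (Suc N)) z) \<longlonglongrightarrow> F z"
  proof (rule AE_I2)
    fix z
    have "(\<lambda>N. 1 / real (Suc N)) \<longlonglongrightarrow> 0"
      using LIMSEQ_inverse_real_of_nat by (simp add: inverse_eq_divide)
    then have "(\<lambda>N. F z * of_real ((max 0 (1 - (1 / real (Suc N)) * (cmod z)\<^sup>2))\<^sup>2)) \<longlonglongrightarrow> F z * of_real ((max 0 (1 - 0 * (cmod z)\<^sup>2))\<^sup>2)"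
      by (intro tendsto_intros)
    then show "(\<lambda>N. F z * cutoff (1 / real (Suc N)) z) \<longlonglongrightarrow> F z" by (simp add: cutoff_def)
  qed
qed (use F in simp)

lemma entire_power_series:
  assumes "g holomorphic_on UNIV"
  shows "(\<lambda>p. (deriv ^^ p) g 0 / fact p * z ^ p) sums g z"
    "summable (\<lambda>p. norm ((deriv ^^ p) g 0 / fact p * z ^ p))"
proof -
  have s: "(\<lambda>p. (deriv ^^ p) g 0 / fact p * w ^ p) sums g w" for w
    using holomorphic_power_series[of g 0 "cmod w + 1" w] holomorphic_on_subset[OF assms subset_UNIV]
    by (simp add: dist_norm)
  show "(\<lambda>p. (deriv ^^ p) g 0 / fact p * z ^ p) sums g z" by (rule s)
  show "summable (\<lambda>p. norm ((deriv ^^ p) g 0 / fact p * z ^ p))"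
  proof (rule powser_insidea[OF sums_summable[OF s[of "of_real (cmod z + 1)"]]])
    show "cmod z < cmod (complex_of_real (cmod z + 1))"
      unfolding norm_of_real using norm_ge_zero[of z] by linarith
  qed
qed

text \<open>
  On a disc the power series can be integrated termwise, and only the term with the rotational
  frequency of the Hermite polynomial contributes.
\<close>

lemma integral_monomial_cutoff_sums:
  assumes g: "g holomorphic_on UNIV" and s: "0 < s"
  shows "(\<lambda>p. (deriv ^^ p) g 0 / fact p * (LINT z|gauss_measure. cnj z ^ j * z ^ p * cnj (herm n m z) * cutoff s z))
    sums (LINT z|gauss_measure. cnj z ^ j * g z * cnj (herm n m z) * cutoff s z)"
proof -
  define c where "c p = (deriv ^^ p) g 0 / fact p" for p
  \<comment> \<open>The radius of the disc supporting the cutoff. There \<open>z ^ p\<close> is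
    bounded by \<open>R ^ p\<close>, so absolute convergence of the Taylor series at
    \<open>R\<close> dominates all terms.\<close>
  define R where "R = 1 / sqrt s"
  have R: "R > 0" using s by (simp add: R_def)
  define h where "h p z = c p * (cnj z ^ j * z ^ p * cnj (herm n m z) * cutoff s z)" for p z
  define k where "k z = cnj z ^ j * cnj (herm n m z)" for z
  have pk: "pgrow k"
    using zpoly_pgrow[OF zpoly_cnj[OF zpoly_power[of j]]] unfolding k_def[abs_def]
    by (intro pgrow_mult pgrow_cnj pgrow_herm) simp
  have pm: "pgrow (\<lambda>z. cnj z ^ j * z ^ p * cnj (herm n m z) * cutoff s z)" for p
    using zpoly_pgrow[OF zpoly_mult[OF zpoly_cnj[OF zpoly_power[of j]] zpoly_power[of p]]] s
    by (intro pgrow_mult[OF _ pgrow_cutoff(1)] pgrow_mult[OF _ pgrow_cnj[OF pgrow_herm]]) auto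
  have hi: "integrable gauss_measure (h p)" for p
    unfolding h_def[abs_def] by (intro integrable_mult_right integrable_pgrow pm)
  have hb: "norm (h p z) \<le> norm (c p) * R ^ p * norm (k z)" for p z
  proof -
    have "cmod z ^ p * cmod (cutoff s z) \<le> R ^ p * 1"
    proof (cases "cutoff s z = 0")
      case False
      then have "s * (cmod z)\<^sup>2 < 1" by (auto simp: cutoff_def max_def split: if_splits)
      then have "(cmod z)\<^sup>2 < R\<^sup>2" using s by (simp add: R_def power_divide field_simps)
      then have "cmod z \<le> R" using R power2_less_imp_less by fastforce
      then show ?thesis using R s by (intro mult_mono power_mono cutoff_bounds) auto
    qed (use R in simp)
    then have "norm (c p) * norm (k z) * (cmod z ^ p * cmod (cutoff s z)) \<le> norm (c p) * norm (k z) * (R ^ p * 1)"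
      by (intro mult_left_mono) auto
    then show ?thesis by (simp add: h_def k_def norm_mult norm_power mult_ac)
  qed
  have "norm ((deriv ^^ p) g 0 / fact p * of_real R ^ p) = norm (c p) * R ^ p" for p
    using R by (simp only: norm_mult norm_power norm_of_real c_def abs_of_pos)
  then have sc: "summable (\<lambda>p. norm (c p) * R ^ p)"
    using entire_power_series(2)[OF g, of "of_real R"] by (simp only:)
  have sn: "summable (\<lambda>p. norm (h p z))" for z
    by (rule summable_comparison_test'[OF summable_mult2[OF sc, of "norm (k z)"]]) (simp add: hb)
  have si: "summable (\<lambda>p. LINT z|gauss_measure. norm (h p z))"
  proof (rule summable_comparison_test'[OF summable_mult2[OF sc, of "LINT z|gauss_measure. norm (k z)"]])
    fix p
    have "(LINT z|gauss_measure. norm (h p z)) \<le> (LINT z|gauss_measure. norm (c p) * R ^ p * norm (k z))"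
      by (intro integral_mono integrable_norm hi integrable_mult_right integrable_pgrow pk hb)
    then show "norm (LINT z|gauss_measure. norm (h p z)) \<le> norm (c p) * R ^ p * (LINT z|gauss_measure. norm (k z))"
      by simp
  qed
  have hs: "(\<lambda>p. h p z) sums (cnj z ^ j * g z * cnj (herm n m z) * cutoff s z)" for z
    using sums_mult2[OF sums_mult[OF entire_power_series(1)[OF g, of z], of "cnj z ^ j"], of "cnj (herm n m z) * cutoff s z"]
    by (simp add: h_def c_def mult_ac)
  have "(\<lambda>p. integral\<^sup>L gauss_measure (h p)) sums (LINT z|gauss_measure. (\<Sum>p. h p z))"
    by (rule sums_integral[OF hi _ si]) (simp add: sn)
  moreover have "(\<Sum>p. h p z) = cnj z ^ j * g z * cnj (herm n m z) * cutoff s z" for z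
    using hs[of z] by (rule sums_unique[symmetric])
  moreover have "integral\<^sup>L gauss_measure (h p) = c p * (LINT z|gauss_measure. cnj z ^ j * z ^ p * cnj (herm n m z) * cutoff s z)" for p
    unfolding h_def[abs_def] by (rule integral_mult_right_zero)
  ultimately show ?thesis by (simp add: c_def)
qed

text \<open>The factor in front of the cutoff has rotation frequency
  \<open>(p - j) - (m - n)\<close>, nonzero by assumption.\<close>

lemma integral_monomial_cutoff_eq_0:
  assumes "p + n \<noteq> j + m" and s: "0 \<le> s"
  shows "(LINT z|gauss_measure. cnj z ^ j * z ^ p * cnj (herm n m z) * cutoff s z) = 0"
proof (rule integral_angular_eq_0[where d = "of_nat p - of_nat j - (of_nat m - of_nat n)"])
  have zp: "zpoly (\<lambda>z. cnj z ^ j * z ^ p) (\<lambda>z. cnj z ^ j * (of_nat p * z ^ (p - 1))) (\<lambda>z. of_nat j * (cnj z ^ (j - 1) * z ^ p))"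
    by (rule zpoly_cong[OF zpoly_mult[OF zpoly_cnj[OF zpoly_power[of j]] zpoly_power[of p]]]) (auto simp: mult_ac)
  show "zpoly (\<lambda>z. cnj z ^ j * z ^ p * cnj (herm n m z))
      (\<lambda>z. cnj z ^ j * (of_nat p * z ^ (p - 1)) * cnj (herm n m z) + cnj z ^ j * z ^ p * cnj (of_nat n * herm (n - 1) m z))
      (\<lambda>z. of_nat j * (cnj z ^ (j - 1) * z ^ p) * cnj (herm n m z) + cnj z ^ j * z ^ p * cnj (of_nat m * herm n (m - 1) z))"
    by (rule zpoly_mult[OF zp zpoly_cnj[OF zpoly_herm]])
  show "of_nat p - of_nat j - (of_nat m - of_nat n) \<noteq> (0::complex)"
  proof
    assume "of_nat p - of_nat j - (of_nat m - of_nat n) = (0::complex)"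
    then have "of_nat (p + n) = (of_nat (j + m) :: complex)" by (simp add: algebra_simps)
    then show False using assms(1) of_nat_eq_iff by blast
  qed
  fix z :: complex
  have e1: "z * (of_nat p * z ^ (p - 1)) = of_nat p * z ^ p" by (cases p) (auto simp: mult_ac)
  have e2: "cnj z * (of_nat j * cnj z ^ (j - 1)) = of_nat j * cnj z ^ j" by (cases j) auto
  have e3: "z * cnj (of_nat n * herm (n - 1) m z) - cnj z * cnj (of_nat m * herm n (m - 1) z) =
      - ((of_nat m - of_nat n) * cnj (herm n m z))"
    using arg_cong[OF herm_euler[of z m n], of cnj] by (simp add: algebra_simps)
  have "z * (cnj z ^ j * (of_nat p * z ^ (p - 1)) * cnj (herm n m z) + cnj z ^ j * z ^ p * cnj (of_nat n * herm (n - 1) m z)) -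
      cnj z * (of_nat j * (cnj z ^ (j - 1) * z ^ p) * cnj (herm n m z) + cnj z ^ j * z ^ p * cnj (of_nat m * herm n (m - 1) z))
    = cnj z ^ j * (z * (of_nat p * z ^ (p - 1))) * cnj (herm n m z) - (cnj z * (of_nat j * cnj z ^ (j - 1))) * z ^ p * cnj (herm n m z)
      + cnj z ^ j * z ^ p * (z * cnj (of_nat n * herm (n - 1) m z) - cnj z * cnj (of_nat m * herm n (m - 1) z))"
    by (simp add: algebra_simps)
  also have "\<dots> = (of_nat p - of_nat j - (of_nat m - of_nat n)) * (cnj z ^ j * z ^ p * cnj (herm n m z))"
    unfolding e1 e2 e3 by (simp add: algebra_simps)
  finally show "z * (cnj z ^ j * (of_nat p * z ^ (p - 1)) * cnj (herm n m z) + cnj z ^ j * z ^ p * cnj (of_nat n * herm (n - 1) m z)) -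
      cnj z * (of_nat j * (cnj z ^ (j - 1) * z ^ p) * cnj (herm n m z) + cnj z ^ j * z ^ p * cnj (of_nat m * herm n (m - 1) z))
    = (of_nat p - of_nat j - (of_nat m - of_nat n)) * (cnj z ^ j * z ^ p * cnj (herm n m z))" .
qed (rule s)

text \<open>Only the Taylor term with \<open>p + n = j + m\<close> survives the rotation argument.
  Removing the cutoff leaves the inner product of a monomial with a Hermite polynomial, nonzero only
  for \<open>j = n\<close> and \<open>p = m\<close>; its \<open>m!\<close> cancels the one in the
  Taylor coefficient.\<close>

lemma tendsto_integral_holomorphic_herm:
  assumes g: "g holomorphic_on UNIV" and j: "j \<le> n"
  shows "(\<lambda>N. LINT z|gauss_measure. cnj z ^ j * g z * cnj (herm n m z) * cutoff (1 / real (Suc N)) z)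
    \<longlonglongrightarrow> (if j = n then fact n * (deriv ^^ m) g 0 else 0)"
proof -
  define I where "I p s = (LINT z|gauss_measure. cnj z ^ j * z ^ p * cnj (herm n m z) * cutoff s z)" for p s
  have sums: "(\<lambda>p. (deriv ^^ p) g 0 / fact p * I p s) sums (LINT z|gauss_measure. cnj z ^ j * g z * cnj (herm n m z) * cutoff s z)"
    if "0 < s" for s
    unfolding I_def by (rule integral_monomial_cutoff_sums[OF g that])
  have I0: "I p s = 0" if "p + n \<noteq> j + m" "0 < s" for p s
    unfolding I_def using that by (intro integral_monomial_cutoff_eq_0) auto
  show ?thesis
  proof (cases "\<exists>p. p + n = j + m")
    case True
    then obtain p where p: "p + n = j + m" by blast
    have eq: "(LINT z|gauss_measure. cnj z ^ j * g z * cnj (herm n m z) * cutoff s z) = (deriv ^^ p) g 0 / fact p * I p s"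
      if "0 < s" for s
    proof (rule sums_unique2[OF sums[OF that]])
      have "(\<lambda>q. if q = p then (deriv ^^ q) g 0 / fact q * I q s else 0) sums ((deriv ^^ p) g 0 / fact p * I p s)"
        by (rule sums_single)
      moreover have "(\<lambda>q. (deriv ^^ q) g 0 / fact q * I q s) = (\<lambda>q. if q = p then (deriv ^^ q) g 0 / fact q * I q s else 0)"
        using I0[OF _ that] p by (auto simp: fun_eq_iff)
      ultimately show "(\<lambda>q. (deriv ^^ q) g 0 / fact q * I q s) sums ((deriv ^^ p) g 0 / fact p * I p s)" by simp
    qed
    have pgm: "pgrow (\<lambda>z. cnj z ^ j * z ^ p * cnj (herm n m z))"
      using zpoly_pgrow[OF zpoly_mult[OF zpoly_cnj[OF zpoly_power[of j]] zpoly_power[of p]]]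
      by (intro pgrow_mult[OF _ pgrow_cnj[OF pgrow_herm]]) auto
    have "(\<lambda>N. I p (1 / real (Suc N))) \<longlonglongrightarrow> ip (\<lambda>z. cnj z ^ j * z ^ p) (herm n m)"
      unfolding I_def ip_def by (rule tendsto_integral_cutoff[OF integrable_pgrow[OF pgm]])
    then have "(\<lambda>N. (deriv ^^ p) g 0 / fact p * I p (1 / real (Suc N))) \<longlonglongrightarrow>
        (deriv ^^ p) g 0 / fact p * ip (\<lambda>z. cnj z ^ j * z ^ p) (herm n m)"
      by (rule tendsto_mult_left)
    moreover have "(deriv ^^ p) g 0 / fact p * ip (\<lambda>z. cnj z ^ j * z ^ p) (herm n m) = (if j = n then fact n * (deriv ^^ m) g 0 else 0)"
      unfolding ip_monomial_herm[OF j] using p by auto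
    ultimately show ?thesis by (simp add: eq del: of_nat_Suc)
  next
    case False
    have "(LINT z|gauss_measure. cnj z ^ j * g z * cnj (herm n m z) * cutoff s z) = 0" if "0 < s" for s
      using sums[OF that] I0[OF _ that] False by (simp add: sums_iff)
    moreover have "j \<noteq> n" using False by (metis add.commute)
    ultimately show ?thesis by simp
  qed
qed

text \<open>The summands \<open>cnj z ^ j * g j z\<close> need not be square-integrable individually
  even though \<open>f\<close> is. The cutoff makes each of them integrable against the Hermite
  polynomial, so the sum is split first and the cutoff removed afterwards.\<close>

lemma ip_panal_herm:
  assumes f: "f \<in> L2_gauss" "f = (\<lambda>z. \<Sum>j<Suc n. cnj z ^ j * g j z)" and g: "\<And>j. g j holomorphic_on UNIV"
  shows "ip f (herm n m) = fact n * (deriv ^^ m) (g n) 0"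
proof (rule LIMSEQ_unique)
  show "(\<lambda>N. LINT z|gauss_measure. f z * cnj (herm n m z) * cutoff (1 / real (Suc N)) z) \<longlonglongrightarrow> ip f (herm n m)"
    unfolding ip_def by (rule tendsto_integral_cutoff[OF L2_integrable_mult[OF f(1) herm_L2]])
  have "integrable gauss_measure (\<lambda>z. cnj z ^ j * g j z * cnj (herm n m z) * cutoff (1 / real (Suc N)) z)" for j N
  proof -
    define R where "R = sqrt (real (Suc N))"
    have "continuous_on UNIV (\<lambda>z. cnj z ^ j * g j z * cnj (herm n m z) * cutoff (1 / real (Suc N)) z)"
      using pgrow_herm[of n m] pgrow_cutoff(1)[of "1 / real (Suc N)"] holomorphic_on_imp_continuous_on[OF g, of j]
      unfolding pgrow_def by (intro continuous_intros) auto
    moreover obtain C where C: "\<And>z. z \<in> cball 0 R \<Longrightarrow> norm (cnj z ^ j * g j z * cnj (herm n m z) * cutoff (1 / real (Suc N)) z) \<le> C"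
    proof -
      have "compact ((\<lambda>z. cnj z ^ j * g j z * cnj (herm n m z) * cutoff (1 / real (Suc N)) z) ` cball 0 R)"
        by (intro compact_continuous_image continuous_on_subset[OF calculation]) auto
      then obtain a where "\<forall>z\<in>cball 0 R. norm (cnj z ^ j * g j z * cnj (herm n m z) * cutoff (1 / real (Suc N)) z) \<le> a"
        by (auto dest!: compact_imp_bounded simp: bounded_iff simp del: of_nat_Suc mem_cball)
      then show ?thesis by (intro that[of a]) blast
    qed
    have "norm (cnj z ^ j * g j z * cnj (herm n m z) * cutoff (1 / real (Suc N)) z) \<le> max C 0" for z
    proof (cases "z \<in> cball 0 R")
      case True
      then show ?thesis using C[OF True] by simp
    next
      case False
      then have "R < cmod z" by simp
      then have "R\<^sup>2 < (cmod z)\<^sup>2" by (intro power_strict_mono) (auto simp: R_def)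
      then have "1 - 1 / real (Suc N) * (cmod z)\<^sup>2 \<le> 0" by (simp add: R_def field_simps)
      then have "cutoff (1 / real (Suc N)) z = 0" unfolding cutoff_def by (simp del: of_nat_Suc)
      then show ?thesis by simp
    qed
    ultimately show ?thesis by (intro integrable_pgrow pgrow_bounded)
  qed
  then have "(LINT z|gauss_measure. f z * cnj (herm n m z) * cutoff (1 / real (Suc N)) z) =
      (\<Sum>j<Suc n. LINT z|gauss_measure. cnj z ^ j * g j z * cnj (herm n m z) * cutoff (1 / real (Suc N)) z)" for N
    unfolding f(2) sum_distrib_right by (intro Bochner_Integration.integral_sum)
  moreover have "(\<lambda>N. \<Sum>j<Suc n. LINT z|gauss_measure. cnj z ^ j * g j z * cnj (herm n m z) * cutoff (1 / real (Suc N)) z)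
      \<longlonglongrightarrow> (\<Sum>j<Suc n. if j = n then fact n * (deriv ^^ m) (g j) 0 else 0)"
    by (intro tendsto_sum tendsto_integral_holomorphic_herm g) auto
  ultimately show "(\<lambda>N. LINT z|gauss_measure. f z * cnj (herm n m z) * cutoff (1 / real (Suc N)) z) \<longlonglongrightarrow> fact n * (deriv ^^ m) (g n) 0"
    by simp
qed

lemma ip_polyfock_herm_eq_0:
  assumes "f \<in> polyfock n"
  shows "ip f (herm n m) = 0"
proof -
  have f: "f \<in> L2_gauss" "panal n f" using assms by (auto simp: polyfock_iff)
  then obtain g where g: "\<And>j. g j holomorphic_on UNIV" "f = (\<lambda>z. \<Sum>j<n. cnj z ^ j * g j z)"
    unfolding panal_def by blast
  define g' where "g' j z = (if j < n then g j z else 0)" for j z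
  have hol: "g' j holomorphic_on UNIV" for j unfolding g'_def[abs_def] using g(1) by (cases "j < n") auto
  have "ip f (herm n m) = fact n * (deriv ^^ m) (g' n) 0"
    by (rule ip_panal_herm[OF f(1) _ hol]) (auto simp: g'_def g(2))
  also have "(deriv ^^ m) (g' n) 0 = 0" unfolding g'_def[abs_def] by (cases m) auto
  finally show ?thesis by simp
qed

text \<open>\<open>polyfock 0\<close> contains only the zero function, so the separate case
  \<open>k = 1\<close> of the definition fits the general pattern.\<close>

lemma true_polyfock_Suc: "true_polyfock (Suc n) = {f \<in> polyfock (Suc n). \<forall>g\<in>polyfock n. ip f g = 0}"
proof (cases n)
  case 0
  have "ip f g = 0" if "g \<in> polyfock 0" for f g
    using that by (auto simp: polyfock_iff panal_def ip_def)
  then show ?thesis using 0 by (auto simp: true_polyfock_def)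
qed (auto simp: true_polyfock_def)

text \<open>By \<open>ip_panal_herm\<close> the top coefficient \<open>g n\<close> has vanishing
  Taylor coefficients, so \<open>f\<close> drops to order \<open>n\<close> and is orthogonal to
  itself.\<close>

lemma true_polyfock_herm_eq_0:
  assumes f: "f \<in> true_polyfock (Suc n)" and z: "\<And>m. ip f (herm n m) = 0"
  shows "f = (\<lambda>z. 0)"
proof -
  have f': "f \<in> L2_gauss" "panal (Suc n) f" "\<And>g. g \<in> polyfock n \<Longrightarrow> ip f g = 0"
    using f by (auto simp: true_polyfock_Suc polyfock_iff)
  obtain g where g: "\<And>j. g j holomorphic_on UNIV" "f = (\<lambda>z. \<Sum>j<Suc n. cnj z ^ j * g j z)"
    using f'(2) unfolding panal_def by blast
  have "(deriv ^^ m) (g n) 0 = 0" for m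
    using z[of m] unfolding ip_panal_herm[OF f'(1) g(2) g(1)] by simp
  then have "g n z = 0" for z using entire_power_series(1)[OF g(1), of n z] by (simp add: sums_iff)
  then have "f = (\<lambda>z. \<Sum>j<n. cnj z ^ j * g j z)" by (simp add: g(2))
  then have "panal n f" by (rule panalI[where g = g, OF g(1)])
  then have "f \<in> polyfock n" using f'(1) by (simp add: polyfock_iff)
  then have "ip f f = 0" by (rule f'(3))
  then show ?thesis by (rule continuous_L2_zero[OF f'(1) panal_partials(5)[OF f'(2)]])
qed

text \<open>A pointwise weighted arithmetic-geometric mean, integrated and then optimized over the
  weight \<open>t\<close>.\<close>

lemma ip_cauchy_schwarz:
  assumes "f \<in> L2_gauss" "g \<in> L2_gauss"
  shows "cmod (ip f g) \<le> nrm f * nrm g"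
proof -
  define I where "I = (LINT z|gauss_measure. norm (f z * cnj (g z)))"
  have le: "2 * I \<le> t * (nrm f)\<^sup>2 + (nrm g)\<^sup>2 / t" if t: "t > 0" for t
  proof -
    have "2 * I = (LINT z|gauss_measure. 2 * norm (f z * cnj (g z)))" by (simp add: I_def)
    also have "\<dots> \<le> (LINT z|gauss_measure. t * (cmod (f z))\<^sup>2 + (cmod (g z))\<^sup>2 / t)"
    proof (rule integral_mono)
      show "integrable gauss_measure (\<lambda>z. 2 * norm (f z * cnj (g z)))"
        by (intro integrable_mult_right integrable_norm L2_integrable_mult assms)
      show "integrable gauss_measure (\<lambda>z. t * (cmod (f z))\<^sup>2 + (cmod (g z))\<^sup>2 / t)"
        by (intro Bochner_Integration.integrable_add integrable_mult_right integrable_divide L2_integrable assms)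
      fix z
      have "0 \<le> (sqrt t * cmod (f z) - cmod (g z) / sqrt t)\<^sup>2" by simp
      also have "\<dots> = t * (cmod (f z))\<^sup>2 + (cmod (g z))\<^sup>2 / t - 2 * cmod (f z) * cmod (g z)"
        using t by (simp add: power2_diff power_mult_distrib power_divide)
      finally show "2 * norm (f z * cnj (g z)) \<le> t * (cmod (f z))\<^sup>2 + (cmod (g z))\<^sup>2 / t" by (simp add: norm_mult)
    qed
    also have "\<dots> = t * (nrm f)\<^sup>2 + (nrm g)\<^sup>2 / t"
      unfolding nrm_square by (subst Bochner_Integration.integral_add) (auto intro!: integrable_mult_right integrable_divide L2_integrable assms)
    finally show ?thesis .
  qed
  have "I \<le> nrm f * nrm g"
  proof (rule field_le_epsilon)
    fix e :: real assume e: "0 < e"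
    define d where "d = e / (nrm f + nrm g + 1)"
    have nn: "0 \<le> nrm f" "0 \<le> nrm g" by (rule nrm_nonneg)+
    have d: "d > 0" using e nn by (simp add: d_def)
    \<comment> \<open>The optimal weight is \<open>nrm g / nrm f\<close>; adding \<open>d\<close> to
      both norms keeps it defined and positive when one of them vanishes, at a cost of at most
      \<open>e\<close>.\<close>
    define t where "t = (nrm g + d) / (nrm f + d)"
    have t: "t > 0" using d nn by (simp add: t_def)
    have "t * (nrm f)\<^sup>2 \<le> (nrm g + d) * nrm f"
    proof -
      have "t * (nrm f)\<^sup>2 = (nrm g + d) * nrm f * (nrm f / (nrm f + d))" by (simp add: t_def power2_eq_square)
      also have "\<dots> \<le> (nrm g + d) * nrm f * 1" using d nn by (intro mult_left_mono) auto
      finally show ?thesis by simp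
    qed
    moreover have "(nrm g)\<^sup>2 / t \<le> (nrm f + d) * nrm g"
    proof -
      have "(nrm g)\<^sup>2 / t = (nrm f + d) * nrm g * (nrm g / (nrm g + d))" by (simp add: t_def power2_eq_square)
      also have "\<dots> \<le> (nrm f + d) * nrm g * 1" using d nn by (intro mult_left_mono) auto
      finally show ?thesis by simp
    qed
    ultimately have "2 * I \<le> (nrm g + d) * nrm f + (nrm f + d) * nrm g" using le[OF t] by linarith
    also have "\<dots> = 2 * (nrm f * nrm g) + d * (nrm f + nrm g)" by (simp add: algebra_simps)
    also have "d * (nrm f + nrm g) \<le> 2 * e"
    proof -
      have "d * (nrm f + nrm g) \<le> d * (nrm f + nrm g + 1)" using d by (intro mult_left_mono) auto
      also have "\<dots> = e" using nn by (simp add: d_def)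
      finally show ?thesis using e by simp
    qed
    finally show "I \<le> nrm f * nrm g + e" by simp
  qed
  moreover have "cmod (ip f g) \<le> I" unfolding ip_def I_def by (rule integral_norm_bound)
  ultimately show ?thesis by simp
qed

text \<open>Hermite series are first constructed as pointwise sums; Fatou's lemma supplies their
  square-integrability and norm bounds.\<close>

lemma L2_fatou:
  assumes G: "\<And>N. G N \<in> L2_gauss" and lim: "\<And>z. (\<lambda>N. G N z) \<longlonglongrightarrow> F z"
    and B: "\<And>N. (nrm (G N))\<^sup>2 \<le> B"
  shows "F \<in> L2_gauss" "(nrm F)\<^sup>2 \<le> B"
proof -
  have [measurable]: "G N \<in> borel_measurable borel" for N by (rule L2_measurable[OF G])
  have [measurable]: "F \<in> borel_measurable borel"
    by (rule borel_measurable_LIMSEQ_metric[where f = G]) (use lim in auto)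
  have B0: "0 \<le> B" using order_trans[OF zero_le_power2 B[of 0]] .
  have nnN: "(\<integral>\<^sup>+ z. ennreal ((cmod (G N z))\<^sup>2) \<partial>gauss_measure) \<le> ennreal B" for N
    using nn_integral_eq_integral[OF L2_integrable[OF G[of N]]] B[of N] by (simp add: nrm_square ennreal_leI)
  have "(\<integral>\<^sup>+ z. ennreal ((cmod (F z))\<^sup>2) \<partial>gauss_measure) = (\<integral>\<^sup>+ z. liminf (\<lambda>N. ennreal ((cmod (G N z))\<^sup>2)) \<partial>gauss_measure)"
  proof (rule nn_integral_cong)
    fix z
    have "(\<lambda>N. ennreal ((cmod (G N z))\<^sup>2)) \<longlonglongrightarrow> ennreal ((cmod (F z))\<^sup>2)"
      by (intro tendsto_ennrealI tendsto_intros lim)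
    then show "ennreal ((cmod (F z))\<^sup>2) = liminf (\<lambda>N. ennreal ((cmod (G N z))\<^sup>2))"
      by (rule lim_imp_Liminf[OF sequentially_bot, symmetric])
  qed
  also have "\<dots> \<le> liminf (\<lambda>N. \<integral>\<^sup>+ z. ennreal ((cmod (G N z))\<^sup>2) \<partial>gauss_measure)"
    by (rule nn_integral_liminf) (simp add: measurable_gauss)
  also have "\<dots> \<le> ennreal B"
    by (rule order_trans[OF Liminf_mono[where g = "\<lambda>_. ennreal B"]]) (simp_all add: nnN Liminf_const)
  finally have fin: "(\<integral>\<^sup>+ z. ennreal ((cmod (F z))\<^sup>2) \<partial>gauss_measure) \<le> ennreal B" .
  have i: "integrable gauss_measure (\<lambda>z. (cmod (F z))\<^sup>2)"
  proof (rule integrableI_nonneg)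
    show "(\<integral>\<^sup>+ z. ennreal ((cmod (F z))\<^sup>2) \<partial>gauss_measure) < \<infinity>"
      using fin by (rule le_less_trans) simp
  qed (auto simp: measurable_gauss)
  then show "F \<in> L2_gauss" by (simp add: L2_gauss_def)
  have "ennreal ((nrm F)\<^sup>2) = (\<integral>\<^sup>+ z. ennreal ((cmod (F z))\<^sup>2) \<partial>gauss_measure)"
    unfolding nrm_square by (rule nn_integral_eq_integral[symmetric, OF i]) simp
  then have "ennreal ((nrm F)\<^sup>2) \<le> ennreal B" using fin by (simp only:)
  then show "(nrm F)\<^sup>2 \<le> B" using B0 by (simp only: ennreal_le_iff)
qed

section \<open>The Hermite basis of the true polyanalytic Fock space\<close>

definition hb :: "nat \<Rightarrow> nat \<Rightarrow> complex \<Rightarrow> complex" where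
  "hb n m z = herm n m z / of_real (sqrt (fact n * fact m))"

lemma hb_eq: "hb n m = (\<lambda>z. (1 / of_real (sqrt (fact n * fact m))) * herm n m z)"
  by (rule ext) (simp add: hb_def)

lemma pgrow_hb: "pgrow (hb n m)"
  unfolding hb_eq by (intro pgrow_mult pgrow_const pgrow_herm)

lemma hb_L2: "hb n m \<in> L2_gauss"
  by (rule pgrow_L2[OF pgrow_hb])

lemma ip_hb: "ip (hb n m) (hb n l) = (if m = l then 1 else 0)"
proof -
  have "sqrt (fact n * fact m) * sqrt (fact n * fact m) = fact n * fact m" by simp
  then have "complex_of_real (sqrt (fact n * fact m)) * of_real (sqrt (fact n * fact m)) = fact n * fact m"
    by (metis of_real_fact of_real_mult)
  then show ?thesis
    unfolding hb_eq ip_cmult_left ip_cmult_right by (auto simp: ip_herm simp del: of_real_mult real_sqrt_mult)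
qed

lemma L2_sum: "(\<And>i. i \<in> I \<Longrightarrow> f i \<in> L2_gauss) \<Longrightarrow> (\<lambda>z. \<Sum>i\<in>I. f i z) \<in> L2_gauss"
  by (induction I rule: infinite_finite_induct) (auto intro!: L2_closed[OF herm_L2 herm_L2] L2_closed(1))

definition hsum :: "nat \<Rightarrow> (nat \<Rightarrow> complex) \<Rightarrow> nat set \<Rightarrow> complex \<Rightarrow> complex" where
  "hsum n c I z = (\<Sum>m\<in>I. c m * hb n m z)"

lemma hsum_L2: "hsum n c I \<in> L2_gauss"
  unfolding hsum_def[abs_def] by (intro L2_sum L2_closed(3)[OF hb_L2 hb_L2])

lemma ip_hsum_left: "f \<in> L2_gauss \<Longrightarrow> ip (hsum n c I) f = (\<Sum>m\<in>I. c m * ip (hb n m) f)"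
  unfolding hsum_def[abs_def]
  by (subst ip_sum_left) (auto intro!: L2_closed(3)[OF hb_L2 hb_L2] simp: ip_cmult_left)

lemma ip_hsum_hb: "finite I \<Longrightarrow> ip (hsum n c I) (hb n m) = (if m \<in> I then c m else 0)"
proof -
  assume "finite I"
  moreover have "ip (hsum n c I) (hb n m) = (\<Sum>i\<in>I. if i = m then c i else 0)"
    unfolding ip_hsum_left[OF hb_L2] by (intro sum.cong) (auto simp: ip_hb)
  ultimately show ?thesis by simp
qed

lemma nrm_hsum:
  assumes "finite I"
  shows "(nrm (hsum n c I))\<^sup>2 = (\<Sum>m\<in>I. (cmod (c m))\<^sup>2)"
proof -
  have "complex_of_real ((nrm (hsum n c I))\<^sup>2) = ip (hsum n c I) (hsum n c I)"
    unfolding ip_self nrm_square ..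
  also have "\<dots> = (\<Sum>m\<in>I. c m * cnj (ip (hsum n c I) (hb n m)))"
    unfolding ip_hsum_left[OF hsum_L2] by (simp add: ip_commute[of "hb n _" "hsum n c I"])
  also have "\<dots> = (\<Sum>m\<in>I. of_real ((cmod (c m))\<^sup>2))"
    by (intro sum.cong refl) (simp only: ip_hsum_hb[OF assms] if_True complex_norm_square)
  also have "\<dots> = of_real (\<Sum>m\<in>I. (cmod (c m))\<^sup>2)" by simp
  finally show ?thesis unfolding of_real_eq_iff .
qed

section \<open>Hermite series\<close>

definition entire_coeffs :: "(nat \<Rightarrow> complex) \<Rightarrow> bool" where
  "entire_coeffs a \<longleftrightarrow> (\<forall>r\<ge>0. summable (\<lambda>m. cmod (a m) * r ^ m))"

text \<open>By the recursion, the series of level \<open>n + 1\<close> is \<open>cnj z\<close> times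
  that of level \<open>n\<close> minus a level \<open>n\<close> series with coefficients
  \<open>(m+1) a (m+1)\<close>. The growth condition is chosen to survive this shift.\<close>

lemma herm_series:
  "entire_coeffs a \<Longrightarrow> \<exists>f. panal (Suc n) f \<and> (\<forall>z. (\<lambda>m. a m * herm n m z) sums f z)"
proof (induction n arbitrary: a)
  case 0
  define f where "f z = (\<Sum>m. a m * z ^ m)" for z
  have s: "(\<lambda>m. a m * z ^ m) sums f z" for z
  proof -
    have "summable (\<lambda>m. norm (a m * z ^ m))"
      using 0 unfolding entire_coeffs_def by (simp add: norm_mult norm_power)
    then show ?thesis unfolding f_def by (rule summable_sums[OF summable_norm_cancel])
  qed
  have "f holomorphic_on UNIV"
  proof (rule holomorphic_onI)
    fix z
    have "f holomorphic_on ball 0 (cmod z + 1)"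
      by (rule power_series_holomorphic[where a = a]) (simp add: s)
    then have "f field_differentiable at z"
      by (rule holomorphic_on_imp_differentiable_at) auto
    then show "f field_differentiable at z within UNIV" by simp
  qed
  then show ?case using s panal_holomorphic[of f] by auto
next
  case (Suc n)
  define b where "b m = of_nat (Suc m) * a (Suc m)" for m
  have "entire_coeffs b"
    unfolding entire_coeffs_def
  proof (intro allI impI)
    fix r :: real assume r: "0 \<le> r"
    \<comment> \<open>Enlarging \<open>r\<close> to \<open>2 (r + 1)\<close> absorbs the new factor,
      as \<open>m + 1\<close> is at most \<open>2 ^ (m + 1)\<close>; the added 1 allows the exponent
      of \<open>r\<close> to be raised by one.\<close>
    have "summable (\<lambda>m. cmod (a m) * (2 * (r + 1)) ^ m)"
      using Suc.prems r unfolding entire_coeffs_def by simp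
    then have "summable (\<lambda>m. cmod (a (Suc m)) * (2 * (r + 1)) ^ Suc m)"
      by (subst summable_Suc_iff)
    then show "summable (\<lambda>m. cmod (b m) * r ^ m)"
    proof (rule summable_comparison_test')
      fix m
      have "real (Suc m) \<le> 2 ^ Suc m" using of_nat_less_two_power[of "Suc m", where 'a = real] by (rule less_imp_le)
      moreover have "r ^ m \<le> (r + 1) ^ Suc m"
      proof -
        have "r ^ m \<le> (r + 1) ^ m" using r by (intro power_mono) auto
        also have "\<dots> \<le> (r + 1) ^ Suc m" using r by (intro power_increasing) auto
        finally show ?thesis .
      qed
      ultimately have "real (Suc m) * r ^ m \<le> 2 ^ Suc m * (r + 1) ^ Suc m" using r by (intro mult_mono) auto
      then have "cmod (a (Suc m)) * (real (Suc m) * r ^ m) \<le> cmod (a (Suc m)) * (2 ^ Suc m * (r + 1) ^ Suc m)"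
        by (rule mult_left_mono) simp
      then show "norm (cmod (b m) * r ^ m) \<le> cmod (a (Suc m)) * (2 * (r + 1)) ^ Suc m"
        unfolding b_def norm_mult norm_of_nat power_mult_distrib using r by (simp add: mult_ac)
    qed
  qed
  then obtain g where g: "panal (Suc n) g" "\<And>z. (\<lambda>m. b m * herm n m z) sums g z" using Suc.IH by blast
  obtain f where f: "panal (Suc n) f" "\<And>z. (\<lambda>m. a m * herm n m z) sums f z" using Suc.IH[OF Suc.prems] by blast
  have "(\<lambda>m. a m * herm (Suc n) m z) sums (cnj z * f z - g z)" for z
  proof -
    have "(\<lambda>m. a (Suc m) * (of_nat (Suc m) * herm n (Suc m - 1) z)) sums g z"
      using g(2)[of z] by (simp add: b_def mult_ac del: of_nat_Suc)
    then have "(\<lambda>m. a m * (of_nat m * herm n (m - 1) z)) sums (g z + a 0 * (of_nat 0 * herm n (0 - 1) z))"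
      by (rule sums_Suc[where f = "\<lambda>m. a m * (of_nat m * herm n (m - 1) z)"])
    then have "(\<lambda>m. a m * (of_nat m * herm n (m - 1) z)) sums g z" by simp
    from sums_diff[OF sums_mult[OF f(2)[of z], of "cnj z"] this] show ?thesis
      by (simp add: algebra_simps)
  qed
  moreover have "panal (Suc (Suc n)) (\<lambda>z. cnj z * f z - g z)"
    by (intro panal_diff panal_cnj_mult f panal_mono[OF g(1)]) simp
  ultimately show ?case by blast
qed

lemma power_div_fact_le_exp:
  assumes "0 \<le> (t::real)"
  shows "t ^ N / fact N \<le> exp t"
  using sum_le_suminf[OF summable_exp_generic[of t], of "{N}"] assms
  by (simp add: exp_def divide_inverse mult.commute)

lemma entire_coeffs_ell2: "entire_coeffs (\<lambda>m. coord x m / of_real (sqrt (fact n * fact m)))"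
  unfolding entire_coeffs_def
proof (intro allI impI)
  fix r :: real assume r: "0 \<le> r"
  \<comment> \<open>\<open>(2 r^2)^m / m!\<close> is at most \<open>exp (2 r^2)\<close>; taking
    roots, \<open>r^m / sqrt (m!)\<close> is at most \<open>exp (r^2)\<close> times
    \<open>(1 / sqrt 2)^m\<close>, which is geometric.\<close>
  have "summable (\<lambda>m. (norm x * exp (r\<^sup>2)) * (1 / sqrt 2) ^ m)"
    by (intro summable_mult summable_geometric) simp
  then show "summable (\<lambda>m. cmod (coord x m / of_real (sqrt (fact n * fact m))) * r ^ m)"
  proof (rule summable_comparison_test')
    fix m
    have "((sqrt 2 * r) ^ m)\<^sup>2 = ((sqrt 2 * r)\<^sup>2) ^ m" by (simp only: power_mult[symmetric] mult.commute)
    also have "(sqrt 2 * r)\<^sup>2 = 2 * r\<^sup>2" by (simp add: power_mult_distrib)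
    finally have "((sqrt 2 * r) ^ m / sqrt (fact m))\<^sup>2 = (2 * r\<^sup>2) ^ m / fact m"
      by (simp add: power_divide)
    also have "\<dots> \<le> exp (2 * r\<^sup>2)" by (rule power_div_fact_le_exp) simp
    also have "\<dots> = (exp (r\<^sup>2))\<^sup>2" by (simp add: exp_double)
    finally have "(sqrt 2 * r) ^ m / sqrt (fact m) \<le> exp (r\<^sup>2)" by (rule power2_le_imp_le) simp
    then have A: "r ^ m / sqrt (fact m) \<le> exp (r\<^sup>2) * (1 / sqrt 2) ^ m"
      by (simp add: power_mult_distrib power_divide field_simps)
    have B: "1 \<le> sqrt (fact n)" by (simp add: fact_ge_1)
    have "cmod (coord x m / of_real (sqrt (fact n * fact m))) * r ^ m = cmod (coord x m) * (r ^ m / sqrt (fact m)) / sqrt (fact n)"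
    proof -
      have nf: "cmod (complex_of_real (sqrt (fact n * fact m))) = sqrt (fact n) * sqrt (fact m)"
        unfolding norm_of_real by (simp add: real_sqrt_mult)
      show ?thesis unfolding norm_divide nf by (simp add: mult.commute)
    qed
    also have "\<dots> \<le> cmod (coord x m) * (r ^ m / sqrt (fact m)) / 1"
      using r B by (intro divide_left_mono) auto
    also have "\<dots> \<le> norm x * (exp (r\<^sup>2) * (1 / sqrt 2) ^ m)"
      unfolding div_by_1 using r by (intro mult_mono norm_coord_le A) auto
    finally show "norm (cmod (coord x m / of_real (sqrt (fact n * fact m))) * r ^ m) \<le> (norm x * exp (r\<^sup>2)) * (1 / sqrt 2) ^ m"
      using r by (simp add: mult.assoc)
  qed
qed

definition emb :: "nat \<Rightarrow> ell2 \<Rightarrow> complex \<Rightarrow> complex" where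
  "emb n x z = (\<Sum>m. coord x m * hb n m z)"

lemma emb_sums: "(\<lambda>m. coord x m * hb n m z) sums emb n x z" and panal_emb: "panal (Suc n) (emb n x)"
proof -
  obtain f where f: "panal (Suc n) f" "\<And>z. (\<lambda>m. coord x m / of_real (sqrt (fact n * fact m)) * herm n m z) sums f z"
    using herm_series[OF entire_coeffs_ell2[of x n], of n] by blast
  have s: "(\<lambda>m. coord x m * hb n m z) sums f z" for z using f(2)[of z] by (simp add: hb_def)
  have "emb n x = f" unfolding emb_def[abs_def] by (rule ext) (rule sums_unique[OF s, symmetric])
  then show "(\<lambda>m. coord x m * hb n m z) sums emb n x z" "panal (Suc n) (emb n x)" using s f by auto
qed

lemma emb_add: "emb n (x + y) = (\<lambda>z. emb n x z + emb n y z)"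
proof
  fix z
  show "emb n (x + y) z = emb n x z + emb n y z"
    by (rule sums_unique2[OF emb_sums]) (use sums_add[OF emb_sums emb_sums] in \<open>simp add: distrib_right\<close>)
qed

lemma emb_scaleC: "emb n (c *\<^sub>C x) = (\<lambda>z. c * emb n x z)"
proof
  fix z
  show "emb n (c *\<^sub>C x) z = c * emb n x z"
    by (rule sums_unique2[OF emb_sums]) (use sums_mult[OF emb_sums] in \<open>simp add: mult.assoc\<close>)
qed

lemma emb_diff: "emb n (x - y) = (\<lambda>z. emb n x z - emb n y z)"
  using emb_add[of n x "(-1) *\<^sub>C y", unfolded emb_scaleC] by (simp add: scaleC_simps(5))

lemma emb_0: "emb n 0 = (\<lambda>z. 0)"
  using emb_scaleC[of n 0 0] by (simp add: scaleC_simps)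

lemma emb_unit_vec: "emb n (unit_vec m) = hb n m"
proof
  fix z
  have "(\<lambda>l. if l = m then hb n l z else 0) sums hb n m z" by (rule sums_single)
  moreover have "(\<lambda>l. coord (unit_vec m) l * hb n l z) = (\<lambda>l. if l = m then hb n l z else 0)"
    by (auto simp: coord_unit_vec)
  ultimately show "emb n (unit_vec m) z = hb n m z" using emb_sums[of "unit_vec m" n z] by (metis sums_unique2)
qed

text \<open>The tail is the pointwise limit of finite sums of orthonormal functions, whose norms are
  bounded by the tail of the coefficients; \<open>L2_fatou\<close> passes the bound to the
  limit.\<close>

lemma emb_tail:
  shows "(\<lambda>z. emb n x z - hsum n (coord x) {..<M} z) \<in> L2_gauss"
    "(nrm (\<lambda>z. emb n x z - hsum n (coord x) {..<M} z))\<^sup>2 \<le> (\<Sum>m. (cmod (coord x (m + M)))\<^sup>2)"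
proof -
  have lim: "(\<lambda>N. hsum n (coord x) {M..<M + N} z) \<longlonglongrightarrow> emb n x z - hsum n (coord x) {..<M} z" for z
  proof -
    have "(\<lambda>N. (\<Sum>m<N. coord x m * hb n m z)) \<longlonglongrightarrow> emb n x z" using emb_sums by (simp add: sums_def)
    then have "(\<lambda>N. (\<Sum>m<N + M. coord x m * hb n m z)) \<longlonglongrightarrow> emb n x z" by (rule LIMSEQ_ignore_initial_segment)
    from tendsto_diff[OF this tendsto_const[of "hsum n (coord x) {..<M} z"]]
    have "(\<lambda>N. (\<Sum>m<N + M. coord x m * hb n m z) - hsum n (coord x) {..<M} z) \<longlonglongrightarrow> emb n x z - hsum n (coord x) {..<M} z" .
    moreover have "(\<Sum>m<N + M. coord x m * hb n m z) - hsum n (coord x) {..<M} z = hsum n (coord x) {M..<M + N} z" for N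
    proof -
      have "{..<N + M} = {..<M} \<union> {M..<M + N}" by auto
      then show ?thesis unfolding hsum_def by (simp add: sum.union_disjoint ivl_disj_int)
    qed
    ultimately show ?thesis by simp
  qed
  have B: "(nrm (hsum n (coord x) {M..<M + N}))\<^sup>2 \<le> (\<Sum>m. (cmod (coord x (m + M)))\<^sup>2)" for N
  proof -
    have "(nrm (hsum n (coord x) {M..<M + N}))\<^sup>2 = (\<Sum>m\<in>{M..<M + N}. (cmod (coord x m))\<^sup>2)"
      by (rule nrm_hsum) simp
    also have "\<dots> = (\<Sum>m<N. (cmod (coord x (m + M)))\<^sup>2)"
      by (rule sum.reindex_bij_witness[where i = "\<lambda>m. m + M" and j = "\<lambda>m. m - M"]) auto
    also have "\<dots> \<le> (\<Sum>m. (cmod (coord x (m + M)))\<^sup>2)"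
      by (rule sum_le_suminf[OF summable_ignore_initial_segment[OF summable_coord]]) auto
    finally show ?thesis .
  qed
  show "(\<lambda>z. emb n x z - hsum n (coord x) {..<M} z) \<in> L2_gauss"
    "(nrm (\<lambda>z. emb n x z - hsum n (coord x) {..<M} z))\<^sup>2 \<le> (\<Sum>m. (cmod (coord x (m + M)))\<^sup>2)"
    using L2_fatou[OF hsum_L2 lim B] by auto
qed

lemma emb_L2: "emb n x \<in> L2_gauss"
  using emb_tail(1)[of n x 0] by (simp add: hsum_def)

text \<open>The norm estimate for the tail and Cauchy-Schwarz allow the inner product to be taken
  termwise.\<close>

lemma ip_emb_sums:
  assumes f: "f \<in> L2_gauss"
  shows "(\<lambda>m. coord x m * ip (hb n m) f) sums ip (emb n x) f"
proof -
  define t where "t M = (\<Sum>m. (cmod (coord x (m + M)))\<^sup>2)" for M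
  have t0: "t \<longlonglongrightarrow> 0" unfolding t_def by (rule suminf_exist_split2[OF summable_coord])
  have le: "norm (ip (emb n x) f - ip (hsum n (coord x) {..<M}) f) \<le> sqrt (t M) * nrm f" for M
  proof -
    have "ip (emb n x) f - ip (hsum n (coord x) {..<M}) f = ip (\<lambda>z. emb n x z - hsum n (coord x) {..<M} z) f"
      by (rule ip_diff_left[OF emb_L2 hsum_L2 f, symmetric])
    also have "norm \<dots> \<le> nrm (\<lambda>z. emb n x z - hsum n (coord x) {..<M} z) * nrm f"
      by (rule ip_cauchy_schwarz[OF emb_tail(1) f])
    also have "\<dots> \<le> sqrt (t M) * nrm f"
      using emb_tail(2)[of n x M] unfolding t_def
      by (intro mult_right_mono nrm_nonneg) (rule real_le_rsqrt)
    finally show ?thesis .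
  qed
  have lim: "(\<lambda>M. sqrt (t M) * nrm f) \<longlonglongrightarrow> 0"
    using tendsto_mult_left_zero[OF tendsto_real_sqrt[OF t0, simplified]] .
  have "(\<lambda>M. ip (emb n x) f - ip (hsum n (coord x) {..<M}) f) \<longlonglongrightarrow> 0"
    by (rule Lim_null_comparison[OF always_eventually[OF allI[OF le]] lim])
  from tendsto_diff[OF tendsto_const[of "ip (emb n x) f"] this]
  have "(\<lambda>M. ip (hsum n (coord x) {..<M}) f) \<longlonglongrightarrow> ip (emb n x) f" by simp
  then show ?thesis unfolding sums_def ip_hsum_left[OF f] .
qed

lemma ip_emb_hb: "ip (emb n x) (hb n m) = coord x m"
proof (rule sums_unique2[OF ip_emb_sums[OF hb_L2]])
  have "(\<lambda>l. if l = m then coord x l else 0) sums coord x m" by (rule sums_single)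
  moreover have "(\<lambda>l. coord x l * ip (hb n l) (hb n m)) = (\<lambda>l. if l = m then coord x l else 0)"
    by (auto simp: ip_hb)
  ultimately show "(\<lambda>l. coord x l * ip (hb n l) (hb n m)) sums coord x m" by simp
qed

lemma emb_mem: "emb n x \<in> true_polyfock (Suc n)"
  unfolding true_polyfock_Suc
proof (intro CollectI conjI ballI)
  show "emb n x \<in> polyfock (Suc n)" by (simp add: polyfock_iff emb_L2 panal_emb)
  fix g assume g: "g \<in> polyfock n"
  then have gL: "g \<in> L2_gauss" by (simp add: polyfock_iff)
  have "ip (hb n m) g = 0" for m
    using ip_polyfock_herm_eq_0[OF g, of m] ip_commute[of "herm n m" g] unfolding hb_eq ip_cmult_left by simp
  then show "ip (emb n x) g = 0" using ip_emb_sums[OF gL, of x n] by (simp add: sums_iff)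
qed

section \<open>Coefficients and the orthogonal projection\<close>

definition coef :: "nat \<Rightarrow> (complex \<Rightarrow> complex) \<Rightarrow> ell2" where
  "coef n f = Abs_ell2 (\<lambda>m. ip f (hb n m))"

text \<open>Bessel's inequality: for \<open>g\<close> the truncated Hermite expansion, the squared
  norm of \<open>f - g\<close> is that of \<open>f\<close> minus \<open>S\<close>. It gives meaning
  to \<open>Abs_ell2\<close> in \<open>coef\<close>.\<close>

lemma coord_coef:
  assumes f: "f \<in> L2_gauss"
  shows "coord (coef n f) m = ip f (hb n m)"
proof -
  define c where "c m = ip f (hb n m)" for m
  have "(\<Sum>m<N. (cmod (c m))\<^sup>2) \<le> (nrm f)\<^sup>2" for N
  proof -
    define g where "g = hsum n c {..<N}"
    have g: "g \<in> L2_gauss" by (simp add: g_def hsum_L2)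
    define S where "S = (\<Sum>m<N. (cmod (c m))\<^sup>2)"
    have gg: "ip g g = of_real S" using nrm_hsum[of "{..<N}" n c] unfolding ip_self nrm_square[symmetric] g_def S_def by simp
    have "ip g f = (\<Sum>m<N. c m * cnj (c m))"
      unfolding g_def ip_hsum_left[OF f] by (simp add: c_def ip_commute[of "hb n _" f])
    also have "\<dots> = of_real S" unfolding S_def of_real_sum complex_norm_square ..
    finally have gf: "ip g f = of_real S" .
    have fg: "ip f g = of_real S" by (subst ip_commute) (simp add: gf)
    have d: "(\<lambda>z. f z - g z) \<in> L2_gauss" by (rule L2_closed(2)[OF f g])
    have "ip (\<lambda>z. f z - g z) (\<lambda>z. f z - g z) = ip f (\<lambda>z. f z - g z) - ip g (\<lambda>z. f z - g z)"
      by (rule ip_diff_left[OF f g d])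
    also have "ip f (\<lambda>z. f z - g z) = cnj (ip f f - ip g f)"
      by (subst ip_commute) (simp add: ip_diff_left[OF f g f])
    also have "ip g (\<lambda>z. f z - g z) = cnj (ip f g - ip g g)"
      by (subst ip_commute) (simp add: ip_diff_left[OF f g g])
    finally have "of_real ((nrm (\<lambda>z. f z - g z))\<^sup>2) = complex_of_real ((nrm f)\<^sup>2 - S)"
      unfolding ip_self[of "\<lambda>z. f z - g z"] ip_self[of f] nrm_square[symmetric] gf fg gg by simp
    then have "(nrm (\<lambda>z. f z - g z))\<^sup>2 = (nrm f)\<^sup>2 - S" unfolding of_real_eq_iff .
    then show ?thesis using zero_le_power2[of "nrm (\<lambda>z. f z - g z)"] unfolding S_def by linarith
  qed
  then have "summable (\<lambda>m. (cmod (c m))\<^sup>2)"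
    by (intro bounded_imp_summable[where B = "(nrm f)\<^sup>2"]) (simp_all only: lessThan_Suc_atMost[symmetric] zero_le_power2)
  then show ?thesis unfolding coef_def c_def by (simp add: Abs_ell2_inverse)
qed

lemma ip_emb_right:
  assumes f: "f \<in> L2_gauss"
  shows "ip f (emb n y) = cinner (coef n f) y"
proof -
  have "cnj (ip (emb n y) f) = cinner (coef n f) y"
  proof (rule sums_unique2[OF _ cinner_sums])
    have "(\<lambda>m. cnj (coord y m * ip (hb n m) f)) sums cnj (ip (emb n y) f)"
      by (rule sums_cnj[THEN iffD2, OF ip_emb_sums[OF f]])
    then show "(\<lambda>m. coord (coef n f) m * cnj (coord y m)) sums cnj (ip (emb n y) f)"
      unfolding coord_coef[OF f] by (simp add: mult.commute ip_commute[of f])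
  qed
  then show ?thesis by (subst ip_commute)
qed

lemma coef_emb: "coef n (emb n x) = x"
  by (rule ell2_eqI) (simp add: coord_coef[OF emb_L2] ip_emb_hb)

lemma ip_emb: "ip (emb n x) (emb n y) = cinner x y"
  by (simp add: ip_emb_right[OF emb_L2] coef_emb)

lemma nrm_emb: "nrm (emb n x) = norm x"
proof -
  have "complex_of_real ((nrm (emb n x))\<^sup>2) = of_real ((norm x)\<^sup>2)"
    unfolding nrm_square ip_self[symmetric] ip_emb cinner_self ..
  then have "(nrm (emb n x))\<^sup>2 = (norm x)\<^sup>2" unfolding of_real_eq_iff .
  then show ?thesis using nrm_nonneg by (simp add: power2_eq_iff_nonneg)
qed

lemma true_polyfock_L2: "f \<in> true_polyfock (Suc n) \<Longrightarrow> f \<in> L2_gauss"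
  by (auto simp: true_polyfock_Suc polyfock_iff)

lemma true_polyfock_diff:
  assumes f: "f \<in> true_polyfock (Suc n)" and g: "g \<in> true_polyfock (Suc n)"
  shows "(\<lambda>z. f z - g z) \<in> true_polyfock (Suc n)"
proof -
  have fg: "f \<in> L2_gauss" "g \<in> L2_gauss" "panal (Suc n) f" "panal (Suc n) g"
    "\<And>h. h \<in> polyfock n \<Longrightarrow> ip f h = 0" "\<And>h. h \<in> polyfock n \<Longrightarrow> ip g h = 0"
    using f g by (auto simp: true_polyfock_Suc polyfock_iff)
  have "ip (\<lambda>z. f z - g z) h = 0" if "h \<in> polyfock n" for h
    using that by (subst ip_diff_left[OF fg(1,2)]) (auto simp: fg polyfock_iff)
  then show ?thesis using L2_closed(2)[OF fg(1,2)] panal_diff[OF fg(3,4)]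
    by (simp add: true_polyfock_Suc polyfock_iff)
qed

lemma emb_coef:
  assumes f: "f \<in> true_polyfock (Suc n)"
  shows "emb n (coef n f) = f"
proof -
  have fL: "f \<in> L2_gauss" by (rule true_polyfock_L2[OF f])
  have "(\<lambda>z. f z - emb n (coef n f) z) = (\<lambda>z. 0)"
  proof (rule true_polyfock_herm_eq_0[OF true_polyfock_diff[OF f emb_mem]])
    fix m
    have e: "herm n m = (\<lambda>z. of_real (sqrt (fact n * fact m)) * hb n m z)" by (rule ext) (simp add: hb_def)
    show "ip (\<lambda>z. f z - emb n (coef n f) z) (herm n m) = 0"
      unfolding e ip_cmult_right ip_diff_left[OF fL emb_L2 hb_L2] ip_emb_hb coord_coef[OF fL] by simp
  qed
  from fun_cong[OF this] show ?thesis by (intro ext) simp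
qed

lemma emb_inj: "emb n x = emb n y \<Longrightarrow> x = y"
  by (metis coef_emb)

lemma true_polyfock_eq: "true_polyfock (Suc n) = range (emb n)"
proof
  show "range (emb n) \<subseteq> true_polyfock (Suc n)" by (intro image_subsetI emb_mem)
  show "true_polyfock (Suc n) \<subseteq> range (emb n)"
  proof
    fix f assume "f \<in> true_polyfock (Suc n)"
    from emb_coef[OF this, symmetric] show "f \<in> range (emb n)" by (rule range_eqI)
  qed
qed

lemma proj_true_polyfock:
  assumes f: "f \<in> L2_gauss"
  shows "Defs.proj (true_polyfock (Suc n)) f = emb n (coef n f)"
  unfolding Defs.proj_def
proof (rule the_equality)
  have z: "ip (\<lambda>z. f z - emb n x z) (emb n y) = cinner (coef n f - x) y" for x y
    by (simp add: ip_diff_left[OF f emb_L2 emb_L2] ip_emb_right[OF f] ip_emb cinner_diff_left)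
  show "emb n (coef n f) \<in> true_polyfock (Suc n) \<and> (\<forall>g\<in>true_polyfock (Suc n). ip (\<lambda>z. f z - emb n (coef n f) z) g = 0)"
    unfolding true_polyfock_eq by (simp add: z)
  fix h assume h: "h \<in> true_polyfock (Suc n) \<and> (\<forall>g\<in>true_polyfock (Suc n). ip (\<lambda>z. f z - h z) g = 0)"
  then obtain x where x: "h = emb n x" unfolding true_polyfock_eq by blast
  have "cinner (coef n f - x) (coef n f - x) = 0"
    using h emb_mem[of n "coef n f - x"] unfolding x z[symmetric] by blast
  then show "h = emb n (coef n f)" by (simp add: x cinner_self)
qed

section \<open>The reproducing kernel\<close>

text \<open>Pascal's rule splits \<open>Suc n choose j\<close>: one part reassembles
  \<open>cnj z * herm n m z\<close>, the other, by the absorption identity for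
  \<open>m choose Suc j\<close>, the term with \<open>m\<close> lowered.\<close>

lemma herm_explicit:
  "herm n m z = (\<Sum>j\<le>n. (-1) ^ j * of_nat (n choose j) * of_nat (m choose j) * fact j * cnj z ^ (n - j) * z ^ (m - j))"
proof (induction n arbitrary: m)
  case 0
  then show ?case by simp
next
  case (Suc n)
  define A where "A m j = of_nat (m choose j) * fact j * z ^ (m - j)" for m j
  have IH: "herm n m z = (\<Sum>j\<le>n. (-1) ^ j * of_nat (n choose j) * A m j * cnj z ^ (n - j))" for m
    unfolding Suc A_def by (intro sum.cong refl) (simp add: mult_ac)
  have AS: "A m (Suc j) = of_nat m * A (m - 1) j" for j
  proof -
    have "Suc j * (m choose Suc j) = m * ((m - 1) choose j)" by (rule binomial_absorption)
    then have "complex_of_nat (Suc j) * of_nat (m choose Suc j) = of_nat m * of_nat ((m - 1) choose j)"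
      by (metis of_nat_mult)
    then have "of_nat (m choose Suc j) * fact (Suc j) = (of_nat m * of_nat ((m - 1) choose j) * fact j :: complex)"
      by (simp add: mult_ac del: of_nat_Suc)
    then show ?thesis unfolding A_def by simp
  qed
  have "(\<Sum>j\<le>Suc n. (-1) ^ j * of_nat (Suc n choose j) * A m j * cnj z ^ (Suc n - j)) =
      A m 0 * cnj z ^ Suc n + (\<Sum>j\<le>n. (-1) ^ Suc j * of_nat (Suc n choose Suc j) * A m (Suc j) * cnj z ^ (n - j))"
    by (subst sum.atMost_Suc_shift) simp
  also have "(\<Sum>j\<le>n. (-1) ^ Suc j * of_nat (Suc n choose Suc j) * A m (Suc j) * cnj z ^ (n - j)) =
      (\<Sum>j\<le>n. (-1) ^ Suc j * of_nat (n choose Suc j) * A m (Suc j) * cnj z ^ (n - j))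
      - (\<Sum>j\<le>n. (-1) ^ j * of_nat (n choose j) * A m (Suc j) * cnj z ^ (n - j))"
    unfolding sum_subtractf[symmetric] by (intro sum.cong refl) (simp add: algebra_simps)
  also have "A m 0 * cnj z ^ Suc n + ((\<Sum>j\<le>n. (-1) ^ Suc j * of_nat (n choose Suc j) * A m (Suc j) * cnj z ^ (n - j))
      - (\<Sum>j\<le>n. (-1) ^ j * of_nat (n choose j) * A m (Suc j) * cnj z ^ (n - j))) =
      (\<Sum>j\<le>Suc n. (-1) ^ j * of_nat (n choose j) * A m j * cnj z ^ (Suc n - j)) - of_nat m * herm n (m - 1) z"
    unfolding sum.atMost_Suc_shift IH AS by (simp add: sum_distrib_left mult_ac)
  also have "(\<Sum>j\<le>Suc n. (-1) ^ j * of_nat (n choose j) * A m j * cnj z ^ (Suc n - j)) = cnj z * herm n m z"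
    unfolding IH sum_distrib_left by (simp add: Suc_diff_le mult_ac)
  finally have "herm (Suc n) m z = (\<Sum>j\<le>Suc n. (-1) ^ j * of_nat (Suc n choose j) * A m j * cnj z ^ (Suc n - j))" by simp
  then show ?case unfolding A_def by (simp add: mult_ac)
qed

text \<open>Reversing the order of summation turns the explicit formula into the Laguerre sum and
  produces the sign \<open>(-1)^n\<close>.\<close>

lemma herm_diagonal: "herm n n z = (-1) ^ n * fact n * of_real (laguerre0 n ((cmod z)\<^sup>2))"
proof -
  have zz: "cnj z ^ i * z ^ i = of_real (((cmod z)\<^sup>2) ^ i)" for i
    unfolding of_real_power[of _ i] complex_norm_square by (simp add: power_mult_distrib mult.commute)
  have "herm n n z = (\<Sum>j\<le>n. (-1) ^ j * of_nat (n choose j) * (of_nat (n choose j) * fact j) * of_real (((cmod z)\<^sup>2) ^ (n - j)))"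
    unfolding herm_explicit zz[symmetric] by (intro sum.cong refl) (simp add: mult_ac)
  also have "\<dots> = (\<Sum>i\<le>n. (-1) ^ (n - i) * of_nat (n choose (n - i)) * (of_nat (n choose (n - i)) * fact (n - i)) * of_real (((cmod z)\<^sup>2) ^ i))"
    by (rule sum.reindex_bij_witness[where i = "\<lambda>i. n - i" and j = "\<lambda>i. n - i"]) auto
  also have "\<dots> = (\<Sum>i\<le>n. (-1) ^ n * fact n * of_real ((-1) ^ i * real (n choose (n - i)) * (((cmod z)\<^sup>2) ^ i / fact i)))"
  proof (intro sum.cong refl)
    fix i assume "i \<in> {..n}"
    then have i: "i \<le> n" by simp
    have "of_nat (n choose (n - i)) * fact (n - i) = (fact n / fact i :: complex)"
      using binomial_fact[of "n - i" n, where 'a = complex] i by simp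
    moreover have "(-1 :: complex) ^ (n - i) = (-1) ^ n * (-1) ^ i"
    proof -
      have "(-1 :: complex) ^ n = (-1) ^ (n - i) * (-1) ^ i" using i by (simp add: power_add[symmetric])
      moreover have "(-1 :: complex) ^ i * (-1) ^ i = 1" by (simp add: power_mult_distrib[symmetric])
      ultimately show ?thesis by (simp only: mult.assoc mult_1_right)
    qed
    ultimately have "(-1) ^ (n - i) * of_nat (n choose (n - i)) * (of_nat (n choose (n - i)) * fact (n - i)) * of_real (((cmod z)\<^sup>2) ^ i) =
        ((-1) ^ n * (-1) ^ i) * of_nat (n choose (n - i)) * (fact n / fact i) * (of_real (((cmod z)\<^sup>2) ^ i) :: complex)"
      by (simp only:)
    also have "\<dots> = (-1 :: complex) ^ n * fact n * of_real ((-1) ^ i * real (n choose (n - i)) * (((cmod z)\<^sup>2) ^ i / fact i))"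
      by (simp add: mult_ac)
    finally show "(-1 :: complex) ^ (n - i) * of_nat (n choose (n - i)) * (of_nat (n choose (n - i)) * fact (n - i)) * of_real (((cmod z)\<^sup>2) ^ i) =
        (-1) ^ n * fact n * of_real ((-1) ^ i * real (n choose (n - i)) * (((cmod z)\<^sup>2) ^ i / fact i))" .
  qed
  also have "\<dots> = (-1) ^ n * fact n * of_real (laguerre0 n ((cmod z)\<^sup>2))"
    unfolding laguerre0_def sum_distrib_left[symmetric] of_real_sum[symmetric] by (simp only: atLeast0AtMost)
  finally show ?thesis .
qed

lemma hb_at_0: "hb n m 0 = (if m = n then (-1) ^ n else 0)"
proof -
  have "herm n m 0 = (\<Sum>j\<le>n. if j = n then (-1) ^ n * of_nat (m choose n) * fact n * 0 ^ (m - n) else 0)"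
    unfolding herm_explicit by (intro sum.cong refl) auto
  also have "\<dots> = (-1) ^ n * of_nat (m choose n) * fact n * 0 ^ (m - n)" by simp
  also have "\<dots> = (if m = n then (-1) ^ n * fact n else 0)"
    by (cases m n rule: linorder_cases) (auto simp: binomial_eq_0)
  finally show ?thesis by (simp add: hb_def flip: power2_eq_square)
qed

text \<open>Only \<open>hb n n\<close> does not vanish at 0, so evaluation at 0 is a coordinate
  functional: the reproducing property at the origin.\<close>

lemma emb_at_0: "emb n x 0 = (-1) ^ n * coord x n"
proof (rule sums_unique2[OF emb_sums])
  have "(\<lambda>m. if m = n then (-1) ^ n * coord x m else 0) sums ((-1) ^ n * coord x n)" by (rule sums_single)
  moreover have "(\<lambda>m. coord x m * hb n m 0) = (\<lambda>m. if m = n then (-1) ^ n * coord x m else 0)"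
    by (auto simp: hb_at_0)
  ultimately show "(\<lambda>m. coord x m * hb n m 0) sums ((-1) ^ n * coord x n)" by simp
qed

lemma nkernel_0: "nkernel (Suc n) 0 = emb n ((-1) ^ n *\<^sub>C unit_vec n)"
proof
  fix w
  have "complex_of_real (sqrt (fact n * fact n)) = fact n" by simp
  then show "nkernel (Suc n) 0 w = emb n ((-1) ^ n *\<^sub>C unit_vec n) w"
    unfolding emb_scaleC emb_unit_vec hb_def herm_diagonal nkernel_def
    by (simp add: power_mult_distrib[symmetric] flip: mult.assoc)
qed

text \<open>The Weyl translation, which preserves inner products (\<open>ip_weyl\<close>) and is
  invertible (\<open>weyl_inverse\<close>). It carries the normalized kernel at 0 to the one at
  \<open>a\<close> and so transports facts from the origin to every point.\<close>

definition weyl :: "complex \<Rightarrow> (complex \<Rightarrow> complex) \<Rightarrow> complex \<Rightarrow> complex" where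
  "weyl a f w = f (w - a) * exp (w * cnj a - of_real ((cmod a)\<^sup>2 / 2))"

lemma nkernel_weyl: "nkernel k a = weyl a (nkernel k 0)"
  by (rule ext) (simp add: nkernel_def weyl_def)

lemma weyl_inverse: "weyl a (weyl (- a) f) = f"
proof
  fix w
  have "exp ((w - a) * cnj (- a) - of_real ((cmod (- a))\<^sup>2 / 2)) * exp (w * cnj a - of_real ((cmod a)\<^sup>2 / 2))
      = exp (a * cnj a - of_real ((cmod a)\<^sup>2))"
    unfolding exp_add[symmetric] by (rule arg_cong[where f = exp]) (simp add: algebra_simps flip: of_real_add)
  also have "\<dots> = 1" by (simp only: complex_norm_square) simp
  finally show "weyl a (weyl (- a) f) w = f w" by (simp add: weyl_def mult.assoc)
qed

lemma weyl_gw: "weyl a f w * cnj (weyl a g w) * gw w = f (w - a) * cnj (g (w - a)) * gw (w - a)"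
proof -
  have "exp (w * cnj a - of_real ((cmod a)\<^sup>2 / 2)) * cnj (exp (w * cnj a - of_real ((cmod a)\<^sup>2 / 2))) * gw w
      = exp (w * cnj a + cnj w * a - of_real ((cmod a)\<^sup>2) - w * cnj w)"
    unfolding gw_def exp_cnj exp_add[symmetric]
    by (rule arg_cong[where f = exp]) (simp add: algebra_simps flip: of_real_add)
  also have "\<dots> = gw (w - a)"
    unfolding gw_def complex_norm_square by (rule arg_cong[where f = exp]) (simp add: algebra_simps)
  finally show ?thesis by (simp add: weyl_def mult_ac)
qed

lemma weyl_measurable: "f \<in> borel_measurable borel \<Longrightarrow> weyl a f \<in> borel_measurable borel"
proof -
  assume [measurable]: "f \<in> borel_measurable borel"
  have [measurable]: "(\<lambda>w. exp (w * cnj a - of_real ((cmod a)\<^sup>2 / 2))) \<in> borel_measurable borel"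
    by (intro borel_measurable_continuous_onI continuous_intros)
  show ?thesis unfolding weyl_def[abs_def] by measurable
qed

lemma ip_weyl:
  assumes "f \<in> L2_gauss" "g \<in> L2_gauss"
  shows "ip (weyl a f) (weyl a g) = ip f g"
proof -
  note [measurable] = L2_measurable[OF assms(1)] L2_measurable[OF assms(2)]
    weyl_measurable[OF L2_measurable[OF assms(1)]] weyl_measurable[OF L2_measurable[OF assms(2)]]
  have "ip (weyl a f) (weyl a g) = (LINT w|lborel. f (w - a) * cnj (g (w - a)) * gw (w - a)) / of_real pi"
    unfolding ip_def by (subst integral_gauss_measure) (auto simp: weyl_gw)
  also have "(LINT w|lborel. f (w - a) * cnj (g (w - a)) * gw (w - a)) = (LINT w|lborel. f w * cnj (g w) * gw w)"
    using integral_shift[of "\<lambda>w. f w * cnj (g w) * gw w" "- a"] by simp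
  also have "(LINT w|lborel. f w * cnj (g w) * gw w) / of_real pi = ip f g"
    unfolding ip_def by (subst integral_gauss_measure) auto
  finally show ?thesis .
qed

lemma weyl_L2:
  assumes f: "f \<in> L2_gauss"
  shows "weyl a f \<in> L2_gauss"
proof -
  note [measurable] = L2_measurable[OF f] weyl_measurable[OF L2_measurable[OF f]]
  have "integrable gauss_measure (\<lambda>z. f z * cnj (f z))" by (rule L2_integrable_mult[OF f f])
  then have "integrable lborel (\<lambda>z. f z * cnj (f z) * gw z)" by (subst (asm) integrable_gauss_measure) auto
  from integrable_shift[OF this, of "- a"]
  have "integrable gauss_measure (\<lambda>z. weyl a f z * cnj (weyl a f z))"
    by (subst integrable_gauss_measure) (auto simp: weyl_gw)
  then have "integrable gauss_measure (\<lambda>z. norm (weyl a f z * cnj (weyl a f z)))" by (rule integrable_norm)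
  then show ?thesis by (simp add: L2_gauss_def norm_mult power2_eq_square)
qed

lemma panal_shift:
  assumes "panal n f"
  shows "panal n (\<lambda>w. f (w - a))"
proof -
  obtain g where g: "\<And>j. g j holomorphic_on UNIV" "f = (\<lambda>z. \<Sum>j<n. cnj z ^ j * g j z)"
    using assms unfolding panal_def by blast
  have h: "(\<lambda>w. g j (w - a)) holomorphic_on UNIV" for j
  proof -
    have "(\<lambda>w. w - a) holomorphic_on UNIV" by (intro holomorphic_intros)
    from holomorphic_on_compose_gen[OF this g(1)[of j]] show ?thesis by (simp add: o_def)
  qed
  have pw: "panal (Suc j) (\<lambda>w. cnj (w - a) ^ j * h w)" if "h holomorphic_on UNIV" for j h
    using that
  proof (induction j)
    case 0
    then show ?case using panal_holomorphic[of h] by simp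
  next
    case (Suc j)
    have "panal (Suc (Suc j)) (\<lambda>w. cnj w * (cnj (w - a) ^ j * h w) - cnj a * (cnj (w - a) ^ j * h w))"
      by (intro panal_diff panal_cnj_mult panal_cmult panal_mono[OF Suc.IH] Suc.prems Suc.IH) simp
    then show ?case by (simp add: algebra_simps)
  qed
  have "panal n (\<lambda>w. \<Sum>j\<in>J. cnj (w - a) ^ j * g j (w - a))" if "J \<subseteq> {..<n}" "finite J" for J
    using that(2,1)
  proof (induction J rule: finite_induct)
    case empty
    show ?case by (rule panalI[where g = "\<lambda>_ _. 0"]) auto
  next
    case (insert j J)
    have "panal n (\<lambda>w. cnj (w - a) ^ j * g j (w - a))"
      by (rule panal_mono[OF pw[OF h]]) (use insert in auto)
    from panal_add[OF this insert.IH] show ?case using insert by simp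
  qed
  then show ?thesis by (simp add: g(2))
qed

lemma weyl_polyfock: "f \<in> polyfock n \<Longrightarrow> weyl a f \<in> polyfock n"
proof -
  assume "f \<in> polyfock n"
  then have f: "f \<in> L2_gauss" "panal n f" by (auto simp: polyfock_iff)
  have "panal n (\<lambda>w. exp (w * cnj a - of_real ((cmod a)\<^sup>2 / 2)) * f (w - a))"
    by (intro panal_holomorphic_mult panal_shift f holomorphic_intros)
  then show ?thesis using weyl_L2[OF f(1)] by (simp add: polyfock_iff weyl_def[abs_def] mult.commute)
qed

text \<open>The inverse translation preserves the smaller space \<open>polyfock n\<close>, so
  orthogonality to that space is preserved.\<close>

lemma weyl_true_polyfock:
  assumes f: "f \<in> true_polyfock (Suc n)"
  shows "weyl a f \<in> true_polyfock (Suc n)"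
  unfolding true_polyfock_Suc
proof (intro CollectI conjI ballI)
  have f': "f \<in> polyfock (Suc n)" "\<And>g. g \<in> polyfock n \<Longrightarrow> ip f g = 0" using f by (auto simp: true_polyfock_Suc)
  show "weyl a f \<in> polyfock (Suc n)" by (rule weyl_polyfock[OF f'(1)])
  fix g assume g: "g \<in> polyfock n"
  have "ip (weyl a f) g = ip (weyl a f) (weyl a (weyl (- a) g))" by (simp add: weyl_inverse)
  also have "\<dots> = ip f (weyl (- a) g)"
    by (rule ip_weyl) (use f' g weyl_L2 in \<open>auto simp: polyfock_iff\<close>)
  also have "\<dots> = 0" by (rule f'(2)[OF weyl_polyfock[OF g]])
  finally show "ip (weyl a f) g = 0" .
qed

section \<open>Kernel vectors\<close>

definition kern :: "nat \<Rightarrow> complex \<Rightarrow> ell2" where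
  "kern n a = coef n (nkernel (Suc n) a)"

lemma nkernel_mem: "nkernel (Suc n) a \<in> true_polyfock (Suc n)"
  unfolding nkernel_weyl[of _ a] nkernel_0 by (intro weyl_true_polyfock emb_mem)

lemma emb_kern: "emb n (kern n a) = nkernel (Suc n) a"
  unfolding kern_def by (rule emb_coef[OF nkernel_mem])

text \<open>Translate by \<open>- a\<close>, evaluate at the origin with \<open>emb_at_0\<close>,
  and read off the Weyl factor; the exponential reflects the normalization of the kernel.\<close>

lemma reproducing:
  assumes f: "f \<in> true_polyfock (Suc n)"
  shows "ip f (nkernel (Suc n) a) = f a * of_real (exp (- ((cmod a)\<^sup>2 / 2)))"
proof -
  obtain x where x: "weyl (- a) f = emb n x"
    using weyl_true_polyfock[OF f, of "- a"] unfolding true_polyfock_eq by blast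
  have "ip f (nkernel (Suc n) a) = ip (weyl a (weyl (- a) f)) (weyl a (nkernel (Suc n) 0))"
    unfolding nkernel_weyl[of _ a] weyl_inverse ..
  also have "\<dots> = ip (weyl (- a) f) (nkernel (Suc n) 0)"
    by (rule ip_weyl[OF weyl_L2[OF true_polyfock_L2[OF f]] true_polyfock_L2[OF nkernel_mem]])
  also have "\<dots> = cnj ((-1) ^ n) * coord x n"
    unfolding x nkernel_0 ip_emb by (simp add: cinner_scaleC_right)
  also have "\<dots> = emb n x 0" unfolding emb_at_0 by simp
  also have "\<dots> = f a * of_real (exp (- ((cmod a)\<^sup>2 / 2)))"
    unfolding x[symmetric] weyl_def by (simp flip: exp_of_real)
  finally show ?thesis .
qed

lemma cinner_kern: "cinner x (kern n a) = emb n x a * of_real (exp (- ((cmod a)\<^sup>2 / 2)))"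
  using reproducing[OF emb_mem, of n x a] unfolding emb_kern[symmetric] ip_emb .

lemma laguerre0_0: "laguerre0 n 0 = 1"
proof -
  have "laguerre0 n 0 = (\<Sum>j=0..n. if j = 0 then 1 else 0)"
    unfolding laguerre0_def by (intro sum.cong refl) auto
  then show ?thesis by simp
qed

lemma cinner_kern_kern: "cinner (kern n a) (kern n b) = nkernel (Suc n) a b * of_real (exp (- ((cmod b)\<^sup>2 / 2)))"
  unfolding cinner_kern emb_kern ..

lemma norm_kern: "norm (kern n a) = 1"
proof -
  define r where "r = (cmod a)\<^sup>2 / 2"
  have aa: "a * cnj a = of_real (r + r)"
    unfolding complex_norm_square[symmetric] r_def by (simp only: field_sum_of_halves)
  have "cinner (kern n a) (kern n a) = exp (a * cnj a - of_real r) * of_real (exp (- r))"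
    unfolding cinner_kern_kern nkernel_def r_def diff_self norm_zero zero_power2 laguerre0_0 by simp
  also have "a * cnj a - of_real r = of_real r" unfolding aa by simp
  also have "exp (of_real r) * of_real (exp (- r)) = complex_of_real (exp r * exp (- r))"
    by (simp only: exp_of_real of_real_mult)
  also have "exp r * exp (- r) = 1" by (simp flip: exp_add)
  finally have "(norm (kern n a))\<^sup>2 = 1\<^sup>2" by (simp add: power2_norm_eq_inner inner_ell2_def)
  then show ?thesis by (rule power2_eq_imp_eq) auto
qed

lemma continuous_on_laguerre0 [continuous_intros]:
  "continuous_on S f \<Longrightarrow> continuous_on S (\<lambda>z. laguerre0 n (f z))"
  unfolding laguerre0_def by (intro continuous_intros) auto

text \<open>For unit vectors the distance is determined by the inner product, which here is an
  explicit continuous function.\<close>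

lemma continuous_kern: "continuous_on UNIV (kern n)"
proof (rule continuous_at_imp_continuous_on, intro ballI)
  fix a
  have sq: "(norm (kern n b - kern n a))\<^sup>2 = 2 - 2 * Re (cinner (kern n b) (kern n a))" for b
  proof -
    have "(norm (x - y))\<^sup>2 = (norm x)\<^sup>2 + (norm y)\<^sup>2 - 2 * inner x y" for x y :: ell2
      by (simp add: power2_norm_eq_inner inner_diff_left inner_diff_right inner_commute)
    then show ?thesis by (simp add: norm_kern inner_ell2_def)
  qed
  have "isCont (\<lambda>b. cinner (kern n b) (kern n a)) a"
  proof -
    have "continuous_on UNIV (\<lambda>b. cinner (kern n b) (kern n a))"
      unfolding cinner_kern_kern nkernel_def by (intro continuous_intros) auto
    then show ?thesis by (simp add: continuous_on_eq_continuous_at)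
  qed
  then have "(\<lambda>b. sqrt (2 - 2 * Re (cinner (kern n b) (kern n a)))) \<midarrow>a\<rightarrow> sqrt (2 - 2 * Re (cinner (kern n a) (kern n a)))"
    unfolding isCont_def by (intro tendsto_intros)
  then have "(\<lambda>b. norm (kern n b - kern n a)) \<midarrow>a\<rightarrow> 0"
    unfolding sq[symmetric] by simp
  then show "isCont (kern n) a"
    unfolding isCont_def by (simp add: tendsto_norm_zero_iff LIM_zero_iff)
qed

section \<open>Operators on the polyanalytic spaces as operators on sequences\<close>

text \<open>The identification of sequence operators with operators on the function space; the
  restriction matches the extensional encoding of the latter.\<close>

definition lift :: "nat \<Rightarrow> ell2_op \<Rightarrow> oper" where
  "lift n T = (\<lambda>x\<in>true_polyfock (Suc n). emb n (T (coef n x)))"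

lemma lift_emb [simp]: "lift n T (emb n x) = emb n (T x)"
  by (simp add: lift_def emb_mem coef_emb)

lemma lift_inj: "lift n S = lift n T \<Longrightarrow> S = T"
proof (rule blinfun_eqI)
  fix x assume "lift n S = lift n T"
  then have "lift n S (emb n x) = lift n T (emb n x)" by simp
  then show "S x = T x" unfolding lift_emb by (rule emb_inj)
qed

lemma oper_eq_liftI:
  fixes T :: ell2_op
  assumes "A \<in> extensional (true_polyfock (Suc n))" "\<And>x. A (emb n x) = emb n (T x)"
  shows "A = lift n T"
proof (rule extensionalityI[OF assms(1)])
  show "lift n T \<in> extensional (true_polyfock (Suc n))" by (simp add: lift_def)
  fix x assume "x \<in> true_polyfock (Suc n)"
  then show "A x = lift n T x" using assms(2)[of "coef n x"] by (simp add: emb_coef lift_def)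
qed

lemma lift_bounded: "clin T \<Longrightarrow> lift n T \<in> bounded_ops (true_polyfock (Suc n))"
  unfolding bounded_ops_def
proof (intro CollectI conjI ballI allI)
  assume T: "clin T"
  show "lift n T \<in> true_polyfock (Suc n) \<rightarrow>\<^sub>E true_polyfock (Suc n)"
    by (auto simp: lift_def emb_mem)
  fix x y assume x: "x \<in> true_polyfock (Suc n)" and y: "y \<in> true_polyfock (Suc n)"
  obtain a b where ab: "x = emb n a" "y = emb n b" using x y unfolding true_polyfock_eq by blast
  show "lift n T (\<lambda>z. x z + y z) = (\<lambda>z. lift n T x z + lift n T y z)"
    unfolding ab emb_add[symmetric] lift_emb blinfun.add_right ..
next
  fix c x assume T: "clin T" and x: "x \<in> true_polyfock (Suc n)"
  obtain a where a: "x = emb n a" using x unfolding true_polyfock_eq by blast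
  show "lift n T (\<lambda>z. c * x z) = (\<lambda>z. c * lift n T x z)"
    unfolding a emb_scaleC[symmetric] lift_emb clinD[OF T] ..
next
  show "\<exists>C. \<forall>x\<in>true_polyfock (Suc n). nrm (lift n T x) \<le> C * nrm x"
    unfolding true_polyfock_eq by (intro exI[of _ "norm T"]) (simp add: nrm_emb norm_blinfun)
qed

lemma bounded_ops_lift:
  assumes A: "A \<in> bounded_ops (true_polyfock (Suc n))"
  shows "\<exists>T. clin T \<and> A = lift n T"
proof -
  have A1: "A \<in> true_polyfock (Suc n) \<rightarrow>\<^sub>E true_polyfock (Suc n)"
    and A2: "\<And>x y. A (\<lambda>z. emb n x z + emb n y z) = (\<lambda>z. A (emb n x) z + A (emb n y) z)"
    and A3: "\<And>c x. A (\<lambda>z. c * emb n x z) = (\<lambda>z. c * A (emb n x) z)"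
    using A emb_mem unfolding bounded_ops_def by auto
  have "\<exists>C. \<forall>x\<in>true_polyfock (Suc n). nrm (A x) \<le> C * nrm x"
    using A unfolding bounded_ops_def by simp
  then obtain C where C: "\<And>x. nrm (A (emb n x)) \<le> C * nrm (emb n x)"
    using emb_mem by blast
  define t where "t x = coef n (A (emb n x))" for x
  have t: "A (emb n x) = emb n (t x)" for x
    unfolding t_def by (rule emb_coef[symmetric]) (use A1 emb_mem in auto)
  have ta: "t (x + y) = t x + t y" for x y
    by (rule emb_inj[of n]) (simp only: t[symmetric] emb_add A2)
  have tc: "t (c *\<^sub>C x) = c *\<^sub>C t x" for c x
    by (rule emb_inj[of n]) (simp only: t[symmetric] emb_scaleC A3)
  have bl: "bounded_linear t"
  proof (rule bounded_linear_intro[where K = C])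
    show "t (x + y) = t x + t y" for x y by (rule ta)
    show "t (r *\<^sub>R x) = r *\<^sub>R t x" for r x unfolding scaleR_scaleC by (rule tc)
    show "norm (t x) \<le> norm x * C" for x using C[of x] unfolding t nrm_emb by (simp add: mult.commute)
  qed
  have "clin (Blinfun t)" by (simp add: clin_def bounded_linear_Blinfun_apply[OF bl] tc)
  moreover have "A = lift n (Blinfun t)"
    by (rule oper_eq_liftI) (use A1 in \<open>auto simp: bounded_linear_Blinfun_apply[OF bl] t PiE_def\<close>)
  ultimately show ?thesis by blast
qed

lemma bounded_ops_eq: "bounded_ops (true_polyfock (Suc n)) = lift n ` {T. clin T}"
  using bounded_ops_lift lift_bounded by blast

lemma op_adj_lift:
  assumes T: "clin T"
  shows "op_adj (true_polyfock (Suc n)) (lift n T) = lift n (adj T)"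
  unfolding op_adj_def
proof (rule the_equality)
  show "lift n (adj T) \<in> bounded_ops (true_polyfock (Suc n)) \<and>
      (\<forall>x\<in>true_polyfock (Suc n). \<forall>y\<in>true_polyfock (Suc n). ip (lift n T x) y = ip x (lift n (adj T) y))"
    using lift_bounded[OF clin_adj[OF T]] unfolding true_polyfock_eq
    by (auto simp: ip_emb cinner_adj[OF T])
  fix B assume B: "B \<in> bounded_ops (true_polyfock (Suc n)) \<and>
      (\<forall>x\<in>true_polyfock (Suc n). \<forall>y\<in>true_polyfock (Suc n). ip (lift n T x) y = ip x (B y))"
  then obtain S where S: "clin S" "B = lift n S" using bounded_ops_lift by blast
  have "cinner (T x) y = cinner x (S y)" for x y
  proof -
    have "ip (lift n T (emb n x)) (emb n y) = ip (emb n x) (B (emb n y))" using B emb_mem by blast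
    then show ?thesis by (simp add: S(2) ip_emb)
  qed
  then have "S = adj T" by (intro adj_unique T) auto
  then show "B = lift n (adj T)" using S(2) by simp
qed

lemma compose_lift: "compose (true_polyfock (Suc n)) (lift n S) (lift n T) = lift n (S o\<^sub>L T)"
  by (rule oper_eq_liftI) (auto simp: compose_def emb_mem)

lemma positive_op_lift: "clin T \<Longrightarrow> positive_op (true_polyfock (Suc n)) (lift n T) \<longleftrightarrow> pos T"
  using lift_bounded[of T n] unfolding positive_op_def pos_def true_polyfock_eq by (auto simp: ip_emb)

text \<open>Uniqueness of the positive square root resolves the \<open>THE\<close> in
  \<open>op_abs\<close>.\<close>

lemma op_abs_lift:
  assumes T: "clin T"
  shows "op_abs (true_polyfock (Suc n)) (lift n T) = lift n (absop T)"
  unfolding op_abs_def op_adj_lift[OF T] compose_lift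
proof (rule the_equality)
  have "clin (absop T)" using pos_absop[OF T] by (simp add: pos_def)
  then show "positive_op (true_polyfock (Suc n)) (lift n (absop T)) \<and>
      compose (true_polyfock (Suc n)) (lift n (absop T)) (lift n (absop T)) = lift n (adj T o\<^sub>L T)"
    using pos_absop[OF T] by (simp add: positive_op_lift compose_lift absop_square[OF T])
  fix P assume P: "positive_op (true_polyfock (Suc n)) P \<and> compose (true_polyfock (Suc n)) P P = lift n (adj T o\<^sub>L T)"
  then obtain S where S: "clin S" "P = lift n S" using bounded_ops_lift unfolding positive_op_def by blast
  have "S o\<^sub>L S = adj T o\<^sub>L T"
    by (rule lift_inj[of n]) (simp only: compose_lift[symmetric] S(2)[symmetric] P)
  moreover have "pos S" using P positive_op_lift[OF S(1)] S(2) by simp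
  ultimately have "S = absop T" unfolding absop_def using op_sqrt(4) pos_adj_self[OF T] by metis
  then show "P = lift n (absop T)" using S(2) by simp
qed

lemma onb_vimage:
  assumes E: "is_onb (true_polyfock (Suc n)) E"
  shows "onb (emb n -` E)" "emb n ` (emb n -` E) = E"
proof -
  show im: "emb n ` (emb n -` E) = E"
    using E unfolding is_onb_def true_polyfock_eq by blast
  show "onb (emb n -` E)"
    unfolding onb_def orthonormal_def
  proof (intro conjI ballI allI impI)
    fix e e' assume "e \<in> emb n -` E" "e' \<in> emb n -` E"
    then have "ip (emb n e) (emb n e') = (if emb n e = emb n e' then 1 else 0)"
      using E unfolding is_onb_def by blast
    then show "cinner e e' = (if e = e' then 1 else 0)" unfolding ip_emb using emb_inj by metis
  next
    fix x assume x: "\<forall>e\<in>emb n -` E. cinner x e = 0"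
    have "ip (emb n x) e = 0" if "e \<in> E" for e
    proof -
      obtain a where "e = emb n a" "a \<in> emb n -` E" using \<open>e \<in> E\<close> im by blast
      then show ?thesis using x by (simp add: ip_emb)
    qed
    then have "emb n x = (\<lambda>z. 0)" using E emb_mem unfolding is_onb_def by blast
    then show "x = 0" using emb_inj[of n x 0] by (simp add: emb_0)
  qed
qed

lemma is_onb_some_onb: "is_onb (true_polyfock (Suc n)) (some_onb (true_polyfock (Suc n)))"
proof -
  have "is_onb (true_polyfock (Suc n)) (emb n ` range unit_vec)"
    unfolding is_onb_def
  proof (intro conjI ballI impI)
    show "emb n ` range unit_vec \<subseteq> true_polyfock (Suc n)" using emb_mem by blast
    fix e e' assume "e \<in> emb n ` range unit_vec" "e' \<in> emb n ` range unit_vec"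
    then obtain i j where ij: "e = emb n (unit_vec i)" "e' = emb n (unit_vec j)" by blast
    have "(e = e') = (i = j)" unfolding ij using emb_inj injD[OF inj_unit_vec] by metis
    then show "ip e e' = (if e = e' then 1 else 0)" unfolding ij by (simp add: ip_emb coord_unit_vec)
  next
    fix x assume "x \<in> true_polyfock (Suc n)" and *: "\<forall>e\<in>emb n ` range unit_vec. ip x e = 0"
    then obtain a where a: "x = emb n a" unfolding true_polyfock_eq by blast
    have "coord a i = 0" for i using * by (auto simp: a ip_emb)
    then have "a = 0" by (intro ell2_eqI) simp
    then show "x = (\<lambda>z. 0)" by (simp add: a emb_0)
  qed
  then show ?thesis unfolding some_onb_def by (rule someI)
qed

text \<open>The unspecified basis picked by \<open>some_onb\<close>, pulled back to sequences. It
  need not be the Hermite basis, which is why the trace results are stated for arbitrary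
  \<open>E\<close>.\<close>

definition basis :: "nat \<Rightarrow> ell2 set" where
  "basis n = emb n -` some_onb (true_polyfock (Suc n))"

lemma onb_basis: "onb (basis n)"
  unfolding basis_def by (rule onb_vimage(1)[OF is_onb_some_onb])

lemma some_onb_eq: "some_onb (true_polyfock (Suc n)) = emb n ` basis n"
  unfolding basis_def by (rule onb_vimage(2)[OF is_onb_some_onb, symmetric])

lemma inj_on_emb: "inj_on (emb n) S"
  by (rule inj_onI) (rule emb_inj)

lemma trace_class_lift:
  assumes T: "clin T"
  shows "lift n T \<in> trace_class (true_polyfock (Suc n)) \<longleftrightarrow> tc T"
proof -
  have "lift n T \<in> trace_class (true_polyfock (Suc n)) \<longleftrightarrow>
      (\<lambda>e. ip (lift n (absop T) e) e) summable_on emb n ` basis n"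
    using lift_bounded[OF T] by (simp add: trace_class_def op_abs_lift[OF T] some_onb_eq)
  also have "\<dots> \<longleftrightarrow> (\<lambda>e. cinner (absop T e) e) summable_on basis n"
    by (simp add: summable_on_reindex[OF inj_on_emb] o_def ip_emb)
  also have "\<dots> \<longleftrightarrow> tc T" using tc_iff_summable(1)[OF onb_basis T] by simp
  finally show ?thesis .
qed

lemma trace_class_eq: "trace_class (true_polyfock (Suc n)) = lift n ` {T. tc T}"
proof -
  have "A \<in> lift n ` {T. tc T}" if A: "A \<in> trace_class (true_polyfock (Suc n))" for A
  proof -
    obtain T where "clin T" "A = lift n T" using A bounded_ops_lift unfolding trace_class_def by blast
    then show ?thesis using A trace_class_lift by blast
  qed
  moreover have "lift n T \<in> trace_class (true_polyfock (Suc n))" if "tc T" for T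
    using that trace_class_lift[of T n] by (simp add: tc_def)
  ultimately show ?thesis by blast
qed

lemma trace_lift: "trace (true_polyfock (Suc n)) (lift n T) = (\<Sum>\<^sub>\<infinity>e\<in>basis n. cinner (T e) e)" for T :: ell2_op
  by (simp add: trace_def some_onb_eq infsum_reindex[OF inj_on_emb] o_def ip_emb)

lemma trace_nuclear:
  "nuclear T u v \<Longrightarrow> trace (true_polyfock (Suc n)) (lift n T) = (\<Sum>j. cinner (v j) (u j))"
  unfolding trace_lift by (rule infsumI[OF nuclear_trace[OF onb_basis]])

lemma trace_norm_lift:
  assumes T: "tc T"
  shows "trace_norm (true_polyfock (Suc n)) (lift n T) = tn T"
proof -
  have c: "clin T" using T by (simp add: tc_def)
  show ?thesis
    unfolding trace_norm_def op_abs_lift[OF c] trace_lift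
      infsumI[OF tc_iff_summable(2)[OF onb_basis c T]] by simp
qed

lemma op_zero_lift: "op_zero (true_polyfock (Suc n)) = lift n 0"
  by (rule oper_eq_liftI) (auto simp: op_zero_def emb_mem emb_0)

lemma op_diff_lift: "op_diff (true_polyfock (Suc n)) (lift n S) (lift n T) = lift n (S - T)"
  by (rule oper_eq_liftI) (auto simp: op_diff_def emb_mem blinfun.diff_left emb_diff)

lemma op_scale_lift: "op_scale (true_polyfock (Suc n)) c (lift n T) = lift n (scop c T)"
  by (rule oper_eq_liftI) (auto simp: op_scale_def emb_mem emb_scaleC)

lemma rank_one_lift: "rank_one (true_polyfock (Suc n)) (emb n g) (emb n h) = lift n (rk g h)"
  by (rule oper_eq_liftI) (auto simp: rank_one_def emb_mem emb_scaleC ip_emb)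

lemma berezin_lift: "berezin (Suc n) (lift n T) z = cinner (T (kern n z)) (kern n z)"
  unfolding berezin_def emb_kern[symmetric] lift_emb ip_emb ..

section \<open>Toeplitz operators with bounded symbols\<close>

lemma AE_gauss: "AE z in lborel. P z \<Longrightarrow> AE z in gauss_measure. P z"
  unfolding gauss_measure_def by (subst AE_density) auto

lemma Linf_measurable: "f \<in> Linf_fun \<Longrightarrow> f \<in> borel_measurable borel"
  by (simp add: Linf_fun_def)

lemma Linf_bound:
  assumes "f \<in> Linf_fun"
  obtains C where "0 \<le> C" "AE z in lborel. cmod (f z) \<le> C"
proof -
  obtain C where C: "AE z in lborel. cmod (f z) \<le> C" using assms unfolding Linf_fun_def by blast
  have "AE z in lborel. cmod (f z) \<le> max 0 C" using C by eventually_elim auto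
  then show thesis using that[of "max 0 C"] by simp
qed

lemma LinfI: "f \<in> borel_measurable borel \<Longrightarrow> (\<And>z. cmod (f z) \<le> C) \<Longrightarrow> f \<in> Linf_fun"
  unfolding Linf_fun_def by auto

lemma Linf_linear:
  assumes f: "f \<in> Linf_fun" and g: "g \<in> Linf_fun"
  shows "(\<lambda>z. a * f z + b * g z) \<in> Linf_fun"
proof -
  note [measurable] = Linf_measurable[OF f] Linf_measurable[OF g]
  obtain C where C: "0 \<le> C" "AE z in lborel. cmod (f z) \<le> C" by (rule Linf_bound[OF f])
  obtain D where D: "0 \<le> D" "AE z in lborel. cmod (g z) \<le> D" by (rule Linf_bound[OF g])
  have "AE z in lborel. cmod (a * f z + b * g z) \<le> cmod a * C + cmod b * D"
    using C(2) D(2)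
  proof eventually_elim
    case (elim z)
    have "cmod (a * f z + b * g z) \<le> cmod a * cmod (f z) + cmod b * cmod (g z)"
      by (metis norm_mult norm_triangle_ineq)
    also have "\<dots> \<le> cmod a * C + cmod b * D" using elim by (intro add_mono mult_left_mono) auto
    finally show ?case .
  qed
  then show ?thesis unfolding Linf_fun_def by auto
qed

lemma Linf_mult_integrable:
  assumes f: "f \<in> Linf_fun" and g: "integrable lborel g"
  shows "integrable lborel (\<lambda>z. f z * g z)"
proof -
  obtain C where C: "0 \<le> C" "AE z in lborel. cmod (f z) \<le> C" by (rule Linf_bound[OF f])
  note [measurable] = Linf_measurable[OF f] borel_measurable_integrable[OF g]
  show ?thesis
  proof (rule Bochner_Integration.integrable_bound)
    show "integrable lborel (\<lambda>z. C * norm (g z))" using g by auto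
    show "AE z in lborel. norm (f z * g z) \<le> norm (C * norm (g z))"
      using C(2) by eventually_elim (use C(1) in \<open>auto simp: norm_mult intro!: mult_right_mono\<close>)
  qed measurable
qed

lemma Linf_mult_L2:
  assumes f: "f \<in> Linf_fun" and g: "g \<in> L2_gauss" and C: "0 \<le> C" "AE z in lborel. cmod (f z) \<le> C"
  shows "(\<lambda>z. f z * g z) \<in> L2_gauss" "nrm (\<lambda>z. f z * g z) \<le> C * nrm g"
proof -
  note [measurable] = Linf_measurable[OF f] L2_measurable[OF g]
  have b: "AE z in gauss_measure. (cmod (f z * g z))\<^sup>2 \<le> C\<^sup>2 * (cmod (g z))\<^sup>2"
    using AE_gauss[OF C(2)]
    by eventually_elim (use C(1) in \<open>auto simp: norm_mult power_mult_distrib intro!: mult_right_mono power_mono\<close>)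
  have ib: "integrable gauss_measure (\<lambda>z. C\<^sup>2 * (cmod (g z))\<^sup>2)"
    using L2_integrable[OF g] by auto
  have i: "integrable gauss_measure (\<lambda>z. (cmod (f z * g z))\<^sup>2)"
  proof (rule Bochner_Integration.integrable_bound[OF ib])
    show "(\<lambda>z. (cmod (f z * g z))\<^sup>2) \<in> borel_measurable gauss_measure" unfolding measurable_gauss by measurable
    show "AE z in gauss_measure. norm ((cmod (f z * g z))\<^sup>2) \<le> norm (C\<^sup>2 * (cmod (g z))\<^sup>2)"
      using b by eventually_elim simp
  qed
  then show "(\<lambda>z. f z * g z) \<in> L2_gauss" by (simp add: L2_gauss_def)
  have "(nrm (\<lambda>z. f z * g z))\<^sup>2 \<le> (LINT z|gauss_measure. C\<^sup>2 * (cmod (g z))\<^sup>2)"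
    unfolding nrm_square by (rule integral_mono_AE[OF i ib b])
  also have "\<dots> = (C * nrm g)\<^sup>2" by (simp add: nrm_square power_mult_distrib)
  finally show "nrm (\<lambda>z. f z * g z) \<le> C * nrm g"
    by (rule power2_le_imp_le) (simp add: C(1) nrm_nonneg)
qed

lemma norm_coef_le: "f \<in> L2_gauss \<Longrightarrow> norm (coef n f) \<le> nrm f"
proof -
  assume f: "f \<in> L2_gauss"
  have "(norm (coef n f))\<^sup>2 = cmod (cinner (coef n f) (coef n f))" by (simp add: cinner_self norm_power)
  also have "\<dots> = cmod (ip f (emb n (coef n f)))" by (simp add: ip_emb_right[OF f])
  also have "\<dots> \<le> nrm f * norm (coef n f)"
    using ip_cauchy_schwarz[OF f emb_L2] by (simp add: nrm_emb)
  finally have "norm (coef n f) * norm (coef n f) \<le> nrm f * norm (coef n f)" by (simp add: power2_eq_square)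
  then show ?thesis using nrm_nonneg[of f] by (cases "norm (coef n f) = 0") (auto dest: mult_right_le_imp_le)
qed

lemma coef_add: "f \<in> L2_gauss \<Longrightarrow> g \<in> L2_gauss \<Longrightarrow> coef n (\<lambda>z. f z + g z) = coef n f + coef n g"
  by (rule cinner_eqI') (simp add: ip_emb_right[symmetric] L2_closed ip_add_left emb_L2 cinner_add_left)

lemma coef_cmult: "f \<in> L2_gauss \<Longrightarrow> coef n (\<lambda>z. c * f z) = c *\<^sub>C coef n f"
  by (rule cinner_eqI') (simp add: ip_emb_right[symmetric] L2_closed ip_cmult_left emb_L2 cinner_scaleC_left)

definition toep :: "nat \<Rightarrow> (complex \<Rightarrow> complex) \<Rightarrow> ell2_op" where
  "toep n f = Blinfun (\<lambda>x. coef n (\<lambda>z. f z * emb n x z))"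

lemma toep_apply:
  assumes f: "f \<in> Linf_fun"
  shows "(toep n f) x = coef n (\<lambda>z. f z * emb n x z)"
    and clin_toep: "clin (toep n f)"
proof -
  obtain C where C: "0 \<le> C" "AE z in lborel. cmod (f z) \<le> C" by (rule Linf_bound[OF f])
  have L: "(\<lambda>z. f z * emb n x z) \<in> L2_gauss" for x by (rule Linf_mult_L2(1)[OF f emb_L2 C])
  have sc: "coef n (\<lambda>z. f z * emb n (c *\<^sub>C x) z) = c *\<^sub>C coef n (\<lambda>z. f z * emb n x z)" for c x
    unfolding coef_cmult[OF L, symmetric] emb_scaleC by (simp add: mult.left_commute)
  have bl: "bounded_linear (\<lambda>x. coef n (\<lambda>z. f z * emb n x z))"
  proof (rule bounded_linear_intro[where K = C])
    show "coef n (\<lambda>z. f z * emb n (x + y) z) = coef n (\<lambda>z. f z * emb n x z) + coef n (\<lambda>z. f z * emb n y z)" for x y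
      unfolding coef_add[OF L L, symmetric] emb_add by (simp add: distrib_left)
    show "coef n (\<lambda>z. f z * emb n (r *\<^sub>R x) z) = r *\<^sub>R coef n (\<lambda>z. f z * emb n x z)" for r x
      unfolding scaleR_scaleC by (rule sc)
    show "norm (coef n (\<lambda>z. f z * emb n x z)) \<le> norm x * C" for x
      using norm_coef_le[OF L, of n x] Linf_mult_L2(2)[OF f emb_L2 C, of n x] by (simp add: nrm_emb mult.commute)
  qed
  show a: "(toep n f) x = coef n (\<lambda>z. f z * emb n x z)" for x
    unfolding toep_def by (simp add: bounded_linear_Blinfun_apply[OF bl])
  show "clin (toep n f)" unfolding clin_def a sc by simp
qed

lemma toeplitz_Linf_lift:
  assumes f: "f \<in> Linf_fun"
  shows "toeplitz_Linf (Suc n) f = lift n (toep n f)"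
proof (rule oper_eq_liftI)
  obtain C where C: "0 \<le> C" "AE z in lborel. cmod (f z) \<le> C" by (rule Linf_bound[OF f])
  show "toeplitz_Linf (Suc n) f \<in> extensional (true_polyfock (Suc n))" by (simp add: toeplitz_Linf_def)
  fix x
  show "toeplitz_Linf (Suc n) f (emb n x) = emb n (toep n f x)"
    by (simp add: toeplitz_Linf_def emb_mem proj_true_polyfock[OF Linf_mult_L2(1)[OF f emb_L2 C]] toep_apply[OF f])
qed

definition kform :: "nat \<Rightarrow> ell2 \<Rightarrow> ell2 \<Rightarrow> complex \<Rightarrow> complex" where
  "kform n x y z = cinner x (kern n z) * cinner (kern n z) y"

lemma kform_eq: "kform n x y z = emb n x z * cnj (emb n y z) * gw z"
proof -
  have "kform n x y z = emb n x z * cnj (emb n y z) * (of_real (exp (- ((cmod z)\<^sup>2 / 2))) * of_real (exp (- ((cmod z)\<^sup>2 / 2))))"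
    unfolding kform_def cinner_commute[of "kern n z" y] cinner_kern by simp
  also have "of_real (exp (- ((cmod z)\<^sup>2 / 2))) * of_real (exp (- ((cmod z)\<^sup>2 / 2))) = gw z"
    unfolding gw_eq of_real_mult[symmetric] exp_add[symmetric] by simp
  finally show ?thesis .
qed

lemma continuous_on_cinner [continuous_intros]:
  "continuous_on S f \<Longrightarrow> continuous_on S g \<Longrightarrow> continuous_on S (\<lambda>z. cinner (f z) (g z))"
  by (rule bounded_bilinear.continuous_on[OF bounded_bilinear_cinner])

lemma continuous_on_kform: "continuous_on UNIV (kform n x y)"
  unfolding kform_def by (intro continuous_intros continuous_kern)

lemma kform_measurable [measurable]: "kform n x y \<in> borel_measurable borel"
  by (rule borel_measurable_continuous_onI[OF continuous_on_kform])

lemma norm_kform_le: "cmod (kform n x y z) \<le> norm x * norm y"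
  unfolding kform_def norm_mult
  using cinner_cauchy_schwarz[of x "kern n z"] cinner_cauchy_schwarz[of "kern n z" y]
  by (intro mult_mono) (auto simp: norm_kern)

text \<open>The projection in the Toeplitz operator disappears on pairing with a vector of the
  space, and \<open>kform\<close> is the product of the two functions with the Gaussian weight;
  \<open>pi\<close> is the normalization of \<open>gauss_measure\<close>.\<close>

lemma integral_kform_toep:
  assumes f: "f \<in> Linf_fun"
  shows "integrable lborel (\<lambda>z. f z * kform n x y z)"
    "(LINT z|lborel. f z * kform n x y z) = of_real pi * cinner (toep n f x) y"
proof -
  note [measurable] = Linf_measurable[OF f] L2_measurable[OF emb_L2]
  obtain C where C: "0 \<le> C" "AE z in lborel. cmod (f z) \<le> C" by (rule Linf_bound[OF f])
  have L: "(\<lambda>z. f z * emb n x z) \<in> L2_gauss" by (rule Linf_mult_L2(1)[OF f emb_L2 C])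
  have e: "f z * kform n x y z = f z * emb n x z * cnj (emb n y z) * gw z" for z
    by (simp add: kform_eq)
  show "integrable lborel (\<lambda>z. f z * kform n x y z)"
    unfolding e by (subst integrable_gauss_measure[symmetric]) (auto intro: L2_integrable_mult[OF L emb_L2])
  have "cinner (toep n f x) y = ip (\<lambda>z. f z * emb n x z) (emb n y)"
    by (simp add: toep_apply[OF f] ip_emb_right[OF L])
  also have "\<dots> = (LINT z|lborel. f z * kform n x y z) / of_real pi"
    unfolding ip_def e by (rule integral_gauss_measure) measurable
  finally show "(LINT z|lborel. f z * kform n x y z) = of_real pi * cinner (toep n f x) y"
    by (simp add: field_simps)
qed

lemma toep_1: "(toep n (\<lambda>_. 1)) x = x"
  by (simp add: toep_apply[OF LinfI[of _ 1]] coef_emb)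

text \<open>Resolution of the identity: the constant symbol 1, whose Toeplitz operator is the
  identity.\<close>

lemma integrable_kform: "integrable lborel (kform n x y)"
  and integral_kform: "(LINT z|lborel. kform n x y z) = of_real pi * cinner x y"
  using integral_kform_toep[OF LinfI[of "\<lambda>_. 1" 1], of n x y] by (simp_all add: toep_1)

text \<open>A product of moduli is at most the sum of their squares, and the squares integrate by
  the resolution of the identity. The bound is summable along a nuclear representation.\<close>

lemma integral_norm_kform_le: "(LINT z|lborel. cmod (kform n x y z)) \<le> pi * ((norm x)\<^sup>2 + (norm y)\<^sup>2)"
proof -
  have "(LINT z|lborel. cmod (kform n x y z)) \<le> (LINT z|lborel. Re (kform n x x z) + Re (kform n y y z))"
  proof (rule integral_mono)
    fix z
    have r: "Re (kform n x x z) = (cmod (cinner x (kern n z)))\<^sup>2" for x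
      unfolding kform_def cinner_commute[of "kern n z" x] complex_norm_square[symmetric] by (rule Re_complex_of_real)
    show "cmod (kform n x y z) \<le> Re (kform n x x z) + Re (kform n y y z)"
      unfolding r unfolding kform_def norm_mult cinner_commute[of "kern n z" y] complex_mod_cnj by (rule mult_le_sum_squares) auto
  qed (intro Bochner_Integration.integrable_add integrable_Re integrable_norm integrable_kform)+
  also have "\<dots> = pi * ((norm x)\<^sup>2 + (norm y)\<^sup>2)"
    by (subst Bochner_Integration.integral_add)
       (auto simp: integrable_kform integral_Re integral_kform cinner_self algebra_simps simp del: of_real_power simp flip: of_real_mult)
  finally show ?thesis .
qed

section \<open>The Berezin transform\<close>

definition ber :: "nat \<Rightarrow> ell2_op \<Rightarrow> complex \<Rightarrow> complex" where
  "ber n T z = cinner (T (kern n z)) (kern n z)"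

lemma continuous_on_ber: "continuous_on UNIV (ber n T)"
  unfolding ber_def by (intro continuous_intros continuous_kern)

lemma ber_Linf: "ber n T \<in> Linf_fun"
proof (rule LinfI)
  show "ber n T \<in> borel_measurable borel" by (rule borel_measurable_continuous_onI[OF continuous_on_ber])
  show "cmod (ber n T z) \<le> norm T" for z
    unfolding ber_def using cinner_cauchy_schwarz[of "T (kern n z)" "kern n z"] norm_blinfun[of T "kern n z"]
    by (simp add: norm_kern)
qed

lemma ber_nuclear:
  assumes "nuclear T u v"
  shows "(\<lambda>j. kform n (v j) (u j) z) sums ber n T z"
proof -
  have "(\<lambda>j. cinner (kern n z) (u j) *\<^sub>C v j) sums T (kern n z)" using assms by (simp add: nuclear_def)
  from bounded_linear.sums[OF bounded_bilinear.bounded_linear_left[OF bounded_bilinear_cinner] this, of "kern n z"]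
  show ?thesis by (simp add: kform_def ber_def cinner_scaleC_left mult.commute)
qed

text \<open>Termwise integration of the nuclear series of the Berezin transform, justified by the
  \<open>L^1\<close> bound on each \<open>kform\<close>.\<close>

lemma integral_ber:
  assumes T: "nuclear T u v" and f: "f \<in> Linf_fun"
  shows "integrable lborel (\<lambda>z. f z * ber n T z)"
    "(\<lambda>j. of_real pi * cinner (toep n f (v j)) (u j)) sums (LINT z|lborel. f z * ber n T z)"
proof -
  obtain C where C: "0 \<le> C" "AE z in lborel. cmod (f z) \<le> C" by (rule Linf_bound[OF f])
  have uv: "summable (\<lambda>j. (norm (u j))\<^sup>2)" "summable (\<lambda>j. (norm (v j))\<^sup>2)" using T by (auto simp: nuclear_def)
  have eq: "(\<Sum>j. f z * kform n (v j) (u j) z) = f z * ber n T z" for z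
    by (rule sums_unique[symmetric, OF sums_mult[OF ber_nuclear[OF T]]])
  have i: "integrable lborel (\<lambda>z. f z * kform n (v j) (u j) z)" for j by (rule integral_kform_toep[OF f])
  have s1: "AE z in lborel. summable (\<lambda>j. norm (f z * kform n (v j) (u j) z))"
  proof (rule AE_I2)
    fix z
    have "summable (\<lambda>j. cmod (f z) * (norm (v j) * norm (u j)))" by (intro summable_mult summable_norm_mult uv)
    then show "summable (\<lambda>j. norm (f z * kform n (v j) (u j) z))"
      by (rule summable_comparison_test'[where N = 0]) (auto simp: norm_mult norm_kform_le intro!: mult_left_mono)
  qed
  have b: "(LINT z|lborel. norm (f z * kform n (v j) (u j) z)) \<le> C * (pi * ((norm (v j))\<^sup>2 + (norm (u j))\<^sup>2))" for j
  proof -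
    have "(LINT z|lborel. norm (f z * kform n (v j) (u j) z)) \<le> (LINT z|lborel. C * cmod (kform n (v j) (u j) z))"
    proof (rule integral_mono_AE)
      show "AE z in lborel. norm (f z * kform n (v j) (u j) z) \<le> C * cmod (kform n (v j) (u j) z)"
        using C(2) by eventually_elim (auto simp: norm_mult intro!: mult_right_mono)
    qed (use i in \<open>auto intro: integrable_kform\<close>)
    also have "\<dots> \<le> C * (pi * ((norm (v j))\<^sup>2 + (norm (u j))\<^sup>2))"
      using mult_left_mono[OF integral_norm_kform_le C(1)] by simp
    finally show ?thesis .
  qed
  have sb: "summable (\<lambda>j. C * (pi * ((norm (v j))\<^sup>2 + (norm (u j))\<^sup>2)))"
    by (intro summable_mult summable_add uv)
  have s2: "summable (\<lambda>j. LINT z|lborel. norm (f z * kform n (v j) (u j) z))"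
  proof (rule summable_comparison_test'[OF sb])
    fix j
    have "0 \<le> (LINT z|lborel. norm (f z * kform n (v j) (u j) z))" by (intro Bochner_Integration.integral_nonneg norm_ge_zero)
    then show "norm (LINT z|lborel. norm (f z * kform n (v j) (u j) z)) \<le> C * (pi * ((norm (v j))\<^sup>2 + (norm (u j))\<^sup>2))"
      using b[of j] by (simp only: real_norm_def abs_of_nonneg)
  qed
  show "integrable lborel (\<lambda>z. f z * ber n T z)"
    using integrable_suminf[OF i s1 s2] unfolding eq .
  show "(\<lambda>j. of_real pi * cinner (toep n f (v j)) (u j)) sums (LINT z|lborel. f z * ber n T z)"
    using sums_integral[OF i s1 s2] unfolding eq integral_kform_toep(2)[OF f] .
qed

lemma ber_integrable:
  assumes "tc T"
  shows "integrable lborel (ber n T)"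
proof -
  obtain u v where "nuclear T u v" using tc_nuclear[OF assms] by blast
  from integral_ber(1)[OF this LinfI[of "\<lambda>_. 1" 1], of n] show ?thesis by simp
qed

text \<open>Both sides are the same series over a nuclear representation. This duality converts
  weak-star density of the Toeplitz operators into injectivity of the Berezin transform.\<close>

lemma trace_toeplitz:
  assumes T: "tc T" and f: "f \<in> Linf_fun"
  shows "trace (true_polyfock (Suc n)) (compose (true_polyfock (Suc n)) (toeplitz_Linf (Suc n) f) (lift n T)) =
    (LINT z|lborel. f z * ber n T z) / of_real pi"
proof -
  obtain u v where uv: "nuclear T u v" using tc_nuclear[OF assms(1)] by blast
  have "(\<lambda>j. of_real pi * cinner (toep n f (v j)) (u j) / of_real pi) sums ((LINT z|lborel. f z * ber n T z) / of_real pi)"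
    by (rule sums_divide[OF integral_ber(2)[OF uv f]])
  then have "(\<Sum>j. cinner (toep n f (v j)) (u j)) = (LINT z|lborel. f z * ber n T z) / of_real pi"
    by (intro sums_unique[symmetric]) simp
  then show ?thesis
    unfolding toeplitz_Linf_lift[OF f] compose_lift trace_nuclear[OF nuclear_compose[OF clin_toep[OF f] uv]] .
qed

section \<open>Injectivity\<close>

text \<open>The order 1 kernel at \<open>\<xi>\<close> times the conjugate of the one at
  \<open>- \<xi>\<close> is a positive constant times the character. Up to this constant the
  transform is thus a kernel value, by the reproducing property, and that is an exponential.\<close>

lemma herm_form_0000_neq_0: "herm_form \<xi> 0 0 0 0 \<noteq> 0"
proof -
  have "ip (nkernel 1 \<xi>) (nkernel 1 (- \<xi>)) = nkernel 1 \<xi> (- \<xi>) * of_real (exp (- ((cmod (- \<xi>))\<^sup>2 / 2)))"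
    using reproducing[OF nkernel_mem, of 0 \<xi> "- \<xi>"] by simp
  moreover have "nkernel 1 \<xi> (- \<xi>) \<noteq> 0" by (simp add: nkernel_def laguerre0_def)
  ultimately have "ip (nkernel 1 \<xi>) (nkernel 1 (- \<xi>)) \<noteq> 0" by simp
  moreover have "nkernel 1 \<xi> z * cnj (nkernel 1 (- \<xi>) z) = exp (- of_real ((cmod \<xi>)\<^sup>2)) * (herm 0 0 z * cnj (herm 0 0 z) * chi \<xi> z)" for z
  proof -
    have "nkernel 1 \<xi> z * cnj (nkernel 1 (- \<xi>) z) =
        exp (z * cnj \<xi> - of_real ((cmod \<xi>)\<^sup>2 / 2)) * exp (cnj z * (- \<xi>) - of_real ((cmod \<xi>)\<^sup>2 / 2))"
      unfolding nkernel_def by (simp add: laguerre0_def exp_cnj)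
    also have "\<dots> = exp ((z * cnj \<xi> - of_real ((cmod \<xi>)\<^sup>2 / 2)) + (cnj z * (- \<xi>) - of_real ((cmod \<xi>)\<^sup>2 / 2)))"
      by (rule exp_add[symmetric])
    also have "(z * cnj \<xi> - of_real ((cmod \<xi>)\<^sup>2 / 2)) + (cnj z * (- \<xi>) - of_real ((cmod \<xi>)\<^sup>2 / 2)) =
        - of_real ((cmod \<xi>)\<^sup>2) + (z * cnj \<xi> - cnj z * \<xi>)"
      by (simp add: field_simps)
    also have "exp \<dots> = exp (- of_real ((cmod \<xi>)\<^sup>2)) * chi \<xi> z" unfolding chi_def by (rule exp_add)
    finally show ?thesis by simp
  qed
  then have "ip (nkernel 1 \<xi>) (nkernel 1 (- \<xi>)) = exp (- of_real ((cmod \<xi>)\<^sup>2)) * herm_form \<xi> 0 0 0 0"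
    unfolding ip_def herm_form_def gchi_def by simp
  ultimately show ?thesis by auto
qed

text \<open>The roots of \<open>p\<close> are finitely many, and the Fourier transform is continuous along the ray.\<close>

lemma fourier_zero_extend:
  fixes f :: "complex \<Rightarrow> complex" and p :: "complex poly"
  assumes f: "integrable lborel f" and p: "p \<noteq> 0"
    and z: "\<And>t::real. poly p (of_real t) \<noteq> 0 \<Longrightarrow> (LINT z|lborel. f z * chi (of_real t * \<xi>) z) = 0"
  shows "(LINT z|lborel. f z * chi \<xi> z) = 0"
proof -
  have [measurable]: "f \<in> borel_measurable borel" using f by auto
  define R where "R = {t::real. poly p (of_real t) = 0}"
  have "finite R"
  proof (rule finite_imageD)
    show "finite (complex_of_real ` R)"
      by (rule finite_subset[OF _ poly_roots_finite[OF p]]) (auto simp: R_def)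
  qed (auto intro: inj_onI)
  define t where "t j = 1 + 1 / real (Suc j)" for j
  have "inj t" by (auto simp: t_def inj_on_def)
  then have "finite (t -` R)" using \<open>finite R\<close> by (rule finite_vimageI[rotated])
  then have ev: "\<forall>\<^sub>F j in sequentially. (LINT z|lborel. f z * chi (of_real (t j) * \<xi>) z) = 0"
    unfolding cofinite_eq_sequentially[symmetric] eventually_cofinite
    by (rule finite_subset[rotated]) (use z in \<open>auto simp: R_def\<close>)
  have t1: "t \<longlonglongrightarrow> 1 + 0"
    unfolding t_def by (intro tendsto_add tendsto_const lim_inverse_n'[THEN LIMSEQ_Suc])
  have "(\<lambda>j. LINT z|lborel. f z * chi (of_real (t j) * \<xi>) z) \<longlonglongrightarrow> (LINT z|lborel. f z * chi \<xi> z)"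
  proof (rule integral_dominated_convergence[where w = "\<lambda>z. norm (f z)"])
    show "AE z in lborel. (\<lambda>j. f z * chi (of_real (t j) * \<xi>) z) \<longlonglongrightarrow> f z * chi \<xi> z"
    proof (rule AE_I2)
      fix z
      have "(\<lambda>j. f z * chi (of_real (t j) * \<xi>) z) \<longlonglongrightarrow> f z * chi (of_real (1 + 0) * \<xi>) z"
        unfolding chi_def by (intro tendsto_intros t1)
      then show "(\<lambda>j. f z * chi (of_real (t j) * \<xi>) z) \<longlonglongrightarrow> f z * chi \<xi> z" by simp
    qed
  qed (use f in \<open>auto simp: norm_mult\<close>)
  moreover have "(\<lambda>j. LINT z|lborel. f z * chi (of_real (t j) * \<xi>) z) \<longlonglongrightarrow> 0"
    by (rule tendsto_eventually[OF ev])
  ultimately show ?thesis by (rule LIMSEQ_unique)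
qed

text \<open>\<open>hk n (z - a)\<close> is the squared modulus of the inner product of the kernels
  at \<open>a\<close> and \<open>z\<close> (see \<open>kform_kern\<close>).\<close>

definition hk :: "nat \<Rightarrow> complex \<Rightarrow> complex" where
  "hk n u = of_real ((laguerre0 n ((cmod u)\<^sup>2))\<^sup>2) * gw u"

lemma hk_minus: "hk n (a - b) = hk n (b - a)"
  by (simp add: hk_def gw_eq norm_minus_commute)

lemma hk_herm: "hk n u = (1 / (fact n)\<^sup>2) * (herm n n u * cnj (herm n n u)) * gw u"
proof -
  have "cnj ((-1) ^ n :: complex) = (-1) ^ n" by simp
  then have "herm n n u * cnj (herm n n u) = ((-1) ^ n * (-1) ^ n) * (fact n)\<^sup>2 * of_real ((laguerre0 n ((cmod u)\<^sup>2))\<^sup>2)"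
    unfolding herm_diagonal by (simp add: power2_eq_square mult_ac)
  also have "(-1 :: complex) ^ n * (-1) ^ n = 1" by (simp flip: power_mult_distrib)
  finally show ?thesis unfolding hk_def by (simp add: field_simps)
qed

lemma integrable_hk: "integrable lborel (hk n)"
proof -
  have "hk n = (\<lambda>u. (1 / (fact n)\<^sup>2) * (herm n n u * cnj (herm n n u)) * gw u)" by (rule ext) (rule hk_herm)
  then show ?thesis by (simp only:) (intro integrable_pgrow_gw pgrow_intros pgrow_herm)
qed

lemma integral_hk_chi: "(LINT u|lborel. hk n u * chi \<xi> u) = of_real pi / (fact n)\<^sup>2 * herm_form \<xi> n n n n"
proof -
  have m: "(\<lambda>u. herm n n u * cnj (herm n n u) * chi \<xi> u) \<in> borel_measurable borel"
    by (intro borel_measurable_times pgrow_measurable pgrow_intros pgrow_herm chi_measurable)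
  have "(LINT u|lborel. hk n u * chi \<xi> u) = (LINT u|lborel. 1 / (fact n)\<^sup>2 * (herm n n u * cnj (herm n n u) * chi \<xi> u * gw u))"
    unfolding hk_herm by (simp add: mult_ac)
  also have "\<dots> = 1 / (fact n)\<^sup>2 * (LINT u|lborel. herm n n u * cnj (herm n n u) * chi \<xi> u * gw u)"
    by (rule integral_mult_right_zero)
  also have "(LINT u|lborel. herm n n u * cnj (herm n n u) * chi \<xi> u * gw u) = of_real pi * herm_form \<xi> n n n n"
    using integral_gauss_measure[OF m] by (simp add: herm_form_def gchi_def)
  finally show ?thesis by simp
qed

lemma kform_kern: "kform n (kern n a) (kern n a) z = hk n (z - a)"
proof -
  define L where "L = laguerre0 n ((cmod (z - a))\<^sup>2)"
  define r where "r = Re (z * cnj a)"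
  have nk: "nkernel (Suc n) a z = of_real L * exp (z * cnj a - of_real ((cmod a)\<^sup>2 / 2))" by (simp add: nkernel_def L_def)
  have "kform n (kern n a) (kern n a) z = nkernel (Suc n) a z * cnj (nkernel (Suc n) a z) * gw z"
    by (simp add: kform_eq emb_kern)
  also have "nkernel (Suc n) a z * cnj (nkernel (Suc n) a z) = of_real ((cmod (nkernel (Suc n) a z))\<^sup>2)"
    by (rule complex_norm_square[symmetric])
  also have "cmod (nkernel (Suc n) a z) = \<bar>L\<bar> * exp (r - (cmod a)\<^sup>2 / 2)"
    unfolding nk norm_mult norm_exp_eq_Re norm_of_real r_def by simp
  also have "of_real ((\<bar>L\<bar> * exp (r - (cmod a)\<^sup>2 / 2))\<^sup>2) * gw z = complex_of_real (L\<^sup>2 * (exp (r - (cmod a)\<^sup>2 / 2) * exp (r - (cmod a)\<^sup>2 / 2) * exp (- (cmod z)\<^sup>2)))"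
    unfolding gw_eq of_real_mult[symmetric] power_mult_distrib power2_abs
    by (simp only: power2_eq_square[of "exp _"] mult.assoc)
  also have "exp (r - (cmod a)\<^sup>2 / 2) * exp (r - (cmod a)\<^sup>2 / 2) * exp (- (cmod z)\<^sup>2) = exp (- (cmod (z - a))\<^sup>2)"
  proof -
    have "- (cmod (z - a))\<^sup>2 = (r - (cmod a)\<^sup>2 / 2) + (r - (cmod a)\<^sup>2 / 2) + - (cmod z)\<^sup>2"
      unfolding r_def by (simp add: cmod_power2) (simp add: power2_eq_square algebra_simps)
    then show ?thesis by (simp only: exp_add)
  qed
  finally show ?thesis by (simp add: hk_def gw_eq L_def)
qed

text \<open>
  With \<open>x = y\<close> the normalized kernel at \<open>a\<close>, the hypothesis says that the convolution of \<open>f\<close> with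
  \<open>hk n\<close> vanishes, and the Fourier transform of \<open>hk n\<close> is a nonzero polynomial times a Gaussian on every ray.
\<close>

lemma kform_total:
  assumes f: "integrable lborel f" and z: "\<And>x y. (LINT z|lborel. f z * kform n x y z) = 0"
  shows "AE z in lborel. f z = 0"
proof (rule fourier_unique[OF f])
  fix \<xi>
  have fm [measurable]: "f \<in> borel_measurable borel" using f by auto
  have [measurable]: "hk n \<in> borel_measurable borel" using integrable_hk by auto
  have prod: "(LINT z|lborel. f z * chi \<xi> z) * herm_form \<xi> n n n n = 0" for \<xi>
  proof -
    define h where "h = (LINT u|lborel. hk n u * chi \<xi> u)"
    \<comment> \<open>\<open>chi \<xi>\<close> is multiplicative and \<open>hk n\<close> is even, so
      the factor depending on \<open>a\<close> is a translate, whose integral \<open>h\<close> does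
      not depend on \<open>z\<close>.\<close>
    have sh: "hk n (z - a) * chi \<xi> a = chi \<xi> z * (hk n (a + - z) * chi \<xi> (a + - z))" for a z
      unfolding hk_minus[of n z a] chi_def by (simp add: algebra_simps flip: exp_add)
    have i1: "integrable lborel (\<lambda>a. hk n (a + - z) * chi \<xi> (a + - z))" for z
      by (rule integrable_shift[OF integrable_mult_chi[OF integrable_hk]])
    have i2: "(LINT a|lborel. hk n (a + - z) * chi \<xi> (a + - z)) = h" for z
      unfolding h_def by (rule integral_shift) measurable
    have i3: "(LINT a|lborel. norm (hk n (a + - z))) = (LINT a|lborel. norm (hk n a))" for z
      by (rule integral_shift) measurable
    define F where "F z a = f z * (chi \<xi> z * (hk n (a + - z) * chi \<xi> (a + - z)))" for z a
    have chim: "(\<lambda>p::complex \<times> complex. chi \<xi> (g p)) \<in> borel_measurable (lborel \<Otimes>\<^sub>M lborel)"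
      if "g \<in> borel_measurable (lborel \<Otimes>\<^sub>M lborel)" for g
      by (rule measurable_compose[OF that chi_measurable])
    have hkm: "(\<lambda>p::complex \<times> complex. hk n (g p)) \<in> borel_measurable (lborel \<Otimes>\<^sub>M lborel)"
      if "g \<in> borel_measurable (lborel \<Otimes>\<^sub>M lborel)" for g
      by (rule measurable_compose[OF that]) measurable
    have Fm: "case_prod F \<in> borel_measurable (lborel \<Otimes>\<^sub>M lborel)"
      unfolding F_def case_prod_unfold by (intro borel_measurable_times chim hkm) measurable
    have Fi: "integrable (lborel \<Otimes>\<^sub>M lborel) (case_prod F)"
    proof (rule lborel_pair.Fubini_integrable[OF Fm])
      have "(LINT a|lborel. norm (F z a)) = norm (f z) * (LINT a|lborel. norm (hk n a))" for z
        unfolding F_def norm_mult norm_chi i3[of z, symmetric] by simp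
      then show "integrable lborel (\<lambda>z. LINT a|lborel. norm (case_prod F (z, a)))" using f by simp
      show "AE z in lborel. integrable lborel (\<lambda>a. case_prod F (z, a))"
        unfolding F_def prod.case by (intro AE_I2 integrable_mult_right i1)
    qed
    have "(LINT z|lborel. f z * hk n (z - a)) = 0" for a
      using z[of "kern n a" "kern n a"] by (simp add: kform_kern)
    then have "(LINT z|lborel. F z a) = 0" for a
      unfolding F_def sh[symmetric] unfolding mult.assoc[symmetric] by simp
    then have "0 = (LINT a|lborel. LINT z|lborel. F z a)" by simp
    also have "\<dots> = (LINT z|lborel. LINT a|lborel. F z a)" by (rule lborel_pair.Fubini_integral[OF Fi])
    also have "\<dots> = (LINT z|lborel. f z * chi \<xi> z * h)"
      unfolding F_def integral_mult_right_zero i2 by (simp only: mult.assoc)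
    also have "\<dots> = (LINT z|lborel. f z * chi \<xi> z) * h" by simp
    finally show ?thesis by (simp add: h_def integral_hk_chi)
  qed
  \<comment> \<open>The transform of \<open>hk n\<close> contains one Laguerre factor from the
    ladder in the first indices and one from the ladder in the second, hence two
    polynomials.\<close>
  obtain p where p: "p \<noteq> 0" "\<And>t. kap (of_real t * \<xi>) n n = poly p (of_real t)" using kap_poly by blast
  obtain q where q: "q \<noteq> 0" "\<And>t. kap (of_real t * (- cnj \<xi>)) n n = poly q (of_real t)" using kap_poly by blast
  show "(LINT z|lborel. f z * chi \<xi> z) = 0"
  proof (rule fourier_zero_extend[OF f])
    show "p * q \<noteq> 0" using p q by simp
    fix t :: real assume "poly (p * q) (of_real t) \<noteq> 0"
    then have "herm_form (of_real t * \<xi>) n n n n \<noteq> 0"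
      unfolding herm_form_kap[of _ n] herm_form_0_kap[of _ n] using p(2)[of t] q(2)[of t] herm_form_0000_neq_0 by simp
    then show "(LINT z|lborel. f z * chi (of_real t * \<xi>) z) = 0" using prod[of "of_real t * \<xi>"] by simp
  qed
qed

lemma clin_eqI:
  fixes S T :: ell2_op
  assumes S: "clin S" and T: "clin T" and e: "\<And>m. S (unit_vec m) = T (unit_vec m)"
  shows "S = T"
proof (rule blinfun_eqI)
  fix x
  have "(\<lambda>m. coord x m *\<^sub>C A (unit_vec m)) sums A x" if "clin A" for A
    using bounded_linear.sums[OF blinfun.bounded_linear_right ell2_expansion, of A x] by (simp add: clinD[OF that])
  from this[OF S] this[OF T] show "S x = T x"
    unfolding e by (rule sums_unique2)
qed

section \<open>Injectivity of the Berezin transform\<close>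

lemma chi_Linf: "chi \<xi> \<in> Linf_fun"
  by (rule LinfI[where C = 1]) auto

text \<open>In the Hermite bases both operators have entries proportional to
  \<open>herm_form\<close>, and \<open>herm_form_kap\<close> splits off a factor depending on
  \<open>n\<close> but not on the matrix position. The \<open>n!\<close> comes from the
  normalization of \<open>hb\<close>.\<close>

lemma toep_chi: "toep n (chi \<xi>) = scop (kap \<xi> n n / fact n) (toep 0 (chi \<xi>))"
proof (rule clin_eqI[OF clin_toep[OF chi_Linf] clin_scop[OF clin_toep[OF chi_Linf]]])
  fix m
  have c: "cinner ((toep n (chi \<xi>)) (unit_vec m)) (unit_vec l) =
      herm_form \<xi> n m n l / (of_real (sqrt (fact n * fact m)) * of_real (sqrt (fact n * fact l)))" for n l
  proof -
    have "cinner ((toep n (chi \<xi>)) (unit_vec m)) (unit_vec l) = ip (\<lambda>z. chi \<xi> z * hb n m z) (hb n l)"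
      using ip_emb_right[OF Linf_mult_L2(1)[OF chi_Linf emb_L2, of 1 \<xi> n "unit_vec m"], of n "unit_vec l"]
      by (simp add: toep_apply[OF chi_Linf] emb_unit_vec)
    also have "\<dots> = (1 / (of_real (sqrt (fact n * fact m)) * of_real (sqrt (fact n * fact l)))) * herm_form \<xi> n m n l"
      unfolding ip_def herm_form_def gchi_def integral_mult_right_zero[symmetric] hb_def by (simp add: mult_ac)
    finally show ?thesis by simp
  qed
  have "sqrt (fact n * fact m) * sqrt (fact n * fact l) = fact n * (sqrt (fact 0 * fact m) * sqrt (fact 0 * fact l))" for l
    by (simp add: real_sqrt_mult)
  then have s: "complex_of_real (sqrt (fact n * fact m)) * of_real (sqrt (fact n * fact l)) =
      fact n * (of_real (sqrt (fact 0 * fact m)) * of_real (sqrt (fact 0 * fact l)))" for l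
    by (metis of_real_fact of_real_mult)
  show "(toep n (chi \<xi>)) (unit_vec m) = (scop (kap \<xi> n n / fact n) (toep 0 (chi \<xi>))) (unit_vec m)"
  proof (rule ell2_eqI)
    fix l
    show "coord ((toep n (chi \<xi>)) (unit_vec m)) l =
        coord ((scop (kap \<xi> n n / fact n) (toep 0 (chi \<xi>))) (unit_vec m)) l"
      using c[of n l] c[of 0 l] unfolding s herm_form_kap[of \<xi> n m n l] cinner_unit_vec_right by simp
  qed
qed

text \<open>The integral of \<open>ber n T\<close> against \<open>chi \<xi>\<close> is a series in
  \<open>toep n (chi \<xi>)\<close>, so \<open>toep_chi\<close> relates the Fourier transforms for
  orders \<open>n\<close> and \<open>0\<close> by a Laguerre factor. Continuity of
  \<open>ber 0 T\<close> turns vanishing almost everywhere into vanishing everywhere.\<close>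

lemma ber_0_eq_0:
  assumes T: "tc T" and z: "AE z in lborel. ber n T z = 0"
  shows "ber 0 T z = 0"
proof (rule continuous_AE_zero[OF continuous_on_ber fourier_unique[OF ber_integrable[OF T]]])
  fix \<xi>
  obtain u v where uv: "nuclear T u v" using tc_nuclear[OF T] by blast
  have tr: "(\<lambda>j. of_real pi * cinner ((toep n (chi \<xi>)) (v j)) (u j)) sums (LINT z|lborel. ber n T z * chi \<xi> z)" for n \<xi>
    using integral_ber(2)[OF uv chi_Linf, of n \<xi>] by (simp add: mult.commute)
  have eq: "(LINT z|lborel. ber n T z * chi \<xi> z) = kap \<xi> n n / fact n * (LINT z|lborel. ber 0 T z * chi \<xi> z)" for \<xi>
    using sums_mult[OF tr[of 0 \<xi>], of "kap \<xi> n n / fact n"] tr[of n \<xi>]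
    unfolding toep_chi[of n] scop_apply cinner_scaleC_left
    by (simp only: mult.left_commute[of "of_real pi"]) (rule sums_unique2)
  obtain p where p: "p \<noteq> 0" "\<And>t. kap (of_real t * \<xi>) n n = poly p (of_real t)" using kap_poly by blast
  show "(LINT z|lborel. ber 0 T z * chi \<xi> z) = 0"
  proof (rule fourier_zero_extend[OF ber_integrable[OF T] p(1)])
    fix t :: real assume t: "poly p (of_real t) \<noteq> 0"
    have "(LINT z|lborel. ber n T z * chi (of_real t * \<xi>) z) = (LINT z::complex|lborel. 0)"
      by (rule Bochner_Integration.integral_cong_AE)
         (use z ber_integrable[OF T, of n] in \<open>auto intro!: borel_measurable_times\<close>)
    then show "(LINT z|lborel. ber 0 T z * chi (of_real t * \<xi>) z) = 0"
      using t eq[of "of_real t * \<xi>"] p(2)[of t] by simp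
  qed
qed

text \<open>
  If all entries of total degree below \<open>m + l\<close> vanish, the degree \<open>m + l\<close> part of the expansion
  of the Berezin transform in \<open>z\<close> and \<open>cnj z\<close> is of higher order at \<open>0\<close>, so it vanishes too; on a
  circle it is a trigonometric polynomial in \<open>cnj z / z\<close>.
\<close>

lemma double_series_eq_0:
  fixes A :: "nat \<Rightarrow> nat \<Rightarrow> complex"
  assumes A: "\<And>m l. cmod (A m l) \<le> C"
    and z: "\<And>z. cmod z \<le> 1 / 2 \<Longrightarrow> (\<Sum>m. \<Sum>l. A m l * cnj z ^ m * z ^ l) = 0"
  shows "A m l = 0"
proof -
  define d where "d p = fst p + snd p" for p :: "nat \<times> nat"
  have C0: "0 \<le> C" using order_trans[OF norm_ge_zero A] .
  have geo: "((\<lambda>p. (1/2) ^ fst p * (1/2) ^ snd p) has_sum (4::real)) UNIV"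
  proof -
    have "((\<lambda>n. (1/2) ^ n) has_sum (2::real)) UNIV"
      using geometric_sums[of "1/2 :: real"] by (subst sums_nonneg_imp_has_sum) auto
    then have 1: "((\<lambda>l. c * (1/2) ^ l) has_sum (c * 2)) UNIV" for c :: real by (rule has_sum_cmult_right)
    have 2: "((\<lambda>m. (1/2) ^ m * 2) has_sum (4::real)) UNIV" using 1[of 2] by (simp add: mult.commute)
    have "((\<lambda>p. (1/2) ^ fst p * (1/2) ^ snd p) has_sum (4::real)) (Sigma UNIV (\<lambda>_. UNIV))"
    proof (rule has_sum_SigmaI[where g = "\<lambda>m. (1/2) ^ m * 2"])
      show "(\<lambda>p. (1/2) ^ fst p * (1/2) ^ snd p :: real) summable_on Sigma UNIV (\<lambda>_. UNIV)"
        by (rule summable_on_SigmaI[where g = "\<lambda>m. (1/2) ^ m * 2"]) (use 1 2 in \<open>auto intro: has_sum_imp_summable\<close>)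
    qed (use 1 2 in auto)
    then show ?thesis by simp
  qed
  have IH: "\<forall>m l. m + l < N \<longrightarrow> A m l = 0" for N
  proof (induction N)
    case (Suc N)
    define P where "P w = (\<Sum>m\<le>N. A m (N - m) * w ^ m)" for w :: complex
    have P0: "P (cnj u / u) = 0" if u: "cmod u = 1" for u
    proof -
      have u0: "u \<noteq> 0" using u by auto
      define q where "q = (\<Sum>m\<le>N. A m (N - m) * cnj u ^ m * u ^ (N - m))"
      \<comment> \<open>At \<open>z = r u\<close> the part of degree \<open>N\<close> is
        \<open>r^N q\<close> and equals minus the tail of higher degree. In the bound for the tail,
        \<open>4\<close> is the total of the geometric double series and \<open>2 ^ Suc N\<close>
        comes from comparing \<open>r\<close> with \<open>1/2\<close>.\<close>
      have bound: "cmod q \<le> 4 * C * 2 ^ Suc N * r" if r: "0 < r" "r \<le> 1 / 2" for r :: real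
      proof -
        define z where "z = of_real r * u"
        have zr: "cmod z = r" using r u by (simp add: z_def norm_mult)
        define g where "g p = A (fst p) (snd p) * cnj z ^ fst p * z ^ snd p" for p
        have gb: "norm (g p) \<le> C * (1/2) ^ fst p * (1/2) ^ snd p" for p
          unfolding g_def norm_mult norm_power complex_mod_cnj zr using r C0
          by (intro mult_mono A power_mono) auto
        have gb': "norm (g p) \<le> C * ((1/2) ^ fst p * (1/2) ^ snd p)" for p using gb[of p] by (simp only: mult.assoc)
        have gs: "g summable_on UNIV"
        proof (rule Infinite_Sum.abs_summable_summable)
          have "(\<lambda>p. C * ((1/2) ^ fst p * (1/2) ^ snd p)) summable_on UNIV"
            by (rule summable_on_cmult_right[OF has_sum_imp_summable[OF geo]])
          then show "(\<lambda>p. norm (g p)) summable_on UNIV"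
            by (rule Infinite_Sum.abs_summable_on_comparison_test') (rule gb')
        qed
        have gs': "g summable_on S" for S by (rule summable_on_subset_banach[OF gs]) simp
        have gS: "(\<lambda>(m, l). g (m, l)) summable_on Sigma UNIV (\<lambda>_. UNIV)" using gs by (simp add: case_prod_unfold)
        have row: "(\<lambda>m. \<Sum>\<^sub>\<infinity>l. g (m, l)) = (\<lambda>m. \<Sum>l. g (m, l))"
        proof
          fix m
          have "(\<lambda>l. g (m, l)) summable_on UNIV" using summable_on_SigmaD1[OF gS, of m] by simp
          from sums_unique[OF has_sum_imp_sums[OF has_sum_infsum[OF this]]]
          show "(\<Sum>\<^sub>\<infinity>l. g (m, l)) = (\<Sum>l. g (m, l))" .
        qed
        have "infsum g UNIV = (\<Sum>\<^sub>\<infinity>m. \<Sum>\<^sub>\<infinity>l. g (m, l))"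
          using infsum_Sigma_banach[of g UNIV "\<lambda>_. UNIV"] gs by simp
        also have "\<dots> = (\<Sum>\<^sub>\<infinity>m. \<Sum>l. g (m, l))" unfolding row ..
        also have "\<dots> = (\<Sum>m. \<Sum>l. g (m, l))"
        proof -
          have "(\<lambda>m. \<Sum>\<^sub>\<infinity>l. g (m, l)) summable_on UNIV" by (rule summable_on_Sigma_banach[OF gS])
          then have "(\<lambda>m. \<Sum>l. g (m, l)) summable_on UNIV" unfolding row .
          from sums_unique[OF has_sum_imp_sums[OF has_sum_infsum[OF this]]] show ?thesis .
        qed
        also have "\<dots> = 0" unfolding g_def fst_conv snd_conv using r by (intro z) (simp add: zr)
        finally have s0: "infsum g UNIV = 0" .
        have "infsum g UNIV = infsum g ({p. d p = N} \<union> {p. N < d p})"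
        proof (rule infsum_cong_neutral)
          fix p assume "p \<in> UNIV - ({p. d p = N} \<union> {p. N < d p})"
          then have "fst p + snd p < N" by (auto simp: d_def)
          then show "g p = 0" using Suc by (simp add: g_def)
        qed auto
        also have "\<dots> = infsum g {p. d p = N} + infsum g {p. N < d p}"
          by (rule infsum_Un_disjoint[OF gs' gs']) auto
        finally have s1: "infsum g {p. d p = N} = - infsum g {p. N < d p}" unfolding s0 by (simp add: eq_neg_iff_add_eq_0)
        have "norm (infsum g {p. N < d p}) \<le> infsum (\<lambda>p. C * (2 * r) ^ Suc N * ((1/2) ^ fst p * (1/2) ^ snd p)) {p. N < d p}"
        proof (rule norm_infsum_le[OF has_sum_infsum[OF gs'] has_sum_infsum])
          show "(\<lambda>p. C * (2 * r) ^ Suc N * ((1/2) ^ fst p * (1/2) ^ snd p)) summable_on {p. N < d p}"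
            by (rule summable_on_subset_banach[OF summable_on_cmult_right[OF has_sum_imp_summable[OF geo]]]) simp
          fix p assume "p \<in> {p. N < d p}"
          then have p: "Suc N \<le> d p" by simp
          have "norm (g p) \<le> C * r ^ d p"
            unfolding g_def norm_mult norm_power complex_mod_cnj zr d_def power_add mult.assoc
            by (intro mult_right_mono A) (use r in simp)
          also have "r ^ d p = (2 * r) ^ d p * (1/2) ^ d p" by (subst power_mult_distrib[symmetric]) simp
          also have "C * \<dots> \<le> C * ((2 * r) ^ Suc N * (1/2) ^ d p)"
            using r p C0 by (intro mult_left_mono mult_right_mono power_decreasing) auto
          finally show "norm (g p) \<le> C * (2 * r) ^ Suc N * ((1/2) ^ fst p * (1/2) ^ snd p)"
            unfolding d_def power_add by (simp only: mult.assoc)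
        qed
        also have "\<dots> \<le> infsum (\<lambda>p. C * (2 * r) ^ Suc N * ((1/2) ^ fst p * (1/2) ^ snd p)) UNIV"
          using r C0
          by (intro infsum_mono2 summable_on_subset_banach[OF summable_on_cmult_right[OF has_sum_imp_summable[OF geo]]]
              mult_nonneg_nonneg zero_le_power subset_UNIV) auto
        also have "\<dots> = C * (2 * r) ^ Suc N * 4" by (rule infsumI[OF has_sum_cmult_right[OF geo]])
        finally have tail: "norm (infsum g {p. d p = N}) \<le> C * (2 * r) ^ Suc N * 4" unfolding s1 norm_minus_cancel .
        have im: "{p. d p = N} = (\<lambda>m. (m, N - m)) ` {..N}" by (force simp: d_def image_iff)
        have inj: "inj_on (\<lambda>m. (m, N - m)) {..N}" by (auto intro: inj_onI)
        have "infsum g {p. d p = N} = (\<Sum>m\<le>N. g (m, N - m))"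
          unfolding im by (simp add: sum.reindex[OF inj])
        also have "\<dots> = of_real r ^ N * q"
          unfolding q_def sum_distrib_left
        proof (intro sum.cong refl)
          fix m assume "m \<in> {..N}"
          then have "complex_of_real r ^ N = of_real r ^ m * of_real r ^ (N - m)" by (subst power_add[symmetric]) simp
          then show "g (m, N - m) = of_real r ^ N * (A m (N - m) * cnj u ^ m * u ^ (N - m))"
            by (simp add: g_def z_def power_mult_distrib mult_ac)
        qed
        finally have "r ^ N * cmod q \<le> r ^ N * (4 * C * 2 ^ Suc N * r)"
          using tail r by (simp add: norm_mult norm_power power_mult_distrib mult_ac)
        then show ?thesis using r by (simp add: mult_le_cancel_left_pos)
      qed
      have "q = 0"
      proof (rule ccontr)
        assume "q \<noteq> 0"
        define D where "D = 4 * C * 2 ^ Suc N"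
        have D0: "0 \<le> D" using C0 by (simp add: D_def)
        \<comment> \<open>Small enough for the linear bound to give at most half of
          \<open>cmod q\<close>; the added 1 excludes division by 0.\<close>
        define r where "r = min (1/2) (cmod q / (2 * (D + 1)))"
        have r: "0 < r" "r \<le> 1/2" using \<open>q \<noteq> 0\<close> D0 by (simp_all add: r_def min_def)
        have "cmod q \<le> D * r" unfolding D_def by (rule bound[OF r])
        also have "\<dots> \<le> (D + 1) * (cmod q / (2 * (D + 1)))"
          using D0 by (intro mult_mono) (auto simp: r_def)
        also have "\<dots> = cmod q / 2"
        proof -
          have "D + 1 \<noteq> 0" using D0 by simp
          then show ?thesis by (metis nonzero_mult_divide_mult_cancel_left mult.commute times_divide_eq_right)
        qed
        finally show False using \<open>q \<noteq> 0\<close> by simp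
      qed
      moreover have "q = u ^ N * P (cnj u / u)"
        unfolding q_def P_def sum_distrib_left
        by (intro sum.cong refl) (use u0 in \<open>simp add: power_divide power_diff\<close>)
      ultimately show ?thesis using u0 by simp
    qed
    have "\<forall>m\<le>N. A m (N - m) = 0"
    proof (rule ccontr)
      assume "\<not> (\<forall>m\<le>N. A m (N - m) = 0)"
      then have "finite {w. P w = 0}"
        unfolding P_def using polyfun_finite_roots[of "\<lambda>m. A m (N - m)" N] by auto
      moreover have "sphere 0 1 \<subseteq> {w. P w = 0}"
      proof
        fix w :: complex assume "w \<in> sphere 0 1"
        then have w: "cmod w = 1" by simp
        \<comment> \<open>Solves \<open>cnj u / u = w\<close>: on the unit circle
          \<open>1 / u = cnj u\<close>, so the quotient is \<open>(cnj u)^2\<close>.\<close>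
        define u where "u = cnj (csqrt w)"
        have u2: "cnj u ^ 2 = w" by (simp add: u_def)
        have nu: "cmod u = 1" using w by (simp add: u_def norm_csqrt)
        have uu: "u * cnj u = 1" unfolding complex_norm_square[symmetric] nu by simp
        have u0: "u \<noteq> 0" using nu by auto
        have "cnj u = (cnj u)\<^sup>2 * u" using uu by (simp add: power2_eq_square mult.assoc mult.commute)
        then have "cnj u / u = w" unfolding u2 nonzero_divide_eq_eq[OF u0] .
        then show "w \<in> {w. P w = 0}" using P0[OF nu] by simp
      qed
      ultimately have fin: "finite (sphere (0::complex) 1)" by (rule finite_subset[rotated])
      have "connected (sphere (0::complex) 1)" by (rule connected_sphere) simp
      from connected_finite_iff_sing[OF this] fin
      have "sphere (0::complex) 1 = {} \<or> (\<exists>a. sphere (0::complex) 1 = {a})" by (rule iffD1)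
      moreover have "1 \<in> sphere (0::complex) 1" "- 1 \<in> sphere (0::complex) 1" by simp_all
      ultimately have "(1::complex) = - 1" by (metis empty_iff singletonD)
      then show False by simp
    qed
    then have "A m l = 0" if "m + l = N" for m l using that by (metis add_diff_cancel_left' le_add1)
    then show ?case using Suc by (auto simp: less_Suc_eq)
  qed simp
  show ?thesis using IH[of "Suc (m + l)"] by simp
qed

text \<open>For order 1 the kernel vector has coordinates \<open>cnj z ^ m / sqrt (m!)\<close> times
  a common Gaussian factor. Divided by the square of that factor, the Berezin transform is a double
  power series with the rescaled matrix entries as coefficients.\<close>

lemma ber_0_injective:
  assumes T: "clin T" and z: "\<And>z. ber 0 T z = 0"
  shows "T = 0"
proof (rule clin_eqI[OF T])
  show "clin 0" using tc_0 by (simp add: tc_def)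
  define A where "A m l = coord (T (unit_vec m)) l / of_real (sqrt (fact m) * sqrt (fact l))" for m l
  have "A m l = 0" for m l
  proof (rule double_series_eq_0)
    show "cmod (A m l) \<le> norm T" for m l
    proof -
      have "cmod (A m l) = cmod (coord (T (unit_vec m)) l) / (sqrt (fact m) * sqrt (fact l))"
        by (simp add: A_def norm_divide norm_mult)
      also have "\<dots> \<le> cmod (coord (T (unit_vec m)) l) / (1 * 1)"
        by (intro divide_left_mono mult_mono) (auto intro!: mult_pos_pos)
      also have "\<dots> \<le> norm (T (unit_vec m))" using norm_coord_le by simp
      also have "\<dots> \<le> norm T" using norm_blinfun[of T "unit_vec m"] by simp
      finally show ?thesis .
    qed
    fix z :: complex
    define k where "k = kern 0 z"
    define e where "e = complex_of_real (exp (- ((cmod z)\<^sup>2 / 2)))"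
    have e0: "e \<noteq> 0" by (simp add: e_def)
    have ck: "cnj (coord k m) = z ^ m / of_real (sqrt (fact m)) * e" for m
    proof -
      have "cnj (coord k m) = cinner (unit_vec m) k" by simp
      also have "\<dots> = z ^ m / of_real (sqrt (fact m)) * e"
        unfolding k_def cinner_kern emb_unit_vec e_def by (simp add: hb_def)
      finally show ?thesis .
    qed
    have ck': "coord k m = cnj z ^ m / of_real (sqrt (fact m)) * e" for m
    proof -
      have "coord k m = cnj (z ^ m / of_real (sqrt (fact m)) * e)" unfolding ck[symmetric] by simp
      then show ?thesis by (simp add: e_def)
    qed
    have inner: "(\<lambda>l. A m l * cnj z ^ m * z ^ l) sums (coord k m * cinner (T (unit_vec m)) k / e\<^sup>2)" for m
    proof -
      have "(\<lambda>l. coord k m / e\<^sup>2 * (coord (T (unit_vec m)) l * cnj (coord k l))) sums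
          (coord k m / e\<^sup>2 * cinner (T (unit_vec m)) k)"
        by (rule sums_mult[OF cinner_sums])
      moreover have "coord k m / e\<^sup>2 * (coord (T (unit_vec m)) l * cnj (coord k l)) = A m l * cnj z ^ m * z ^ l" for l
        unfolding ck unfolding ck' A_def using e0 by (simp add: power2_eq_square)
      ultimately show ?thesis by simp
    qed
    have "(\<lambda>m. coord k m * cinner (T (unit_vec m)) k) sums ber 0 T z"
    proof -
      have "(\<lambda>m. coord k m *\<^sub>C T (unit_vec m)) sums T k"
        using bounded_linear.sums[OF blinfun.bounded_linear_right ell2_expansion, of T k] by (simp add: clinD[OF T])
      from bounded_linear.sums[OF bounded_bilinear.bounded_linear_left[OF bounded_bilinear_cinner] this, of k]
      show ?thesis by (simp add: cinner_scaleC_left ber_def k_def)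
    qed
    from sums_divide[OF this, of "e\<^sup>2"] have "(\<lambda>m. coord k m * cinner (T (unit_vec m)) k / e\<^sup>2) sums 0"
      unfolding z by simp
    then show "(\<Sum>m. \<Sum>l. A m l * cnj z ^ m * z ^ l) = 0"
      unfolding sums_unique[OF inner, symmetric] by (rule sums_unique[symmetric])
  qed
  then have "coord (T (unit_vec m)) l = 0" for m l by (simp add: A_def)
  then show "T (unit_vec m) = blinfun_apply 0 (unit_vec m)" for m
    by (intro ell2_eqI) simp
qed

lemma ber_injective:
  assumes T: "tc T" and z: "AE z in lborel. ber n T z = 0"
  shows "T = 0"
  using T by (intro ber_0_injective ber_0_eq_0[OF T z]) (simp add: tc_def)

section \<open>Toeplitz operators with integrable symbols\<close>

lemma L1_kform_integrable:
  assumes f: "integrable lborel f"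
  shows "integrable lborel (\<lambda>z. f z * kform n x y z)"
proof (rule Bochner_Integration.integrable_bound)
  have [measurable]: "f \<in> borel_measurable borel" using f by auto
  show "integrable lborel (\<lambda>z. norm (f z) * (norm x * norm y))" using f by auto
  show "AE z in lborel. norm (f z * kform n x y z) \<le> norm (norm (f z) * (norm x * norm y))"
    by (intro AE_I2) (auto simp: norm_mult abs_mult intro!: mult_left_mono norm_kform_le)
  show "(\<lambda>z. f z * kform n x y z) \<in> borel_measurable lborel" by measurable
qed

text \<open>The weak integral, given by its form. That it is trace class is seen only later, by
  comparison with integrals of simple functions.\<close>

lemma L1_op_exists:
  assumes f: "integrable lborel f"
  shows "\<exists>T. clin T \<and> (\<forall>x y. cinner (T x) y = (LINT z|lborel. f z * kform n x y z))"
proof (rule sesquilinear_op)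
  note i = L1_kform_integrable[OF f]
  show "(LINT z|lborel. f z * kform n (x + y) w z) = (LINT z|lborel. f z * kform n x w z) + (LINT z|lborel. f z * kform n y w z)" for x y w
    unfolding Bochner_Integration.integral_add[OF i i, symmetric]
    by (simp add: kform_def cinner_add_left algebra_simps)
  show "(LINT z|lborel. f z * kform n w (x + y) z) = (LINT z|lborel. f z * kform n w x z) + (LINT z|lborel. f z * kform n w y z)" for x y w
    unfolding Bochner_Integration.integral_add[OF i i, symmetric]
    by (simp add: kform_def cinner_add_right algebra_simps)
  show "(LINT z|lborel. f z * kform n (c *\<^sub>C x) y z) = c * (LINT z|lborel. f z * kform n x y z)" for c x y
    unfolding integral_mult_right_zero[symmetric] by (simp add: kform_def cinner_scaleC_left mult_ac)
  show "(LINT z|lborel. f z * kform n y (c *\<^sub>C x) z) = cnj c * (LINT z|lborel. f z * kform n y x z)" for c x y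
    unfolding integral_mult_right_zero[symmetric] by (simp add: kform_def cinner_scaleC_right mult_ac)
  show "cmod (LINT z|lborel. f z * kform n x y z) \<le> (LINT z|lborel. norm (f z)) * norm x * norm y" for x y
  proof -
    have "cmod (LINT z|lborel. f z * kform n x y z) \<le> (LINT z|lborel. norm (f z) * (norm x * norm y))"
      by (intro Bochner_Integration.integral_norm_bound_integral i)
         (use f in \<open>auto simp: norm_mult intro!: mult_left_mono norm_kform_le\<close>)
    then show ?thesis by (simp add: mult.assoc)
  qed
qed

definition L1_op :: "nat \<Rightarrow> (complex \<Rightarrow> complex) \<Rightarrow> ell2_op" where
  "L1_op n f = (SOME T. clin T \<and> (\<forall>x y. cinner (T x) y = (LINT z|lborel. f z * kform n x y z)))"

lemma
  assumes "integrable lborel f"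
  shows clin_L1_op: "clin (L1_op n f)"
    and cinner_L1_op: "cinner (L1_op n f x) y = (LINT z|lborel. f z * kform n x y z)"
  using someI_ex[OF L1_op_exists[OF assms, of n]] unfolding L1_op_def by auto

definition krk :: "nat \<Rightarrow> complex \<Rightarrow> complex \<Rightarrow> ell2_op" where
  "krk n c z = scop c (rk (kern n z) (kern n z))"

lemma tc_krk: "tc (krk n c z)"
  unfolding krk_def by (intro tc_scop tc_rk)

lemma cinner_krk: "cinner (krk n c z x) y = c * kform n x y z"
  by (simp add: krk_def kform_def cinner_scaleC_left)

lemma krk_op: "op_scale (true_polyfock (Suc n)) c (rank_one (true_polyfock (Suc n)) (nkernel (Suc n) z) (nkernel (Suc n) z)) = lift n (krk n c z)"
  unfolding emb_kern[symmetric] rank_one_lift op_scale_lift krk_def ..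

text \<open>The coefficient is changed at the point \<open>a\<close> first, then the point; the
  factor 2 is the sum of the norms of two unit vectors.\<close>

lemma tn_krk_diff: "tn (krk n c a - krk n d b) \<le> cmod (c - d) + cmod d * (2 * norm (kern n a - kern n b))"
proof -
  define X Y where "X = rk (kern n a) (kern n a)" and "Y = rk (kern n b) (kern n b)"
  have XY: "tc X" "tc Y" by (simp_all add: X_def Y_def tc_rk)
  have "krk n c a - krk n d b = scop (c - d) X + scop d (X - Y)"
    by (rule blinfun_eqI, rule ell2_eqI) (simp add: krk_def X_def Y_def blinfun.bilinear_simps algebra_simps)
  then have "tn (krk n c a - krk n d b) \<le> tn (scop (c - d) X) + tn (scop d (X - Y))"
    using XY by (simp add: tn_add_le tc_scop tc_diff)
  also have "\<dots> \<le> cmod (c - d) * tn X + cmod d * tn (X - Y)"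
    using XY by (intro add_mono tn_scop_le tc_diff)
  also have "\<dots> \<le> cmod (c - d) * 1 + cmod d * (2 * norm (kern n a - kern n b))"
  proof (intro add_mono mult_left_mono)
    show "tn X \<le> 1" using tn_le[OF tcbound_rk, of "kern n a" "kern n a"] by (simp add: X_def norm_kern)
    show "tn (X - Y) \<le> 2 * norm (kern n a - kern n b)"
      using tn_rk_diff[of "kern n a" "kern n b"] by (simp add: X_def Y_def norm_kern)
  qed auto
  finally show ?thesis by simp
qed

lemma continuous_on_kern: "continuous_on S f \<Longrightarrow> continuous_on S (\<lambda>z. kern n (f z))"
  by (rule continuous_on_compose2[OF continuous_kern]) auto

text \<open>The trace norm of such a difference depends continuously on four complex parameters,
  with \<open>D\<close> as modulus of continuity. There are four because the approximating simple
  functions replace both the coefficient and the point.\<close>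

lemma tn_krk_measurable:
  assumes [measurable]: "f \<in> borel_measurable borel" "c \<in> borel_measurable borel" "w \<in> borel_measurable borel"
  shows "(\<lambda>z. tn (krk n (f z) z - krk n (c z) (w z))) \<in> borel_measurable borel"
proof -
  define N where "N p = tn (krk n (fst p) (fst (snd p)) - krk n (fst (snd (snd p))) (snd (snd (snd p))))"
    for p :: "complex \<times> complex \<times> complex \<times> complex"
  define D where "D p q = (cmod (fst p - fst q) + cmod (fst q) * (2 * norm (kern n (fst (snd p)) - kern n (fst (snd q)))))
      + (cmod (fst (snd (snd p)) - fst (snd (snd q))) + cmod (fst (snd (snd q))) * (2 * norm (kern n (snd (snd (snd p))) - kern n (snd (snd (snd q))))))"
    for p q :: "complex \<times> complex \<times> complex \<times> complex"
  have tri: "N p - N q \<le> tn (krk n (fst p) (fst (snd p)) - krk n (fst q) (fst (snd q))) + tn (krk n (fst (snd (snd p))) (snd (snd (snd p))) - krk n (fst (snd (snd q))) (snd (snd (snd q))))" for p q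
  proof -
    define X1 X2 Y1 Y2 where "X1 = krk n (fst p) (fst (snd p))" and "X2 = krk n (fst (snd (snd p))) (snd (snd (snd p)))"
      and "Y1 = krk n (fst q) (fst (snd q))" and "Y2 = krk n (fst (snd (snd q))) (snd (snd (snd q)))"
    have t: "tc X1" "tc X2" "tc Y1" "tc Y2" by (simp_all add: X1_def X2_def Y1_def Y2_def tc_krk)
    have "X1 - X2 = (Y1 - Y2) + ((X1 - Y1) - (X2 - Y2))" by simp
    then have "tn (X1 - X2) \<le> tn (Y1 - Y2) + tn ((X1 - Y1) - (X2 - Y2))"
      using tn_add_le[of "Y1 - Y2" "(X1 - Y1) - (X2 - Y2)"] t by (simp add: tc_diff)
    also have "tn ((X1 - Y1) - (X2 - Y2)) \<le> tn (X1 - Y1) + tn (X2 - Y2)"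
      using t by (intro tn_diff_le tc_diff)
    finally show ?thesis unfolding N_def X1_def X2_def Y1_def Y2_def by simp
  qed
  have sym: "tn (X - Y) = tn (Y - X)" for X Y
  proof -
    have "tcbound (X - Y) C \<longleftrightarrow> tcbound (Y - X) C" for C
      using tcbound_uminus[of "X - Y" C] tcbound_uminus[of "Y - X" C] by auto
    then have "tcbound (X - Y) = tcbound (Y - X)" by (rule ext)
    then show ?thesis unfolding tn_def by simp
  qed
  have ND: "norm (N p - N q) \<le> D p q" for p q
  proof -
    have "\<bar>N p - N q\<bar> \<le> tn (krk n (fst p) (fst (snd p)) - krk n (fst q) (fst (snd q))) + tn (krk n (fst (snd (snd p))) (snd (snd (snd p))) - krk n (fst (snd (snd q))) (snd (snd (snd q))))"
      using tri[of p q] tri[of q p] sym[of "krk n (fst q) (fst (snd q))"] sym[of "krk n (fst (snd (snd q))) (snd (snd (snd q)))"]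
      by simp
    also have "\<dots> \<le> D p q" unfolding D_def by (intro add_mono tn_krk_diff)
    finally show ?thesis by simp
  qed
  have "continuous_on UNIV N"
  proof (rule continuous_at_imp_continuous_on, intro ballI)
    fix q
    have "continuous_on UNIV (\<lambda>p. D p q)" unfolding D_def by (intro continuous_intros continuous_on_kern)
    then have "isCont (\<lambda>p. D p q) q"
      unfolding continuous_on_eq_continuous_at[OF open_UNIV] by (rule bspec) (rule UNIV_I)
    then have "(\<lambda>p. D p q) \<midarrow>q\<rightarrow> 0" unfolding isCont_def by (simp add: D_def)
    then have "(\<lambda>p. N p - N q) \<midarrow>q\<rightarrow> 0"
      by (rule Lim_null_comparison[rotated]) (intro always_eventually allI ND)
    then show "isCont N q" unfolding isCont_def by (rule LIM_zero_cancel)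
  qed
  then have N: "N \<in> borel_measurable borel" by (rule borel_measurable_continuous_onI)
  have "(\<lambda>z. (f z, z, c z, w z)) \<in> borel_measurable borel" by measurable
  from measurable_compose[OF this N] show ?thesis by (simp add: N_def)
qed

text \<open>A test sum is finite, so it moves under the weak integral, where it is bounded pointwise
  by the trace norm. This is the triangle inequality for the Bochner integral in weak form.\<close>

lemma tcbound_integral_diff:
  fixes R T :: ell2_op
  assumes G: "\<And>z. tc (G z)" and S: "\<And>z. tc (S z)"
    and Gi: "\<And>x y. integrable lborel (\<lambda>z::complex. cinner (G z x) y)"
    and Si: "\<And>x y. integrable lborel (\<lambda>z::complex. cinner (S z x) y)"
    and T: "\<And>x y. cinner (T x) y = (LINT z|lborel. cinner (G z x) y)"
    and R: "\<And>x y. cinner (R x) y = (LINT z|lborel. cinner (S z x) y)"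
    and D: "integrable lborel (\<lambda>z. tn (G z - S z))"
  shows "tcbound (R - T) (LINT z|lborel. tn (G z - S z))"
  unfolding tcbound_def
proof (intro allI impI)
  fix m e f assume b: "bessel m e" "bessel m f"
  have i: "integrable lborel (\<lambda>z. cinner ((G z - S z) x) y)" for x y
    unfolding blinfun.diff_left cinner_diff_left by (intro Bochner_Integration.integrable_diff Gi Si)
  have "cinner ((R - T) x) y = - (LINT z|lborel. cinner ((G z - S z) x) y)" for x y
    unfolding blinfun.diff_left cinner_diff_left T R Bochner_Integration.integral_diff[OF Gi Si] by simp
  then have "(\<Sum>j<m. cmod (cinner ((R - T) (e j)) (f j))) =
      (\<Sum>j<m. cmod (LINT z|lborel. cinner ((G z - S z) (e j)) (f j)))" by simp
  also have "\<dots> \<le> (\<Sum>j<m. (LINT z|lborel. cmod (cinner ((G z - S z) (e j)) (f j))))"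
    by (intro sum_mono integral_norm_bound)
  also have "\<dots> = (LINT z|lborel. (\<Sum>j<m. cmod (cinner ((G z - S z) (e j)) (f j))))"
    by (rule Bochner_Integration.integral_sum[symmetric]) (intro integrable_norm i)
  also have "\<dots> \<le> (LINT z|lborel. tn (G z - S z))"
  proof (rule integral_mono[OF _ D])
    show "integrable lborel (\<lambda>z. \<Sum>j<m. cmod (cinner ((G z - S z) (e j)) (f j)))"
      by (intro Bochner_Integration.integrable_sum integrable_norm i)
    show "(\<Sum>j<m. cmod (cinner ((G z - S z) (e j)) (f j))) \<le> tn (G z - S z)" for z
      using tcbound_tn[OF tc_diff[OF G S]] b unfolding tcbound_def by blast
  qed
  finally show "(\<Sum>j<m. cmod (cinner ((R - T) (e j)) (f j))) \<le> (LINT z|lborel. tn (G z - S z))" .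
qed

lemma emb_sum: "emb n (\<Sum>i\<in>I. c i *\<^sub>C x i) = (\<lambda>w. \<Sum>i\<in>I. c i * emb n (x i) w)"
  by (induction I rule: infinite_finite_induct) (simp_all add: emb_0 emb_add emb_scaleC)

lemma tc_sum: "(\<And>i. i \<in> I \<Longrightarrow> tc (T i)) \<Longrightarrow> tc (sum T I)"
  by (induction I rule: infinite_finite_induct) (simp_all add: tc_0 tc_add)

text \<open>On the side of sequences the integral of a simple function agrees with its weak
  integral, value by value.\<close>

lemma simple_tc_lift:
  assumes s: "simple_tc (true_polyfock (Suc n)) s"
  shows "\<exists>S R. (\<forall>z. s z = lift n (S z) \<and> tc (S z)) \<and> tc R \<and> simple_tc_integral (true_polyfock (Suc n)) s = lift n R \<and>
    (\<forall>x y. integrable lborel (\<lambda>z. cinner (S z x) y) \<and>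
      cinner (R x) y = (LINT z|lborel. cinner (S z x) y))"
proof -
  have fin: "finite (range s)" and tcr: "range s \<subseteq> lift n ` {T. tc T}" and m: "\<And>A. {z. s z = A} \<in> sets lborel"
    and em: "emeasure lborel {z. s z \<noteq> lift n 0} < \<infinity>"
    using s unfolding simple_tc_def trace_class_eq op_zero_lift by auto
  from tcr have "\<forall>A\<in>range s. \<exists>T. A = lift n T \<and> tc T" by blast
  then obtain Q where Q: "\<And>A. A \<in> range s \<Longrightarrow> A = lift n (Q A)" "\<And>A. A \<in> range s \<Longrightarrow> tc (Q A)" by metis
  define \<mu> where "\<mu> A = complex_of_real (measure lborel {z. s z = A})" for A
  define R where "R = (\<Sum>A\<in>range s. scop (\<mu> A) (Q A))"
  have tcR: "tc R" unfolding R_def by (intro tc_sum tc_scop Q)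
  have Rx: "R x = (\<Sum>A\<in>range s. \<mu> A *\<^sub>C (Q A) x)" for x
    unfolding R_def by (simp add: blinfun.sum_left)
  have int: "simple_tc_integral (true_polyfock (Suc n)) s = lift n R"
  proof (rule oper_eq_liftI)
    fix x
    have "(\<lambda>w. \<Sum>A\<in>range s. \<mu> A * A (emb n x) w) = (\<lambda>w. \<Sum>A\<in>range s. \<mu> A * emb n (Q A x) w)"
      by (intro ext sum.cong refl) (metis Q(1) lift_emb)
    then show "simple_tc_integral (true_polyfock (Suc n)) s (emb n x) = emb n (R x)"
      unfolding simple_tc_integral_def Rx emb_sum by (simp add: emb_mem \<mu>_def)
  qed (simp add: simple_tc_integral_def)
  have "integrable lborel (\<lambda>z. cinner ((Q (s z)) x) y) \<and>
      cinner (R x) y = (LINT z|lborel. cinner ((Q (s z)) x) y)" for x y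
  proof -
    define c where "c A = cinner (Q A x) y" for A
    have eq: "cinner ((Q (s z)) x) y = (\<Sum>A\<in>range s. indicator {z. s z = A} z *\<^sub>R c A)" for z
    proof -
      have "(\<Sum>A\<in>range s. indicator {z. s z = A} z *\<^sub>R c A) = (\<Sum>A\<in>range s. if s z = A then c A else 0)"
        by (intro sum.cong refl) auto
      also have "\<dots> = c (s z)" using fin by simp
      finally show ?thesis by (simp add: c_def)
    qed
    have i: "integrable lborel (\<lambda>z. indicator {z. s z = A} z *\<^sub>R c A)"
      "(LINT z|lborel. indicator {z. s z = A} z *\<^sub>R c A) = \<mu> A * c A" if A: "A \<in> range s" for A
    proof -
      \<comment> \<open>Only the zero operator can be attained on a set of infinite measure, and for
        it \<open>c A = 0\<close>, so the conventional value of \<open>measure\<close> there does no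
        harm.\<close>
      have ir: "integrable lborel (indicator {z. s z = A} :: complex \<Rightarrow> real)" if "c A \<noteq> 0"
      proof -
        have "A \<noteq> lift n 0"
        proof
          assume "A = lift n 0"
          then have "Q A = 0" using Q(1)[OF A] lift_inj by metis
          then show False using that by (simp add: c_def)
        qed
        moreover have "{z. s z \<noteq> lift n 0} = UNIV - {z. s z = lift n 0}" by auto
        then have "{z. s z \<noteq> lift n 0} \<in> sets lborel" using sets.compl_sets[OF m[of "lift n 0"]] by simp
        ultimately have "emeasure lborel {z. s z = A} \<le> emeasure lborel {z. s z \<noteq> lift n 0}"
          by (intro emeasure_mono) auto
        then have "emeasure lborel {z. s z = A} < \<infinity>" using em by (rule le_less_trans)
        then show ?thesis by (intro integrable_real_indicator m)
      qed
      then show "integrable lborel (\<lambda>z. indicator {z. s z = A} z *\<^sub>R c A)" by (rule integrable_scaleR_left)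
      have "(LINT z|lborel. indicator {z. s z = A} z *\<^sub>R c A) = (LINT z|lborel. indicator {z. s z = A} z) *\<^sub>R c A"
        using ir by (rule integral_scaleR_left)
      also have "(LINT z|lborel. indicator {z. s z = A} z) = measure lborel {z. s z = A}"
        by (subst Bochner_Integration.integral_indicator) simp
      finally show "(LINT z|lborel. indicator {z. s z = A} z *\<^sub>R c A) = \<mu> A * c A"
        by (simp only: \<mu>_def scaleR_conv_of_real)
    qed
    have "cinner (R x) y = (\<Sum>A\<in>range s. \<mu> A * c A)"
      unfolding Rx by (simp add: cinner_sum_left cinner_scaleC_left c_def)
    also have "\<dots> = (LINT z|lborel. (\<Sum>A\<in>range s. indicator {z. s z = A} z *\<^sub>R c A))"
      by (subst Bochner_Integration.integral_sum) (simp_all add: i)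
    finally show ?thesis unfolding eq using i(1) by (intro conjI Bochner_Integration.integrable_sum)
  qed
  then show ?thesis using Q tcR int by (intro exI[of _ "\<lambda>z. Q (s z)"] exI[of _ R]) auto
qed

text \<open>The Bochner integral and the weak integral are both approximated in trace norm by the
  same simple integrals \<open>R i\<close>, hence coincide. This resolves the \<open>THE\<close> in
  \<open>tc_integral\<close>.\<close>

lemma has_tc_integral_unique:
  assumes h: "has_tc_integral (true_polyfock (Suc n)) (\<lambda>z. lift n (G z)) A" and G: "\<And>z. tc (G z)"
    and Gi: "\<And>x y. integrable lborel (\<lambda>z. cinner (G z x) y)"
    and T: "clin T" "\<And>x y. cinner (T x) y = (LINT z|lborel. cinner (G z x) y)"
  shows "A = lift n T" "tc T"
proof -
  obtain T' where T': "tc T'" "A = lift n T'"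
    using h unfolding has_tc_integral_def trace_class_eq by blast
  obtain s where s: "\<And>i. simple_tc (true_polyfock (Suc n)) (s i)"
    and si: "\<And>i. integrable lborel (\<lambda>z. trace_norm (true_polyfock (Suc n)) (op_diff (true_polyfock (Suc n)) (lift n (G z)) (s i z)))"
    and sl: "(\<lambda>i. LINT z|lborel. trace_norm (true_polyfock (Suc n)) (op_diff (true_polyfock (Suc n)) (lift n (G z)) (s i z))) \<longlonglongrightarrow> 0"
    and sT: "(\<lambda>i. trace_norm (true_polyfock (Suc n)) (op_diff (true_polyfock (Suc n)) (simple_tc_integral (true_polyfock (Suc n)) (s i)) A)) \<longlonglongrightarrow> 0"
    using h unfolding has_tc_integral_def by blast
  from simple_tc_lift[OF s] obtain S R where SR: "\<And>i z. s i z = lift n (S i z)" "\<And>i z. tc (S i z)" "\<And>i. tc (R i)"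
    "\<And>i. simple_tc_integral (true_polyfock (Suc n)) (s i) = lift n (R i)"
    "\<And>i x y. integrable lborel (\<lambda>z. cinner (S i z x) y)"
    "\<And>i x y. cinner (R i x) y = (LINT z|lborel. cinner (S i z x) y)" by metis
  have tn1: "trace_norm (true_polyfock (Suc n)) (op_diff (true_polyfock (Suc n)) (lift n (G z)) (s i z)) = tn (G z - S i z)" for i z
    unfolding SR(1) op_diff_lift by (rule trace_norm_lift[OF tc_diff[OF G SR(2)]])
  have tn2: "trace_norm (true_polyfock (Suc n)) (op_diff (true_polyfock (Suc n)) (simple_tc_integral (true_polyfock (Suc n)) (s i)) A) = tn (R i - T')" for i
    unfolding SR(4) T'(2) op_diff_lift by (rule trace_norm_lift[OF tc_diff[OF SR(3) T'(1)]])
  have b: "tcbound (R i - T) (LINT z|lborel. tn (G z - S i z))" for i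
    by (rule tcbound_integral_diff[OF G SR(2) Gi SR(5) T(2) SR(6)]) (use si[of i] in \<open>simp add: tn1\<close>)
  have tcRT: "tc (R i - T)" for i
    using SR(3)[of i] T(1) by (intro tcI[OF clin_closed(4) b]) (simp_all add: tc_def)
  have "R 0 - (R 0 - T) = T" by simp
  then show tcT: "tc T" using tc_diff[OF SR(3)[of 0] tcRT[of 0]] by simp
  have "tn (T' - T) \<le> (LINT z|lborel. tn (G z - S i z)) + tn (R i - T')" for i
  proof -
    have "T' - T = (R i - T) - (R i - T')" by simp
    then have "tn (T' - T) \<le> tn (R i - T) + tn (R i - T')"
      using tn_diff_le[OF tcRT tc_diff[OF SR(3) T'(1)], of i i] by simp
    then show ?thesis using tn_le[OF b[of i]] by simp
  qed
  moreover have "(\<lambda>i. (LINT z|lborel. tn (G z - S i z)) + tn (R i - T')) \<longlonglongrightarrow> 0 + 0"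
    using sl sT unfolding tn1 tn2 by (rule tendsto_add)
  ultimately have "tn (T' - T) \<le> 0 + 0" by (intro LIMSEQ_le_const) auto
  then have t0: "tn (T' - T) = 0" using tn_nonneg[OF tc_diff[OF T'(1) tcT]] by simp
  have "cinner ((T' - T) x) y = 0" for x y
    using cinner_le_tn[OF tc_diff[OF T'(1) tcT], of x y] unfolding t0 by simp
  then have "T' = T"
    by (intro blinfun_eqI cinner_eqI') (simp add: blinfun.diff_left cinner_diff_left)
  then show "A = lift n T" using T'(2) by simp
qed

text \<open>An integrable simple coefficient is nonzero only on a set of finite measure, and off
  this set the operator is 0.\<close>

lemma simple_tc_krk:
  assumes c: "simple_function lborel c" "integrable lborel c" and w: "simple_function lborel w"
  shows "simple_tc (true_polyfock (Suc n)) (\<lambda>z. lift n (krk n (c z) (w z)))"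
proof -
  define s where "s = (\<lambda>z. lift n (krk n (c z) (w z)))"
  have "simple_function lborel (\<lambda>z. (c z, w z))" by (rule simple_function_Pair[OF c(1) w])
  from simple_function_compose[OF this, of "\<lambda>p. lift n (krk n (fst p) (snd p))"]
  have s: "simple_function lborel s" by (simp add: s_def comp_def)
  then have fin: "finite (range s)" by (auto simp: simple_function_def)
  have m: "{z. s z = A} \<in> sets lborel" for A
    using simple_functionD(2)[OF s, of "{A}"] by (simp add: vimage_def)
  have "(\<integral>\<^sup>+ z. ennreal (norm (c z)) \<partial>lborel) < \<infinity>" using c(2) by (simp add: integrable_iff_bounded)
  then have fm: "emeasure lborel {z \<in> space lborel. c z \<noteq> 0} \<noteq> \<infinity>"
    using simple_bochner_integrableI_bounded[OF c(1)] by (auto elim: simple_bochner_integrable.cases)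
  have cm: "{z. c z \<noteq> 0} \<in> sets lborel"
    using simple_functionD(2)[OF c(1), of "UNIV - {0}"] by (simp add: vimage_def)
  have "krk n 0 z = 0" for z by (rule blinfun_eqI) (simp add: krk_def scaleC_simps)
  then have "{z. s z \<noteq> lift n 0} \<subseteq> {z. c z \<noteq> 0}" by (auto simp: s_def)
  then have "emeasure lborel {z. s z \<noteq> lift n 0} \<le> emeasure lborel {z. c z \<noteq> 0}"
    using cm by (rule emeasure_mono)
  then have "emeasure lborel {z. s z \<noteq> lift n 0} < \<infinity>"
    using fm by (simp add: less_top le_less_trans)
  then show ?thesis
    using fin m unfolding simple_tc_def trace_class_eq op_zero_lift s_def[symmetric]
    by (auto simp: s_def tc_krk)
qed

text \<open>The integrand varies through the symbol and through the kernel, so both are discretized: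
  \<open>c i\<close> approximates \<open>f\<close> and \<open>w i\<close> the point. Continuity of
  \<open>kern\<close> gives pointwise convergence in trace norm, and dominated convergence gives
  convergence of the integrals.\<close>

lemma has_tc_integral_krk:
  assumes f: "integrable lborel f"
  shows "has_tc_integral (true_polyfock (Suc n)) (\<lambda>z. lift n (krk n (f z) z)) (lift n (L1_op n f))" "tc (L1_op n f)"
proof -
  have fm: "f \<in> borel_measurable lborel" using f by auto
  obtain c where c: "\<And>i. simple_function lborel (c i)" "\<And>z. (\<lambda>i. c i z) \<longlonglongrightarrow> f z" "\<And>i z. dist (c i z) 0 \<le> 2 * dist (f z) 0"
    using borel_measurable_implies_sequence_metric[OF fm, of 0] by auto
  obtain w where w: "\<And>i. simple_function lborel (w i)" "\<And>z::complex. (\<lambda>i. w i z) \<longlonglongrightarrow> z"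
    using borel_measurable_implies_sequence_metric[of "\<lambda>z::complex. z" lborel 0] by auto
  have cb: "cmod (c i z) \<le> 2 * cmod (f z)" for i z using c(3)[of i z] by simp
  have cm [measurable]: "c i \<in> borel_measurable borel" "w i \<in> borel_measurable borel" for i
    using borel_measurable_simple_function[OF c(1)] borel_measurable_simple_function[OF w(1)] by auto
  have fm' [measurable]: "f \<in> borel_measurable borel" using fm by simp
  have ci: "integrable lborel (c i)" for i
  proof (rule Bochner_Integration.integrable_bound)
    show "integrable lborel (\<lambda>z. 2 * norm (f z))" using f by auto
  qed (use cb in auto)
  define G where "G z = krk n (f z) z" for z
  define S where "S i z = krk n (c i z) (w i z)" for i z
  have GS: "tc (G z)" "tc (S i z)" for i z by (simp_all add: G_def S_def tc_krk)
  have st: "simple_tc (true_polyfock (Suc n)) (\<lambda>z. lift n (S i z))" for i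
    unfolding S_def by (rule simple_tc_krk[OF c(1) ci w(1)])
  have Gi: "integrable lborel (\<lambda>z. cinner (G z x) y)" for x y
    unfolding G_def cinner_krk by (rule L1_kform_integrable[OF f])
  have LG: "cinner (L1_op n f x) y = (LINT z|lborel. cinner (G z x) y)" for x y
    unfolding G_def cinner_krk by (rule cinner_L1_op[OF f])
  have bd: "tn (G z - S i z) \<le> cmod (f z - c i z) + cmod (c i z) * (2 * norm (kern n z - kern n (w i z)))" for i z
    unfolding G_def S_def by (rule tn_krk_diff)
  \<comment> \<open>\<open>11 = 3 + 8\<close>: the first summand of \<open>bd\<close> is at most
    \<open>3 |f|\<close>, the second at most \<open>2 |f|\<close> times 4.\<close>
  have bd2: "tn (G z - S i z) \<le> 11 * cmod (f z)" for i z
  proof -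
    have "norm (kern n z - kern n (w i z)) \<le> norm (kern n z) + norm (kern n (w i z))" by (rule norm_triangle_ineq4)
    then have "norm (kern n z - kern n (w i z)) \<le> 2" by (simp add: norm_kern)
    then have "cmod (c i z) * (2 * norm (kern n z - kern n (w i z))) \<le> (2 * cmod (f z)) * (2 * 2)"
      by (intro mult_mono cb) auto
    moreover have "cmod (f z - c i z) \<le> 3 * cmod (f z)"
      using norm_triangle_ineq4[of "f z" "c i z"] cb[of i z] by simp
    ultimately show ?thesis using bd[of z i] by simp
  qed
  have tn0: "0 \<le> tn (G z - S i z)" for i z by (intro tn_nonneg tc_diff GS)
  have mt: "(\<lambda>z. tn (G z - S i z)) \<in> borel_measurable lborel" for i
    unfolding G_def S_def by (simp add: tn_krk_measurable cm fm')
  have fi: "integrable lborel (\<lambda>z. 11 * cmod (f z))" using f by auto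
  have ti: "integrable lborel (\<lambda>z. tn (G z - S i z))" for i
    by (rule Bochner_Integration.integrable_bound[OF fi mt]) (use bd2 tn0 in auto)
  have lim: "(\<lambda>i. LINT z|lborel. tn (G z - S i z)) \<longlonglongrightarrow> (LINT z::complex|lborel. 0)"
  proof (rule integral_dominated_convergence[OF _ mt fi])
    show "AE z in lborel. (\<lambda>i. tn (G z - S i z)) \<longlonglongrightarrow> 0"
    proof (rule AE_I2)
      fix z
      have "isCont (kern n) z" using continuous_kern by (simp add: continuous_on_eq_continuous_at)
      then have "(\<lambda>i. kern n (w i z)) \<longlonglongrightarrow> kern n z" by (rule isCont_tendsto_compose[OF _ w(2)])
      then have "(\<lambda>i. cmod (f z - c i z) + cmod (c i z) * (2 * norm (kern n z - kern n (w i z)))) \<longlonglongrightarrow>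
          cmod (f z - f z) + cmod (f z) * (2 * norm (kern n z - kern n z))"
        by (intro tendsto_intros c(2))
      then have "(\<lambda>i. cmod (f z - c i z) + cmod (c i z) * (2 * norm (kern n z - kern n (w i z)))) \<longlonglongrightarrow> 0" by simp
      then show "(\<lambda>i. tn (G z - S i z)) \<longlonglongrightarrow> 0"
        by (rule tendsto_sandwich[OF _ _ tendsto_const, rotated 2]) (use bd tn0 in auto)
    qed
    show "AE z in lborel. norm (tn (G z - S i z)) \<le> 11 * cmod (f z)" for i using bd2 tn0 by auto
  qed simp
  have "\<exists>R. tc R \<and> simple_tc_integral (true_polyfock (Suc n)) (\<lambda>z. lift n (S i z)) = lift n R \<and>
      tcbound (R - L1_op n f) (LINT z|lborel. tn (G z - S i z))" for i
  proof -
    from simple_tc_lift[OF st[of i]] obtain S' R where SR: "\<And>z. lift n (S i z) = lift n (S' z)" "tc R"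
      "simple_tc_integral (true_polyfock (Suc n)) (\<lambda>z. lift n (S i z)) = lift n R"
      "\<And>x y. integrable lborel (\<lambda>z. cinner (S' z x) y)"
      "\<And>x y. cinner (R x) y = (LINT z|lborel. cinner (S' z x) y)" by blast
    have "S' z = S i z" for z using lift_inj[OF SR(1)[of z]] by simp
    then have S': "S' = S i" by (rule ext)
    show ?thesis
      using SR(2,3) tcbound_integral_diff[OF GS Gi SR(4)[unfolded S'] LG SR(5)[unfolded S'] ti] by blast
  qed
  then obtain R where R: "\<And>i. tc (R i)" "\<And>i. simple_tc_integral (true_polyfock (Suc n)) (\<lambda>z. lift n (S i z)) = lift n (R i)"
    "\<And>i. tcbound (R i - L1_op n f) (LINT z|lborel. tn (G z - S i z))" by metis
  have tcRL: "tc (R i - L1_op n f)" for i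
    using R(1)[of i] clin_L1_op[OF f] by (intro tcI[OF clin_closed(4) R(3)]) (simp_all add: tc_def)
  have "R 0 - (R 0 - L1_op n f) = L1_op n f" by simp
  then show tcL: "tc (L1_op n f)" using tc_diff[OF R(1)[of 0] tcRL[of 0]] by simp
  have "(\<lambda>i. tn (R i - L1_op n f)) \<longlonglongrightarrow> 0"
  proof (rule tendsto_sandwich[OF _ _ tendsto_const])
    show "\<forall>\<^sub>F i in sequentially. 0 \<le> tn (R i - L1_op n f)" using tn_nonneg[OF tcRL] by simp
    show "\<forall>\<^sub>F i in sequentially. tn (R i - L1_op n f) \<le> (LINT z|lborel. tn (G z - S i z))" using tn_le[OF R(3)] by simp
    show "(\<lambda>i. LINT z|lborel. tn (G z - S i z)) \<longlonglongrightarrow> 0" using lim by simp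
  qed
  then show "has_tc_integral (true_polyfock (Suc n)) (\<lambda>z. lift n (krk n (f z) z)) (lift n (L1_op n f))"
    unfolding has_tc_integral_def trace_class_eq G_def[symmetric]
    using GS tcL st ti lim
    by (intro conjI exI[of _ "\<lambda>i z. lift n (S i z)"])
       (auto simp: op_diff_lift R(2) trace_norm_lift tc_diff R(1))
qed

lemma toeplitz_L1_lift:
  assumes f: "integrable lborel f"
  shows "toeplitz_L1 (Suc n) f = lift n (scop (1 / of_real pi) (L1_op n f))"
proof -
  have "tc_integral (true_polyfock (Suc n)) (\<lambda>z. lift n (krk n (f z) z)) = lift n (L1_op n f)"
    unfolding tc_integral_def
  proof (rule the_equality)
    show "has_tc_integral (true_polyfock (Suc n)) (\<lambda>z. lift n (krk n (f z) z)) (lift n (L1_op n f))"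
      by (rule has_tc_integral_krk(1)[OF f])
    fix A assume "has_tc_integral (true_polyfock (Suc n)) (\<lambda>z. lift n (krk n (f z) z)) A"
    then show "A = lift n (L1_op n f)"
      by (rule has_tc_integral_unique(1))
         (auto simp: cinner_krk tc_krk clin_L1_op[OF f] cinner_L1_op[OF f] L1_kform_integrable[OF f])
  qed
  then show ?thesis unfolding toeplitz_L1_def krk_op by (simp add: op_scale_lift)
qed

section \<open>Density in weak topologies\<close>

text \<open>A subspace of a finite-dimensional space is determined by its annihilator. The induction
  eliminates the coordinate \<open>k\<close>: if some \<open>v0\<close> in \<open>V\<close> is
  nonzero there, it is used to clear that coordinate; otherwise \<open>t k\<close> vanishes.\<close>

lemma finite_interpolation:
  fixes V :: "('i \<Rightarrow> complex) set"
  assumes "finite I"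
    and "\<And>a b v w. v \<in> V \<Longrightarrow> w \<in> V \<Longrightarrow> (\<lambda>i. a * v i + b * w i) \<in> V" and "(\<lambda>i. 0) \<in> V"
    and "\<And>c. (\<And>v. v \<in> V \<Longrightarrow> (\<Sum>i\<in>I. c i * v i) = 0) \<Longrightarrow> (\<Sum>i\<in>I. c i * t i) = 0"
  shows "\<exists>v\<in>V. \<forall>i\<in>I. v i = t i"
  using assms
proof (induction I arbitrary: V t rule: finite_induct)
  case (insert k I)
  note lin = insert.prems(1) and zero = insert.prems(2) and ann = insert.prems(3)
  have sumk: "(\<Sum>i\<in>I. (if i = k then e else c i) * v i) = (\<Sum>i\<in>I. c i * v i)" for e and c v :: "'i \<Rightarrow> complex"
    by (intro sum.cong refl) (use insert.hyps(2) in auto)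
  show ?case
  proof (cases "\<exists>v\<in>V. v k \<noteq> 0")
    case False
    have "(\<Sum>i\<in>insert k I. (if i = k then 1 else 0) * t i) = 0"
    proof (rule ann)
      fix v assume "v \<in> V"
      then show "(\<Sum>i\<in>insert k I. (if i = k then 1 else 0) * v i) = 0"
        using False insert.hyps by (auto simp: sumk)
    qed
    then have tk: "t k = 0" using insert.hyps by (simp add: sumk)
    have "\<exists>v\<in>V. \<forall>i\<in>I. v i = t i"
    proof (rule insert.IH[OF lin zero])
      fix c assume c: "\<And>v. v \<in> V \<Longrightarrow> (\<Sum>i\<in>I. c i * v i) = 0"
      have "(\<Sum>i\<in>insert k I. (if i = k then 0 else c i) * t i) = 0"
        by (rule ann) (use c insert.hyps in \<open>simp add: sumk\<close>)
      then show "(\<Sum>i\<in>I. c i * t i) = 0" using insert.hyps by (simp add: sumk)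
    qed
    then show ?thesis using False tk by auto
  next
    case True
    then obtain v0 where v0: "v0 \<in> V" "v0 k \<noteq> 0" by blast
    define V' where "V' = {v \<in> V. v k = 0}"
    define t' where "t' i = t i - t k / v0 k * v0 i" for i
    have "\<exists>v\<in>V'. \<forall>i\<in>I. v i = t' i"
    proof (rule insert.IH)
      show "(\<lambda>i. a * v i + b * w i) \<in> V'" if "v \<in> V'" "w \<in> V'" for a b v w
        using that lin by (simp add: V'_def)
      show "(\<lambda>i. 0) \<in> V'" using zero by (simp add: V'_def)
      fix c assume c: "\<And>v. v \<in> V' \<Longrightarrow> (\<Sum>i\<in>I. c i * v i) = 0"
      \<comment> \<open>The coefficient at \<open>k\<close> for which the extended functional
        vanishes on \<open>v0\<close>, and thereby on all of \<open>V\<close>.\<close>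
      define e where "e = - (\<Sum>i\<in>I. c i * v0 i) / v0 k"
      have "(\<Sum>i\<in>insert k I. (if i = k then e else c i) * t i) = 0"
      proof (rule ann)
        fix v assume v: "v \<in> V"
        have "(\<lambda>i. 1 * v i + (- (v k / v0 k)) * v0 i) \<in> V'" using lin[OF v v0(1), of 1 "- (v k / v0 k)"] v0(2) by (simp add: V'_def)
        from c[OF this] have "(\<Sum>i\<in>I. c i * v i) = v k / v0 k * (\<Sum>i\<in>I. c i * v0 i)"
          by (simp add: algebra_simps sum_subtractf sum_distrib_left)
        moreover have "(\<Sum>i\<in>insert k I. (if i = k then e else c i) * v i) = e * v k + (\<Sum>i\<in>I. c i * v i)"
          using insert.hyps by (simp add: sumk)
        ultimately show "(\<Sum>i\<in>insert k I. (if i = k then e else c i) * v i) = 0"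
          by (simp add: e_def)
      qed
      then have "e * t k + (\<Sum>i\<in>I. c i * t i) = 0" using insert.hyps by (simp add: sumk)
      moreover have "(\<Sum>i\<in>I. c i * t' i) = (\<Sum>i\<in>I. c i * t i) - t k / v0 k * (\<Sum>i\<in>I. c i * v0 i)"
        by (simp add: t'_def algebra_simps sum_subtractf sum_distrib_left)
      ultimately show "(\<Sum>i\<in>I. c i * t' i) = 0" by (simp add: e_def algebra_simps)
    qed
    then obtain v where v: "v \<in> V" "v k = 0" "\<forall>i\<in>I. v i = t' i" by (auto simp: V'_def)
    have "(\<lambda>i. 1 * v i + t k / v0 k * v0 i) \<in> V" by (rule lin[OF v(1) v0(1)])
    moreover have "\<forall>i\<in>insert k I. 1 * v i + t k / v0 k * v0 i = t i"
      using v v0(2) by (auto simp: t'_def)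
    ultimately show ?thesis by (intro bexI[where x = "\<lambda>i. 1 * v i + t k / v0 k * v0 i"])
  qed
qed auto

text \<open>Every open set around \<open>x\<close> contains all points of \<open>X\<close> that
  agree with \<open>x\<close> under some finite set of functionals; this property survives finite
  intersections and arbitrary unions. So exact interpolation on finite sets suffices.\<close>

lemma weak_topology_dense:
  assumes D: "D \<subseteq> X" and S: "S \<noteq> {}"
    and I: "\<And>x I. x \<in> X \<Longrightarrow> finite I \<Longrightarrow> I \<subseteq> S \<Longrightarrow> \<exists>d\<in>D. \<forall>s\<in>I. \<beta> d s = \<beta> x s"
  shows "weak_topology X S \<beta> closure_of D = X"
proof -
  let ?B = "{{x \<in> X. \<beta> x s \<in> U} |s U. s \<in> S \<and> open U}"
  have "\<Union>?B = X"
  proof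
    obtain s where "s \<in> S" using S by blast
    then have "{x \<in> X. \<beta> x s \<in> UNIV} \<in> ?B" using open_UNIV by blast
    then show "X \<subseteq> \<Union>?B" by auto
  qed auto
  then have top: "topspace (weak_topology X S \<beta>) = X" by (simp add: weak_topology_def)
  have nb: "\<forall>x\<in>T. \<exists>I. finite I \<and> I \<subseteq> S \<and> (\<forall>y\<in>X. (\<forall>s\<in>I. \<beta> y s = \<beta> x s) \<longrightarrow> y \<in> T)"
    if "generate_topology_on ?B T" for T
    using that
  proof induction
    case Empty
    show ?case by simp
  next
    case (Int a b)
    show ?case
    proof
      fix x assume "x \<in> a \<inter> b"
      then have xab: "x \<in> a" "x \<in> b" by simp_all
      from bspec[OF Int.IH(1) xab(1)] obtain I where I: "finite I" "I \<subseteq> S" "\<forall>y\<in>X. (\<forall>s\<in>I. \<beta> y s = \<beta> x s) \<longrightarrow> y \<in> a"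
        by (elim exE conjE)
      from bspec[OF Int.IH(2) xab(2)] obtain J where J: "finite J" "J \<subseteq> S" "\<forall>y\<in>X. (\<forall>s\<in>J. \<beta> y s = \<beta> x s) \<longrightarrow> y \<in> b"
        by (elim exE conjE)
      show "\<exists>I. finite I \<and> I \<subseteq> S \<and> (\<forall>y\<in>X. (\<forall>s\<in>I. \<beta> y s = \<beta> x s) \<longrightarrow> y \<in> a \<inter> b)"
      proof (intro exI[of _ "I \<union> J"] conjI ballI impI IntI)
        show "finite (I \<union> J)" "I \<union> J \<subseteq> S" using I J by simp_all
        fix y assume y: "y \<in> X" "\<forall>s\<in>I \<union> J. \<beta> y s = \<beta> x s"
        show "y \<in> a" using bspec[OF I(3) y(1)] y(2) by simp
        show "y \<in> b" using bspec[OF J(3) y(1)] y(2) by simp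
      qed
    qed
  next
    case (UN K)
    show ?case
    proof
      fix x assume "x \<in> \<Union>K"
      then obtain a where a: "a \<in> K" "x \<in> a" by blast
      from bspec[OF UN.IH[OF a(1)] a(2)] obtain I where "finite I" "I \<subseteq> S" "\<forall>y\<in>X. (\<forall>s\<in>I. \<beta> y s = \<beta> x s) \<longrightarrow> y \<in> a"
        by (elim exE conjE)
      then show "\<exists>I. finite I \<and> I \<subseteq> S \<and> (\<forall>y\<in>X. (\<forall>s\<in>I. \<beta> y s = \<beta> x s) \<longrightarrow> y \<in> \<Union>K)"
        using a(1) by (intro exI[of _ I]) auto
    qed
  next
    case (Basis T)
    then obtain s U where T: "T = {x \<in> X. \<beta> x s \<in> U}" "s \<in> S" by blast
    show ?case unfolding T(1) using T(2) by (intro ballI exI[of _ "{s}"]) auto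
  qed
  show ?thesis
  proof
    show "weak_topology X S \<beta> closure_of D \<subseteq> X"
      using closure_of_subset_topspace[of "weak_topology X S \<beta>" D] top by simp
    show "X \<subseteq> weak_topology X S \<beta> closure_of D"
    proof
      fix x assume x: "x \<in> X"
      have "\<exists>y. y \<in> D \<and> y \<in> T" if T: "x \<in> T" "openin (weak_topology X S \<beta>) T" for T
      proof -
        have "generate_topology_on ?B T"
          using T(2) unfolding weak_topology_def openin_topology_generated_by_iff .
        from bspec[OF nb[OF this] T(1)] obtain J where J: "finite J" "J \<subseteq> S" "\<forall>y\<in>X. (\<forall>s\<in>J. \<beta> y s = \<beta> x s) \<longrightarrow> y \<in> T"
          by (elim exE conjE)
        from I[OF x J(1,2)] obtain d where d: "d \<in> D" "\<forall>s\<in>J. \<beta> d s = \<beta> x s" by (elim bexE)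
        have "d \<in> T" by (rule mp[OF bspec[OF J(3) subsetD[OF D d(1)]] d(2)])
        then show ?thesis using d(1) by (intro exI conjI)
      qed
      then show "x \<in> weak_topology X S \<beta> closure_of D" using x top unfolding in_closure_of by blast
    qed
  qed
qed

text \<open>The annihilator criterion for density. Linearity of \<open>D\<close> is required after
  evaluation by the functionals, a form that covers both operators and functions.\<close>

lemma weak_topology_dense':
  assumes D: "D \<subseteq> X" "D \<noteq> {}" and S: "S \<noteq> {}"
    and lin: "\<And>a b d e. d \<in> D \<Longrightarrow> e \<in> D \<Longrightarrow> \<exists>f\<in>D. \<forall>s\<in>S. \<beta> f s = a * \<beta> d s + b * \<beta> e s"
    and ann: "\<And>x I c. x \<in> X \<Longrightarrow> finite I \<Longrightarrow> I \<subseteq> S \<Longrightarrow> (\<And>d. d \<in> D \<Longrightarrow> (\<Sum>s\<in>I. c s * \<beta> d s) = 0) \<Longrightarrow>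
      (\<Sum>s\<in>I. c s * \<beta> x s) = 0"
  shows "weak_topology X S \<beta> closure_of D = X"
proof (rule weak_topology_dense[OF D(1) S])
  fix x I assume x: "x \<in> X" and I: "finite I" "I \<subseteq> S"
  define V where "V = {v. \<exists>d\<in>D. \<forall>s\<in>S. v s = \<beta> d s}"
  have "\<exists>v\<in>V. \<forall>s\<in>I. v s = \<beta> x s"
  proof (rule finite_interpolation[OF I(1)])
    show "(\<lambda>s. a * v s + b * w s) \<in> V" if "v \<in> V" "w \<in> V" for a b v w
    proof -
      from that obtain d e where de: "d \<in> D" "e \<in> D" "\<forall>s\<in>S. v s = \<beta> d s" "\<forall>s\<in>S. w s = \<beta> e s" by (auto simp: V_def)
      from lin[OF de(1,2), of a b] obtain f where "f \<in> D" "\<forall>s\<in>S. \<beta> f s = a * \<beta> d s + b * \<beta> e s" by blast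
      then show ?thesis using de(3,4) unfolding V_def by (intro CollectI bexI[of _ f]) auto
    qed
    obtain d where "d \<in> D" using D(2) by blast
    from lin[OF this this, of 0 0] show "(\<lambda>s. 0) \<in> V" by (auto simp: V_def)
    fix c assume c: "\<And>v. v \<in> V \<Longrightarrow> (\<Sum>s\<in>I. c s * v s) = 0"
    show "(\<Sum>s\<in>I. c s * \<beta> x s) = 0"
      by (rule ann[OF x I]) (rule c, auto simp: V_def)
  qed
  then obtain v d where "d \<in> D" "\<forall>s\<in>S. v s = \<beta> d s" "\<forall>s\<in>I. v s = \<beta> x s" by (auto simp: V_def)
  then show "\<exists>d\<in>D. \<forall>s\<in>I. \<beta> d s = \<beta> x s" using I(2) by (metis subsetD)
qed

section \<open>Toeplitz quantization and Berezin transform\<close>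

text \<open>Nuclear representations make each diagonal summable, so the sums over \<open>I\<close>
  and over the basis can be exchanged.\<close>

lemma trace_sum:
  assumes T: "\<And>i. i \<in> I \<Longrightarrow> tc (T i)" and A: "clin A" and I: "finite I"
  shows "trace (true_polyfock (Suc n)) (lift n (A o\<^sub>L (\<Sum>i\<in>I. scop (c i) (T i)))) =
    (\<Sum>i\<in>I. c i * trace (true_polyfock (Suc n)) (lift n (A o\<^sub>L T i)))"
proof -
  have "(\<lambda>e. cinner ((A o\<^sub>L T i) e) e) summable_on basis n" if i: "i \<in> I" for i
  proof -
    obtain u v where uv: "nuclear (T i) u v" using tc_nuclear[OF T[OF i]] by blast
    show ?thesis by (rule has_sum_imp_summable[OF nuclear_trace[OF onb_basis nuclear_compose[OF A uv]]])
  qed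
  then have s: "((\<lambda>e. cinner ((A o\<^sub>L T i) e) e) has_sum trace (true_polyfock (Suc n)) (lift n (A o\<^sub>L T i))) (basis n)"
    if "i \<in> I" for i
    unfolding trace_lift using that by (intro has_sum_infsum)
  have "cinner ((A o\<^sub>L (\<Sum>i\<in>I. scop (c i) (T i))) e) e = (\<Sum>i\<in>I. c i * cinner ((A o\<^sub>L T i) e) e)" for e
    by (simp add: blinfun.sum_left blinfun.sum_right clinD[OF A] cinner_sum_left cinner_scaleC_left)
  then show ?thesis
    unfolding trace_lift[of n "A o\<^sub>L (\<Sum>i\<in>I. scop (c i) (T i))"]
    by (intro infsumI) (simp only:, intro has_sum_sum has_sum_cmult_right s)
qed

lemma toeplitz_L1_injective:
  assumes f: "integrable lborel f" and g: "integrable lborel g" and eq: "toeplitz_L1 (Suc n) f = toeplitz_L1 (Suc n) g"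
  shows "AE z in lborel. f z = g z"
proof -
  have "scop (1 / of_real pi) (L1_op n f) = scop (1 / of_real pi) (L1_op n g)"
    using eq unfolding toeplitz_L1_lift[OF f] toeplitz_L1_lift[OF g] by (rule lift_inj)
  then have e: "cinner ((scop (1 / of_real pi) (L1_op n f)) x) y = cinner ((scop (1 / of_real pi) (L1_op n g)) x) y" for x y
    by simp
  have "(LINT z|lborel. (f z - g z) * kform n x y z) = 0" for x y
    unfolding left_diff_distrib Bochner_Integration.integral_diff[OF L1_kform_integrable[OF f] L1_kform_integrable[OF g]]
    using e[of x y] by (simp add: cinner_scaleC_left cinner_L1_op f g)
  from kform_total[OF Bochner_Integration.integrable_diff[OF f g] this]
  show ?thesis by eventually_elim simp
qed

lemma berezin_injective:
  assumes A: "A \<in> trace_class (true_polyfock (Suc n))" and B: "B \<in> trace_class (true_polyfock (Suc n))"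
    and eq: "AE z in lborel. berezin (Suc n) A z = berezin (Suc n) B z"
  shows "A = B"
proof -
  obtain S T where ST: "A = lift n S" "tc S" "B = lift n T" "tc T" using A B unfolding trace_class_eq by blast
  have "AE z in lborel. ber n (S - T) z = 0"
    using eq unfolding ST berezin_lift
    by eventually_elim (simp add: ber_def blinfun.diff_left cinner_diff_left)
  from ber_injective[OF tc_diff[OF ST(2,4)] this] show ?thesis using ST by simp
qed

lemma toeplitz_dense:
  "weak_star_ops (true_polyfock (Suc n)) closure_of (toeplitz_Linf (Suc n) ` Linf_fun) = bounded_ops (true_polyfock (Suc n))"
  unfolding weak_star_ops_def
proof (rule weak_topology_dense')
  let ?H = "true_polyfock (Suc n)"
  show "toeplitz_Linf (Suc n) ` Linf_fun \<subseteq> bounded_ops ?H"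
    using toeplitz_Linf_lift lift_bounded[OF clin_toep] by auto
  show "toeplitz_Linf (Suc n) ` Linf_fun \<noteq> {}" using chi_Linf by blast
  show "trace_class ?H \<noteq> {}" unfolding trace_class_eq using tc_0 by blast
  have tr: "trace ?H (compose ?H (toeplitz_Linf (Suc n) f) (lift n T)) = (LINT z|lborel. f z * ber n T z) / of_real pi"
    if "f \<in> Linf_fun" "tc T" for f T by (rule trace_toeplitz[OF that(2,1)])
  show "\<exists>f\<in>toeplitz_Linf (Suc n) ` Linf_fun. \<forall>s\<in>trace_class ?H. trace ?H (compose ?H f s) = a * trace ?H (compose ?H d s) + b * trace ?H (compose ?H e s)"
    if de: "d \<in> toeplitz_Linf (Suc n) ` Linf_fun" "e \<in> toeplitz_Linf (Suc n) ` Linf_fun" for a b d e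
  proof -
    obtain f g where fg: "d = toeplitz_Linf (Suc n) f" "e = toeplitz_Linf (Suc n) g" "f \<in> Linf_fun" "g \<in> Linf_fun" using de by blast
    have fg': "(\<lambda>z. a * f z + b * g z) \<in> Linf_fun" by (rule Linf_linear[OF fg(3,4)])
    have "trace ?H (compose ?H (toeplitz_Linf (Suc n) (\<lambda>z. a * f z + b * g z)) s) = a * trace ?H (compose ?H d s) + b * trace ?H (compose ?H e s)"
      if s: "s \<in> trace_class ?H" for s
    proof -
      obtain T where T: "s = lift n T" "tc T" using s unfolding trace_class_eq by blast
      note i = Linf_mult_integrable[OF fg(3) ber_integrable[OF T(2)]] Linf_mult_integrable[OF fg(4) ber_integrable[OF T(2)]]
      have "(LINT z|lborel. (a * f z + b * g z) * ber n T z) = (LINT z|lborel. a * (f z * ber n T z) + b * (g z * ber n T z))"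
        by (simp add: algebra_simps)
      also have "\<dots> = a * (LINT z|lborel. f z * ber n T z) + b * (LINT z|lborel. g z * ber n T z)"
        using i by (subst Bochner_Integration.integral_add) auto
      finally show ?thesis unfolding T(1) fg(1,2) tr[OF fg' T(2)] tr[OF fg(3) T(2)] tr[OF fg(4) T(2)]
        by (simp add: add_divide_distrib)
    qed
    then show ?thesis using fg' by blast
  qed
  fix A I c assume A: "A \<in> bounded_ops ?H" and I: "finite I" "I \<subseteq> trace_class ?H"
    and c: "\<And>d. d \<in> toeplitz_Linf (Suc n) ` Linf_fun \<Longrightarrow> (\<Sum>s\<in>I. c s * trace ?H (compose ?H d s)) = 0"
  obtain A' where A': "clin A'" "A = lift n A'" using bounded_ops_lift[OF A] by blast
  have "\<forall>s\<in>I. \<exists>T. s = lift n T \<and> tc T" using I(2) unfolding trace_class_eq by blast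
  then obtain Q where Q: "\<And>s. s \<in> I \<Longrightarrow> s = lift n (Q s)" "\<And>s. s \<in> I \<Longrightarrow> tc (Q s)" by metis
  \<comment> \<open>The combination of functionals is pairing with this single trace class
    operator.\<close>
  define T where "T = (\<Sum>s\<in>I. scop (c s) (Q s))"
  have T: "tc T" unfolding T_def by (intro tc_sum tc_scop Q)
  have tr_sum: "(\<Sum>s\<in>I. c s * trace ?H (compose ?H (lift n S) s)) = trace ?H (lift n (S o\<^sub>L T))" if S: "clin S" for S
  proof -
    have "(\<Sum>s\<in>I. c s * trace ?H (compose ?H (lift n S) s)) = (\<Sum>s\<in>I. c s * trace ?H (lift n (S o\<^sub>L Q s)))"
      by (intro sum.cong refl) (metis Q(1) compose_lift)
    also have "\<dots> = trace ?H (lift n (S o\<^sub>L T))" unfolding T_def by (rule trace_sum[OF Q(2) S I(1), symmetric])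
    finally show ?thesis .
  qed
  \<comment> \<open>For this symbol the pairing is, up to \<open>1 / pi\<close>, the
    \<open>L^1\<close> norm of the Berezin transform of \<open>T\<close>.\<close>
  define f where "f z = cnj (sgn (ber n T z))" for z
  have bm [measurable]: "ber n T \<in> borel_measurable borel" by (rule Linf_measurable[OF ber_Linf])
  have f: "f \<in> Linf_fun"
    unfolding f_def by (rule LinfI[where C = 1]) (measurable, simp add: norm_sgn)
  have "trace ?H (compose ?H (toeplitz_Linf (Suc n) f) (lift n T)) = 0"
    using c[OF imageI[OF f]] unfolding toeplitz_Linf_lift[OF f] tr_sum[OF clin_toep[OF f]] compose_lift .
  then have "(LINT z|lborel. f z * ber n T z) = 0" unfolding tr[OF f T] by simp
  moreover have "f z * ber n T z = of_real (cmod (ber n T z))" for z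
  proof (cases "ber n T z = 0")
    case False
    define w where "w = ber n T z"
    have "w * cnj w = of_real (cmod w) * of_real (cmod w)"
      using complex_norm_square[of w] by (simp add: power2_eq_square)
    then show ?thesis using False unfolding f_def w_def[symmetric]
      by (simp add: sgn_div_norm scaleR_conv_of_real field_simps)
  qed (simp add: f_def)
  ultimately have "(LINT z|lborel. cmod (ber n T z)) = 0" by simp
  then have "AE z in lborel. ber n T z = 0"
    using integral_nonneg_eq_0_iff_AE[OF integrable_norm[OF ber_integrable[OF T, of n]]] by simp
  then have "T = 0" by (rule ber_injective[OF T])
  moreover have "trace ?H (lift n (A' o\<^sub>L 0)) = 0" by (simp add: trace_lift)
  ultimately show "(\<Sum>s\<in>I. c s * trace ?H (compose ?H A s)) = 0"
    unfolding A'(2) tr_sum[OF A'(1)] by simp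
qed

lemma berezin_Linf: "A \<in> bounded_ops (true_polyfock (Suc n)) \<Longrightarrow> berezin (Suc n) A \<in> Linf_fun"
proof -
  assume "A \<in> bounded_ops (true_polyfock (Suc n))"
  then obtain T where T: "A = lift n T" using bounded_ops_lift by blast
  have "berezin (Suc n) A = ber n T" by (rule ext) (simp add: T berezin_lift ber_def)
  then show ?thesis by (simp add: ber_Linf)
qed

lemma berezin_dense:
  "weak_star_Linf closure_of (berezin (Suc n) ` bounded_ops (true_polyfock (Suc n))) = Linf_fun"
  unfolding weak_star_Linf_def
proof (rule weak_topology_dense')
  let ?H = "true_polyfock (Suc n)"
  have b: "berezin (Suc n) (lift n T) = ber n T" for T by (rule ext) (simp add: berezin_lift ber_def)
  have D: "berezin (Suc n) ` bounded_ops ?H = ber n ` {T. clin T}"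
    unfolding bounded_ops_eq image_image b ..
  show "berezin (Suc n) ` bounded_ops ?H \<subseteq> Linf_fun" using berezin_Linf by blast
  show "berezin (Suc n) ` bounded_ops ?H \<noteq> {}" unfolding D using tc_0 by (auto simp: tc_def)
  show "L1_fun \<noteq> {}" using integrable_zero by (auto simp: L1_fun_def)
  show "\<exists>f\<in>berezin (Suc n) ` bounded_ops ?H. \<forall>s\<in>L1_fun. (LINT z|lborel. f z * s z) = a * (LINT z|lborel. d z * s z) + b * (LINT z|lborel. e z * s z)"
    if de: "d \<in> berezin (Suc n) ` bounded_ops ?H" "e \<in> berezin (Suc n) ` bounded_ops ?H" for a b d e
  proof -
    obtain S T where ST: "clin S" "clin T" "d = ber n S" "e = ber n T" using de unfolding D by blast
    define R where "R = scop a S + scop b T"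
    have "clin R" unfolding R_def by (intro clin_closed clin_scop ST)
    moreover have "(LINT z|lborel. ber n R z * s z) = a * (LINT z|lborel. d z * s z) + b * (LINT z|lborel. e z * s z)"
      if s': "s \<in> L1_fun" for s
    proof -
      have s: "integrable lborel s" using s' by (simp add: L1_fun_def)
      have "(LINT z|lborel. ber n R z * s z) = (LINT z|lborel. a * (d z * s z) + b * (e z * s z))"
        by (simp add: ber_def R_def ST blinfun.add_left cinner_add_left cinner_scaleC_left algebra_simps)
      also have "\<dots> = a * (LINT z|lborel. d z * s z) + b * (LINT z|lborel. e z * s z)"
        using Linf_mult_integrable[OF ber_Linf s] unfolding ST by (subst Bochner_Integration.integral_add) auto
      finally show ?thesis .
    qed
    ultimately show ?thesis unfolding D by blast
  qed
  fix f I c assume f: "f \<in> Linf_fun" and I: "finite I" "I \<subseteq> L1_fun"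
    and c: "\<And>d. d \<in> berezin (Suc n) ` bounded_ops ?H \<Longrightarrow> (\<Sum>s\<in>I. c s * (LINT z|lborel. d z * s z)) = 0"
  have Ii: "integrable lborel s" if "s \<in> I" for s using that I(2) by (auto simp: L1_fun_def)
  define g where "g z = (\<Sum>s\<in>I. c s * s z)" for z
  have gi: "integrable lborel g" unfolding g_def using Ii by auto
  have sum: "(\<Sum>s\<in>I. c s * (LINT z|lborel. d z * s z)) = (LINT z|lborel. d z * g z)" if d: "d \<in> Linf_fun" for d
  proof -
    have "(LINT z|lborel. d z * g z) = (LINT z|lborel. (\<Sum>s\<in>I. c s * (d z * s z)))"
      by (simp add: g_def sum_distrib_left mult.left_commute)
    also have "\<dots> = (\<Sum>s\<in>I. (LINT z|lborel. c s * (d z * s z)))"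
      by (rule Bochner_Integration.integral_sum) (use Linf_mult_integrable[OF d Ii] in auto)
    finally show ?thesis by simp
  qed
  have "(LINT z|lborel. g z * kform n x y z) = 0" for x y
  proof -
    \<comment> \<open>Rank-one operators already have the functions \<open>kform n x y\<close> as
      Berezin transforms, so annihilation yields the hypothesis of
      \<open>kform_total\<close>.\<close>
    have "ber n (rk x y) = kform n x y" by (rule ext) (simp add: ber_def kform_def cinner_scaleC_left mult.commute)
    moreover have "ber n (rk x y) \<in> berezin (Suc n) ` bounded_ops ?H" unfolding D using clin_rk by blast
    ultimately have "(LINT z|lborel. kform n x y z * g z) = 0" using c sum ber_Linf by metis
    then show ?thesis by (simp add: mult.commute)
  qed
  from kform_total[OF gi this] have "AE z in lborel. f z * g z = 0" by eventually_elim simp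
  moreover have "(\<lambda>z. f z * g z) \<in> borel_measurable lborel"
    using Linf_mult_integrable[OF f gi] by auto
  ultimately have "(LINT z|lborel. f z * g z) = 0" by (simp add: integral_eq_zero_AE)
  then show "(\<Sum>s\<in>I. c s * (LINT z|lborel. f z * s z)) = 0" unfolding sum[OF f] .
qed

theorem proposition3p8:
  fixes k :: nat
  assumes "k \<ge> 1"
  shows
    "(toeplitz_L1 k \<in> L1_fun \<rightarrow> trace_class (true_polyfock k) \<and>
      (\<forall>f\<in>L1_fun. \<forall>g\<in>L1_fun.
         toeplitz_L1 k f = toeplitz_L1 k g \<longrightarrow> (AE z in lborel. f z = g z))) \<and>
     (berezin k \<in> trace_class (true_polyfock k) \<rightarrow> L1_fun \<and>
      (\<forall>A\<in>trace_class (true_polyfock k). \<forall>B\<in>trace_class (true_polyfock k).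
         (AE z in lborel. berezin k A z = berezin k B z) \<longrightarrow> A = B)) \<and>
     (toeplitz_Linf k \<in> Linf_fun \<rightarrow> bounded_ops (true_polyfock k) \<and>
      weak_star_ops (true_polyfock k) closure_of (toeplitz_Linf k ` Linf_fun)
        = bounded_ops (true_polyfock k)) \<and>
     (berezin k \<in> bounded_ops (true_polyfock k) \<rightarrow> Linf_fun \<and>
      weak_star_Linf closure_of (berezin k ` bounded_ops (true_polyfock k)) = Linf_fun)"
proof -
  obtain n where k: "k = Suc n" using assms by (cases k) auto
  show ?thesis
    unfolding k
  proof (intro conjI ballI impI funcsetI)
    fix f assume "f \<in> L1_fun"
    then have f: "integrable lborel f" by (simp add: L1_fun_def)
    show "toeplitz_L1 (Suc n) f \<in> trace_class (true_polyfock (Suc n))"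
      unfolding toeplitz_L1_lift[OF f] trace_class_eq using tc_scop[OF has_tc_integral_krk(2)[OF f]] by blast
  next
    fix f g assume "f \<in> L1_fun" "g \<in> L1_fun" "toeplitz_L1 (Suc n) f = toeplitz_L1 (Suc n) g"
    then show "AE z in lborel. f z = g z" by (intro toeplitz_L1_injective) (simp_all add: L1_fun_def)
  next
    fix A assume "A \<in> trace_class (true_polyfock (Suc n))"
    then obtain T where T: "A = lift n T" "tc T" unfolding trace_class_eq by blast
    have "berezin (Suc n) A = ber n T" by (rule ext) (simp add: T berezin_lift ber_def)
    then show "berezin (Suc n) A \<in> L1_fun" using ber_integrable[OF T(2)] by (simp add: L1_fun_def)
  next
    fix f assume "f \<in> Linf_fun"
    then show "toeplitz_Linf (Suc n) f \<in> bounded_ops (true_polyfock (Suc n))"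
      by (simp add: toeplitz_Linf_lift lift_bounded clin_toep)
  next
    fix A B
    assume "A \<in> trace_class (true_polyfock (Suc n))" "B \<in> trace_class (true_polyfock (Suc n))"
      "AE z in lborel. berezin (Suc n) A z = berezin (Suc n) B z"
    then show "A = B" by (rule berezin_injective)
  next
    show "weak_star_ops (true_polyfock (Suc n)) closure_of (toeplitz_Linf (Suc n) ` Linf_fun) = bounded_ops (true_polyfock (Suc n))"
      by (rule toeplitz_dense)
    show "weak_star_Linf closure_of (berezin (Suc n) ` bounded_ops (true_polyfock (Suc n))) = Linf_fun"
      by (rule berezin_dense)
    fix A assume "A \<in> bounded_ops (true_polyfock (Suc n))"
    then show "berezin (Suc n) A \<in> Linf_fun" by (rule berezin_Linf)
  qed
qed

end
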